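(* Let $\mathcal N_{A_{[T]}\to BE}$ be a quantum multiple-access channel (MAC) with $T$ transmitters and $S$ messages whose message assignment $(\mathcal I_t)_{t\in[T]}$ has the special message hierarchy. Let $R_1,\dots,R_S\ge 0$, and let $$\rho_{\tilde X_{[T]}A_{[T]}}=\sum_{\tilde x_{[T]}}\prod_{t=1}^T p_{\tilde X_t|\tilde X_{\mathbb D_t}}(\tilde x_t|\tilde x_{\mathbb D_t})\,|\tilde x_1\rangle\langle\tilde x_1|\otimes\cdots\otimes|\tilde x_T\rangle\langle\tilde x_T|\otimes\theta_{A_1}^{x_1}\otimes\cdots\otimes\theta_{A_T}^{x_T}$$ be a classical-quantum state, where $\tilde x_t=(x_t,u_t)$ if $v_t$ is a multi-parent vertex, $\tilde x_t=x_t$ otherwise, and $\theta_{A_t}^{x_t}$ is a density operator on $\mathcal H_t$. Let $\rho_{\tilde X_{[T]}BE}=(\mathrm{id}\otimes\mathcal N_{A_{[T]}\to BE})(\rho_{\tilde X_{[T]}A_{[T]}})$, and suppose that its marginal on $E$ satisfies $\rho_E=\rho_0$. Let $\alpha\in(0,\tfrac12)$. Then there exists a $(2^{R_1},\dots,2^{R_S},1)$ code such that $$\mathbb P\{\hat M_{[S]}\ne M_{[S]}\}\le 6\mu_{B,[T]}^{\alpha}2^{\alpha\left(\sum_{s=1}^S R_s-\underline D_{1-\alpha}(\rho_{\tilde X_{[T]}B}\|\rho_{\tilde X_{[T]}}\otimes\rho_B)\right)}+6\sum_{\emptyset\neq\mathcal S\subsetneq[S]}\mu_{B,\mathcal T_{\mathcal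 S}^c}^{\alpha}2^{\alpha\left(\sum_{s\in\mathcal S}R_s-\underline I_{1-\alpha}(\tilde X_{\mathcal T_{\mathcal S}};B|\tilde X_{\mathcal T_{\mathcal S}^c})\right)}$$ and $$\|\tau_E-\rho_0\|_1\le\frac{2}{\sqrt\alpha}\Big[\mu_{E,|\mathfrak B|}^{\alpha/2}2^{\frac\alpha2\left(-\sum_{s=1}^SR_s+\underline D_{1+\alpha}(\rho_{\tilde X_{[T]}E}\|\rho_{\tilde X_{[T]}}\otimes\rho_E)\right)}+\sum_{i=1}^{|\mathfrak B|}\mu_{E,i-1}^{\alpha/2}2^{\frac\alpha2\left(-\sum_{s\in\mathcal S_i}R_s+\underline D_{1+\alpha}(\rho_{\tilde X(\mathcal S_i)E}\|\rho_{\tilde X(\mathcal S_i)}\otimes\rho_E)\right)}\Big].$$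
   Context: Notation: $[k]=\{1,\dots,k\}$; logarithms are base 2; $\mathcal D(\mathcal H)$ is the set of density operators on $\mathcal H$; all Hilbert spaces are finite-dimensional and all classical alphabets are finite; $Y_{\mathcal J}=(Y_j)_{j\in\mathcal J}$. MAC and messages. $\mathcal N_{A_{[T]}\to BE}$ is a completely positive trace-preserving map from operators on $\mathcal H_1\otimes\cdots\otimes\mathcal H_T$ to operators on $\mathcal H_b\otimes\mathcal H_e$; $B$ is observed by the legitimate receiver, $E$ by the warden. There are $S$ independent uniform messages $M_1,\dots,M_S$; transmitter $t$ knows $M_{\mathcal I_t}$ where $\emptyset\ne\mathcal I_t\subseteq[S]$. The sets $\mathcal I_t$ are pairwise distinct, each message is known to at least one transmitter, and no two messages are available to exactly the same set of transmitters. Special message hierarchy: for all $t_1\ne t_2$, $\mathcal I_{t_1}\cap\mathcal I_{t_2}$ is empty or equals $\mathcal I_{t_3}$ for some $t_3\in[T]$. Message graph. Vertices $v_0$ (root) and $v_1,\dots,v_T$. There is a directed edge from $v_{t_1}$ to $v_{t_2}$ ($v_{t_2}$ is a parent of $v_{t_1}$) if $\mathcal I_{t_1}\subsetneq\mathcal I_{t_2}$ and no $t_3$ has $\mathcal I_{t_1}\subsetneq\mathcal I_{t_3}\subsetneq\mathcal I_{t_2}$; a vertex with no parent gets $v_0$ as parent (this may be skipped if some transmitter knows all messages). A multi-parent vertex is one with more than one parent. $\mathbb D_t$ is the set of descendants of $v_t$, i.e. the $t'$ with $\mathcal I_{t'}\subsetneq\mathcal I_t$. Code. A $(2^{R_1},\dots,2^{R_S},1)$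 code consists of message sets $\mathcal M_s=[\lfloor2^{R_s}\rfloor]$, encoders $\mathcal F^{(t)}:\mathcal M_{\mathcal I_t}\to\mathcal D(\mathcal H_t)$ for $t\in[T]$, and a POVM on $\mathcal H_b$ indexed by $m_{[S]}$ with outcome $\hat M_{[S]}$. The channel is used once, with input $\bigotimes_t\mathcal F^{(t)}(m_{\mathcal I_t})$ for messages $m_{[S]}$. $\mathbb P\{\hat M_{[S]}\neq M_{[S]}\}$ is the average error probability over uniform messages, and $\tau_E$ is the warden's output state averaged over uniform messages. Innocent input states $\phi_{0,t}\in\mathcal D(\mathcal H_t)$ are fixed, and $\rho_0=\mathrm{Tr}_B\,\mathcal N_{A_{[T]}\to BE}(\bigotimes_t\phi_{0,t})$. Index sets. For $\mathcal S\subseteq[S]$: $\mathcal T_{\mathcal S}=\{t:\mathcal I_t\cap\mathcal S\ne\emptyset\}$, $\mathcal T_{\mathcal S}^c=[T]\setminus\mathcal T_{\mathcal S}$, and $\tilde X(\mathcal S)=(\tilde X_t)_{t:\mathcal I_t\subseteq\mathcal S}$. $\mathfrak B=(\mathcal S_1,\dots,\mathcal S_{|\mathfrak B|})$ is an ordering of all non-empty strict subsets of $[S]$ with $|\mathcal S_i|\le|\mathcal S_j|$ for $i<j$. Rényi quantities. For $\alpha\in(-1,0)\cup(0,\infty)$, the sandwiched Rényi relative entropy is $\underline D_{1+\alpha}(\rho\|\sigma)=\frac1\alpha\log\mathrm{Tr}\big[(\sigma^{-\frac{\alpha}{2(1+\alpha)}}\rho\,\sigma^{-\frac{\alpha}{2(1+\alpha)}})^{1+\alpha}\big]$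 ($\underline D_{1-\alpha}$ is obtained by replacing $\alpha$ with $-\alpha$). For a classical-quantum state $\rho_{UVB}=\sum_{u,v}p(u,v)|u\rangle\langle u|\otimes|v\rangle\langle v|\otimes\rho_{B|u,v}$, $\underline I_{1-\alpha}(U;B|V)=\min\underline D_{1-\alpha}(\rho_{UVB}\|\sigma_{U-V-B})$, where the minimum is over states $\sigma_{U-V-B}=\sum_{u,v}p(u,v)|u\rangle\langle u|\otimes|v\rangle\langle v|\otimes\sigma_{B|v}$ with $\sigma_{B|v}$ density operators. All quantities are evaluated on the marginals of $\rho_{\tilde X_{[T]}BE}$; $\rho_{B|\tilde x_{\mathcal T}}$ and $\rho_{E|\tilde x(\mathcal S)}$ denote its conditional output states given the indicated classical values. Pinching. For Hermitian $\sigma$ with spectral decomposition $\sigma=\sum_i\lambda_iP_i$ ($\lambda_i$ distinct, $P_i$ the eigenprojections), $\Delta_\sigma(\rho)=\sum_iP_i\rho P_i$. $\Delta_B$ is the pinching with respect to $\rho_B$. For $\mathcal T\subseteq[T]$, $\mu_{B,\mathcal T}$ is the maximum over $\tilde x_{\mathcal T}$ of the number of distinct eigenvalues of $\Delta_B(\rho_{B|\tilde x_{\mathcal T}})$. For the warden, given $\tilde x_{[T]}$, put $\omega_0=\rho_E$ and recursively $\omega_i=\Delta_{\omega_{i-1}}(\rho_{E|\tilde x(\mathcal S_i)})$ for $i=1,\dots,|\mathfrak B|$ (with $\rho_{E|\tilde x(\mathcal S_i)}=\rho_E$ if $\tilde X(\mathcal S_i)$ is empty). $\mu_{E,0}$ is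 the number of distinct eigenvalues of $\rho_E$, and for $i\ge1$ $\mu_{E,i}$ is the maximum over $\tilde x(\mathcal S_1),\dots,\tilde x(\mathcal S_i)$ of the number of distinct eigenvalues of $\omega_i$. *)

theory Defs
  imports "HOL-Analysis.Analysis"
begin

section \<open>Operators on finite-dimensional Hilbert spaces\<close>

text \<open>
  The Hilbert space with orthonormal basis indexed by a finite type is the space of complex
  vectors over that type.  Tensor products are indexed by product types, and a tensor product
  over all \<open>t :: 't\<close> by the function type.
\<close>

type_synonym 'n op = "complex^'n^'n"

definition dagger :: "'n::finite op \<Rightarrow> 'n op" where
  "dagger A = (\<chi> i j. cnj (A $ j $ i))"

definition hermitian :: "'n::finite op \<Rightarrow> bool" where
  "hermitian A \<longleftrightarrow> dagger A = A"

text \<open>The inner product \<open>\<bullet>\<close> is the real part of the complex one, which for hermitian \<open>A\<close> loses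
  nothing in the quadratic form.\<close>

definition psd :: "'n::finite op \<Rightarrow> bool" where
  "psd A \<longleftrightarrow> hermitian A \<and> (\<forall>v. 0 \<le> v \<bullet> (A *v v))"

definition density_op :: "'n::finite op \<Rightarrow> bool" where
  "density_op A \<longleftrightarrow> psd A \<and> trace A = 1"

text \<open>Spaces of different dimensions are handled as the coordinate subspaces spanned by the basis
  vectors with index in \<open>I\<close>; an operator on such a subspace vanishes off \<open>I \<times> I\<close>.\<close>

definition operators_on :: "'n::finite set \<Rightarrow> 'n op set" where
  "operators_on I = {A. \<forall>i j. A $ i $ j \<noteq> 0 \<longrightarrow> i \<in> I \<and> j \<in> I}"

definition densities_on :: "'n::finite set \<Rightarrow> 'n op set" where
  "densities_on I = {A \<in> operators_on I. density_op A}"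

definition tensor :: "'m::finite op \<Rightarrow> 'n::finite op \<Rightarrow> ('m \<times> 'n) op" where
  "tensor A C = (\<chi> i j. A $ fst i $ fst j * C $ snd i $ snd j)"

definition Tensor :: "('t::finite \<Rightarrow> 'a::finite op) \<Rightarrow> ('t \<Rightarrow> 'a) op" where
  "Tensor A = (\<chi> i j. \<Prod>t\<in>UNIV. A t $ i t $ j t)"

definition tr_snd :: "('b::finite \<times> 'e::finite) op \<Rightarrow> 'b op" where
  "tr_snd A = (\<chi> i j. \<Sum>k\<in>UNIV. A $ (i, k) $ (j, k))"

definition tr_fst :: "('b::finite \<times> 'e::finite) op \<Rightarrow> 'e op" where
  "tr_fst A = (\<chi> i j. \<Sum>k\<in>UNIV. A $ (k, i) $ (k, j))"

definition ketbra :: "'x::finite \<Rightarrow> 'x op" where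
  "ketbra x = (\<chi> i j. if i = x \<and> j = x then 1 else 0)"


subsection \<open>Completely positive trace-preserving maps\<close>

text \<open>Positivity of the operator on the tensor product of an \<open>n\<close>-dimensional space with the given one
  that has the blocks \<open>X k l\<close>, for \<open>k, l < n\<close>.\<close>

definition block_psd :: "nat \<Rightarrow> (nat \<Rightarrow> nat \<Rightarrow> 'i::finite op) \<Rightarrow> bool" where
  "block_psd n X \<longleftrightarrow>
     (\<forall>k<n. \<forall>l<n. X l k = dagger (X k l)) \<and>
     (\<forall>v :: nat \<Rightarrow> complex^'i. 0 \<le> (\<Sum>k<n. \<Sum>l<n. v k \<bullet> (X k l *v v l)))"

text \<open>\<open>mat c ** A\<close> is the complex multiple \<open>c A\<close>.\<close>

definition cptp_on :: "'i::finite set \<Rightarrow> ('i op \<Rightarrow> 'j::finite op) \<Rightarrow> bool" where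
  "cptp_on I N \<longleftrightarrow>
     (\<forall>A\<in>operators_on I. \<forall>C\<in>operators_on I. N (A + C) = N A + N C) \<and>
     (\<forall>A\<in>operators_on I. \<forall>c. N (mat c ** A) = mat c ** N A) \<and>
     (\<forall>n X. (\<forall>k<n. \<forall>l<n. X k l \<in> operators_on I) \<longrightarrow> block_psd n X \<longrightarrow>
        block_psd n (\<lambda>k l. N (X k l))) \<and>
     (\<forall>A\<in>operators_on I. trace (N A) = trace A)"


subsection \<open>Spectral calculus\<close>

text \<open>The following are meant for hermitian operators, whose eigenvalues are real.\<close>

definition eigvals :: "'n::finite op \<Rightarrow> real set" where
  "eigvals A = {l. \<exists>v. v \<noteq> 0 \<and> A *v v = of_real l *s v}"

definition eigproj :: "'n::finite op \<Rightarrow> real \<Rightarrow> 'n op" where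
  "eigproj A l = (THE P. hermitian P \<and> P ** P = P \<and>
     range (\<lambda>v. P *v v) = {v. A *v v = of_real l *s v})"

definition pinching :: "'n::finite op \<Rightarrow> 'n op \<Rightarrow> 'n op" where
  "pinching \<sigma> \<rho> = (\<Sum>l\<in>eigvals \<sigma>. eigproj \<sigma> l ** \<rho> ** eigproj \<sigma> l)"

text \<open>Powers are taken on the support: \<open>0 powr r = 0\<close> for every \<open>r\<close>, negative ones included.\<close>

definition op_powr :: "'n::finite op \<Rightarrow> real \<Rightarrow> 'n op" where
  "op_powr A r = (\<Sum>l\<in>eigvals A. (l powr r) *\<^sub>R eigproj A l)"

definition trace_norm :: "'n::finite op \<Rightarrow> real" where
  "trace_norm A = Re (trace (op_powr (dagger A ** A) (1/2)))"


section \<open>Renyi quantities\<close>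

text \<open>Sandwiched relative entropy of order \<open>1 + a\<close>, for \<open>a \<in> (-1,0) \<union> (0,\<infinity>)\<close>, with the usual value
  \<open>\<infinity>\<close> if the support of \<open>\<rho>\<close> is not contained in that of \<open>\<sigma>\<close> (\<open>a > 0\<close>), respectively if \<open>\<rho>\<close> and
  \<open>\<sigma>\<close> have orthogonal supports (\<open>a < 0\<close>); note \<open>log 2 0 = 0\<close>.\<close>

definition renyi_trace :: "real \<Rightarrow> 'n::finite op \<Rightarrow> 'n op \<Rightarrow> real" where
  "renyi_trace a \<rho> \<sigma> =
     (let s = op_powr \<sigma> (- a / (2 * (1 + a))) in Re (trace (op_powr (s ** \<rho> ** s) (1 + a))))"

definition renyi_D :: "real \<Rightarrow> 'n::finite op \<Rightarrow> 'n op \<Rightarrow> ereal" where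
  "renyi_D a \<rho> \<sigma> =
     (if a > 0 \<and> \<not> (\<forall>v. \<sigma> *v v = 0 \<longrightarrow> \<rho> *v v = 0) \<or> a < 0 \<and> renyi_trace a \<rho> \<sigma> = 0 then \<infinity>
      else ereal (1 / a * log 2 (renyi_trace a \<rho> \<sigma>)))"

definition classical_state :: "('x::finite \<Rightarrow> real) \<Rightarrow> 'x op" where
  "classical_state q = (\<Sum>x\<in>UNIV. q x *\<^sub>R ketbra x)"

definition cq_state :: "('x::finite \<Rightarrow> real) \<Rightarrow> ('x \<Rightarrow> 'b::finite op) \<Rightarrow> ('x \<times> 'b) op" where
  "cq_state q V = (\<Sum>x\<in>UNIV. q x *\<^sub>R tensor (ketbra x) (V x))"

text \<open>\<open>renyi_I (-\<alpha>)\<close> is the conditional quantity of order \<open>1 - \<alpha>\<close> of the state with joint law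
  \<open>q (u, v)\<close> and conditional states \<open>V (u, v)\<close>; \<open>ketbra (u, v)\<close> is the tensor product of \<open>ketbra u\<close>
  and \<open>ketbra v\<close>.  By compactness and lower semicontinuity the infimum is a minimum.\<close>

definition renyi_I ::
    "real \<Rightarrow> ('u::finite \<times> 'v::finite \<Rightarrow> real) \<Rightarrow> ('u \<times> 'v \<Rightarrow> 'b::finite op) \<Rightarrow> ereal" where
  "renyi_I a q V = (INF \<sigma> \<in> {\<sigma> :: 'v \<Rightarrow> 'b op. \<forall>v. density_op (\<sigma> v)}.
     renyi_D a (cq_state q V) (cq_state q (\<lambda>(u, v). \<sigma> v)))"


section \<open>Messages\<close>

definition message_assignment :: "('t::finite \<Rightarrow> 's::finite set) \<Rightarrow> bool" where
  "message_assignment I \<longleftrightarrow>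
     (\<forall>t. I t \<noteq> {}) \<and> inj I \<and> (\<forall>s. \<exists>t. s \<in> I t) \<and> inj (\<lambda>s. {t. s \<in> I t})"

definition special_hierarchy :: "('t::finite \<Rightarrow> 's::finite set) \<Rightarrow> bool" where
  "special_hierarchy I \<longleftrightarrow>
     (\<forall>t1 t2. t1 \<noteq> t2 \<longrightarrow> I t1 \<inter> I t2 = {} \<or> (\<exists>t3. I t1 \<inter> I t2 = I t3))"

text \<open>The root \<open>v\<^sub>0\<close> of the message graph is \<open>None\<close>.\<close>

definition parents :: "('t::finite \<Rightarrow> 's::finite set) \<Rightarrow> 't \<Rightarrow> 't option set" where
  "parents I t1 =
     (let Q = {t2. I t1 \<subset> I t2 \<and> \<not> (\<exists>t3. I t1 \<subset> I t3 \<and> I t3 \<subset> I t2)}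
      in if Q = {} then {None} else Some ` Q)"

definition multi_parent :: "('t::finite \<Rightarrow> 's::finite set) \<Rightarrow> 't \<Rightarrow> bool" where
  "multi_parent I t \<longleftrightarrow> 1 < card (parents I t)"

definition descendants :: "('t::finite \<Rightarrow> 's::finite set) \<Rightarrow> 't \<Rightarrow> 't set" where
  "descendants I t = {t'. I t' \<subset> I t}"

definition transmitters_meeting :: "('t::finite \<Rightarrow> 's::finite set) \<Rightarrow> 's set \<Rightarrow> 't set" where
  "transmitters_meeting I S = {t. I t \<inter> S \<noteq> {}}"

definition transmitters_inside :: "('t::finite \<Rightarrow> 's::finite set) \<Rightarrow> 's set \<Rightarrow> 't set" where
  "transmitters_inside I S = {t. I t \<subseteq> S}"

definition subset_ordering :: "'s::finite set list \<Rightarrow> bool" where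
  "subset_ordering Bs \<longleftrightarrow> distinct Bs \<and> set Bs = {S. S \<noteq> {} \<and> S \<subset> UNIV} \<and>
     sorted_wrt (\<lambda>S S'. card S \<le> card S') Bs"


section \<open>Codes\<close>

text \<open>\<open>H t\<close> is the set of basis indices of the input space of transmitter \<open>t\<close>.  Tuples of messages
  known to a transmitter are functions in \<open>Pi\<^sub>E (I t)\<close>, obtained from a full tuple by \<open>restrict\<close>.\<close>

definition message_set :: "real \<Rightarrow> nat set" where
  "message_set r = {1..nat \<lfloor>2 powr r\<rfloor>}"

definition messages :: "('s::finite \<Rightarrow> real) \<Rightarrow> ('s \<Rightarrow> nat) set" where
  "messages R = {m. \<forall>s. m s \<in> message_set (R s)}"

definition is_code ::
    "('t::finite \<Rightarrow> 'a::finite set) \<Rightarrow> ('t \<Rightarrow> 's::finite set) \<Rightarrow> ('s \<Rightarrow> real) \<Rightarrow>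
     ('t \<Rightarrow> ('s \<Rightarrow> nat) \<Rightarrow> 'a op) \<Rightarrow> (('s \<Rightarrow> nat) \<Rightarrow> 'b::finite op) \<Rightarrow> bool" where
  "is_code H I R F \<Lambda> \<longleftrightarrow>
     (\<forall>t. \<forall>m \<in> Pi\<^sub>E (I t) (\<lambda>s. message_set (R s)). F t m \<in> densities_on (H t)) \<and>
     (\<forall>m\<in>messages R. psd (\<Lambda> m)) \<and> (\<Sum>m\<in>messages R. \<Lambda> m) = mat 1"

definition code_output ::
    "(('t::finite \<Rightarrow> 'a::finite) op \<Rightarrow> ('b::finite \<times> 'e::finite) op) \<Rightarrow> ('t \<Rightarrow> 's::finite set) \<Rightarrow>
     ('t \<Rightarrow> ('s \<Rightarrow> nat) \<Rightarrow> 'a op) \<Rightarrow> ('s \<Rightarrow> nat) \<Rightarrow> ('b \<times> 'e) op" where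
  "code_output N I F m = N (Tensor (\<lambda>t. F t (restrict m (I t))))"

definition error_prob ::
    "(('t::finite \<Rightarrow> 'a::finite) op \<Rightarrow> ('b::finite \<times> 'e::finite) op) \<Rightarrow> ('t \<Rightarrow> 's::finite set) \<Rightarrow>
     ('s \<Rightarrow> real) \<Rightarrow> ('t \<Rightarrow> ('s \<Rightarrow> nat) \<Rightarrow> 'a op) \<Rightarrow> (('s \<Rightarrow> nat) \<Rightarrow> 'b op) \<Rightarrow> real" where
  "error_prob N I R F \<Lambda> =
     (\<Sum>m\<in>messages R. \<Sum>m'\<in>messages R - {m}.
        Re (trace (\<Lambda> m' ** tr_snd (code_output N I F m)))) / real (card (messages R))"

definition warden_state ::
    "(('t::finite \<Rightarrow> 'a::finite) op \<Rightarrow> ('b::finite \<times> 'e::finite) op) \<Rightarrow> ('t \<Rightarrow> 's::finite set) \<Rightarrow>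
     ('s \<Rightarrow> real) \<Rightarrow> ('t \<Rightarrow> ('s \<Rightarrow> nat) \<Rightarrow> 'a op) \<Rightarrow> 'e op" where
  "warden_state N I R F =
     (1 / real (card (messages R))) *\<^sub>R (\<Sum>m\<in>messages R. tr_fst (code_output N I F m))"


section \<open>The classical-quantum state\<close>

text \<open>A symbol of transmitter \<open>t\<close> is \<open>(x, Some u)\<close> at a multi-parent vertex and \<open>(x, None)\<close>
  otherwise.  A word assigns a symbol to every transmitter.\<close>

definition symbols ::
    "('t::finite \<Rightarrow> 's::finite set) \<Rightarrow> ('t \<Rightarrow> 'x set) \<Rightarrow> ('t \<Rightarrow> 'u set) \<Rightarrow> 't \<Rightarrow> ('x \<times> 'u option) set"
    where
  "symbols I X U t = X t \<times> (if multi_parent I t then Some ` U t else {None})"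

text \<open>\<open>p t a y\<close> is the probability of the symbol \<open>a\<close> of transmitter \<open>t\<close> given the symbols \<open>y\<close> of its
  descendants.\<close>

definition conditional_laws ::
    "('t::finite \<Rightarrow> 's::finite set) \<Rightarrow> ('t \<Rightarrow> 'c set) \<Rightarrow> ('t \<Rightarrow> 'c \<Rightarrow> ('t \<Rightarrow> 'c) \<Rightarrow> real) \<Rightarrow> bool" where
  "conditional_laws I L p \<longleftrightarrow>
     (\<forall>t. \<forall>y \<in> Pi\<^sub>E (descendants I t) L. (\<forall>a\<in>L t. 0 \<le> p t a y) \<and> (\<Sum>a\<in>L t. p t a y) = 1)"

definition joint_law ::
    "('t::finite \<Rightarrow> 's::finite set) \<Rightarrow> ('t \<Rightarrow> 'c set) \<Rightarrow> ('t \<Rightarrow> 'c \<Rightarrow> ('t \<Rightarrow> 'c) \<Rightarrow> real) \<Rightarrow>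
     ('t \<Rightarrow> 'c) \<Rightarrow> real" where
  "joint_law I L p x =
     (if \<forall>t. x t \<in> L t then \<Prod>t\<in>UNIV. p t (x t) (restrict x (descendants I t)) else 0)"

text \<open>The identity on the classical registers tensored with \<open>N\<close> acts blockwise, so the output state is
  the classical-quantum state with the following conditional states.\<close>

definition word_output ::
    "(('t::finite \<Rightarrow> 'a::finite) op \<Rightarrow> ('b::finite \<times> 'e::finite) op) \<Rightarrow> ('t \<Rightarrow> 'x \<Rightarrow> 'a op) \<Rightarrow>
     ('t \<Rightarrow> 'x \<times> 'u) \<Rightarrow> ('b \<times> 'e) op" where
  "word_output N \<theta> x = N (Tensor (\<lambda>t. \<theta> t (fst (x t))))"

text \<open>Marginals of the state with law \<open>P\<close> and conditional states \<open>W\<close>: the law of a function \<open>f\<close> of the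
  classical part, the conditional state given its value (\<open>0\<close> for values of probability zero), and
  the quantum marginal.\<close>

definition law_of :: "('w::finite \<Rightarrow> real) \<Rightarrow> ('w \<Rightarrow> 'y) \<Rightarrow> 'y \<Rightarrow> real" where
  "law_of P f y = (\<Sum>x | f x = y. P x)"

definition cond_state ::
    "('w::finite \<Rightarrow> real) \<Rightarrow> ('w \<Rightarrow> 'n::finite op) \<Rightarrow> ('w \<Rightarrow> 'y) \<Rightarrow> 'y \<Rightarrow> 'n op" where
  "cond_state P W f y = (1 / law_of P f y) *\<^sub>R (\<Sum>x | f x = y. P x *\<^sub>R W x)"

definition mean_state :: "('w::finite \<Rightarrow> real) \<Rightarrow> ('w \<Rightarrow> 'n::finite op) \<Rightarrow> 'n op" where
  "mean_state P W = (\<Sum>x\<in>UNIV. P x *\<^sub>R W x)"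

text \<open>The relative entropy of the joint state of \<open>f\<close> and the quantum system with respect to the product
  of its marginals, and the conditional quantity for the pair \<open>(f, g)\<close>.  On the states at hand
  both are finite, so that \<open>real_of_ereal\<close> discards nothing.\<close>

definition D_of ::
    "real \<Rightarrow> ('w::finite \<Rightarrow> real) \<Rightarrow> ('w \<Rightarrow> 'n::finite op) \<Rightarrow> ('w \<Rightarrow> 'y::finite) \<Rightarrow> real" where
  "D_of a P W f = real_of_ereal
     (renyi_D a (cq_state (law_of P f) (cond_state P W f))
                (tensor (classical_state (law_of P f)) (mean_state P W)))"

definition I_of ::
    "real \<Rightarrow> ('w::finite \<Rightarrow> real) \<Rightarrow> ('w \<Rightarrow> 'n::finite op) \<Rightarrow> ('w \<Rightarrow> 'y::finite) \<Rightarrow> ('w \<Rightarrow> 'z::finite) \<Rightarrow>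
     real" where
  "I_of a P W f g = (let h = (\<lambda>x. (f x, g x)) in
     real_of_ereal (renyi_I a (law_of P h) (cond_state P W h)))"


subsection \<open>Numbers of eigenvalues\<close>

text \<open>Conditional states exist only for words of positive probability, so the maxima are over those.\<close>

definition mu_B ::
    "(('t::finite \<Rightarrow> 'c::finite) \<Rightarrow> real) \<Rightarrow> (('t \<Rightarrow> 'c) \<Rightarrow> 'b::finite op) \<Rightarrow> 't set \<Rightarrow> nat" where
  "mu_B P W T = (let f = (\<lambda>x. restrict x T) in
     Max ((\<lambda>x. card (eigvals (pinching (mean_state P W) (cond_state P W f (f x)))))
          ` {x. 0 < P x}))"

text \<open>The list \<open>Bs\<close> is indexed from \<open>0\<close>, so \<open>Bs ! i\<close> is the set \<open>\<S>\<^sub>i\<^sub>+\<^sub>1\<close>.\<close>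

fun omega ::
    "('t::finite \<Rightarrow> 's::finite set) \<Rightarrow> 's set list \<Rightarrow> (('t \<Rightarrow> 'c::finite) \<Rightarrow> real) \<Rightarrow>
     (('t \<Rightarrow> 'c) \<Rightarrow> 'e::finite op) \<Rightarrow> ('t \<Rightarrow> 'c) \<Rightarrow> nat \<Rightarrow> 'e op" where
  "omega I Bs P W x 0 = mean_state P W"
| "omega I Bs P W x (Suc i) =
     (let f = (\<lambda>x. restrict x (transmitters_inside I (Bs ! i)))
      in pinching (omega I Bs P W x i) (cond_state P W f (f x)))"

definition mu_E ::
    "('t::finite \<Rightarrow> 's::finite set) \<Rightarrow> 's set list \<Rightarrow> (('t \<Rightarrow> 'c::finite) \<Rightarrow> real) \<Rightarrow>
     (('t \<Rightarrow> 'c) \<Rightarrow> 'e::finite op) \<Rightarrow> nat \<Rightarrow> nat" where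
  "mu_E I Bs P W i = Max ((\<lambda>x. card (eigvals (omega I Bs P W x i))) ` {x. 0 < P x})"

end

theory Submission
  imports Defs "HOL-Probability.Probability"
begin

text \<open>
  All numbers of eigenvalues are at least \<open>1\<close>, so it suffices to prove the bounds without them.
  Codewords are drawn at random.  Each transmitter has a random response function which maps the
  symbols of its descendants to its own symbol; these seeds are independent, and a codebook is built
  by recursion over the messages, merging independent seeds transmitter by transmitter.  Redrawing
  the seeds of all transmitters that meet \<open>S\<close> averages the output into exactly the conditional state
  that occurs in the term for \<open>S\<close>.

  For \<open>\<Phi>\<^sub>l t = t\<^sup>2 / (l + t)\<close> and a random positive \<open>Z\<close> one has
  \<open>E tr \<Phi>\<^sub>l (X + Z) \<le> tr \<Phi>\<^sub>l (X + E Z) + E tr \<Phi>\<^sub>l Z\<close>; iterated along the recursion this bounds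
  \<open>E tr \<Phi>\<^sub>l\<close> of a sum over all messages by one term for every set of messages.  Integrating over \<open>l\<close>
  turns \<open>\<Phi>\<^sub>l t\<close> into \<open>t powr (1 + \<alpha>)\<close>.

  Reliability: for the measurement \<open>K\<^sub>m = \<rho>\<^sub>m O powr (-1/2)\<close>, \<open>O = \<Sum>\<^sub>m \<rho>\<^sub>m\<^sup>2\<close>, the total error is at most
  \<open>2 (\<Sum>\<^sub>m tr \<rho>\<^sub>m - tr (sqrt O))\<close>.  With \<open>sqrt x = (2 / \<pi>) \<integral> x / (x + h\<^sup>2) dh\<close> the integrand at each \<open>h\<close> is
  bounded by \<open>\<Phi>\<^sub>1\<close> of sums of \<open>\<rho>\<^sub>m\<^sup>2 / (\<rho>\<^sub>m\<^sup>2 + 2 h\<^sup>2)\<close>, to which the recursion applies.  The result is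
  a sum of terms \<open>tr \<rho> powr (1 - \<alpha>) \<sigma> powr \<alpha>\<close>, and these are at most the sandwiched quantities.

  Covertness: \<open>tr \<bar>X\<bar> powr (1 + \<alpha>)\<close> obeys Clarkson's inequality, so symmetrisation gives the same
  recursion for the deviation from the mean, up to a factor \<open>2\<close>; Hoelder's inequality passes from this
  quantity to the trace norm.  The expected error uses up at most the fraction \<open>1 - \<alpha>\<close> of its bound and
  the expected deviation the fraction \<open>\<alpha>\<close> of its own, so some codebook satisfies both.
\<close>

section \<open>Hermitian and positive matrices\<close>

text \<open>The symbols of a word are correlated along the message graph, so they cannot be redrawn
  one by one. Response functions are independent, and redrawing those of the transmitters that meet
  a set leaves all other symbols untouched, because a transmitter that does not meet the set has no
  descendant that does.

  Averaging inside a noncommutative function is the obstacle. For \<Phi> it reduces to completing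
  squares with resolvents, and all powers that occur are integrals over such functions.

  The constants leave little room. The fraction 1 - \<alpha> of the error comes from t / (1 + t)
  \<le> (1 - \<alpha>) t powr \<alpha>; what remains is 2 sqrt 2 * 2 powr (- \<alpha>) * (1 + 0.96
  \<alpha>), which stays below 3, half of the 6 in the statement. The fraction \<alpha> of the
  leakage comes from the prefactor 2 / sqrt \<alpha>. Message sets have only the rounded-down sizes:
  if the leakage bound is at least 2 it holds for every code, and if it is smaller it forces the
  sizes to be large enough for rounding to be cheap.\<close>

definition tr :: "'n::finite op \<Rightarrow> real" where
  "tr A = Re (trace A)"

lemma matrix_diff_ldistrib: "(A :: 'n::finite op) ** (B - C) = A ** B - A ** C"
  by (simp add: matrix_matrix_mult_def vec_eq_iff algebra_simps sum_subtractf)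

lemma matrix_diff_rdistrib: "(B - C) ** (A :: 'n::finite op) = B ** A - C ** A"
  by (simp add: matrix_matrix_mult_def vec_eq_iff algebra_simps sum_subtractf)

lemma matrix_add_rdistrib': "(B + C) ** (A :: 'n::finite op) = B ** A + C ** A"
  by (simp add: matrix_matrix_mult_def vec_eq_iff algebra_simps sum.distrib)

lemma matrix_scaleR_left: "(c *\<^sub>R A) ** (B :: 'n::finite op) = c *\<^sub>R (A ** B)"
  by (simp add: matrix_matrix_mult_def vec_eq_iff scaleR_sum_right)

lemma matrix_scaleR_right: "(A :: 'n::finite op) ** (c *\<^sub>R B) = c *\<^sub>R (A ** B)"
  by (simp add: matrix_matrix_mult_def vec_eq_iff scaleR_sum_right)

lemma matrix_minus_left: "(- A) ** (B :: 'n::finite op) = - (A ** B)"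
  by (simp add: matrix_matrix_mult_def vec_eq_iff sum_negf)

lemma matrix_minus_right: "(A :: 'n::finite op) ** (- B) = - (A ** B)"
  by (simp add: matrix_matrix_mult_def vec_eq_iff sum_negf)

lemma matrix_zero_left: "0 ** (B :: 'n::finite op) = 0"
  by (simp add: matrix_matrix_mult_def vec_eq_iff)

lemma matrix_zero_right: "(A :: 'n::finite op) ** 0 = 0"
  by (simp add: matrix_matrix_mult_def vec_eq_iff)

text \<open>Flattens a polynomial in operators into right-nested words. Cancellation rules such as
  \<open>A ** (K ** Y) = Y\<close> are stated with a trailing factor below, so that they still apply
  inside such a word.\<close>

lemmas mx = matrix_add_ldistrib matrix_add_rdistrib' matrix_diff_ldistrib matrix_diff_rdistrib
  matrix_scaleR_left matrix_scaleR_right matrix_minus_left matrix_minus_right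
  matrix_mul_lid matrix_mul_rid matrix_zero_left matrix_zero_right matrix_mul_assoc[symmetric]

lemma matrix_sum_left: "(\<Sum>i\<in>S. F i) ** (B :: 'n::finite op) = (\<Sum>i\<in>S. F i ** B)"
  by (induction S rule: infinite_finite_induct) (auto simp: mx)

lemma matrix_sum_right: "(B :: 'n::finite op) ** (\<Sum>i\<in>S. F i) = (\<Sum>i\<in>S. B ** F i)"
  by (induction S rule: infinite_finite_induct) (auto simp: mx)

lemma tr_add: "tr (A + B) = tr A + tr B"
  by (simp add: tr_def trace_add)
lemma tr_diff: "tr (A - B) = tr A - tr B"
  by (simp add: tr_def trace_sub)
lemma tr_minus: "tr (- A) = - tr A"
  by (simp add: tr_def trace_def sum_negf)
lemma tr_scaleR: "tr (c *\<^sub>R A) = c * tr A"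
  by (simp add: tr_def trace_def sum_distrib_left)
lemma tr_zero: "tr 0 = 0"
  by (simp add: tr_def trace_def)
lemma tr_sum: "tr (\<Sum>i\<in>S. F i) = (\<Sum>i\<in>S. tr (F i))"
  by (induction S rule: infinite_finite_induct) (auto simp: tr_add tr_zero)
lemma tr_comm: "tr (A ** B) = tr (B ** A)"
  unfolding tr_def by (subst trace_mul_sym) (rule refl)
lemma tr_cyc: "tr (A ** (B ** C)) = tr (B ** (C ** A))"
  by (subst tr_comm) (simp only: matrix_mul_assoc)

lemmas trs = tr_add tr_diff tr_minus tr_scaleR tr_zero

section \<open>Adjoints and hermitian operators\<close>

lemma dagger_dagger [simp]: "dagger (dagger A) = A"
  by (simp add: dagger_def vec_eq_iff)
lemma dagger_mult: "dagger (A ** B) = dagger B ** dagger A"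
  by (simp add: dagger_def matrix_matrix_mult_def vec_eq_iff mult.commute)
lemma dagger_add: "dagger (A + B) = dagger A + dagger B"
  by (simp add: dagger_def vec_eq_iff)
lemma dagger_diff: "dagger (A - B) = dagger A - dagger B"
  by (simp add: dagger_def vec_eq_iff)
lemma dagger_scaleR: "dagger (c *\<^sub>R A) = c *\<^sub>R dagger A"
  by (simp add: dagger_def vec_eq_iff)
lemma dagger_zero [simp]: "dagger 0 = 0"
  by (simp add: dagger_def vec_eq_iff)
lemma dagger_one [simp]: "dagger (mat 1) = mat 1"
  by (simp add: dagger_def vec_eq_iff mat_def)
lemma dagger_sum: "dagger (\<Sum>i\<in>S. F i) = (\<Sum>i\<in>S. dagger (F i))"
  by (induction S rule: infinite_finite_induct) (auto simp: dagger_add)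
lemma tr_dagger: "tr (dagger A) = tr A"
  by (simp add: tr_def trace_def dagger_def)

lemma herm_add: "hermitian A \<Longrightarrow> hermitian B \<Longrightarrow> hermitian (A + B)"
  by (simp add: hermitian_def dagger_add)
lemma herm_diff: "hermitian A \<Longrightarrow> hermitian B \<Longrightarrow> hermitian (A - B)"
  by (simp add: hermitian_def dagger_diff)
lemma herm_scaleR: "hermitian A \<Longrightarrow> hermitian (c *\<^sub>R A)"
  by (simp add: hermitian_def dagger_scaleR)
lemma herm_zero [simp]: "hermitian 0"
  by (simp add: hermitian_def)
lemma herm_one [simp]: "hermitian (mat 1)"
  by (simp add: hermitian_def)
lemma herm_sum: "(\<And>i. i \<in> S \<Longrightarrow> hermitian (F i)) \<Longrightarrow> hermitian (\<Sum>i\<in>S. F i)"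
  by (simp add: hermitian_def dagger_sum)
lemma herm_conj: "hermitian A \<Longrightarrow> hermitian (dagger V ** A ** V)"
  by (simp add: hermitian_def dagger_mult matrix_mul_assoc)
lemma herm_sandwich: "hermitian A \<Longrightarrow> hermitian V \<Longrightarrow> hermitian (V ** A ** V)"
  using herm_conj[of A V] by (simp add: hermitian_def)

section \<open>The complex inner product and positive semidefinite operators\<close>

definition cinner :: "complex^'n::finite \<Rightarrow> complex^'n \<Rightarrow> complex" where
  "cinner v w = (\<Sum>i\<in>UNIV. cnj (v $ i) * w $ i)"

lemma inner_eq_Re_cinner: "v \<bullet> w = Re (cinner v w)"
  by (simp add: inner_vec_def cinner_def inner_complex_def)

lemma cinner_mult_right: "cinner v (A *v w) = cinner (dagger A *v v) w"
proof -
  have "cinner v (A *v w) = (\<Sum>i\<in>UNIV. \<Sum>j\<in>UNIV. cnj (v $ i) * (A $ i $ j * w $ j))"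
    by (simp add: cinner_def matrix_vector_mult_def sum_distrib_left)
  also have "\<dots> = (\<Sum>j\<in>UNIV. \<Sum>i\<in>UNIV. cnj (v $ i) * (A $ i $ j * w $ j))"
    by (rule sum.swap)
  also have "\<dots> = cinner (dagger A *v v) w"
    by (simp add: cinner_def matrix_vector_mult_def dagger_def sum_distrib_right sum_distrib_left mult_ac)
  finally show ?thesis .
qed

lemma inner_conj: "v \<bullet> ((dagger V ** A ** V) *v v) = (V *v v) \<bullet> (A *v (V *v v))"
  by (simp add: inner_eq_Re_cinner cinner_mult_right matrix_vector_mul_assoc[symmetric])

lemma psd_herm: "psd A \<Longrightarrow> hermitian A"
  by (simp add: psd_def)
lemma psd_zero [simp]: "psd 0"
  by (simp add: psd_def)
lemma psd_add: "psd A \<Longrightarrow> psd B \<Longrightarrow> psd (A + B)"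
  by (auto simp: psd_def herm_add matrix_vector_mult_add_rdistrib inner_add_right)
lemma psd_sum: "(\<And>i. i \<in> S \<Longrightarrow> psd (F i)) \<Longrightarrow> psd (\<Sum>i\<in>S. F i)"
  by (induction S rule: infinite_finite_induct) (auto simp: psd_add)
lemma scaleR_mult_vec: "(c *\<^sub>R A) *v v = c *\<^sub>R (A *v v)" for A :: "'n::finite op"
  by (simp add: matrix_vector_mult_def vec_eq_iff scaleR_sum_right)
lemma psd_scaleR: "psd A \<Longrightarrow> 0 \<le> c \<Longrightarrow> psd (c *\<^sub>R A)"
  by (auto simp: psd_def herm_scaleR scaleR_mult_vec)
lemma psd_one [simp]: "psd (mat 1)"
  by (simp add: psd_def)
lemma psd_conj: "psd A \<Longrightarrow> psd (dagger V ** A ** V)"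
  by (simp add: psd_def herm_conj inner_conj)
lemma psd_sandwich: "psd A \<Longrightarrow> hermitian V \<Longrightarrow> psd (V ** A ** V)"
  using psd_conj[of A V] by (simp add: hermitian_def)
lemma psd_square: "psd (dagger V ** V)"
  using psd_conj[of "mat 1" V] by simp
lemma psd_herm_square: "hermitian V \<Longrightarrow> psd (V ** V)"
  using psd_square[of V] by (simp add: hermitian_def)

lemma cinner_self: "cinner v v = of_real ((norm v)\<^sup>2)"
proof -
  have "cinner v v = of_real (\<Sum>i\<in>UNIV. (cmod (v $ i))\<^sup>2)"
    unfolding cinner_def of_real_sum by (intro sum.cong refl) (simp add: mult.commute complex_norm_square[symmetric])
  also have "(\<Sum>i\<in>UNIV. (cmod (v $ i))\<^sup>2) = (norm v)\<^sup>2"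
    by (simp add: norm_vec_def L2_set_def sum_nonneg)
  finally show ?thesis .
qed

lemma tr_psd: "psd A \<Longrightarrow> 0 \<le> tr A"
proof -
  assume A: "psd A"
  have "tr A = (\<Sum>i\<in>UNIV. axis i 1 \<bullet> (A *v axis i 1))"
  proof -
    have "axis i 1 \<bullet> (A *v axis i 1) = Re (A $ i $ i)" for i
      by (simp add: inner_eq_Re_cinner cinner_def matrix_vector_mult_def axis_def if_distrib
            if_distribR sum.delta cong: if_cong)
    then show ?thesis by (simp add: tr_def trace_def)
  qed
  then show ?thesis using A by (auto simp: psd_def intro!: sum_nonneg)
qed

section \<open>The spectral theorem and functional calculus\<close>

definition unitary :: "'n::finite op \<Rightarrow> bool" where
  "unitary U \<longleftrightarrow> dagger U ** U = mat 1"

lemma unitary_right: "unitary U \<Longrightarrow> U ** dagger U = mat 1"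
  by (simp add: unitary_def matrix_left_right_inverse)

definition diagm :: "('n::finite \<Rightarrow> real) \<Rightarrow> 'n op" where
  "diagm d = (\<chi> i j. if i = j then of_real (d i) else 0)"

lemma diagm_left: "(diagm d ** B) $ i $ j = of_real (d i) * B $ i $ j"
  by (simp add: diagm_def matrix_matrix_mult_def mult_delta_left)
lemma diagm_right: "(B ** diagm d) $ i $ j = B $ i $ j * of_real (d j)"
  by (simp add: diagm_def matrix_matrix_mult_def mult_delta_right)
lemma diagm_mult: "diagm d ** diagm e = diagm (\<lambda>i. d i * e i)"
  by (simp add: vec_eq_iff diagm_left) (simp add: diagm_def)
lemma diagm_add: "diagm d + diagm e = diagm (\<lambda>i. d i + e i)"
  by (auto simp: diagm_def vec_eq_iff)
lemma diagm_scaleR: "c *\<^sub>R diagm d = diagm (\<lambda>i. c * d i)"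
  by (auto simp: diagm_def vec_eq_iff complex_eq_iff)
lemma diagm_one: "diagm (\<lambda>_. 1) = mat 1"
  by (auto simp: diagm_def vec_eq_iff mat_def)
lemma diagm_dagger: "dagger (diagm d) = diagm d"
  by (auto simp: diagm_def dagger_def vec_eq_iff)
lemma tr_diagm: "tr (diagm d) = (\<Sum>i\<in>UNIV. d i)"
  by (simp add: tr_def trace_def diagm_def)
lemma diagm_vec: "(diagm d *v v) $ i = of_real (d i) * v $ i"
  by (simp add: diagm_def matrix_vector_mult_def mult_delta_left)

definition conjd :: "'n::finite op \<Rightarrow> ('n \<Rightarrow> real) \<Rightarrow> 'n op" where
  "conjd U d = U ** diagm d ** dagger U"

lemma conjd_mult: "unitary U \<Longrightarrow> conjd U d ** conjd U e = conjd U (\<lambda>i. d i * e i)"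
proof -
  assume U: "unitary U"
  have "conjd U d ** conjd U e = U ** diagm d ** (dagger U ** U) ** diagm e ** dagger U"
    by (simp add: conjd_def matrix_mul_assoc)
  also have "\<dots> = U ** (diagm d ** diagm e) ** dagger U"
    using U by (simp add: unitary_def matrix_mul_assoc)
  finally show ?thesis by (simp add: conjd_def diagm_mult)
qed

lemma conjd_add: "conjd U d + conjd U e = conjd U (\<lambda>i. d i + e i)"
  by (simp add: conjd_def diagm_add[symmetric] mx)
lemma conjd_scaleR: "c *\<^sub>R conjd U d = conjd U (\<lambda>i. c * d i)"
  by (simp add: conjd_def diagm_scaleR[symmetric] mx)
lemma conjd_one: "unitary U \<Longrightarrow> conjd U (\<lambda>_. 1) = mat 1"
  by (simp add: conjd_def diagm_one unitary_right)
lemma conjd_herm: "hermitian (conjd U d)"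
  by (simp add: hermitian_def conjd_def dagger_mult diagm_dagger matrix_mul_assoc)
lemma tr_conjd: "unitary U \<Longrightarrow> tr (conjd U d) = (\<Sum>i\<in>UNIV. d i)"
proof -
  assume U: "unitary U"
  have "tr (conjd U d) = tr (dagger U ** U ** diagm d)"
    unfolding conjd_def by (subst tr_comm) (simp add: matrix_mul_assoc)
  then show ?thesis using U by (simp add: unitary_def tr_diagm)
qed

text \<open>Provides the maximiser in \<open>spectral\<close>. The rows of a unitary are unit
  vectors, which bounds the set.\<close>

lemma compact_unitary: "compact {U :: 'n::finite op. unitary U}"
proof -
  have "continuous_on UNIV (\<lambda>U :: 'n op. dagger U ** U)"
    unfolding dagger_def matrix_matrix_mult_def
    by (intro continuous_intros)
  then have "closed {U :: 'n op. dagger U ** U = mat 1}"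
    by (intro closed_Collect_eq continuous_on_const)
  moreover have "bounded {U :: 'n op. unitary U}"
  proof (rule boundedI)
    fix U :: "'n op" assume "U \<in> {U. unitary U}"
    then have U: "U ** dagger U = mat 1" by (simp add: unitary_right)
    have row: "norm (U $ i) = 1" for i
    proof -
      have "(U ** dagger U) $ i $ i = 1" by (simp add: U mat_def)
      then have "(\<Sum>j\<in>UNIV. U $ i $ j * cnj (U $ i $ j)) = 1"
        by (simp add: matrix_matrix_mult_def dagger_def)
      then have "cinner (U $ i) (U $ i) = 1"
        by (simp add: cinner_def mult.commute)
      then have "(norm (U $ i))\<^sup>2 = 1"
        by (metis cinner_self of_real_eq_1_iff)
      then show ?thesis by (simp add: power2_eq_1_iff) (metis norm_ge_zero not_one_le_zero neg_0_le_iff_le)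
    qed
    show "norm U \<le> real CARD('n)"
    proof -
      have "norm U \<le> (\<Sum>i\<in>UNIV. norm (U $ i))"
        unfolding norm_vec_def[of U] by (rule L2_set_le_sum) simp
      then show ?thesis by (simp add: row)
    qed
  qed
  ultimately show ?thesis by (simp add: compact_eq_bounded_closed unitary_def)
qed

definition col :: "'n::finite op \<Rightarrow> 'n \<Rightarrow> complex^'n" where
  "col U b = (\<chi> a. U $ a $ b)"

lemma dagger_mult_entry: "(dagger U ** V) $ a $ b = cinner (col U a) (col V b)"
  by (simp add: matrix_matrix_mult_def dagger_def cinner_def col_def)

lemma col_mult: "col (A ** U) b = A *v col U b"
  by (simp add: col_def matrix_matrix_mult_def matrix_vector_mult_def)

lemma unitary_col: "unitary U \<longleftrightarrow> (\<forall>a b. cinner (col U a) (col U b) = (if a = b then 1 else 0))"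
  by (simp add: unitary_def vec_eq_iff dagger_mult_entry mat_def)

lemma cinner_lin:
  "cinner (u + v) w = cinner u w + cinner v w" "cinner w (u + v) = cinner w u + cinner w v"
  "cinner (x *s u) w = cnj x * cinner u w" "cinner w (x *s u) = x * cinner w u"
  by (simp_all add: cinner_def sum.distrib sum_distrib_left algebra_simps)

lemma mult_vec_lin: "A *v (u + v) = A *v u + A *v v" "A *v (x *s u) = x *s (A *v u)"
  for A :: "'n::finite op"
  by (simp_all add: matrix_vector_mult_def vec_eq_iff sum.distrib sum_distrib_left algebra_simps)

lemma cnj_cinner: "cnj (cinner u v) = cinner v u"
  by (simp add: cinner_def mult.commute)

text \<open>A unitary maximising a generic weighted sum of the diagonal entries diagonalises: otherwise
  a small rotation in a coordinate plane would increase the sum.\<close>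

theorem spectral:
  fixes A :: "'n::finite op"
  assumes A: "hermitian A"
  shows "\<exists>U d. unitary U \<and> A = conjd U d"
proof -
  \<comment> \<open>Distinct weights: with equal ones the objective is a multiple of the trace,
    which every rotation preserves.\<close>
  obtain w0 :: "'n \<Rightarrow> nat" where w0: "inj w0"
    using finite_imp_inj_to_nat_seg[of "UNIV :: 'n set"] by auto
  define w where "w = (\<lambda>k. real (w0 k))"
  have w: "w a \<noteq> w b" if "a \<noteq> b" for a b
    using w0 that by (auto simp: w_def inj_def)
  define g where "g = (\<lambda>U :: 'n op. \<Sum>k\<in>UNIV. w k * Re (cinner (col U k) (A *v col U k)))"
  have "continuous_on {U :: 'n op. unitary U} g"
    unfolding g_def cinner_def col_def matrix_vector_mult_def
    by (intro continuous_intros)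
  moreover have "unitary (mat 1 :: 'n op)" by (simp add: unitary_def)
  ultimately obtain U where U: "unitary U" and max: "\<And>V. unitary V \<Longrightarrow> g V \<le> g U"
    using continuous_attains_sup[OF compact_unitary, of g] by auto
  define u where "u = col U"
  have ortho: "cinner (u a) (u b) = (if a = b then 1 else 0)" for a b
    using U by (simp add: unitary_col u_def)
  have off: "cinner (u i) (A *v u j) = 0" if ij: "i \<noteq> j" for i j
  proof (rule ccontr)
    define z where "z = cinner (u i) (A *v u j)"
    assume "cinner (u i) (A *v u j) \<noteq> 0"
    then have z: "z \<noteq> 0" by (simp add: z_def)
    have z': "cinner (u j) (A *v u i) = cnj z"
      using A by (simp add: z_def cnj_cinner cinner_mult_right[of "u j"] hermitian_def)
    \<comment> \<open>This phase turns \<open>z\<close> into \<open>cmod z\<close>. The rotation by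
      the angle \<open>x\<close> then changes the objective at first order, with slope
      \<open>(w i - w j) * (2 * cmod z)\<close> at 0, which cannot vanish.\<close>
    define y where "y = cnj z / of_real (cmod z)"
    have yz: "y * z = of_real (cmod z)"
      using z by (simp add: y_def divide_simps mult.commute complex_norm_square[symmetric] power2_eq_square)
    have yy: "y * cnj y = 1"
      using z by (simp add: y_def divide_simps mult.commute complex_norm_square[symmetric] power2_eq_square)
    have yy': "cnj y * y = 1" using yy by (simp add: mult.commute)
    have yz': "cnj y * cnj z = of_real (cmod z)"
      using arg_cong[OF yz, of cnj] by simp
    define c where "c = (\<lambda>x::real. complex_of_real (cos x))"
    define k where "k = (\<lambda>x::real. y * of_real (sin x))"
    have cnj_c: "cnj (c x) = c x" for x by (simp add: c_def)
    have kk: "cnj (k x) * k x = of_real ((sin x)\<^sup>2)" for x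
    proof -
      have "cnj (k x) * k x = (cnj y * y) * (of_real (sin x) * of_real (sin x))"
        by (simp add: k_def mult_ac)
      then show ?thesis by (simp add: yy' power2_eq_square)
    qed
    have cc: "c x * c x = of_real ((cos x)\<^sup>2)" for x by (simp add: c_def power2_eq_square)
    have sum1: "c x * c x + cnj (k x) * k x = 1" for x
      unfolding kk cc of_real_add[symmetric] by simp
    define v where "v = (\<lambda>x. u(i := c x *s u i + k x *s u j, j := (- cnj (k x)) *s u i + c x *s u j))"
    define V where "V = (\<lambda>x. (\<chi> a b. v x b $ a) :: 'n op)"
    have colV: "col (V x) = v x" for x by (auto simp: V_def col_def vec_eq_iff)
    have vi: "v x i = c x *s u i + k x *s u j" and vj: "v x j = (- cnj (k x)) *s u i + c x *s u j"
      and vo: "b \<noteq> i \<Longrightarrow> b \<noteq> j \<Longrightarrow> v x b = u b" for x b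
      using ij by (auto simp: v_def)
    have uV: "unitary (V x)" for x
      unfolding unitary_col colV
    proof (intro allI)
      fix a b
      have oo: "cinner (u i) (u j) = 0" "cinner (u j) (u i) = 0" "cinner (u i) (u i) = 1" "cinner (u j) (u j) = 1"
        using ij by (auto simp: ortho)
      have 1: "cinner (v x i) (v x i) = 1" "cinner (v x j) (v x j) = 1"
        using sum1[of x] unfolding vi vj cinner_lin by (simp_all add: oo cnj_c mult_ac add_ac)
      have 2: "cinner (v x i) (v x j) = 0" "cinner (v x j) (v x i) = 0"
        unfolding vi vj cinner_lin by (simp_all add: oo cnj_c mult_ac)
      have 3: "cinner (v x i) (u b) = 0" "cinner (u b) (v x i) = 0" "cinner (v x j) (u b) = 0" "cinner (u b) (v x j) = 0"
        if "b \<noteq> i" "b \<noteq> j" for b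
        unfolding vi vj cinner_lin using that by (auto simp: ortho)
      show "cinner (v x a) (v x b) = (if a = b then 1 else 0)"
        using 1 2 3 ij vo[of a x] vo[of b x] ortho[of a b]
        by (cases "a = i"; cases "a = j"; cases "b = i"; cases "b = j") auto
    qed
    have gV: "g (V x) = g U + (w i - w j) * (((cos x)\<^sup>2 - 1) * Re (cinner (u i) (A *v u i))
        + (sin x)\<^sup>2 * Re (cinner (u j) (A *v u j)) + 2 * cos x * sin x * cmod z)" for x
    proof -
      define F where "F = (\<lambda>v. Re (cinner v (A *v v)))"
      have ck: "c x * k x * z = of_real (cos x * sin x * cmod z)"
      proof -
        have "c x * k x * z = of_real (cos x) * of_real (sin x) * (y * z)" by (simp add: c_def k_def mult_ac)
        then show ?thesis by (simp add: yz)
      qed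
      have ck': "c x * cnj (k x) * cnj z = of_real (cos x * sin x * cmod z)"
        using arg_cong[OF ck, of cnj] by (simp add: cnj_c)
      have "cinner (v x i) (A *v v x i) = c x * c x * cinner (u i) (A *v u i)
          + cnj (k x) * k x * cinner (u j) (A *v u j) + c x * k x * z + c x * cnj (k x) * cnj z"
        unfolding vi cinner_lin mult_vec_lin by (simp add: z' cnj_c z_def[symmetric] algebra_simps)
      then have Fi: "F (v x i) = (cos x)\<^sup>2 * F (u i) + (sin x)\<^sup>2 * F (u j) + 2 * cos x * sin x * cmod z"
        unfolding kk cc ck ck' by (simp add: F_def)
      have "cinner (v x j) (A *v v x j) = cnj (k x) * k x * cinner (u i) (A *v u i)
          + c x * c x * cinner (u j) (A *v u j) - (c x * k x * z + c x * cnj (k x) * cnj z)"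
        unfolding vj cinner_lin mult_vec_lin by (simp add: z' cnj_c z_def[symmetric] algebra_simps)
      then have Fj: "F (v x j) = (sin x)\<^sup>2 * F (u i) + (cos x)\<^sup>2 * F (u j) - 2 * cos x * sin x * cmod z"
        unfolding kk cc ck ck' by (simp add: F_def)
      have "g (V x) - g U = (\<Sum>b\<in>UNIV. w b * F (v x b) - w b * F (u b))"
        by (simp add: g_def colV u_def F_def sum_subtractf)
      also have "\<dots> = (\<Sum>b\<in>{i, j}. w b * F (v x b) - w b * F (u b))"
        by (rule sum.mono_neutral_right) (auto simp: vo)
      also have "\<dots> = w i * (F (v x i) - F (u i)) + w j * (F (v x j) - F (u j))"
        using ij by (simp add: algebra_simps)
      also have "\<dots> = (w i - w j) * (((cos x)\<^sup>2 - 1) * F (u i) + (sin x)\<^sup>2 * F (u j) + 2 * cos x * sin x * cmod z)"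
        unfolding Fi Fj sin_squared_eq by (simp add: algebra_simps)
      finally show ?thesis by (simp add: F_def)
    qed
    have "((\<lambda>x. g (V x)) has_real_derivative (w i - w j) * (2 * cmod z)) (at 0)"
      unfolding gV by (auto intro!: derivative_eq_intros simp: power2_eq_square)
    moreover have "g (V y) \<le> g (V 0)" for y
      using max[OF uV[of y]] by (simp add: gV[of 0])
    ultimately have "(w i - w j) * (2 * cmod z) = 0"
      by (intro DERIV_local_max[of _ _ 0 1]) auto
    then show False using z w[OF ij] by simp
  qed
  have "A = conjd U (\<lambda>k. Re (cinner (u k) (A *v u k)))"
  proof -
    have "dagger U ** (A ** U) = diagm (\<lambda>k. Re (cinner (u k) (A *v u k)))"
    proof -
      have "cnj (cinner (u k) (A *v u k)) = cinner (u k) (A *v u k)" for k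
        using A by (simp add: cnj_cinner cinner_mult_right[of "u k"] hermitian_def)
      then have "cinner (u k) (A *v u k) = of_real (Re (cinner (u k) (A *v u k)))" for k
        by (simp add: complex_eq_iff)
      then show ?thesis
        using off by (auto simp: vec_eq_iff dagger_mult_entry col_mult diagm_def u_def)
    qed
    then have "conjd U (\<lambda>k. Re (cinner (u k) (A *v u k))) = (U ** dagger U) ** A ** (U ** dagger U)"
      unfolding conjd_def by (simp add: matrix_mul_assoc flip: \<open>_ = diagm _\<close>)
    then show ?thesis using U by (simp add: unitary_right)
  qed
  then show ?thesis using U by blast
qed


section \<open>Eigenvalues and eigenprojections of a diagonalised operator\<close>

lemma conjd_vec: "conjd U d *v v = U *v (diagm d *v (dagger U *v v))"
  by (simp add: conjd_def matrix_vector_mul_assoc[symmetric])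

lemma unitary_vec: "unitary U \<Longrightarrow> dagger U *v (U *v v) = v" "unitary U \<Longrightarrow> U *v (dagger U *v v) = v"
  by (simp_all add: matrix_vector_mul_assoc unitary_right) (simp add: unitary_def)

lemma conjd_eigen_iff:
  assumes U: "unitary U"
  shows "conjd U d *v v = of_real l *s v \<longleftrightarrow> (\<forall>i. d i \<noteq> l \<longrightarrow> (dagger U *v v) $ i = 0)"
proof -
  have "conjd U d *v v = of_real l *s v \<longleftrightarrow> dagger U *v (conjd U d *v v) = dagger U *v (of_real l *s v)"
    by (metis unitary_vec(2)[OF U])
  also have "\<dots> \<longleftrightarrow> diagm d *v (dagger U *v v) = of_real l *s (dagger U *v v)"
    by (simp add: conjd_vec unitary_vec[OF U] mult_vec_lin)
  also have "\<dots> \<longleftrightarrow> (\<forall>i. d i \<noteq> l \<longrightarrow> (dagger U *v v) $ i = 0)"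
    by (auto simp: vec_eq_iff diagm_vec)
  finally show ?thesis .
qed

lemma eigvals_conjd:
  assumes U: "unitary U"
  shows "eigvals (conjd U d) = range d"
proof (intro equalityI subsetI)
  fix l assume "l \<in> eigvals (conjd U d)"
  then obtain v where v: "v \<noteq> 0" "conjd U d *v v = of_real l *s v" by (auto simp: eigvals_def)
  then have "\<forall>i. d i \<noteq> l \<longrightarrow> (dagger U *v v) $ i = 0" by (simp add: conjd_eigen_iff[OF U])
  moreover have "dagger U *v v \<noteq> 0" using v(1) by (metis unitary_vec(2)[OF U] matrix_vector_mult_0_right)
  ultimately show "l \<in> range d" by (auto simp: vec_eq_iff)
next
  fix l assume "l \<in> range d"
  then obtain i where i: "l = d i" by auto
  define v where "v = U *v axis i 1"
  have v': "dagger U *v v = axis i 1" by (simp add: v_def unitary_vec[OF U])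
  have "v \<noteq> 0"
  proof
    assume "v = 0"
    then have "(axis i 1 :: complex^'a) = 0" using v' by simp
    then show False by (simp add: axis_eq_0_iff)
  qed
  moreover have "conjd U d *v v = of_real l *s v"
    unfolding conjd_eigen_iff[OF U] v' by (auto simp: axis_def i)
  ultimately show "l \<in> eigvals (conjd U d)" by (auto simp: eigvals_def)
qed

text \<open>Each projection fixes the range of the other, so \<open>P ** Q = Q\<close> and
  \<open>Q ** P = P\<close>, and these products are adjoint to each other. This makes the
  \<open>THE\<close> in \<open>eigproj\<close> well defined.\<close>

lemma projection_unique:
  assumes P: "hermitian P" "P ** P = P" and Q: "hermitian Q" "Q ** Q = Q"
    and r: "range (\<lambda>v. P *v v) = range (\<lambda>v. Q *v v)"
  shows "P = Q"
proof -
  have fix_range: "P ** Q = Q" if pp: "P ** P = P" and pr: "range (\<lambda>v. P *v v) = range (\<lambda>v. Q *v v)" for P Q :: "'a op"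
  proof -
    have "(P ** Q) *v v = Q *v v" for v
    proof -
      obtain w where "Q *v v = P *v w" using pr by (metis rangeE rangeI)
      then show ?thesis by (metis matrix_vector_mul_assoc pp)
    qed
    then show ?thesis by (simp add: matrix_eq)
  qed
  have "dagger (P ** Q) = Q ** P" using P Q by (simp add: dagger_mult hermitian_def)
  then show ?thesis
    using fix_range[OF P(2) r] fix_range[OF Q(2) r[symmetric]] Q(1) by (simp add: hermitian_def)
qed

lemma eigproj_conjd:
  assumes U: "unitary U"
  shows "eigproj (conjd U d) l = conjd U (\<lambda>k. if d k = l then 1 else 0)" (is "_ = ?P")
proof -
  have "(\<lambda>k. (if d k = l then 1 else 0 :: real) * (if d k = l then 1 else 0)) = (\<lambda>k. if d k = l then 1 else 0)"
    by auto
  then have idem: "?P ** ?P = ?P" by (simp only: conjd_mult[OF U])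
  have range: "range (\<lambda>v. ?P *v v) = {v. conjd U d *v v = of_real l *s v}"
  proof (intro equalityI subsetI)
    fix v assume "v \<in> range (\<lambda>v. ?P *v v)"
    then obtain w where "v = ?P *v w" by auto
    then have "dagger U *v v = diagm (\<lambda>k. if d k = l then 1 else 0) *v (dagger U *v w)"
      by (simp add: conjd_vec unitary_vec[OF U])
    then show "v \<in> {v. conjd U d *v v = of_real l *s v}"
      by (auto simp: conjd_eigen_iff[OF U] diagm_vec)
  next
    fix v assume "v \<in> {v. conjd U d *v v = of_real l *s v}"
    then have "\<forall>i. d i \<noteq> l \<longrightarrow> (dagger U *v v) $ i = 0" by (simp add: conjd_eigen_iff[OF U])
    then have "diagm (\<lambda>k. if d k = l then 1 else 0) *v (dagger U *v v) = dagger U *v v"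
      by (auto simp: vec_eq_iff diagm_vec)
    then have "?P *v v = v" by (simp add: conjd_vec unitary_vec[OF U])
    then show "v \<in> range (\<lambda>v. ?P *v v)" by (metis rangeI)
  qed
  show ?thesis
    unfolding eigproj_def
  proof (rule the_equality)
    show "hermitian ?P \<and> ?P ** ?P = ?P \<and> range (\<lambda>v. ?P *v v) = {v. conjd U d *v v = of_real l *s v}"
      using idem range conjd_herm by blast
  next
    fix Q assume "hermitian Q \<and> Q ** Q = Q \<and> range (\<lambda>v. Q *v v) = {v. conjd U d *v v = of_real l *s v}"
    then show "Q = ?P" using projection_unique[of Q ?P] idem range conjd_herm by metis
  qed
qed

text \<open>The common form of \<open>op_powr\<close> and of all functions of operators below. By
  \<open>hfun_conjd\<close> it may be evaluated in any diagonalisation, so degenerate eigenvalues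
  cause no ambiguity.\<close>

definition hfun :: "(real \<Rightarrow> real) \<Rightarrow> 'n::finite op \<Rightarrow> 'n op" where
  "hfun f A = (\<Sum>l\<in>eigvals A. f l *\<^sub>R eigproj A l)"

lemma op_powr_hfun: "op_powr A r = hfun (\<lambda>l. l powr r) A"
  by (simp add: op_powr_def hfun_def)

lemma conjd_sum: "finite S \<Longrightarrow> (\<Sum>l\<in>S. conjd U (d l)) = conjd U (\<lambda>k. \<Sum>l\<in>S. d l k)"
proof (induction S rule: finite_induct)
  case empty
  show ?case using conjd_scaleR[of 0 U "\<lambda>_. 0"] by simp
qed (simp add: conjd_add)

lemma hfun_conjd:
  assumes U: "unitary U"
  shows "hfun f (conjd U d) = conjd U (\<lambda>k. f (d k))"
proof -
  have "hfun f (conjd U d) = (\<Sum>l\<in>range d. conjd U (\<lambda>k. if d k = l then f l else 0))"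
    unfolding hfun_def eigvals_conjd[OF U] eigproj_conjd[OF U] conjd_scaleR
    by (intro sum.cong refl arg_cong[of _ _ "conjd U"]) auto
  also have "\<dots> = conjd U (\<lambda>k. f (d k))"
    by (simp add: conjd_sum sum.delta)
  finally show ?thesis .
qed

text \<open>A fixed eigenbasis indexed like the space itself, with eigenvalues repeated, so that
  traces become sums over the index type.\<close>

definition spec :: "'n::finite op \<Rightarrow> 'n op \<times> ('n \<Rightarrow> real)" where
  "spec A = (SOME (U, d). unitary U \<and> A = conjd U d)"

definition eu :: "'n::finite op \<Rightarrow> 'n op" where "eu A = fst (spec A)"
definition ev :: "'n::finite op \<Rightarrow> 'n \<Rightarrow> real" where "ev A = snd (spec A)"

lemma
  assumes "hermitian A"
  shows eu_unitary: "unitary (eu A)" and eu_ev: "conjd (eu A) (ev A) = A"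
proof -
  have "\<exists>x. case x of (U, d) \<Rightarrow> unitary U \<and> A = conjd U d" using spectral[OF assms] by auto
  then have "case spec A of (U, d) \<Rightarrow> unitary U \<and> A = conjd U d" unfolding spec_def by (rule someI_ex)
  then show "unitary (eu A)" "conjd (eu A) (ev A) = A" by (auto simp: eu_def ev_def split: prod.splits)
qed

lemma hfun_eu: "hermitian A \<Longrightarrow> hfun f A = conjd (eu A) (\<lambda>k. f (ev A k))"
  using hfun_conjd[of "eu A" f "ev A"] by (simp add: eu_unitary eu_ev)

lemma eigvals_ev: "hermitian A \<Longrightarrow> eigvals A = range (ev A)"
  using eigvals_conjd[of "eu A" "ev A"] by (simp add: eu_unitary eu_ev)

lemma card_eigvals: "hermitian A \<Longrightarrow> 1 \<le> card (eigvals A)"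
  by (simp add: eigvals_ev Suc_le_eq card_gt_0_iff)

lemma hfun_herm: "hermitian A \<Longrightarrow> hermitian (hfun f A)"
  by (simp add: hfun_eu conjd_herm)
lemma hfun_mult: "hermitian A \<Longrightarrow> hfun f A ** hfun g A = hfun (\<lambda>t. f t * g t) A"
  by (simp add: hfun_eu conjd_mult eu_unitary)
lemma hfun_add: "hermitian A \<Longrightarrow> hfun f A + hfun g A = hfun (\<lambda>t. f t + g t) A"
  by (simp add: hfun_eu conjd_add)
lemma hfun_scaleR: "hermitian A \<Longrightarrow> c *\<^sub>R hfun f A = hfun (\<lambda>t. c * f t) A"
  by (simp add: hfun_eu conjd_scaleR)
lemma conjd_diff: "conjd U d - conjd U e = conjd U (\<lambda>i. d i - e i)"
proof -
  have "conjd U d - conjd U e = conjd U d + (-1) *\<^sub>R conjd U e" by simp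
  also have "\<dots> = conjd U (\<lambda>i. d i + (-1) * e i)" by (simp only: conjd_scaleR conjd_add)
  finally show ?thesis by simp
qed

lemma hfun_diff: "hermitian A \<Longrightarrow> hfun f A - hfun g A = hfun (\<lambda>t. f t - g t) A"
  by (simp add: hfun_eu conjd_diff)
lemma hfun_const: "hermitian A \<Longrightarrow> hfun (\<lambda>_. c) A = c *\<^sub>R mat 1"
  using hfun_scaleR[of A c "\<lambda>_. 1"] by (simp add: hfun_eu conjd_one eu_unitary)
lemma hfun_id: "hermitian A \<Longrightarrow> hfun (\<lambda>t. t) A = A"
  by (simp add: hfun_eu eu_ev)
lemma hfun_hfun: "hermitian A \<Longrightarrow> hfun f (hfun g A) = hfun (\<lambda>t. f (g t)) A"
  by (simp add: hfun_eu[of A] hfun_conjd eu_unitary)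
lemma tr_hfun: "hermitian A \<Longrightarrow> tr (hfun f A) = (\<Sum>k\<in>UNIV. f (ev A k))"
  by (simp add: hfun_eu tr_conjd eu_unitary)
lemma tr_ev: "hermitian A \<Longrightarrow> tr A = (\<Sum>k\<in>UNIV. ev A k)"
  using tr_hfun[of A "\<lambda>t. t"] by (simp add: hfun_id)

lemma hfun_cong: "hermitian A \<Longrightarrow> (\<And>k. f (ev A k) = g (ev A k)) \<Longrightarrow> hfun f A = hfun g A"
  by (simp add: hfun_eu)

lemma conjd_eq: "conjd U d = dagger (dagger U) ** diagm d ** dagger U"
  by (simp add: conjd_def)

lemma quad_conjd: "v \<bullet> (conjd U d *v v) = (\<Sum>k\<in>UNIV. d k * (cmod (cinner (col U k) v))\<^sup>2)"
proof -
  have c: "(dagger U *v v) $ k = cinner (col U k) v" for k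
    by (simp add: matrix_vector_mult_def dagger_def cinner_def col_def)
  have "v \<bullet> (conjd U d *v v) = (dagger U *v v) \<bullet> (diagm d *v (dagger U *v v))"
    unfolding conjd_eq inner_conj by simp
  also have "\<dots> = (\<Sum>k\<in>UNIV. Re (cnj (cinner (col U k) v) * (of_real (d k) * cinner (col U k) v)))"
    by (simp add: inner_eq_Re_cinner cinner_def[of "dagger U *v v"] diagm_vec c)
  also have "\<dots> = (\<Sum>k\<in>UNIV. d k * (cmod (cinner (col U k) v))\<^sup>2)"
  proof (rule sum.cong, simp)
    fix k
    show "Re (cnj (cinner (col U k) v) * (of_real (d k) * cinner (col U k) v)) =
        d k * (cmod (cinner (col U k) v))\<^sup>2"
      by (simp add: cmod_power2) (simp add: power2_eq_square algebra_simps)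
  qed
  finally show ?thesis .
qed

lemma quad_col:
  assumes U: "unitary U"
  shows "col U k \<bullet> (conjd U d *v col U k) = d k"
proof -
  have "d j * (cmod (cinner (col U j) (col U k)))\<^sup>2 = (if j = k then d j else 0)" for j
    using U by (simp add: unitary_col)
  then show ?thesis by (simp add: quad_conjd)
qed

lemma psd_conjd: "(\<And>k. 0 \<le> d k) \<Longrightarrow> psd (conjd U d)"
  by (simp add: psd_def conjd_herm quad_conjd sum_nonneg)

lemma psd_hfun: "hermitian A \<Longrightarrow> (\<And>k. 0 \<le> f (ev A k)) \<Longrightarrow> psd (hfun f A)"
  by (simp add: hfun_eu psd_conjd)

lemma quad_ev: "hermitian A \<Longrightarrow> col (eu A) k \<bullet> (A *v col (eu A) k) = ev A k"
  using quad_col[of "eu A" k "ev A"] by (simp add: eu_unitary eu_ev)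

lemma ev_nonneg: "psd A \<Longrightarrow> 0 \<le> ev A k"
  by (metis quad_ev psd_def)

lemma psd_hfun': "psd A \<Longrightarrow> (\<And>t. 0 \<le> t \<Longrightarrow> 0 \<le> f t) \<Longrightarrow> psd (hfun f A)"
  by (rule psd_hfun) (auto simp: ev_nonneg psd_herm)

lemma hfun_cong_psd: "psd A \<Longrightarrow> (\<And>t. 0 \<le> t \<Longrightarrow> f t = g t) \<Longrightarrow> hfun f A = hfun g A"
  by (rule hfun_cong) (auto simp: ev_nonneg psd_herm)

lemma sqrt_mult: "psd A \<Longrightarrow> hfun sqrt A ** hfun sqrt A = A"
proof -
  assume A: "psd A"
  have "hfun sqrt A ** hfun sqrt A = hfun (\<lambda>t. sqrt t * sqrt t) A" by (simp add: hfun_mult psd_herm A)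
  also have "\<dots> = hfun (\<lambda>t. t) A" by (rule hfun_cong_psd[OF A]) simp
  finally show ?thesis by (simp add: hfun_id psd_herm A)
qed

lemma tr_mult_psd: "psd A \<Longrightarrow> psd B \<Longrightarrow> 0 \<le> tr (A ** B)"
proof -
  assume A: "psd A" and B: "psd B"
  define V where "V = hfun sqrt B"
  have V: "hermitian V" "V ** V = B" by (auto simp: V_def hfun_herm psd_herm B sqrt_mult)
  have "tr (A ** B) = tr (V ** A ** V)"
    using tr_comm[of "A ** V" V] by (simp add: V(2)[symmetric] matrix_mul_assoc)
  then show ?thesis using tr_psd[OF psd_sandwich[OF A V(1)]] by simp
qed

lemma tr_mult_mono: "psd A \<Longrightarrow> psd (C - B) \<Longrightarrow> tr (A ** B) \<le> tr (A ** C)"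
  using tr_mult_psd[of A "C - B"] by (simp add: mx trs)

text \<open>Squared overlaps of two orthonormal bases, a doubly stochastic matrix by
  \<open>ov_sum_left\<close> and \<open>ov_sum_right\<close>. They reduce the trace of a product of
  functions of two noncommuting operators to a scalar double sum.\<close>

definition ov :: "'n::finite op \<Rightarrow> 'n op \<Rightarrow> 'n \<Rightarrow> 'n \<Rightarrow> real" where
  "ov U V k l = (cmod (cinner (col U k) (col V l)))\<^sup>2"

lemma ov_nonneg [simp]: "0 \<le> ov U V k l"
  by (simp add: ov_def)

lemma ov_sym: "ov U V k l = ov V U l k"
  by (simp add: ov_def cnj_cinner[symmetric, of "col V l" "col U k"])

lemma quad_ov: "col V l \<bullet> (conjd U d *v col V l) = (\<Sum>k\<in>UNIV. d k * ov U V k l)"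
  by (simp add: quad_conjd ov_def)

lemma ov_sum_left: "unitary U \<Longrightarrow> unitary V \<Longrightarrow> (\<Sum>k\<in>UNIV. ov U V k l) = 1"
proof -
  assume U: "unitary U" and V: "unitary V"
  have "(\<Sum>k\<in>UNIV. ov U V k l) = col V l \<bullet> col V l"
    using quad_ov[of V l U "\<lambda>_. 1"] by (simp add: conjd_one[OF U])
  also have "\<dots> = 1" using V by (simp add: inner_eq_Re_cinner unitary_col)
  finally show ?thesis .
qed

lemma ov_sum_right: "unitary U \<Longrightarrow> unitary V \<Longrightarrow> (\<Sum>l\<in>UNIV. ov U V k l) = 1"
  using ov_sum_left[of V U k] by (simp add: ov_sym[of U V])

lemma tr_quad: "unitary U \<Longrightarrow> tr A = (\<Sum>k\<in>UNIV. col U k \<bullet> (A *v col U k))"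
proof -
  assume U: "unitary U"
  have "tr A = tr (U ** (dagger U ** A))" by (simp add: matrix_mul_assoc unitary_right[OF U])
  also have "\<dots> = tr (dagger U ** (A ** U))" by (subst tr_comm) (simp add: matrix_mul_assoc)
  also have "\<dots> = (\<Sum>k\<in>UNIV. col U k \<bullet> (A *v col U k))"
    by (simp add: tr_def trace_def dagger_mult_entry col_mult inner_eq_Re_cinner)
  finally show ?thesis .
qed

lemma conjd_col: "unitary V \<Longrightarrow> conjd V e *v col V l = e l *\<^sub>R col V l"
proof -
  assume V: "unitary V"
  have c: "col V l = V *v axis l 1"
    by (simp add: col_def vec_eq_iff matrix_vector_mult_def axis_def mult_delta_right if_distrib cong: if_cong)
  have d: "dagger V *v col V l = axis l 1" by (simp add: c unitary_vec[OF V])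
  have "diagm e *v axis l 1 = e l *\<^sub>R axis l 1"
    by (simp add: vec_eq_iff diagm_vec axis_def) (simp add: scaleR_conv_of_real)
  then have "conjd V e *v col V l = V *v (e l *\<^sub>R axis l 1)" by (simp add: conjd_vec d)
  also have "\<dots> = e l *\<^sub>R col V l"
    by (simp add: c matrix_vector_mult_def vec_eq_iff scaleR_sum_right)
  finally show ?thesis .
qed

lemma tr_conjd_mult:
  assumes V: "unitary V"
  shows "tr (conjd U d ** conjd V e) = (\<Sum>k\<in>UNIV. \<Sum>l\<in>UNIV. ov U V k l * d k * e l)"
proof -
  have "tr (conjd U d ** conjd V e) = (\<Sum>l\<in>UNIV. col V l \<bullet> (conjd U d *v (e l *\<^sub>R col V l)))"
    by (simp add: tr_quad[OF V] matrix_vector_mul_assoc[symmetric] conjd_col[OF V])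
  also have "\<dots> = (\<Sum>l\<in>UNIV. e l * (\<Sum>k\<in>UNIV. d k * ov U V k l))"
  proof (intro sum.cong refl)
    fix l
    have "conjd U d *v (e l *\<^sub>R col V l) = e l *\<^sub>R (conjd U d *v col V l)"
      by (simp add: matrix_vector_mult_def vec_eq_iff scaleR_sum_right)
    then show "col V l \<bullet> (conjd U d *v (e l *\<^sub>R col V l)) = e l * (\<Sum>k\<in>UNIV. d k * ov U V k l)"
      by (simp add: quad_ov)
  qed
  also have "\<dots> = (\<Sum>k\<in>UNIV. \<Sum>l\<in>UNIV. ov U V k l * d k * e l)"
    by (subst sum.swap) (simp add: sum_distrib_left mult_ac)
  finally show ?thesis .
qed

lemma tr_hfun_mult:
  assumes "hermitian A" "hermitian B"
  shows "tr (hfun f A ** hfun g B)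
    = (\<Sum>k\<in>UNIV. \<Sum>l\<in>UNIV. ov (eu A) (eu B) k l * f (ev A k) * g (ev B l))"
  using assms by (simp add: hfun_eu tr_conjd_mult eu_unitary)


section \<open>Resolvents and operator inequalities\<close>

lemma scaleR_eq_hfun: "hermitian A \<Longrightarrow> c *\<^sub>R A = hfun (\<lambda>t. c * t) A"
  using hfun_scaleR[of A c "\<lambda>t. t"] by (simp add: hfun_id)

lemma hfun_scaled: "hermitian A \<Longrightarrow> hfun f (c *\<^sub>R A) = hfun (\<lambda>t. f (c * t)) A"
  by (simp add: scaleR_eq_hfun hfun_hfun)

definition rs :: "real \<Rightarrow> 'n::finite op \<Rightarrow> 'n op" where
  "rs l A = hfun (\<lambda>t. 1 / (l + t)) A"

lemma rs_herm: "psd A \<Longrightarrow> hermitian (rs l A)"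
  by (simp add: rs_def hfun_herm psd_herm)

lemma psd_rs: "psd A \<Longrightarrow> 0 < l \<Longrightarrow> psd (rs l A)"
  unfolding rs_def by (rule psd_hfun') auto

lemma shift_hfun: "hermitian A \<Longrightarrow> l *\<^sub>R mat 1 + A = hfun (\<lambda>t. l + t) A"
  using hfun_add[of A "\<lambda>_. l" "\<lambda>t. t"] by (simp add: hfun_const hfun_id)

lemma rs_inverse:
  assumes "psd A" "0 < l"
  shows "rs l A ** (l *\<^sub>R mat 1 + A) = mat 1" "(l *\<^sub>R mat 1 + A) ** rs l A = mat 1"
proof -
  have h: "hermitian A" using assms by (simp add: psd_herm)
  have "hfun (\<lambda>t. 1 / (l + t) * (l + t)) A = hfun (\<lambda>_. 1) A"
    using assms by (intro hfun_cong_psd) auto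
  then show "rs l A ** (l *\<^sub>R mat 1 + A) = mat 1" "(l *\<^sub>R mat 1 + A) ** rs l A = mat 1"
    using h by (simp_all add: rs_def shift_hfun hfun_mult hfun_const mult.commute)
qed

lemma rs1_inverse:
  assumes "psd A"
  shows "rs 1 A ** (mat 1 + A) = mat 1" "(mat 1 + A) ** rs 1 A = mat 1"
  using rs_inverse[OF assms, of 1] by simp_all

lemma rs_mult_hfun:
  "psd A \<Longrightarrow> A ** rs l A = hfun (\<lambda>t. t / (l + t)) A"
  using hfun_mult[of A "\<lambda>t. t" "\<lambda>t. 1 / (l + t)"] by (simp add: rs_def hfun_id psd_herm)

text \<open>With \<open>K\<close> the inverse of \<open>R = rs l A\<close> and
  \<open>S = rs l B\<close>, the difference is the explicit sum
  \<open>(S - R) K (S - R) + S (B - A) S\<close> of positive terms.\<close>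

lemma rs_antitone:
  assumes A: "psd A" and B: "psd B" and BA: "psd (B - A)" and l: "0 < l"
  shows "psd (rs l A - rs l B)"
proof -
  define R K S where "R = rs l A" and "K = l *\<^sub>R mat 1 + A" and "S = rs l B"
  have i: "R ** K = mat 1" "K ** R = mat 1" using rs_inverse[OF A l] by (simp_all add: R_def K_def)
  have K: "psd K" using A l by (simp add: K_def psd_add psd_scaleR)
  have h: "hermitian R" "hermitian S" by (simp_all add: R_def S_def rs_herm A B)
  have iS: "S ** (K + (B - A)) = mat 1" using rs_inverse[OF B l] by (simp add: S_def K_def)
  have "S ** (K + (B - A)) ** S = S" using iS by simp
  then have e: "S ** (K ** S) + S ** (B ** S) - S ** (A ** S) = S" by (simp add: mx algebra_simps)
  have a: "R ** (K ** S) = S" using i(1) by (simp add: matrix_mul_assoc)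
  have "R - S = (S - R) ** K ** (S - R) + S ** (B - A) ** S"
    using e by (simp add: mx i a algebra_simps)
  then show ?thesis unfolding R_def[symmetric] S_def[symmetric]
    using psd_add[OF psd_sandwich[OF K, of "S - R"] psd_sandwich[OF BA, of S]] h by (simp add: herm_diff)
qed

text \<open>Completing the square at \<open>U = R ** W\<close>, where equality holds. The right-hand
  side contains the inverse of \<open>K\<close>, whereas the left-hand side is affine in
  \<open>K\<close>, so a mean over \<open>K\<close> can be taken there.\<close>

lemma tr_rs_lower:
  assumes K: "psd K" and i: "K ** R = mat 1" "R ** K = mat 1" and R: "hermitian R" and W: "hermitian W"
  shows "2 * tr (W ** U) - tr (dagger U ** K ** U) \<le> tr (W ** R ** W)"
proof -
  have a: "K ** (R ** X) = X" "R ** (K ** X) = X" for X using i by (simp_all add: matrix_mul_assoc)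
  have "0 \<le> tr (dagger (U - R ** W) ** K ** (U - R ** W))" by (rule tr_psd[OF psd_conj[OF K]])
  also have "dagger (U - R ** W) = dagger U - W ** R"
    using R W by (simp add: dagger_diff dagger_mult hermitian_def)
  also have "tr ((dagger U - W ** R) ** K ** (U - R ** W))
      = tr (dagger U ** K ** U) - tr (dagger U ** W) - tr (W ** U) + tr (W ** R ** W)"
    by (simp add: mx trs a i)
  also have "tr (dagger U ** W) = tr (W ** U)"
    using tr_dagger[of "W ** U"] W by (simp add: dagger_mult hermitian_def)
  finally show ?thesis by simp
qed

lemma tr_mult_le:
  assumes D: "psd D" and P: "hermitian P" and "psd (mat 1 - P ** P)"
  shows "tr (P ** D ** P) \<le> tr D"
proof -
  have "0 \<le> tr (D ** (mat 1 - P ** P))" using assms tr_mult_psd by blast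
  then show ?thesis using tr_cyc[of P D P] by (simp add: mx trs)
qed

lemma rs1_contract:
  assumes "psd A"
  shows "psd (mat 1 - rs 1 A)" "psd (mat 1 - rs 1 A ** rs 1 A)"
proof -
  have h: "hermitian A" using assms by (simp add: psd_herm)
  have o: "mat 1 = hfun (\<lambda>_. 1) A" using h by (simp add: hfun_const)
  show "psd (mat 1 - rs 1 A)"
    unfolding o rs_def hfun_diff[OF h] by (rule psd_hfun'[OF assms]) (auto simp: field_simps)
  show "psd (mat 1 - rs 1 A ** rs 1 A)"
    unfolding o rs_def hfun_mult[OF h] hfun_diff[OF h] 
  proof (rule psd_hfun'[OF assms])
    fix t :: real assume "0 \<le> t"
    then have "1 / (1 + t) * (1 / (1 + t)) \<le> 1 * 1" by (intro mult_mono) auto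
    then show "0 \<le> 1 - 1 / (1 + t) * (1 / (1 + t))" by simp
  qed
qed

section \<open>The trace of A / (1 + A) with random positive summands\<close>

definition frac_tr :: "'n::finite op \<Rightarrow> real" where
  "frac_tr A = tr (hfun (\<lambda>t. t / (1 + t)) A)"

lemma frac_tr_rs: "psd A \<Longrightarrow> frac_tr A = tr (A ** rs 1 A)"
  by (simp add: frac_tr_def rs_mult_hfun)

lemma frac_tr_rs': 
  assumes "psd A"
  shows "frac_tr A = tr (mat 1 :: 'n::finite op) - tr (rs 1 (A :: 'n op))"
proof -
  have "(mat 1 + A) ** rs 1 A = mat 1" by (rule rs1_inverse[OF assms])
  then have "rs 1 A + A ** rs 1 A = mat 1" by (simp add: mx)
  then have "tr (rs 1 A) + tr (A ** rs 1 A) = tr (mat 1 :: 'n op)" by (metis tr_add)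
  then show ?thesis by (simp add: frac_tr_rs[OF assms])
qed

text \<open>The slope of \<open>t / (1 + t)\<close> is at most 1. The resolvents satisfy
  \<open>G - Q = G (Z - g) Q\<close>; the trace of this mixed term is at most the mean of those of
  \<open>G (Z - g) G\<close> and \<open>Q (Z - g) Q\<close>, where \<open>G\<close> and
  \<open>Q\<close> are contractions.\<close>

lemma frac_tr_diff:
  assumes Z: "psd Z" and g: "psd g" and D: "psd (Z - g)"
  shows "frac_tr Z - frac_tr g \<le> tr (Z - g)"
proof -
  define G Q where "G = rs 1 g" and "Q = rs 1 Z"
  have h: "hermitian G" "hermitian Q" by (simp_all add: G_def Q_def rs_herm Z g)
  have GQ: "G - Q = G ** (Z - g) ** Q"
  proof -
    have "G ** (mat 1 + g) = mat 1" "(mat 1 + Z) ** Q = mat 1"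
      by (simp_all add: G_def Q_def rs1_inverse Z g)
    then have "G ** (mat 1 + Z) ** Q = G" "G ** (mat 1 + g) ** Q = Q"
      by (simp_all add: matrix_mul_assoc[symmetric])
    then have "G ** (mat 1 + Z) ** Q - G ** (mat 1 + g) ** Q = G - Q" by simp
    then show ?thesis by (simp add: mx algebra_simps)
  qed
  have "0 \<le> tr ((G - Q) ** (Z - g) ** (G - Q))"
    by (rule tr_psd[OF psd_sandwich[OF D]]) (simp add: h herm_diff)
  also have "\<dots> = tr (G ** (Z - g) ** G) + tr (Q ** (Z - g) ** Q)
      - tr (G ** (Z - g) ** Q) - tr (Q ** (Z - g) ** G)"
    by (simp add: mx trs)
  also have "tr (Q ** (Z - g) ** G) = tr (G ** (Z - g) ** Q)"
    using tr_dagger[of "G ** (Z - g) ** Q"] h psd_herm[OF D]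
    by (simp add: dagger_mult hermitian_def matrix_mul_assoc)
  finally have "2 * tr (G - Q) \<le> tr (G ** (Z - g) ** G) + tr (Q ** (Z - g) ** Q)"
    by (simp add: GQ)
  also have "\<dots> \<le> tr (Z - g) + tr (Z - g)"
    by (intro add_mono tr_mult_le D h) (simp_all add: G_def Q_def rs1_contract Z g)
  finally show ?thesis using Z g by (simp add: frac_tr_rs' G_def Q_def trs)
qed

text \<open>Each \<open>tr (V R V)\<close> with \<open>R = (1 + X + Z)\<close> inverse and \<open>V\<^sup>2 = Z\<close> is bounded below by
  \<open>2 tr (V U) - tr (U\<^sup>* (1 + X + Z) U)\<close>, with \<open>U\<close> built from the inverse \<open>A\<close> of \<open>1 + X + E Z\<close>, so that
  the expectation can be taken inside.\<close>

lemma frac_tr_step: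
  fixes Z :: "'i \<Rightarrow> 'n::finite op"
  assumes S: "finite S" and w: "\<And>i. i \<in> S \<Longrightarrow> 0 \<le> w i" "sum w S = 1"
    and X: "psd X" and Z: "\<And>i. i \<in> S \<Longrightarrow> psd (Z i)"
  shows "frac_tr (X + (\<Sum>i\<in>S. w i *\<^sub>R Z i)) + (\<Sum>i\<in>S. w i * frac_tr (Z i))
    \<le> (\<Sum>i\<in>S. w i * frac_tr (X + Z i)) + tr (\<Sum>i\<in>S. w i *\<^sub>R Z i)"
proof -
  define \<mu> where "\<mu> = (\<Sum>i\<in>S. w i *\<^sub>R Z i)"
  define A where "A = rs 1 (X + \<mu>)"
  define K where "K = mat 1 + (X + \<mu>)"
  have mu: "psd \<mu>" unfolding \<mu>_def by (intro psd_sum psd_scaleR Z w)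
  have Xm: "psd (X + \<mu>)" by (simp add: X mu psd_add)
  have AK: "A ** K = mat 1" "K ** A = mat 1" using rs1_inverse[OF Xm] by (simp_all add: A_def K_def)
  have AK': "A ** (K ** Y) = Y" for Y using AK by (simp add: matrix_mul_assoc)
  have A: "hermitian A" by (simp add: A_def rs_herm Xm)
  have pA: "psd A" by (simp add: A_def psd_rs Xm)
  define W where "W = hfun sqrt X"
  have W: "hermitian W" "W ** W = X" by (simp_all add: W_def hfun_herm psd_herm X sqrt_mult)
  define V where "V i = hfun sqrt (Z i)" for i
  have V: "hermitian (V i)" "V i ** V i = Z i" if "i \<in> S" for i
    using Z[OF that] by (simp_all add: V_def hfun_herm psd_herm sqrt_mult)
  define g where "g i = V i ** A ** V i" for i
  define G where "G i = rs 1 (g i)" for i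
  define Ki where "Ki i = mat 1 + (X + Z i)" for i
  define R where "R i = rs 1 (X + Z i)" for i
  have one: "w i * (2 * tr (W ** A ** W)) - w i * tr (W ** A ** Ki i ** A ** W)
      + w i * (frac_tr (Z i) - tr (Z i) + tr (Z i ** A)) \<le> w i * frac_tr (X + Z i)"
    if i: "i \<in> S" for i
  proof -
    have XZ: "psd (X + Z i)" using X Z i by (simp add: psd_add)
    have KR: "Ki i ** R i = mat 1" "R i ** Ki i = mat 1"
      using rs1_inverse[OF XZ] by (simp_all add: Ki_def R_def)
    have pK: "psd (Ki i)" unfolding Ki_def by (simp add: psd_add XZ)
    have hR: "hermitian (R i)" by (simp add: R_def rs_herm XZ)
    have g: "psd (g i)" unfolding g_def by (rule psd_sandwich[OF pA]) (simp add: V i)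
    have G: "hermitian (G i)" by (simp add: G_def rs_herm g)
    have gG: "G i ** (mat 1 + g i) = mat 1" by (simp add: G_def rs1_inverse g)
    \<comment> \<open>\<open>A ** W\<close> is the optimal test operator for the mean
      \<open>K\<close> of the \<open>Ki i\<close>. The bound is affine in \<open>Ki i\<close>, so
      its average over \<open>i\<close> is the exact value at \<open>K\<close>.\<close>
    have "2 * tr (W ** (A ** W)) - tr (dagger (A ** W) ** Ki i ** (A ** W)) \<le> tr (W ** R i ** W)"
      by (rule tr_rs_lower[OF pK KR hR W(1)])
    then have 1: "2 * tr (W ** A ** W) - tr (W ** A ** Ki i ** A ** W) \<le> tr (W ** R i ** W)"
      using A W(1) by (simp add: dagger_mult hermitian_def matrix_mul_assoc)
    \<comment> \<open>For the part in \<open>Z i\<close> the test operator also carries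
      \<open>G i\<close>, the inverse of \<open>1 + g i\<close>. The quadratic term then collapses
      to \<open>g i ** G i\<close>, up to a term in \<open>\<mu>\<close> whose sign allows it to be
      dropped.\<close>
    have "2 * tr (V i ** (A ** V i ** G i)) - tr (dagger (A ** V i ** G i) ** Ki i ** (A ** V i ** G i))
        \<le> tr (V i ** R i ** V i)"
      by (rule tr_rs_lower[OF pK KR hR V(1)[OF i]])
    also have "dagger (A ** V i ** G i) = G i ** V i ** A"
      using A V(1)[OF i] G by (simp add: dagger_mult hermitian_def matrix_mul_assoc)
    also have "V i ** (A ** V i ** G i) = g i ** G i" by (simp add: g_def matrix_mul_assoc)
    finally have 2: "2 * tr (g i ** G i) - tr (G i ** V i ** A ** Ki i ** (A ** V i ** G i))
      \<le> tr (V i ** R i ** V i)" .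
    have e: "Ki i = K + Z i - \<mu>" by (simp add: Ki_def K_def)
    have "0 \<le> tr (dagger (A ** V i ** G i) ** \<mu> ** (A ** V i ** G i))"
      by (rule tr_psd[OF psd_conj[OF mu]])
    then have 3: "0 \<le> tr (G i ** V i ** A ** \<mu> ** (A ** V i ** G i))"
      using A V(1)[OF i] G by (simp add: dagger_mult hermitian_def matrix_mul_assoc)
    have "G i ** V i ** A ** (K + Z i) ** (A ** V i ** G i) = G i ** g i ** G i + G i ** g i ** g i ** G i"
      by (simp add: mx AK' g_def V(2)[OF i, symmetric])
    also have "\<dots> = G i ** (mat 1 + g i) ** (g i ** G i)" by (simp add: mx)
    finally have 4: "G i ** V i ** A ** (K + Z i) ** (A ** V i ** G i) = g i ** G i"
      by (simp add: gG)
    have "G i ** V i ** A ** Ki i ** (A ** V i ** G i) = g i ** G i - G i ** V i ** A ** \<mu> ** (A ** V i ** G i)"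
      unfolding 4[symmetric] e by (simp add: mx)
    then have 5: "tr (g i ** G i) \<le> tr (V i ** R i ** V i)"
      using 2 3 by (simp add: tr_diff)
    have D: "psd (Z i - g i)"
    proof -
      have "Z i - g i = V i ** (mat 1 - A) ** V i" by (simp add: g_def mx V(2)[OF i])
      then show ?thesis
        using psd_sandwich[OF rs1_contract(1)[OF Xm] V(1)[OF i]] by (simp add: A_def)
    qed
    have 6: "frac_tr (Z i) - tr (Z i) + tr (g i) \<le> tr (g i ** G i)"
      using frac_tr_diff[OF Z[OF i] g D] by (simp add: frac_tr_rs[OF g] G_def trs)
    have 7: "tr (g i) = tr (Z i ** A)"
      using tr_cyc[of "V i" A "V i"] tr_comm[of A "Z i"] by (simp add: g_def matrix_mul_assoc[symmetric] V(2)[OF i])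
    have "frac_tr (X + Z i) = tr (X ** R i) + tr (Z i ** R i)"
      by (simp add: frac_tr_rs[OF XZ] R_def mx trs)
    also have "tr (X ** R i) = tr (W ** R i ** W)"
      using tr_cyc[of W "R i" W] tr_comm[of "R i" X] by (simp add: matrix_mul_assoc[symmetric] W(2))
    also have "tr (Z i ** R i) = tr (V i ** R i ** V i)"
      using tr_cyc[of "V i" "R i" "V i"] tr_comm[of "R i" "Z i"] by (simp add: matrix_mul_assoc[symmetric] V(2)[OF i])
    finally have "2 * tr (W ** A ** W) - tr (W ** A ** Ki i ** A ** W) + (frac_tr (Z i) - tr (Z i) + tr (Z i ** A)) \<le> frac_tr (X + Z i)"
      using 1 5 6 7 by linarith
    from mult_left_mono[OF this w(1)[OF i]] show ?thesis by (simp add: algebra_simps)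
  qed
  have sK: "(\<Sum>i\<in>S. w i *\<^sub>R Ki i) = K"
    by (simp add: Ki_def K_def \<mu>_def scaleR_add_right sum.distrib scaleR_left.sum[symmetric] w(2))
  have "(\<Sum>i\<in>S. w i * tr (W ** A ** Ki i ** A ** W)) = tr (\<Sum>i\<in>S. w i *\<^sub>R (W ** A ** Ki i ** A ** W))"
    by (simp add: tr_sum tr_scaleR)
  also have "(\<Sum>i\<in>S. w i *\<^sub>R (W ** A ** Ki i ** A ** W)) = W ** A ** (\<Sum>i\<in>S. w i *\<^sub>R Ki i) ** A ** W"
    by (simp add: matrix_sum_left matrix_sum_right mx)
  also have "\<dots> = W ** A ** W" by (simp add: sK mx AK')
  finally have a: "(\<Sum>i\<in>S. w i * tr (W ** A ** Ki i ** A ** W)) = tr (W ** A ** W)" .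
  have b: "(\<Sum>i\<in>S. w i * tr (Z i ** A)) = tr (\<mu> ** A)"
    by (simp add: \<mu>_def matrix_sum_left tr_sum mx tr_scaleR)
  have c: "(\<Sum>i\<in>S. w i * tr (Z i)) = tr \<mu>" by (simp add: \<mu>_def tr_sum tr_scaleR)
  have "(\<Sum>i\<in>S. w i * (2 * tr (W ** A ** W)) - w i * tr (W ** A ** Ki i ** A ** W)
      + w i * (frac_tr (Z i) - tr (Z i) + tr (Z i ** A))) \<le> (\<Sum>i\<in>S. w i * frac_tr (X + Z i))"
    by (rule sum_mono) (rule one)
  then have "tr (W ** A ** W) + (\<Sum>i\<in>S. w i * frac_tr (Z i)) - tr \<mu> + tr (\<mu> ** A)
      \<le> (\<Sum>i\<in>S. w i * frac_tr (X + Z i))"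
    by (simp add: sum.distrib sum_subtractf distrib_left right_diff_distrib a b c sum_distrib_right[symmetric] w(2))
  moreover have "tr (W ** A ** W) = tr (X ** A)"
    using tr_cyc[of W A W] tr_comm[of A X] by (simp add: matrix_mul_assoc[symmetric] W(2))
  moreover have "frac_tr (X + \<mu>) = tr (X ** A) + tr (\<mu> ** A)"
    by (simp add: frac_tr_rs[OF Xm] A_def mx trs)
  ultimately show ?thesis by (simp add: \<mu>_def)
qed

section \<open>The function \<Phi> and its averaging inequality\<close>

definition phi :: "real \<Rightarrow> 'n::finite op \<Rightarrow> real" where
  "phi l A = tr (hfun (\<lambda>t. t\<^sup>2 / (l + t)) A)"

lemma phi_frac: 
  assumes A: "psd A" and l: "0 < l"
  shows "phi l A = tr A - l * frac_tr ((1 / l) *\<^sub>R A)"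
proof -
  have h: "hermitian A" using A by (simp add: psd_herm)
  have "hfun (\<lambda>t. t\<^sup>2 / (l + t)) A = hfun (\<lambda>t. t - l * (1 / l * t / (1 + 1 / l * t))) A"
  proof (rule hfun_cong_psd[OF A])
    fix t :: real assume "0 \<le> t"
    then have "l + t \<noteq> 0" using l by auto
    then show "t\<^sup>2 / (l + t) = t - l * (1 / l * t / (1 + 1 / l * t))"
      using l by (simp add: field_simps power2_eq_square)
  qed
  also have "\<dots> = A - l *\<^sub>R hfun (\<lambda>t. 1 / l * t / (1 + 1 / l * t)) A"
    using hfun_diff[OF h, of "\<lambda>t. t" "\<lambda>t. l * (1 / l * t / (1 + 1 / l * t))"]
    by (simp only: hfun_scaleR[OF h] hfun_id[OF h])
  also have "hfun (\<lambda>t. 1 / l * t / (1 + 1 / l * t)) A = hfun (\<lambda>t. t / (1 + t)) ((1 / l) *\<^sub>R A)"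
    by (simp only: hfun_scaled[OF h])
  finally show ?thesis by (simp only: phi_def frac_tr_def trs)
qed

lemma phi_step:
  fixes Z :: "'i \<Rightarrow> 'n::finite op"
  assumes S: "finite S" and w: "\<And>i. i \<in> S \<Longrightarrow> 0 \<le> w i" "sum w S = 1"
    and X: "psd X" and Z: "\<And>i. i \<in> S \<Longrightarrow> psd (Z i)" and l: "0 < l"
  shows "(\<Sum>i\<in>S. w i * phi l (X + Z i)) \<le> phi l (X + (\<Sum>i\<in>S. w i *\<^sub>R Z i)) + (\<Sum>i\<in>S. w i * phi l (Z i))"
proof -
  define \<mu> where "\<mu> = (\<Sum>i\<in>S. w i *\<^sub>R Z i)"
  have mu: "psd \<mu>" unfolding \<mu>_def by (intro psd_sum psd_scaleR Z w)
  have e: "(1 / l) *\<^sub>R X + (\<Sum>i\<in>S. w i *\<^sub>R ((1 / l) *\<^sub>R Z i)) = (1 / l) *\<^sub>R (X + \<mu>)"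
    by (simp add: \<mu>_def scaleR_add_right scaleR_sum_right mult.commute)
  have s: "(\<Sum>i\<in>S. w i *\<^sub>R ((1 / l) *\<^sub>R Z i)) = (1 / l) *\<^sub>R \<mu>"
    by (simp add: \<mu>_def scaleR_sum_right mult.commute)
  have "frac_tr ((1 / l) *\<^sub>R (X + \<mu>)) + (\<Sum>i\<in>S. w i * frac_tr ((1 / l) *\<^sub>R Z i))
    \<le> (\<Sum>i\<in>S. w i * frac_tr ((1 / l) *\<^sub>R (X + Z i))) + 1 / l * tr \<mu>"
    using frac_tr_step[OF S w, of "(1 / l) *\<^sub>R X" "\<lambda>i. (1 / l) *\<^sub>R Z i"] X Z l
    unfolding e s by (simp add: psd_scaleR tr_scaleR scaleR_add_right)
  from mult_left_mono[OF this, of l]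
  have "l * frac_tr ((1 / l) *\<^sub>R (X + \<mu>)) + (\<Sum>i\<in>S. w i * (l * frac_tr ((1 / l) *\<^sub>R Z i)))
    \<le> (\<Sum>i\<in>S. w i * (l * frac_tr ((1 / l) *\<^sub>R (X + Z i)))) + tr \<mu>"
    using l by (simp add: distrib_left sum_distrib_left mult_ac)
  moreover have "tr \<mu> = (\<Sum>i\<in>S. w i * tr (Z i))" by (simp add: \<mu>_def tr_sum tr_scaleR)
  moreover have "(\<Sum>i\<in>S. w i * tr X) = tr X" by (simp add: sum_distrib_right[symmetric] w(2))
  ultimately show ?thesis unfolding \<mu>_def[symmetric] using X Z mu l
    by (simp add: phi_frac psd_add right_diff_distrib distrib_left sum.distrib sum_subtractf trs cong: sum.cong)
qed

section \<open>Decoding\<close>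

text \<open>\<open>N / (2 + N)\<close> is the parallel sum of \<open>N / 2\<close> and the identity.\<close>

lemma parallel_sum_bound:
  fixes N :: "'a::finite op"
  assumes N: "psd N" and A: "A = hfun (\<lambda>t. t / (2 + t)) N"
    and X: "hermitian X" and Z: "hermitian Z"
  shows "tr ((X + Z) ** A ** (X + Z)) \<le> 1/2 * tr (X ** N ** X) + tr (Z ** Z)"
proof -
  have h: "hermitian N" using N by (simp add: psd_herm)
  define J where "J = hfun (\<lambda>t. 1 / (2 * (2 + t))) N"
  have J: "psd J" unfolding J_def by (rule psd_hfun'[OF N]) auto
  have comm: "J ** N = N ** J"
    using hfun_mult[OF h, of "\<lambda>t. 1 / (2 * (2 + t))" "\<lambda>t. t"] hfun_mult[OF h, of "\<lambda>t. t" "\<lambda>t. 1 / (2 * (2 + t))"]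
    by (simp add: J_def hfun_id[OF h])
  have NJ: "N ** J = (1/2) *\<^sub>R A"
  proof -
    have "N ** J = hfun (\<lambda>t. t * (1 / (2 * (2 + t)))) N"
      using hfun_mult[OF h, of "\<lambda>t. t" "\<lambda>t. 1 / (2 * (2 + t))"] by (simp add: J_def hfun_id[OF h])
    also have "\<dots> = hfun (\<lambda>t. 1/2 * (t / (2 + t))) N" by (rule hfun_cong[OF h]) simp
    finally show ?thesis by (simp only: A hfun_scaleR[OF h])
  qed
  have NJN: "N ** (J ** N) = (1/2) *\<^sub>R N - A"
  proof -
    have "N ** (J ** N) = hfun (\<lambda>t. t * (1 / (2 * (2 + t)) * t)) N"
      using hfun_mult[OF h, of "\<lambda>t. t" "\<lambda>t. 1 / (2 * (2 + t)) * t"] hfun_mult[OF h, of "\<lambda>t. 1 / (2 * (2 + t))" "\<lambda>t. t"]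
      by (simp add: J_def hfun_id[OF h])
    also have "\<dots> = hfun (\<lambda>t. 1/2 * t - t / (2 + t)) N"
      by (rule hfun_cong_psd[OF N]) (auto simp: field_simps)
    finally show ?thesis unfolding A scaleR_eq_hfun[OF h] hfun_diff[OF h] .
  qed
  have J4: "4 *\<^sub>R J = mat 1 - A"
  proof -
    have "hfun (\<lambda>t. 4 * (1 / (2 * (2 + t)))) N = hfun (\<lambda>t. 1 - t / (2 + t)) N"
      by (rule hfun_cong_psd[OF N]) (auto simp: field_simps)
    then show ?thesis using hfun_scaleR[OF h, of 4 "\<lambda>t. 1 / (2 * (2 + t))"]
        hfun_diff[OF h, of "\<lambda>_. 1" "\<lambda>t. t / (2 + t)"]
      by (simp add: J_def A hfun_const[OF h])
  qed
  have a: "N ** (J ** (N ** Y)) = (1/2) *\<^sub>R (N ** Y) - A ** Y" "N ** (J ** Y) = (1/2) *\<^sub>R (A ** Y)"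
      "J ** (N ** Y) = (1/2) *\<^sub>R (A ** Y)" "J ** Y = (1/4) *\<^sub>R (Y - A ** Y)" for Y :: "'a op"
  proof -
    show "N ** (J ** (N ** Y)) = (1/2) *\<^sub>R (N ** Y) - A ** Y"
      using arg_cong[OF NJN, of "\<lambda>B. B ** Y"] by (simp add: mx)
    show "N ** (J ** Y) = (1/2) *\<^sub>R (A ** Y)"
      using arg_cong[OF NJ, of "\<lambda>B. B ** Y"] by (simp add: mx)
    then show "J ** (N ** Y) = (1/2) *\<^sub>R (A ** Y)"
      using arg_cong[OF comm, of "\<lambda>B. B ** Y"] by (simp add: mx)
    have "J = (1/4) *\<^sub>R (mat 1 - A)" by (simp flip: J4)
    then show "J ** Y = (1/4) *\<^sub>R (Y - A ** Y)" by (simp add: mx)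
  qed
  \<comment> \<open>A splitting into \<open>X\<close> and \<open>Z\<close> is optimal when
    \<open>N ** X = 2 *\<^sub>R Z\<close>. The square of the deviation from this, weighted by
    \<open>J\<close>, is exactly the gap between the two sides.\<close>
  have "0 \<le> tr (dagger (N ** X - 2 *\<^sub>R Z) ** J ** (N ** X - 2 *\<^sub>R Z))"
    by (rule tr_psd[OF psd_conj[OF J]])
  also have "dagger (N ** X - 2 *\<^sub>R Z) = X ** N - 2 *\<^sub>R Z"
    using X Z h by (simp add: dagger_diff dagger_mult dagger_scaleR hermitian_def)
  also have "(X ** N - 2 *\<^sub>R Z) ** J ** (N ** X - 2 *\<^sub>R Z)
      = X ** (N ** (J ** (N ** X))) - 2 *\<^sub>R (X ** (N ** (J ** Z))) - 2 *\<^sub>R (Z ** (J ** (N ** X)))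
        + 4 *\<^sub>R (Z ** (J ** Z))"
    by (simp add: mx algebra_simps)
  also have "\<dots> = (1/2) *\<^sub>R (X ** N ** X) + Z ** Z - (X + Z) ** A ** (X + Z)"
    unfolding a(1) unfolding a(2,3) unfolding a(4) by (simp add: mx algebra_simps scaleR_2[symmetric])
  finally show ?thesis by (simp add: trs)
qed

text \<open>\<open>frac_tr B\<close> is the minimum of
  \<open>tr (Q B Q) + tr ((1 - Q)\<^sup>2)\<close> over hermitian \<open>Q\<close>. The test
  operator \<open>Q = (1 + R) / 2\<close> is built from the resolvent \<open>R\<close> of the total.
  The constant 2 in \<open>t / (2 + t)\<close> is the one for which both sides agree when there is a
  single message.\<close>

lemma decode_frac:
  fixes N :: "'i \<Rightarrow> 'n::finite op"
  assumes M: "finite M" and N: "\<And>m. m \<in> M \<Longrightarrow> psd (N m)"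
  defines "A \<equiv> \<lambda>m. hfun (\<lambda>t. t / (2 + t)) (N m)"
  shows "4 * frac_tr (\<Sum>m\<in>M. A m) \<le> frac_tr (\<Sum>m\<in>M. N m) + (\<Sum>m\<in>M. frac_tr (N m))"
proof -
  define Y B R where "Y = (\<Sum>m\<in>M. N m)" and "B = (\<Sum>m\<in>M. A m)" and "R = rs 1 Y"
  define r where "r m = rs 1 (N m)" for m
  have Y: "psd Y" unfolding Y_def by (rule psd_sum) (rule N)
  have pA: "psd (A m)" if "m \<in> M" for m unfolding A_def by (rule psd_hfun'[OF N[OF that]]) auto
  have B: "psd B" unfolding B_def by (rule psd_sum) (rule pA)
  have hR: "hermitian R" by (simp add: R_def rs_herm Y)
  have hr: "hermitian (r m)" if "m \<in> M" for m by (simp add: r_def rs_herm N that)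
  define Q where "Q = (1/2) *\<^sub>R (mat 1 + R)"
  have hQ: "hermitian Q" by (simp add: Q_def herm_scaleR herm_add hR)
  define X where "X = rs 1 B"
  have hX: "hermitian X" by (simp add: X_def rs_herm B)
  have iX: "X ** (mat 1 + B) = mat 1" "(mat 1 + B) ** X = mat 1" by (simp_all add: X_def rs1_inverse B)
  have iX': "X ** (B ** Z) = Z - X ** Z" "B ** (X ** Z) = Z - X ** Z" "B ** X = mat 1 - X" for Z :: "'n op"
  proof -
    have "X ** B = mat 1 - X" using iX(1) by (simp add: mx algebra_simps)
    from arg_cong[OF this, of "\<lambda>Y. Y ** Z"] show "X ** (B ** Z) = Z - X ** Z"
      by (simp add: mx)
    show b: "B ** X = mat 1 - X" using iX(2) by (simp add: mx algebra_simps)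
    from arg_cong[OF this, of "\<lambda>Y. Y ** Z"] show "B ** (X ** Z) = Z - X ** Z"
      by (simp add: mx)
  qed
  have XB: "X ** B = mat 1 - X" using iX(1) by (simp add: mx algebra_simps)
  have "0 \<le> tr ((Q - X) ** (mat 1 + B) ** (Q - X))"
    by (rule tr_psd[OF psd_sandwich]) (simp_all add: psd_add B herm_diff hQ hX)
  also have "(Q - X) ** (mat 1 + B) ** (Q - X) = Q ** B ** Q + (mat 1 - Q) ** (mat 1 - Q) - (mat 1 - X)"
    by (simp add: mx iX' XB algebra_simps)
  finally have 1: "tr (mat 1 - X) \<le> tr (Q ** B ** Q) + tr ((mat 1 - Q) ** (mat 1 - Q))"
    by (simp add: trs)
  have fB: "frac_tr B = tr (mat 1 - X)" by (simp add: frac_tr_rs'[OF B] X_def trs)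
  have "4 *\<^sub>R (Q ** B ** Q) = (mat 1 + R) ** B ** (mat 1 + R)"
    by (simp add: Q_def mx scaleR_add_right)
  from arg_cong[OF this, of tr] have q1: "4 * tr (Q ** B ** Q) = (\<Sum>m\<in>M. tr ((mat 1 + R) ** A m ** (mat 1 + R)))"
    by (simp only: tr_scaleR B_def matrix_sum_left matrix_sum_right tr_sum)
  have q2: "4 * tr ((mat 1 - Q) ** (mat 1 - Q)) = tr ((mat 1 - R) ** (mat 1 - R))"
  proof -
    have "mat 1 - Q = (1/2) *\<^sub>R (mat 1 - R)"
      by (simp add: Q_def scaleR_add_right scaleR_diff_right)
    then show ?thesis by (simp only: matrix_scaleR_left matrix_scaleR_right tr_scaleR)
  qed
  have m: "tr ((mat 1 + R) ** A m ** (mat 1 + R)) \<le> tr (R ** N m ** R) + tr (mat 1 - r m)"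
    if m: "m \<in> M" for m
  proof -
    \<comment> \<open>\<open>1 + R\<close> is split with the help of the resolvent
      \<open>r m\<close> of the single operator; the parallelogram law then separates
      \<open>R\<close> from \<open>r m\<close>.\<close>
    have "tr (((R + r m) + (mat 1 - r m)) ** A m ** ((R + r m) + (mat 1 - r m)))
      \<le> 1/2 * tr ((R + r m) ** N m ** (R + r m)) + tr ((mat 1 - r m) ** (mat 1 - r m))"
      by (rule parallel_sum_bound[OF N[OF m]]) (simp_all add: A_def herm_add herm_diff hR hr m)
    moreover have "(R + r m) + (mat 1 - r m) = mat 1 + R" by simp
    moreover have "0 \<le> tr ((R - r m) ** N m ** (R - r m))"
      by (rule tr_psd[OF psd_sandwich[OF N[OF m]]]) (simp add: herm_diff hR hr m)
    moreover have "tr ((R + r m) ** N m ** (R + r m)) + tr ((R - r m) ** N m ** (R - r m))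
        = 2 * tr (R ** N m ** R) + 2 * tr (r m ** N m ** r m)"
      by (simp add: mx trs)
    moreover have "r m ** N m ** r m + (mat 1 - r m) ** (mat 1 - r m) = mat 1 - r m"
    proof -
      have "r m + r m ** N m = mat 1"
        using rs1_inverse(1)[OF N[OF m]] by (simp add: r_def mx)
      from arg_cong[OF this, of "\<lambda>B. B ** r m"] show ?thesis by (simp add: mx algebra_simps)
    qed
    then have "tr (r m ** N m ** r m) + tr ((mat 1 - r m) ** (mat 1 - r m)) = tr (mat 1 - r m)"
      by (metis tr_add)
    ultimately show ?thesis by simp
  qed
  have RY: "R ** Y ** R + (mat 1 - R) ** (mat 1 - R) = mat 1 - R"
  proof -
    have "R + R ** Y = mat 1" using rs1_inverse(1)[OF Y] by (simp add: R_def mx)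
    from arg_cong[OF this, of "\<lambda>B. B ** R"] show ?thesis by (simp add: mx algebra_simps)
  qed
  have "(\<Sum>m\<in>M. tr (R ** N m ** R)) = tr (R ** Y ** R)"
    by (simp add: Y_def matrix_sum_left matrix_sum_right tr_sum)
  moreover have sm: "(\<Sum>m\<in>M. tr ((mat 1 + R) ** A m ** (mat 1 + R)))
    \<le> (\<Sum>m\<in>M. tr (R ** N m ** R) + tr (mat 1 - r m))"
    by (rule sum_mono) (rule m)
  ultimately have "4 * frac_tr B \<le> tr (R ** Y ** R) + (\<Sum>m\<in>M. tr (mat 1 - r m)) + tr ((mat 1 - R) ** (mat 1 - R))"
    using 1 q1 q2 sm unfolding fB by (simp add: sum.distrib)
  also have "\<dots> = tr (mat 1 - R) + (\<Sum>m\<in>M. tr (mat 1 - r m))"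
    using arg_cong[OF RY, of tr] by (simp add: tr_add)
  also have "tr (mat 1 - R) = frac_tr Y" by (simp add: frac_tr_rs'[OF Y] R_def trs)
  also have "(\<Sum>m\<in>M. tr (mat 1 - r m)) = (\<Sum>m\<in>M. frac_tr (N m))"
    by (intro sum.cong refl) (simp add: frac_tr_rs' N r_def trs)
  finally show ?thesis by (simp add: B_def Y_def)
qed

text \<open>\<open>N / (2 + N)\<close> for \<open>N = A\<^sup>2 / h\<^sup>2\<close>, the form in
  which \<open>decode_frac\<close> receives a codeword state.\<close>

definition damp :: "real \<Rightarrow> 'n::finite op \<Rightarrow> 'n op" where
  "damp h A = hfun (\<lambda>t. t\<^sup>2 / (t\<^sup>2 + 2 * h\<^sup>2)) A"

lemma psd_damp: "psd A \<Longrightarrow> psd (damp h A)"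
  unfolding damp_def by (rule psd_hfun') auto

lemma hfun_square: "hermitian A \<Longrightarrow> A ** A = hfun (\<lambda>t. t\<^sup>2) A"
  using hfun_mult[of A "\<lambda>t. t" "\<lambda>t. t"] by (simp add: hfun_id power2_eq_square)

text \<open>\<open>decode_frac\<close> for \<open>N m = \<rho> m\<^sup>2 / h\<^sup>2\<close>,
  rewritten with \<open>phi 1 C = tr C - frac_tr C\<close>. The single-message terms on the left
  later cancel against the empty set in the codebook recursion.\<close>

lemma decode_level:
  fixes \<rho> :: "'i \<Rightarrow> 'n::finite op"
  assumes M: "finite M" and \<rho>: "\<And>m. m \<in> M \<Longrightarrow> psd (\<rho> m)" and h: "0 < h"
  shows "(\<Sum>m\<in>M. tr (hfun (\<lambda>t. t\<^sup>2 / (t\<^sup>2 + h\<^sup>2)) (\<rho> m))) + 4 * (\<Sum>m\<in>M. phi 1 (damp h (\<rho> m)))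
    \<le> tr (hfun (\<lambda>t. t / (t + h\<^sup>2)) (\<Sum>m\<in>M. \<rho> m ** \<rho> m)) + 4 * phi 1 (\<Sum>m\<in>M. damp h (\<rho> m))"
proof -
  define N where "N m = (1 / h\<^sup>2) *\<^sub>R (\<rho> m ** \<rho> m)" for m
  define O' where "O' = (\<Sum>m\<in>M. \<rho> m ** \<rho> m)"
  have hr: "hermitian (\<rho> m)" if "m \<in> M" for m using \<rho>[OF that] by (rule psd_herm)
  have N: "psd (N m)" if "m \<in> M" for m
    unfolding N_def by (intro psd_scaleR psd_herm_square hr that) simp
  have pO: "psd O'" unfolding O'_def by (intro psd_sum psd_herm_square hr)
  have Nf: "N m = hfun (\<lambda>t. 1 / h\<^sup>2 * t\<^sup>2) (\<rho> m)" if "m \<in> M" for m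
    using hr[OF that] by (simp only: N_def hfun_square hfun_scaleR)
  have A: "damp h (\<rho> m) = hfun (\<lambda>t. t / (2 + t)) (N m)" if m: "m \<in> M" for m
    unfolding damp_def Nf[OF m] hfun_hfun[OF hr[OF m]]
    using h by (intro hfun_cong[OF hr[OF m]]) (simp add: field_simps)
  have fN: "frac_tr (N m) = tr (hfun (\<lambda>t. t\<^sup>2 / (t\<^sup>2 + h\<^sup>2)) (\<rho> m))" if m: "m \<in> M" for m
    unfolding frac_tr_def Nf[OF m] hfun_hfun[OF hr[OF m]]
    using h by (intro arg_cong[of _ _ tr] hfun_cong[OF hr[OF m]]) (simp add: field_simps)
  have fA: "frac_tr (damp h (\<rho> m)) = 1/2 * frac_tr (N m)" if m: "m \<in> M" for m
  proof -
    have "frac_tr (damp h (\<rho> m)) = tr (hfun (\<lambda>t. 1/2 * (t\<^sup>2 / (t\<^sup>2 + h\<^sup>2))) (\<rho> m))"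
      unfolding frac_tr_def damp_def hfun_hfun[OF hr[OF m]]
    proof (intro arg_cong[of _ _ tr] hfun_cong[OF hr[OF m]])
      fix k
      have "(ev (\<rho> m) k)\<^sup>2 + h\<^sup>2 \<noteq> 0" "(ev (\<rho> m) k)\<^sup>2 + 2 * h\<^sup>2 \<noteq> 0"
        using h by (smt (verit) zero_le_power2 zero_less_power)+
      then show "(ev (\<rho> m) k)\<^sup>2 / ((ev (\<rho> m) k)\<^sup>2 + 2 * h\<^sup>2) / (1 + (ev (\<rho> m) k)\<^sup>2 / ((ev (\<rho> m) k)\<^sup>2 + 2 * h\<^sup>2))
        = 1/2 * ((ev (\<rho> m) k)\<^sup>2 / ((ev (\<rho> m) k)\<^sup>2 + h\<^sup>2))"
        by (simp add: divide_simps)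
    qed
    also have "\<dots> = 1/2 * frac_tr (N m)"
      by (simp only: hfun_scaleR[OF hr[OF m], symmetric] tr_scaleR fN[OF m])
    finally show ?thesis .
  qed
  have ph: "phi 1 C = tr C - frac_tr C" if "psd C" for C :: "'n op"
    using phi_frac[OF that, of 1] by simp
  have "(\<Sum>m\<in>M. N m) = (1 / h\<^sup>2) *\<^sub>R O'" by (simp add: N_def O'_def scaleR_sum_right)
  moreover have "1 / h\<^sup>2 * x / (1 + 1 / h\<^sup>2 * x) = x / (x + h\<^sup>2)" for x
  proof -
    have "1 + 1 / h\<^sup>2 * x = (x + h\<^sup>2) / h\<^sup>2" using h by (simp add: field_simps)
    then show ?thesis using h by simp
  qed
  ultimately have fY: "frac_tr (\<Sum>m\<in>M. N m) = tr (hfun (\<lambda>t. t / (t + h\<^sup>2)) O')"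
    unfolding frac_tr_def by (simp only: hfun_scaled[OF psd_herm[OF pO]])
  have "4 * frac_tr (\<Sum>m\<in>M. damp h (\<rho> m)) \<le> frac_tr (\<Sum>m\<in>M. N m) + (\<Sum>m\<in>M. frac_tr (N m))"
    using decode_frac[of M N, OF M N] A by (simp cong: sum.cong)
  moreover have "(\<Sum>m\<in>M. phi 1 (damp h (\<rho> m))) = tr (\<Sum>m\<in>M. damp h (\<rho> m)) - 1/2 * (\<Sum>m\<in>M. frac_tr (N m))"
    by (simp add: ph psd_damp \<rho> fA sum_subtractf tr_sum sum_distrib_left cong: sum.cong)
  moreover have "phi 1 (\<Sum>m\<in>M. damp h (\<rho> m)) = tr (\<Sum>m\<in>M. damp h (\<rho> m)) - frac_tr (\<Sum>m\<in>M. damp h (\<rho> m))"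
    by (intro ph psd_sum psd_damp \<rho>)
  ultimately show ?thesis unfolding fY O'_def[symmetric] by (simp add: fN cong: sum.cong)
qed

text \<open>Weighting by the squares \<open>\<rho> m ** \<rho> m\<close> makes the linearised
  success terms \<open>\<rho> m ** \<rho> m ** q\<close> add up to the square root of their sum,
  whatever the number of messages.\<close>

lemma povm_exists:
  fixes \<rho> :: "'i \<Rightarrow> 'n::finite op"
  assumes M: "finite M" "M \<noteq> {}" and \<rho>: "\<And>m. m \<in> M \<Longrightarrow> psd (\<rho> m)"
  shows "\<exists>\<Lambda>. (\<forall>m\<in>M. psd (\<Lambda> m)) \<and> (\<Sum>m\<in>M. \<Lambda> m) = mat 1 \<and>
    (\<Sum>m\<in>M. \<Sum>m'\<in>M - {m}. tr (\<Lambda> m' ** \<rho> m))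
      \<le> 2 * ((\<Sum>m\<in>M. tr (\<rho> m)) - tr (hfun sqrt (\<Sum>m\<in>M. \<rho> m ** \<rho> m)))"
proof -
  obtain m0 where m0: "m0 \<in> M" using M by auto
  define O' where "O' = (\<Sum>m\<in>M. \<rho> m ** \<rho> m)"
  have hr: "hermitian (\<rho> m)" if "m \<in> M" for m using \<rho>[OF that] by (rule psd_herm)
  have pO: "psd O'" unfolding O'_def by (intro psd_sum psd_herm_square hr)
  have hO: "hermitian O'" using pO by (rule psd_herm)
  \<comment> \<open>Since \<open>1 / sqrt 0 = 0\<close>, this is the inverse square root on the
    support of \<open>O'\<close> and 0 on its kernel.\<close>
  define q where "q = hfun (\<lambda>t. 1 / sqrt t) O'"
  have q: "hermitian q" unfolding q_def by (rule hfun_herm[OF hO])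
  define L where "L m = q ** (\<rho> m ** \<rho> m) ** q" for m
  define rest where "rest = mat 1 - (\<Sum>m\<in>M. L m)"
  \<comment> \<open>The \<open>L m\<close> add up to the support projection of \<open>O'\<close>
    only; the missing part is given to an arbitrary message and can only help it.\<close>
  define \<Lambda> where "\<Lambda> m = L m + (if m = m0 then rest else 0)" for m
  have L: "psd (L m)" if "m \<in> M" for m
    unfolding L_def by (intro psd_sandwich q psd_herm_square hr that)
  have "(\<Sum>m\<in>M. L m) = q ** O' ** q" by (simp add: L_def O'_def matrix_sum_left matrix_sum_right)
  also have "\<dots> = hfun (\<lambda>t. 1 / sqrt t * t * (1 / sqrt t)) O'"
    using hfun_mult[OF hO, of "\<lambda>t. 1 / sqrt t" "\<lambda>t. t"] hfun_mult[OF hO, of "\<lambda>t. 1 / sqrt t * t" "\<lambda>t. 1 / sqrt t"]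
    by (simp add: q_def hfun_id[OF hO])
  finally have "rest = hfun (\<lambda>t. 1 - 1 / sqrt t * t * (1 / sqrt t)) O'"
    using hfun_diff[OF hO, of "\<lambda>_. 1"] by (simp add: rest_def hfun_const[OF hO])
  moreover have "psd (hfun (\<lambda>t. 1 - 1 / sqrt t * t * (1 / sqrt t)) O')"
  proof (rule psd_hfun'[OF pO])
    fix t :: real assume "0 \<le> t"
    then show "0 \<le> 1 - 1 / sqrt t * t * (1 / sqrt t)"
      by (cases "t = 0") (simp_all add: field_simps)
  qed
  ultimately have rest: "psd rest" by simp
  have pL: "psd (\<Lambda> m)" if "m \<in> M" for m using L[OF that] rest by (simp add: \<Lambda>_def psd_add)
  have sL: "(\<Sum>m\<in>M. \<Lambda> m) = mat 1"
    by (simp add: \<Lambda>_def sum.distrib rest_def m0 M)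
  have ge: "2 * tr (\<rho> m ** \<rho> m ** q) - tr (\<rho> m) \<le> tr (\<Lambda> m ** \<rho> m)" if m: "m \<in> M" for m
  proof -
    define W where "W = hfun sqrt (\<rho> m)"
    have W: "hermitian W" "W ** W = \<rho> m" by (simp_all add: W_def hfun_herm hr m sqrt_mult \<rho>)
    \<comment> \<open>The cyclic trace turns this square into \<open>tr (L m ** \<rho> m) - 2 * tr
      (\<rho> m ** \<rho> m ** q) + tr (\<rho> m)\<close>, which bounds the success term from below
      by an expression linear in \<open>q\<close>.\<close>
    have "0 \<le> tr ((W ** q ** W - mat 1) ** \<rho> m ** (W ** q ** W - mat 1))"
      by (rule tr_psd[OF psd_sandwich[OF \<rho>[OF m]]]) (simp add: herm_diff herm_sandwich q W)
    also have "\<dots> = tr (W ** q ** W ** \<rho> m ** W ** q ** W) - tr (W ** q ** W ** \<rho> m)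
        - tr (\<rho> m ** W ** q ** W) + tr (\<rho> m)"
      by (simp add: mx trs)
    also have "tr (W ** q ** W ** \<rho> m ** W ** q ** W) = tr (q ** (\<rho> m ** \<rho> m) ** q ** \<rho> m)"
      using tr_comm[of W "q ** W ** \<rho> m ** W ** q ** W"]
      by (simp add: W(2)[symmetric] matrix_mul_assoc[symmetric])
    also have "tr (W ** q ** W ** \<rho> m) = tr (\<rho> m ** \<rho> m ** q)"
      using tr_comm[of "W ** q" "W ** \<rho> m"] tr_comm[of W "\<rho> m ** W ** q"]
      by (simp add: W(2)[symmetric] matrix_mul_assoc[symmetric])
    also have "tr (\<rho> m ** W ** q ** W) = tr (\<rho> m ** \<rho> m ** q)"
      using tr_comm[of "\<rho> m ** W ** q" W] tr_comm[of W "\<rho> m ** W ** q"]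
      by (simp add: W(2)[symmetric] matrix_mul_assoc[symmetric])
    finally have "2 * tr (\<rho> m ** \<rho> m ** q) - tr (\<rho> m) \<le> tr (L m ** \<rho> m)" by (simp add: L_def)
    moreover have "0 \<le> tr (rest ** \<rho> m)" using rest \<rho>[OF m] by (rule tr_mult_psd)
    ultimately show ?thesis by (cases "m = m0") (auto simp: \<Lambda>_def mx trs)
  qed
  have "(\<Sum>m\<in>M. tr (\<rho> m ** \<rho> m ** q)) = tr (O' ** q)"
    by (simp add: O'_def matrix_sum_left tr_sum)
  also have "O' ** q = hfun (\<lambda>t. t * (1 / sqrt t)) O'"
    using hfun_mult[OF hO, of "\<lambda>t. t" "\<lambda>t. 1 / sqrt t"] by (simp add: q_def hfun_id[OF hO])
  also have "\<dots> = hfun sqrt O'"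
    by (rule hfun_cong_psd[OF pO]) (simp add: real_div_sqrt)
  finally have sq: "(\<Sum>m\<in>M. tr (\<rho> m ** \<rho> m ** q)) = tr (hfun sqrt O')" .
  have "(\<Sum>m'\<in>M - {m}. tr (\<Lambda> m' ** \<rho> m)) = tr (\<rho> m) - tr (\<Lambda> m ** \<rho> m)" if m: "m \<in> M" for m
  proof -
    have "(\<Sum>m'\<in>M. tr (\<Lambda> m' ** \<rho> m)) = tr (\<rho> m)"
      by (simp add: tr_sum[symmetric] matrix_sum_left[symmetric] sL)
    then show ?thesis using sum.remove[OF M(1) m, of "\<lambda>m'. tr (\<Lambda> m' ** \<rho> m)"] by simp
  qed
  then have "(\<Sum>m\<in>M. \<Sum>m'\<in>M - {m}. tr (\<Lambda> m' ** \<rho> m)) = (\<Sum>m\<in>M. tr (\<rho> m) - tr (\<Lambda> m ** \<rho> m))"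
    by (intro sum.cong) auto
  also have "\<dots> \<le> (\<Sum>m\<in>M. 2 * tr (\<rho> m) - 2 * tr (\<rho> m ** \<rho> m ** q))"
    using ge by (intro sum_mono) force
  also have "\<dots> = 2 * ((\<Sum>m\<in>M. tr (\<rho> m)) - tr (hfun sqrt O'))"
    by (simp add: sum_subtractf sum_distrib_left[symmetric] sq)
  finally show ?thesis using pL sL unfolding O'_def by blast
qed

section \<open>Operator bounds that prepare the recursion for the error\<close>

lemma frac_op_mono:
  assumes "psd A" "psd B" "psd (B - A)"
  shows "psd (hfun (\<lambda>t. t / (1 + t)) B - hfun (\<lambda>t. t / (1 + t)) A)"
proof -
  have "hfun (\<lambda>t. t / (1 + t)) C = mat 1 - rs 1 C" if "psd C" for C :: "'a op"
  proof -
    have "hfun (\<lambda>t. t / (1 + t)) C = hfun (\<lambda>t. 1 - 1 / (1 + t)) C"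
      by (rule hfun_cong_psd[OF that]) (simp add: field_simps)
    then show ?thesis using hfun_diff[of C "\<lambda>_. 1"] that by (simp add: rs_def psd_herm hfun_const)
  qed
  then show ?thesis using rs_antitone[OF assms, of 1] assms by simp
qed

text \<open>Only one of the two factors of \<open>B ** (B / (1 + B))\<close> is enlarged. The bound
  stays linear in the other, which lets \<open>error_level\<close> undo an average there.\<close>

lemma phi_le_tr:
  assumes B: "psd B" and C: "psd C" and BC: "psd (C - B)"
  shows "phi 1 B \<le> tr (B ** hfun (\<lambda>t. t / (1 + t)) C)"
proof -
  have "phi 1 B = tr (B ** hfun (\<lambda>t. t / (1 + t)) B)"
    unfolding phi_def using hfun_mult[OF psd_herm[OF B], of "\<lambda>t. t" "\<lambda>t. t / (1 + t)"]
    by (simp add: hfun_id psd_herm[OF B] power2_eq_square)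
  also have "\<dots> \<le> tr (B ** hfun (\<lambda>t. t / (1 + t)) C)"
    by (rule tr_mult_mono[OF B frac_op_mono[OF B C BC]])
  finally show ?thesis .
qed

text \<open>The inequality \<open>t\<^sup>2 + 2 * h\<^sup>2 \<ge> 2 * sqrt 2 * h * t\<close> of the
  means; the origin of every later factor \<open>2 * sqrt 2 * h\<close>.\<close>

lemma damp_le:
  assumes A: "psd A" and h: "0 < h"
  shows "psd ((1 / (2 * sqrt 2 * h)) *\<^sub>R A - damp h A)"
proof -
  have hA: "hermitian A" using A by (rule psd_herm)
  show ?thesis
    unfolding damp_def scaleR_eq_hfun[OF hA] hfun_diff[OF hA]
  proof (rule psd_hfun'[OF A])
    fix t :: real assume t: "0 \<le> t"
    have "0 \<le> (t - sqrt 2 * h)\<^sup>2" by simp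
    then have "2 * sqrt 2 * h * t \<le> t\<^sup>2 + 2 * h\<^sup>2"
      by (simp add: power2_diff power_mult_distrib mult_ac)
    then have "t * (2 * sqrt 2 * h * t) \<le> t * (t\<^sup>2 + 2 * h\<^sup>2)"
      using t by (rule mult_left_mono)
    moreover have "0 < t\<^sup>2 + 2 * h\<^sup>2" using h by (simp add: add_nonneg_pos)
    ultimately show "0 \<le> 1 / (2 * sqrt 2 * h) * t - t\<^sup>2 / (t\<^sup>2 + 2 * h\<^sup>2)"
      using h by (simp add: divide_simps power2_eq_square mult_ac)
  qed
qed


section \<open>Scalar integrals and inequalities\<close>

lemma sum_powr_le_powr_sum:
  fixes a y :: "'i \<Rightarrow> real"
  assumes S: "finite S" and a: "\<And>i. i \<in> S \<Longrightarrow> 0 \<le> a i" "sum a S = 1"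
    and y: "\<And>i. i \<in> S \<Longrightarrow> 0 \<le> y i" and r: "0 < r" "r < 1"
  shows "(\<Sum>i\<in>S. a i * y i powr r) \<le> (\<Sum>i\<in>S. a i * y i) powr r"
proof -
  define t where "t = (\<Sum>i\<in>S. a i * y i)"
  have t: "0 \<le> t" unfolding t_def by (intro sum_nonneg mult_nonneg_nonneg a y)
  show ?thesis
  proof (cases "t = 0")
    case True
    then have "a i * y i = 0" if "i \<in> S" for i
      using S a y that unfolding t_def by (subst (asm) sum_nonneg_eq_0_iff) auto
    then have "a i * y i powr r = 0" if "i \<in> S" for i using that by force
    then have "(\<Sum>i\<in>S. a i * y i powr r) = 0" by (intro sum.neutral ballI)
    then show ?thesis by simp
  next
    case False
    then have t: "0 < t" using t by simp
    have "a i * y i powr r * t powr (1 - r) \<le> r * (a i * y i) + (1 - r) * t * a i" if i: "i \<in> S" for i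
    proof (cases "y i = 0")
      case False
      then have "y i powr r * t powr (1 - r) \<le> r * y i + (1 - r) * t"
        using y[OF i] r t by (intro Youngs_inequality_0) auto
      from mult_left_mono[OF this a(1)[OF i]] show ?thesis by (simp add: algebra_simps)
    qed (use r t a i in auto)
    then have "(\<Sum>i\<in>S. a i * y i powr r * t powr (1 - r)) \<le> (\<Sum>i\<in>S. r * (a i * y i) + (1 - r) * t * a i)"
      by (rule sum_mono)
    also have "\<dots> = r * t + (1 - r) * t"
      by (simp add: sum.distrib sum_distrib_left[symmetric] a(2) t_def)
    also have "\<dots> = t powr r * t powr (1 - r)" using t by (simp add: powr_add[symmetric] algebra_simps)
    finally show ?thesis using t by (simp add: sum_distrib_right[symmetric] t_def[symmetric])
  qed
qed

lemma powr_sum_le_sum_powr: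
  fixes a y :: "'i \<Rightarrow> real"
  assumes S: "finite S" and a: "\<And>i. i \<in> S \<Longrightarrow> 0 \<le> a i" "sum a S = 1" and p: "1 < p"
  shows "\<bar>\<Sum>i\<in>S. a i * y i\<bar> powr p \<le> (\<Sum>i\<in>S. a i * \<bar>y i\<bar> powr p)"
proof -
  have "\<bar>\<Sum>i\<in>S. a i * y i\<bar> \<le> (\<Sum>i\<in>S. \<bar>a i * y i\<bar>)" by (rule sum_abs)
  also have "\<dots> = (\<Sum>i\<in>S. a i * (\<bar>y i\<bar> powr p) powr (1 / p))"
    using a p by (intro sum.cong refl) (simp add: abs_mult powr_powr)
  also have "\<dots> \<le> (\<Sum>i\<in>S. a i * \<bar>y i\<bar> powr p) powr (1 / p)"
    using p by (intro sum_powr_le_powr_sum S a) auto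
  finally have "\<bar>\<Sum>i\<in>S. a i * y i\<bar> powr p \<le> ((\<Sum>i\<in>S. a i * \<bar>y i\<bar> powr p) powr (1 / p)) powr p"
    using p by (intro powr_mono2) auto
  also have "\<dots> = (\<Sum>i\<in>S. a i * \<bar>y i\<bar> powr p)"
    using p a by (simp add: powr_powr sum_nonneg)
  finally show ?thesis .
qed

lemma holder_normalised:
  fixes y s :: "'i \<Rightarrow> real"
  assumes S: "finite S" and y: "\<And>i. i \<in> S \<Longrightarrow> 0 \<le> y i" and s: "\<And>i. i \<in> S \<Longrightarrow> 0 \<le> s i"
    and p: "1 < p" and q: "1 < q" "1 / p + 1 / q = 1" and s1: "(\<Sum>i\<in>S. s i powr q) \<le> 1"
  shows "(\<Sum>i\<in>S. y i * s i) \<le> (\<Sum>i\<in>S. y i powr p) powr (1 / p)"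
proof -
  define N where "N = (\<Sum>i\<in>S. y i powr p)"
  have N: "0 \<le> N" by (simp add: N_def sum_nonneg)
  show ?thesis
  proof (cases "N = 0")
    case True
    then have "y i = 0" if "i \<in> S" for i
      using S that unfolding N_def by (subst (asm) sum_nonneg_eq_0_iff) auto
    then show ?thesis by simp
  next
    case False
    then have N: "0 < N" using N by simp
    define c where "c = N powr (1 / p)"
    have c: "0 < c" "c powr p = N" using N p by (simp_all add: c_def powr_powr)
    have "y i * s i \<le> c * (y i powr p / N / p + s i powr q / q)" if i: "i \<in> S" for i
    proof -
      have "y i / c * s i \<le> (y i / c) powr p / p + s i powr q / q"
        using p q y[OF i] s[OF i] c by (intro Youngs_inequality) auto
      also have "(y i / c) powr p = y i powr p / N" using y[OF i] c by (simp add: powr_divide)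
      finally have "c * (y i / c * s i) \<le> c * (y i powr p / N / p + s i powr q / q)"
        using c by (intro mult_left_mono) auto
      then show ?thesis using c by simp
    qed
    then have "(\<Sum>i\<in>S. y i * s i) \<le> (\<Sum>i\<in>S. c * (y i powr p / N / p + s i powr q / q))"
      by (rule sum_mono)
    also have "\<dots> = c * (N / N / p + (\<Sum>i\<in>S. s i powr q) / q)"
      by (simp add: sum_distrib_left[symmetric] sum.distrib sum_divide_distrib[symmetric] N_def)
    also have "\<dots> \<le> c * (1 / p + 1 / q)"
      using c N s1 q p by (intro mult_left_mono add_mono divide_right_mono) auto
    finally show ?thesis using q by (simp add: c_def N_def)
  qed
qed

text \<open>Integrability over the positive reals and the value of the integral in one predicate, so
  that \<open>hi_mono\<close> compares integrals without side conditions.\<close>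

definition hi :: "(real \<Rightarrow> real) \<Rightarrow> real \<Rightarrow> bool" where
  "hi f v \<longleftrightarrow> has_bochner_integral lborel (\<lambda>x. indicator {0<..} x * f x) v"

lemma hi_cong: "hi f v \<Longrightarrow> (\<And>x. 0 < x \<Longrightarrow> f x = g x) \<Longrightarrow> hi g v"
proof -
  assume f: "hi f v" and "\<And>x. 0 < x \<Longrightarrow> f x = g x"
  then have "(\<lambda>x :: real. indicator {0<..} x * f x) = (\<lambda>x. indicator {0<..} x * g x)"
    by (auto simp: indicator_def)
  with f show ?thesis by (simp add: hi_def)
qed

lemma hi_add: "hi f v \<Longrightarrow> hi g w \<Longrightarrow> hi (\<lambda>x. f x + g x) (v + w)"
  unfolding hi_def by (drule (1) has_bochner_integral_add) (simp add: distrib_left)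

lemma hi_cmult: "hi f v \<Longrightarrow> hi (\<lambda>x. c * f x) (c * v)"
  using has_bochner_integral_mult_right[of c lborel "\<lambda>x. indicator {0<..} x * f x" v]
  by (simp add: hi_def mult_ac)

lemma hi_sum: "(\<And>i. i \<in> S \<Longrightarrow> hi (f i) (v i)) \<Longrightarrow> hi (\<lambda>x. \<Sum>i\<in>S. f i x) (\<Sum>i\<in>S. v i)"
  unfolding hi_def sum_distrib_left by (rule has_bochner_integral_sum)

lemma hi_mono: 
  assumes "hi f v" "hi g w" "\<And>x. 0 < x \<Longrightarrow> f x \<le> g x"
  shows "v \<le> w"
proof -
  have "integral\<^sup>L lborel (\<lambda>x. indicator {0<..} x * f x) \<le> integral\<^sup>L lborel (\<lambda>x. indicator {0<..} x * g x)"
    using assms by (intro integral_mono) (auto simp: hi_def has_bochner_integral_iff indicator_def)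
  then show ?thesis using assms by (simp add: hi_def has_bochner_integral_iff)
qed

lemma hi_scale:
  assumes "hi f v" "0 < c"
  shows "hi (\<lambda>x. f (c * x)) (v / c)"
proof -
  have "has_bochner_integral lborel (\<lambda>x. indicator {0<..} (0 + c * x) * f (0 + c * x)) (v /\<^sub>R \<bar>c\<bar>)"
    using assms lborel_has_bochner_integral_real_affine_iff[of c "\<lambda>x. indicator {0<..} x * f x" v 0]
    by (simp add: hi_def)
  moreover have "indicator {0<..} (c * x) = (indicator {0<..} x :: real)" for x :: real
    using assms by (simp add: indicator_def zero_less_mult_iff)
  ultimately show ?thesis using assms by (simp add: hi_def divide_inverse mult.commute)
qed

lemma hi_nn:
  assumes [measurable]: "f \<in> borel_measurable borel" and f: "\<And>x. 0 < x \<Longrightarrow> 0 \<le> f x" and v: "0 \<le> v"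
    and A: "(\<integral>\<^sup>+x. ennreal (f x) * indicator {0<..} x \<partial>lborel) = ennreal v"
  shows "hi f v"
  unfolding hi_def
proof (rule has_bochner_integral_nn_integral)
  have "(\<integral>\<^sup>+x. ennreal (indicator {0<..} x * f x) \<partial>lborel) = (\<integral>\<^sup>+x. ennreal (f x) * indicator {0<..} x \<partial>lborel)"
    by (intro nn_integral_cong) (auto simp: indicator_def)
  then show "(\<integral>\<^sup>+x. ennreal (indicator {0<..} x * f x) \<partial>lborel) = ennreal v" using A by simp
qed (use f v in \<open>auto simp: indicator_def\<close>)

lemma hi_has_integral:
  fixes f :: "real \<Rightarrow> real"
  assumes [measurable]: "f \<in> borel_measurable borel" and A: "A \<in> sets borel"
    and f: "\<And>x. 0 \<le> f x" and I: "(f has_integral v) A"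
  shows "has_bochner_integral lborel (\<lambda>x. indicator A x * f x) v"
proof (rule has_bochner_integral_nn_integral)
  have "((\<lambda>x. indicator A x * f x) has_integral v) UNIV"
  proof -
    have e: "(\<lambda>x. indicator A x * f x) = (\<lambda>x. if x \<in> A then f x else 0)"
      by (auto simp: indicator_def)
    show ?thesis unfolding e has_integral_restrict_UNIV by (rule I)
  qed
  then show "(\<integral>\<^sup>+x. ennreal (indicator A x * f x) \<partial>lborel) = ennreal v"
    using A f by (intro nn_integral_has_integral_lborel) auto
  show "0 \<le> v" by (rule has_integral_nonneg[OF I]) (rule f)
qed (use f A in auto)

lemma hi_powr_0: 
  assumes "-1 < a"
  shows "hi (\<lambda>x. indicator {0..1} x * x powr a) (1 / (a + 1))"
proof -
  have "((\<lambda>x::real. x powr a) has_integral 1 powr (a + 1) / (a + 1)) {0..1}"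
    using assms by (rule has_integral_powr_from_0) simp
  then have "has_bochner_integral lborel (\<lambda>x. indicator {0..1} x * x powr a) (1 / (a + 1))"
    by (intro hi_has_integral) auto
  moreover have "(\<lambda>x::real. indicator {0<..} x * (indicator {0..1} x * x powr a)) = (\<lambda>x. indicator {0..1} x * x powr a)"
    by (auto simp: indicator_def fun_eq_iff)
  ultimately show ?thesis by (simp add: hi_def)
qed

lemma hi_powr_inf: 
  assumes "a < -1"
  shows "hi (\<lambda>x. indicator {1..} x * x powr a) (- 1 / (a + 1))"
proof -
  have "((\<lambda>x::real. x powr a) has_integral - (1 powr (a + 1)) / (a + 1)) {1..}"
    using assms by (rule has_integral_powr_to_inf) simp
  then have "has_bochner_integral lborel (\<lambda>x. indicator {1..} x * x powr a) (- 1 / (a + 1))"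
    by (intro hi_has_integral) auto
  moreover have "(\<lambda>x::real. indicator {0<..} x * (indicator {1..} x * x powr a)) = (\<lambda>x. indicator {1..} x * x powr a)"
    by (auto simp: indicator_def fun_eq_iff)
  ultimately show ?thesis by (simp add: hi_def)
qed

lemma hi_exists:
  assumes g: "hi g w" and [measurable]: "f \<in> borel_measurable borel"
    and f: "\<And>x. 0 < x \<Longrightarrow> 0 \<le> f x" "\<And>x. 0 < x \<Longrightarrow> f x \<le> g x"
  shows "\<exists>v. hi f v"
proof -
  have "integrable lborel (\<lambda>x. indicator {0<..} x * f x)"
  proof (rule Bochner_Integration.integrable_bound)
    show "integrable lborel (\<lambda>x. indicator {0<..} x * g x)"
      using g by (simp add: hi_def has_bochner_integral_iff)
    show "AE x in lborel. norm (indicator {0<..} x * f x) \<le> norm (indicator {0<..} x * g x)"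
      using f by (intro AE_I2) (force simp: indicator_def)
  qed measurable
  then show ?thesis by (auto simp: hi_def has_bochner_integral_iff)
qed

text \<open>Only the sign of \<open>c\<close> matters: it occurs on both sides of each inequality
  that is integrated against this kernel and cancels.\<close>

lemma hi_resolvent_const:
  assumes r: "0 < r" "r < 1"
  shows "\<exists>c>0. hi (\<lambda>x. x powr (r - 1) / (1 + x)) c"
proof -
  have 1: "hi (\<lambda>x. indicator {0..1} x * x powr (r - 1)) (1 / r)" using hi_powr_0[of "r - 1"] r by simp
  have 2: "hi (\<lambda>x. indicator {1..} x * x powr (r - 2)) (- 1 / (r - 2 + 1))" using hi_powr_inf[of "r - 2"] r by simp
  have le: "x powr (r - 1) / (1 + x) \<le> indicator {0..1} x * x powr (r - 1) + indicator {1..} x * x powr (r - 2)"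
    if x: "0 < x" for x :: real
  proof (cases "x \<le> 1")
    case True
    have "x powr (r - 1) / (1 + x) \<le> x powr (r - 1) / 1" using x by (intro divide_left_mono) auto
    then show ?thesis using True x by (auto simp: indicator_def intro: order_trans)
  next
    case False
    have "x powr (r - 1) / (1 + x) \<le> x powr (r - 1) / x" using x by (intro divide_left_mono) auto
    also have "\<dots> = x powr (r - 2)" using x by (simp add: powr_diff power2_eq_square)
    finally show ?thesis using False x by (auto simp: indicator_def)
  qed
  have ge: "1/2 * (indicator {0..1} x * x powr (r - 1)) \<le> x powr (r - 1) / (1 + x)" if x: "0 < x" for x :: real
  proof (cases "x \<le> 1")
    case True
    have "x powr (r - 1) / 2 \<le> x powr (r - 1) / (1 + x)" using x True by (intro divide_left_mono) auto
    then show ?thesis using True x by (simp add: indicator_def)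
  qed (use x in \<open>simp add: indicator_def\<close>)
  obtain c where c: "hi (\<lambda>x. x powr (r - 1) / (1 + x)) c"
    using hi_exists[OF hi_add[OF 1 2], of "\<lambda>x. x powr (r - 1) / (1 + x)"] le by auto
  have "1/2 * (1 / r) \<le> c" using hi_mono[OF hi_cmult[OF 1] c ge] .
  moreover have "0 < 1/2 * (1 / r)" using r by simp
  ultimately show ?thesis using c by (intro exI[of _ c]) linarith
qed

text \<open>Follows from the case \<open>t = 1\<close> by scaling. Through this representation,
  inequalities between resolvents pass to powers with exponent in (0, 1).\<close>

lemma hi_resolvent:
  assumes r: "0 < r" "r < 1"
  shows "\<exists>c>0. \<forall>t\<ge>0. hi (\<lambda>x. x powr (r - 1) * (t / (x + t))) (c * t powr r)"
proof -
  obtain c where c: "0 < c" "hi (\<lambda>x. x powr (r - 1) / (1 + x)) c" using hi_resolvent_const[OF r] by blast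
  have "hi (\<lambda>x. x powr (r - 1) * (t / (x + t))) (c * t powr r)" if "0 \<le> t" for t
  proof (cases "t = 0")
    case True
    have "hi (\<lambda>x. 0 * (x powr (r - 1) / (1 + x))) (0 * c)" by (rule hi_cmult) (rule c)
    then show ?thesis using True by simp
  next
    case False
    then have t: "0 < t" using that by simp
    have e: "hi (\<lambda>x. t powr (r - 1) * ((1 / t * x) powr (r - 1) / (1 + 1 / t * x))) (t powr (r - 1) * (c / (1 / t)))"
      by (intro hi_cmult hi_scale c) (simp add: t)
    have v: "t powr (r - 1) * (c / (1 / t)) = c * t powr r"
    proof -
      have "t powr (r - 1) * t = t powr r" using t by (simp add: powr_diff)
      then show ?thesis by (simp add: mult_ac)
    qed
    show ?thesis
    proof (rule hi_cong[OF e[unfolded v]])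
      fix x :: real assume x: "0 < x"
      have "t powr (r - 1) * (1 / t * x) powr (r - 1) = x powr (r - 1)"
        using t x by (simp add: powr_mult[symmetric])
      then have "t powr (r - 1) * ((1 / t * x) powr (r - 1) / (1 + 1 / t * x)) = x powr (r - 1) / (1 + 1 / t * x)"
        by (metis times_divide_eq_right)
      also have "\<dots> = x powr (r - 1) * (t / (x + t))" using t x by (simp add: field_simps)
      finally show "t powr (r - 1) * ((1 / t * x) powr (r - 1) / (1 + 1 / t * x)) = x powr (r - 1) * (t / (x + t))" .
    qed
  qed
  then show ?thesis using c(1) by blast
qed

lemma hi_cauchy: "hi (\<lambda>y. 1 / (1 + y\<^sup>2)) (pi / 2)"
proof (rule hi_nn)
  have "(\<integral>\<^sup>+x. ennreal (1 / (1 + x\<^sup>2)) * indicator {0..} x \<partial>lborel) = ennreal (pi / 2 - arctan 0)"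
  proof (rule nn_integral_FTC_atLeast)
    show "DERIV arctan x :> 1 / (1 + x\<^sup>2)" for x :: real
      using DERIV_arctan[of x] by (simp add: divide_inverse)
  qed (use tendsto_arctan_at_top in auto)
  moreover have "(\<integral>\<^sup>+x. ennreal (1 / (1 + x\<^sup>2)) * indicator {0<..} x \<partial>lborel) = (\<integral>\<^sup>+x. ennreal (1 / (1 + x\<^sup>2)) * indicator {0..} x \<partial>lborel)"
  proof (rule nn_integral_cong_AE)
    have "AE x in lborel. x \<noteq> (0::real)" by (rule AE_lborel_singleton)
    then show "AE x in lborel. ennreal (1 / (1 + x\<^sup>2)) * indicator {0<..} x = ennreal (1 / (1 + x\<^sup>2)) * indicator {0..} x"
      by eventually_elim (auto simp: indicator_def)
  qed
  ultimately show "(\<integral>\<^sup>+x. ennreal (1 / (1 + x\<^sup>2)) * indicator {0<..} x \<partial>lborel) = ennreal (pi / 2)" by simp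
qed auto

lemma hi_square:
  assumes "0 \<le> a"
  shows "hi (\<lambda>h. a\<^sup>2 / (a\<^sup>2 + h\<^sup>2)) (pi / 2 * a)"
proof (cases "a = 0")
  case True
  have "hi (\<lambda>x. 0 * (1 / (1 + x\<^sup>2))) (0 * (pi / 2))" by (rule hi_cmult) (rule hi_cauchy)
  then show ?thesis using True by simp
next
  case False
  then have a: "0 < a" using assms by simp
  have "hi (\<lambda>h. 1 / (1 + (1 / a * h)\<^sup>2)) (pi / 2 / (1 / a))"
    by (intro hi_scale hi_cauchy) (use a in simp)
  then have e: "hi (\<lambda>h. 1 / (1 + (1 / a * h)\<^sup>2)) (pi / 2 * a)" by simp
  show ?thesis
  proof (rule hi_cong[OF e])
    fix h :: real
    have "1 + (1 / a * h)\<^sup>2 = (a\<^sup>2 + h\<^sup>2) / a\<^sup>2" using a by (simp add: field_simps power_mult_distrib)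
    then show "1 / (1 + (1 / a * h)\<^sup>2) = a\<^sup>2 / (a\<^sup>2 + h\<^sup>2)" by simp
  qed
qed

text \<open>The exact value is pi / sqrt 2, about 2.22. The bound 488/210 uses
  \<open>1 / (1 + z) \<le> 1 - z / 2\<close> on [0, 1], with \<open>z = y\<^sup>2\<close> up to 1
  and \<open>z = y powr (-2)\<close> beyond.\<close>

lemma hi_half: "\<exists>J. hi (\<lambda>y. y powr (- 1/2) / (1 + y\<^sup>2)) J \<and> J \<le> 488/210"
proof -
  define g where "g = (\<lambda>y::real. (indicator {0..1} y * y powr (- 1/2) + (- 1/2) * (indicator {0..1} y * y powr (3/2)))
    + (indicator {1..} y * y powr (- 5/2) + (- 1/2) * (indicator {1..} y * y powr (- 9/2))))"
  have g: "hi g ((1 / (- 1/2 + 1) + (- 1/2) * (1 / (3/2 + 1))) + (- 1 / (- 5/2 + 1) + (- 1/2) * (- 1 / (- 9/2 + 1))))"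
    unfolding g_def by (intro hi_add hi_cmult hi_powr_0 hi_powr_inf) simp_all
  have le: "y powr (- 1/2) / (1 + y\<^sup>2) \<le> g y" if y: "0 < y" for y :: real
  proof -
    have b: "1 / (1 + z) \<le> 1 - 1/2 * z" if "0 \<le> z" "z \<le> 1" for z :: real
    proof -
      have "z * z \<le> 1 * z" using that by (intro mult_right_mono)
      then show ?thesis using that by (simp add: field_simps)
    qed
    show ?thesis
    proof (cases "y \<le> 1")
      case True
      have "y\<^sup>2 \<le> 1\<^sup>2" using y True by (intro power_mono) auto
      then have "y powr (- 1/2) * (1 / (1 + y\<^sup>2)) \<le> y powr (- 1/2) * (1 - 1/2 * y\<^sup>2)"
        by (intro mult_left_mono b) auto
      also have "y powr (- 1/2) * y\<^sup>2 = y powr (3/2)"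
        using y powr_add[of y "-1/2" 2] by simp
      then have "y powr (- 1/2) * (1 - 1/2 * y\<^sup>2) = y powr (- 1/2) - 1/2 * y powr (3/2)"
        by (simp add: algebra_simps)
      also have "\<dots> \<le> g y"
      \<comment> \<open>Both indicators are 1 at this point; the additional summand only increases
        \<open>g\<close>.\<close>
      proof (cases "y = 1")
        case False
        then show ?thesis using True y by (simp add: g_def indicator_def)
      qed (simp add: g_def)
      finally show ?thesis by simp
    next
      case False
      define z where "z = y powr (- 2)"
      have z: "0 \<le> z" "z \<le> 1" using False y by (auto simp: z_def powr_le_one_le powr_minus_divide field_simps)
      have zy: "y\<^sup>2 * z = 1" using y powr_add[of y 2 "-2"] by (simp add: z_def)
      have "1 / (1 + y\<^sup>2) = z * (1 / (1 + z))"
      proof -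
        have "z * (1 + y\<^sup>2) = 1 + z" using zy by (simp add: algebra_simps)
        then show ?thesis using z by (simp add: field_simps add_nonneg_eq_0_iff)
      qed
      also have "\<dots> \<le> z * (1 - 1/2 * z)" using z by (intro mult_left_mono b) auto
      finally have "y powr (- 1/2) * (1 / (1 + y\<^sup>2)) \<le> y powr (- 1/2) * (z * (1 - 1/2 * z))"
        by (rule mult_left_mono) simp
      also have "\<dots> = y powr (- 1/2) * z - 1/2 * (y powr (- 1/2) * z * z)" by (simp add: algebra_simps)
      also have "y powr (- 1/2) * z = y powr (- 5/2)" using powr_add[of y "-1/2" "-2"] by (simp add: z_def)
      also have "y powr (- 5/2) * z = y powr (- 9/2)" using powr_add[of y "-5/2" "-2"] by (simp add: z_def)
      also have "y powr (- 5/2) - 1/2 * y powr (- 9/2) = g y" using False y by (simp add: g_def indicator_def)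
      finally show ?thesis by simp
    qed
  qed
  obtain J where J: "hi (\<lambda>y. y powr (- 1/2) / (1 + y\<^sup>2)) J"
    using hi_exists[OF g, of "\<lambda>y. y powr (- 1/2) / (1 + y\<^sup>2)"] le by auto
  have "J \<le> (1 / (- 1/2 + 1) + (- 1/2) * (1 / (3/2 + 1))) + (- 1 / (- 5/2 + 1) + (- 1/2) * (- 1 / (- 9/2 + 1)))"
    using hi_mono[OF J g le] .
  then show ?thesis using J by (intro exI[of _ J]) simp
qed

text \<open>The power \<open>y powr (- \<alpha>)\<close> is at most the interpolation
  \<open>(1 - 2 * \<alpha>) + 2 * \<alpha> * y powr (- 1/2)\<close>. Since 2 / pi * 488/210 is below
  148/100, the slope in \<alpha> is 2 * (148/100 - 1) = 96/100.\<close>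

lemma hi_powr_cauchy:
  assumes \<alpha>: "0 < \<alpha>" "\<alpha> < 1/2"
  shows "\<exists>J. hi (\<lambda>y. y powr (- \<alpha>) / (1 + y\<^sup>2)) J \<and> 2 / pi * J \<le> 1 + 96/100 * \<alpha>"
proof -
  obtain J2 where J2: "hi (\<lambda>y. y powr (- 1/2) / (1 + y\<^sup>2)) J2" "J2 \<le> 488/210" using hi_half by blast
  define g where "g = (\<lambda>y::real. (1 - 2 * \<alpha>) * (1 / (1 + y\<^sup>2)) + 2 * \<alpha> * (y powr (- 1/2) / (1 + y\<^sup>2)))"
  have g: "hi g ((1 - 2 * \<alpha>) * (pi / 2) + 2 * \<alpha> * J2)"
    unfolding g_def by (intro hi_add hi_cmult hi_cauchy J2)
  have le: "y powr (- \<alpha>) / (1 + y\<^sup>2) \<le> g y" if y: "0 < y" for y :: real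
  proof -
    have "1 powr (1 - 2 * \<alpha>) * (y powr (- 1/2)) powr (2 * \<alpha>) \<le> (1 - 2 * \<alpha>) * 1 + 2 * \<alpha> * (y powr (- 1/2))"
      using \<alpha> y by (intro Youngs_inequality_0) auto
    then have "y powr (- \<alpha>) \<le> (1 - 2 * \<alpha>) + 2 * \<alpha> * y powr (- 1/2)" by (simp add: powr_powr)
    then have "y powr (- \<alpha>) / (1 + y\<^sup>2) \<le> ((1 - 2 * \<alpha>) + 2 * \<alpha> * y powr (- 1/2)) / (1 + y\<^sup>2)"
      by (intro divide_right_mono) auto
    then show ?thesis by (simp add: g_def add_divide_distrib)
  qed
  obtain J where J: "hi (\<lambda>y. y powr (- \<alpha>) / (1 + y\<^sup>2)) J"
    using hi_exists[OF g, of "\<lambda>y. y powr (- \<alpha>) / (1 + y\<^sup>2)"] le by auto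
  have "J \<le> (1 - 2 * \<alpha>) * (pi / 2) + 2 * \<alpha> * J2" using hi_mono[OF J g le] .
  also have "\<dots> \<le> (1 - 2 * \<alpha>) * (pi / 2) + 2 * \<alpha> * (148/100 * (pi / 2))"
    using J2 pi_approx \<alpha> by (intro add_mono mult_left_mono) auto
  also have "\<dots> = (1 + 96/100 * \<alpha>) * (pi / 2)" by (simp add: algebra_simps)
  finally have "2 / pi * J \<le> 1 + 96/100 * \<alpha>" by (simp add: field_simps)
  then show ?thesis using J by blast
qed

text \<open>The weighted means of \<open>1 / \<alpha>\<close> and \<open>t / (1 - \<alpha>)\<close>
  give the sharp constant
  \<open>\<alpha> powr \<alpha> * (1 - \<alpha>) powr (1 - \<alpha>)\<close>, which is at most
  \<open>1 - \<alpha>\<close> because \<alpha> is below 1/2. This factor saves the share of the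
  probability budget that the leakage needs.\<close>

lemma frac_le_powr:
  fixes t :: real
  assumes \<alpha>: "0 < \<alpha>" "\<alpha> < 1/2" and t: "0 \<le> t"
  shows "t / (1 + t) \<le> (1 - \<alpha>) * t powr \<alpha>"
proof (cases "t = 0")
  case False
  then have t: "0 < t" using t by simp
  have "(1 / \<alpha>) powr \<alpha> * (t / (1 - \<alpha>)) powr (1 - \<alpha>) \<le> \<alpha> * (1 / \<alpha>) + (1 - \<alpha>) * (t / (1 - \<alpha>))"
    using \<alpha> t by (intro Youngs_inequality_0) auto
  also have "\<dots> = 1 + t" using \<alpha> by simp
  finally have 1: "(1 / \<alpha>) powr \<alpha> * (t / (1 - \<alpha>)) powr (1 - \<alpha>) \<le> 1 + t" .
  have "1 = (1 - \<alpha>) * (1 / (1 - \<alpha>)) powr \<alpha> * (1 / (1 - \<alpha>)) powr (1 - \<alpha>)"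
    using \<alpha> by (simp add: mult.assoc powr_add[symmetric])
  also have "\<dots> \<le> (1 - \<alpha>) * (1 / \<alpha>) powr \<alpha> * (1 / (1 - \<alpha>)) powr (1 - \<alpha>)"
    using \<alpha> by (intro mult_right_mono mult_left_mono powr_mono2) (auto simp: field_simps)
  finally have "t powr (1 - \<alpha>) * 1 \<le> t powr (1 - \<alpha>) * ((1 - \<alpha>) * (1 / \<alpha>) powr \<alpha> * (1 / (1 - \<alpha>)) powr (1 - \<alpha>))"
    by (rule mult_left_mono) simp
  also have "\<dots> = (1 - \<alpha>) * ((1 / \<alpha>) powr \<alpha> * (t / (1 - \<alpha>)) powr (1 - \<alpha>))"
    using \<alpha> t by (simp add: powr_divide powr_mult)
  also have "\<dots> \<le> (1 - \<alpha>) * (1 + t)" using 1 \<alpha> by (intro mult_left_mono) auto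
  finally have "t powr \<alpha> * t powr (1 - \<alpha>) \<le> t powr \<alpha> * ((1 - \<alpha>) * (1 + t))" by (intro mult_left_mono) auto
  then have "t \<le> t powr \<alpha> * ((1 - \<alpha>) * (1 + t))" using t by (simp add: powr_add[symmetric])
  then show ?thesis using t by (simp add: field_simps)
qed simp

text \<open>The numerical room for the constant 6. The quantity
  \<open>2 * sqrt 2 * 2 powr (- \<alpha>) * (1 + 96/100 * \<alpha>)\<close> is about 2.83 near 0 and
  2.96 near 1/2, so crude estimates of the power do not suffice.\<close>

lemma two_powr_lower:
  fixes \<alpha> :: real
  assumes \<alpha>: "0 < \<alpha>" "\<alpha> < 1/2"
  shows "2 * sqrt 2 / 3 * (1 + 96/100 * \<alpha>) < 2 powr \<alpha>"
proof -
  have s2: "sqrt 2 < 141422/100000" by (rule real_less_lsqrt) (simp_all add: power2_eq_square)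
  have s1: "1 < sqrt 2" by simp
  define L where "L = ln (2::real)"
  have L: "2/3 \<le> L" "L \<le> 25/36" using ln2_ge_two_thirds ln2_le_25_over_36 by (simp_all add: L_def)
  show ?thesis
  \<comment> \<open>For small \<alpha> the quadratic Taylor polynomial of exp is used with ln 2
    \<ge> 2/3. For larger \<alpha> it is the tangent of \<open>2 powr \<alpha>\<close> at 1/2, with
    ln 2 \<le> 25/36.\<close>
  proof (cases "\<alpha> \<le> 2555/10000")
    case True
    have "2 * sqrt 2 / 3 * (1 + 96/100 * \<alpha>) < 2 * (141422/100000) / 3 * (1 + 96/100 * \<alpha>)"
      using s2 \<alpha> by (intro mult_strict_right_mono divide_strict_right_mono) auto
    also have "\<dots> \<le> 1 + 2/3 * \<alpha> + (2/3 * \<alpha>)\<^sup>2 / 2"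
    proof -
      have "0 \<le> (\<alpha> - 255/1000)\<^sup>2" by simp
      then show ?thesis using \<alpha> True by (simp add: power2_eq_square algebra_simps)
    qed
    also have "\<dots> \<le> exp (2/3 * \<alpha>)" using \<alpha> by (intro exp_lower_Taylor_quadratic) auto
    also have "\<dots> \<le> exp (\<alpha> * L)" using L \<alpha> by simp
    also have "\<dots> = 2 powr \<alpha>" by (simp add: powr_def L_def)
    finally show ?thesis .
  next
    case False
    define \<beta> where "\<beta> = 1/2 - \<alpha>"
    have b: "0 < \<beta>" "\<beta> < 2445/10000" using False \<alpha> by (auto simp: \<beta>_def)
    \<comment> \<open>The number 0.2445 * (25/36 - 0.64) lies just below 1/75 = 1 - 2/3 * 1.48, the
      slack of the tangent estimate; this fixes the point of the case split.\<close>
    have "\<beta> * (L - 64/100) \<le> 2445/10000 * (25/36 - 64/100)" using b L by (intro mult_mono) auto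
    then have "2/3 * (148/100 - 96/100 * \<beta>) < 1 + - (\<beta> * L)" by (simp add: algebra_simps)
    also have "\<dots> \<le> exp (- (\<beta> * L))" by (rule exp_ge_add_one_self)
    finally have "sqrt 2 * (2/3 * (148/100 - 96/100 * \<beta>)) < sqrt 2 * exp (- (\<beta> * L))"
      by (rule mult_strict_left_mono) simp
    moreover have "sqrt 2 * exp (- (\<beta> * L)) = 2 powr \<alpha>"
    proof -
      have "2 powr \<alpha> = 2 powr (1/2) * 2 powr (- \<beta>)" by (simp add: powr_add[symmetric] \<beta>_def)
      moreover have "2 powr (1/2) = sqrt (2 :: real)" by (rule powr_half_sqrt) simp
      moreover have "2 powr (- \<beta>) = exp (- (\<beta> * L))" by (simp add: powr_def L_def)
      ultimately show ?thesis by simp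
    qed
    moreover have "2 * sqrt 2 / 3 * (1 + 96/100 * \<alpha>) = sqrt 2 * (2/3 * (148/100 - 96/100 * \<beta>))"
    proof -
      have "148/100 - 96/100 * \<beta> = 1 + 96/100 * \<alpha>" by (simp add: \<beta>_def field_simps)
      then show ?thesis by (simp only: mult_ac times_divide_eq_left times_divide_eq_right)
    qed
    ultimately show ?thesis by linarith
  qed
qed


section \<open>Trace inequalities for powers\<close>

text \<open>For hermitian \<open>A\<close>, the Schatten norm of order \<open>p\<close>, raised to
  the power \<open>p\<close>.\<close>

definition npow :: "real \<Rightarrow> 'n::finite op \<Rightarrow> real" where
  "npow p A = tr (hfun (\<lambda>t. \<bar>t\<bar> powr p) A)"

lemma npow_nonneg: "hermitian A \<Longrightarrow> 0 \<le> npow p A"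
  by (simp add: npow_def tr_hfun sum_nonneg)

lemma quad_mixture:
  "hermitian A \<Longrightarrow> col V k \<bullet> (A *v col V k) = (\<Sum>j\<in>UNIV. ov (eu A) V j k * ev A j)"
  using quad_ov[of V k "eu A" "ev A"] by (simp add: eu_ev mult.commute)

text \<open>Diagonal entries in any orthonormal basis are means of the eigenvalues with the doubly
  stochastic weights \<open>ov\<close>. Jensen applies to each entry, and summing the weights the
  other way returns the spectrum.\<close>

lemma peierls_convex:
  assumes A: "hermitian A" and V: "unitary V" and p: "1 < p"
  shows "(\<Sum>k\<in>UNIV. \<bar>col V k \<bullet> (A *v col V k)\<bar> powr p) \<le> npow p A"
proof -
  have U: "unitary (eu A)" by (rule eu_unitary[OF A])
  have "(\<Sum>k\<in>UNIV. \<bar>col V k \<bullet> (A *v col V k)\<bar> powr p)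
      \<le> (\<Sum>k\<in>UNIV. \<Sum>j\<in>UNIV. ov (eu A) V j k * \<bar>ev A j\<bar> powr p)"
    unfolding quad_mixture[OF A]
    by (intro sum_mono powr_sum_le_sum_powr p) (simp_all add: ov_sum_left[OF U V])
  also have "\<dots> = npow p A"
    by (subst sum.swap) (simp add: sum_distrib_right[symmetric] ov_sum_right[OF U V] npow_def tr_hfun A)
  finally show ?thesis .
qed

lemma peierls_concave:
  assumes A: "psd A" and V: "unitary V" and r: "0 < r" "r < 1"
  shows "tr (hfun (\<lambda>t. t powr r) A) \<le> (\<Sum>k\<in>UNIV. (col V k \<bullet> (A *v col V k)) powr r)"
proof -
  have hA: "hermitian A" using A by (rule psd_herm)
  have U: "unitary (eu A)" by (rule eu_unitary[OF hA])
  have "tr (hfun (\<lambda>t. t powr r) A) = (\<Sum>k\<in>UNIV. \<Sum>j\<in>UNIV. ov (eu A) V j k * ev A j powr r)"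
    by (subst sum.swap) (simp add: sum_distrib_right[symmetric] ov_sum_right[OF U V] tr_hfun hA)
  also have "\<dots> \<le> (\<Sum>k\<in>UNIV. (col V k \<bullet> (A *v col V k)) powr r)"
    unfolding quad_mixture[OF hA]
    by (intro sum_mono sum_powr_le_powr_sum r) (simp_all add: ov_sum_left[OF U V] ev_nonneg[OF A])
  finally show ?thesis .
qed

text \<open>The factor \<open>g\<close> covers two cases: \<open>g = 1\<close> yields
  \<open>t powr r\<close>, and \<open>g t = t\<close> yields \<open>t powr (1 + r)\<close>.\<close>

lemma hi_tr:
  assumes r: "0 < r" "r < 1"
  shows "\<exists>c>0. \<forall>A :: 'n::finite op. psd A \<longrightarrow>
    hi (\<lambda>l. l powr (r - 1) * tr (hfun (\<lambda>t. g t * (t / (l + t))) A)) (c * tr (hfun (\<lambda>t. g t * t powr r) A))"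
proof -
  obtain c where c: "0 < c" "\<And>t. 0 \<le> t \<Longrightarrow> hi (\<lambda>x. x powr (r - 1) * (t / (x + t))) (c * t powr r)"
    using hi_resolvent[OF r] by blast
  have "hi (\<lambda>l. l powr (r - 1) * tr (hfun (\<lambda>t. g t * (t / (l + t))) A)) (c * tr (hfun (\<lambda>t. g t * t powr r) A))"
    if A: "psd A" for A :: "'n op"
  proof -
    have "hi (\<lambda>l. \<Sum>k\<in>UNIV. g (ev A k) * (l powr (r - 1) * (ev A k / (l + ev A k))))
        (\<Sum>k\<in>UNIV. g (ev A k) * (c * ev A k powr r))"
      by (intro hi_sum hi_cmult c ev_nonneg A)
    then show ?thesis by (simp add: tr_hfun psd_herm[OF A] sum_distrib_left mult_ac)
  qed
  then show ?thesis using c(1) by blast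
qed

text \<open>At every resolvent level both \<open>A\<close> and \<open>B\<close> meet the smaller
  resolvent of \<open>A + B\<close> on the left; integration turns this into subadditivity of the
  power.\<close>

lemma tr_powr_add:
  assumes A: "psd A" and B: "psd B" and r: "0 < r" "r < 1"
  shows "tr (hfun (\<lambda>t. t powr r) (A + B)) \<le> tr (hfun (\<lambda>t. t powr r) A) + tr (hfun (\<lambda>t. t powr r) B)"
proof -
  obtain c where c: "0 < c" "\<And>C :: 'a op. psd C \<Longrightarrow>
      hi (\<lambda>l. l powr (r - 1) * tr (hfun (\<lambda>t. 1 * (t / (l + t))) C)) (c * tr (hfun (\<lambda>t. 1 * t powr r) C))"
    using hi_tr[OF r, of "\<lambda>_. 1"] by blast
  have AB: "psd (A + B)" using A B by (rule psd_add)
  have "c * tr (hfun (\<lambda>t. 1 * t powr r) (A + B))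
    \<le> c * tr (hfun (\<lambda>t. 1 * t powr r) A) + c * tr (hfun (\<lambda>t. 1 * t powr r) B)"
  proof (rule hi_mono[OF c(2)[OF AB] hi_add[OF c(2)[OF A] c(2)[OF B]]])
    fix l :: real assume l: "0 < l"
    have "psd (rs l A - rs l (A + B))" "psd (rs l B - rs l (A + B))"
      using rs_antitone[OF A AB _ l] rs_antitone[OF B AB _ l] A B by simp_all
    then have "tr (A ** rs l (A + B)) + tr (B ** rs l (A + B)) \<le> tr (A ** rs l A) + tr (B ** rs l B)"
      by (intro add_mono tr_mult_mono A B)
    then have "tr ((A + B) ** rs l (A + B)) \<le> tr (A ** rs l A) + tr (B ** rs l B)"
      by (simp add: mx trs)
    then have "tr (hfun (\<lambda>t. t / (l + t)) (A + B)) \<le> tr (hfun (\<lambda>t. t / (l + t)) A) + tr (hfun (\<lambda>t. t / (l + t)) B)"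
      by (simp add: rs_mult_hfun A B AB)
    from mult_left_mono[OF this, of "l powr (r - 1)"]
    show "l powr (r - 1) * tr (hfun (\<lambda>t. 1 * (t / (l + t))) (A + B))
      \<le> l powr (r - 1) * tr (hfun (\<lambda>t. 1 * (t / (l + t))) A) + l powr (r - 1) * tr (hfun (\<lambda>t. 1 * (t / (l + t))) B)"
      by (simp add: distrib_left)
  qed
  then have "c * tr (hfun (\<lambda>t. t powr r) (A + B))
      \<le> c * (tr (hfun (\<lambda>t. t powr r) A) + tr (hfun (\<lambda>t. t powr r) B))"
    by (simp add: distrib_left)
  then show ?thesis using c(1) by simp
qed

lemma npow_square:
  assumes A: "hermitian A"
  shows "npow p A = tr (hfun (\<lambda>t. t powr (p / 2)) (A ** A))"
proof -
  have "(t\<^sup>2) powr (p / 2) = \<bar>t\<bar> powr p" for t :: real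
  proof (cases "t = 0")
    case False
    then have "(\<bar>t\<bar> powr 2) powr (p / 2) = \<bar>t\<bar> powr p" by (simp only: powr_powr) simp
    then show ?thesis using False by simp
  qed simp
  then show ?thesis unfolding npow_def hfun_square[OF A] hfun_hfun[OF A] by simp
qed

text \<open>\<open>(X + D)\<^sup>2 + (X - D)\<^sup>2 = 2 X\<^sup>2 + 2 D\<^sup>2\<close>, and \<open>A \<mapsto> tr (A powr (p / 2))\<close> is concave and subadditive.\<close>

lemma clarkson:
  assumes X: "hermitian X" and D: "hermitian D" and p: "1 < p" "p < 2"
  shows "npow p (X + D) + npow p (X - D) \<le> 2 * npow p X + 2 * npow p D"
proof -
  define r where "r = p / 2"
  have r: "0 < r" "r < 1" using p by (auto simp: r_def)
  define A B C where "A = (X + D) ** (X + D)" and "B = (X - D) ** (X - D)" and "C = X ** X + D ** D"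
  have pA: "psd A" "psd B" unfolding A_def B_def by (intro psd_herm_square herm_add herm_diff X D)+
  have XX: "psd (X ** X)" "psd (D ** D)" by (intro psd_herm_square X D)+
  have pC: "psd C" unfolding C_def by (intro psd_add XX)
  have hC: "hermitian C" using pC by (rule psd_herm)
  have C: "2 *\<^sub>R C = A + B" by (simp add: A_def B_def C_def mx scaleR_2)
  define q where "q M k = col (eu C) k \<bullet> (M *v col (eu C) k)" for M k
  have qC: "q C k = 1/2 * (q A k + q B k)" for k
  proof -
    have "q (2 *\<^sub>R C) k = q A k + q B k"
      unfolding C by (simp add: q_def matrix_vector_mult_add_rdistrib inner_add_right)
    then show ?thesis by (simp add: q_def scaleR_mult_vec)
  qed
  have q0: "0 \<le> q A k" "0 \<le> q B k" for k using pA by (auto simp: q_def psd_def)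
  have half: "a powr r + b powr r \<le> 2 * (1/2 * (a + b)) powr r" if "0 \<le> a" "0 \<le> b" for a b :: real
  proof -
    have "(\<Sum>x\<in>{True, False}. 1/2 * (if x then a else b) powr r) \<le> (\<Sum>x\<in>{True, False}. 1/2 * (if x then a else b)) powr r"
      by (rule sum_powr_le_powr_sum) (use that r in auto)
    then show ?thesis by (simp add: add_divide_distrib)
  qed
  have "npow p (X + D) + npow p (X - D) = tr (hfun (\<lambda>t. t powr r) A) + tr (hfun (\<lambda>t. t powr r) B)"
    by (simp add: npow_square herm_add herm_diff X D A_def B_def r_def)
  \<comment> \<open>Everything is read off in an eigenbasis of \<open>C\<close>. Passing to diagonal
    entries increases the traces for \<open>A\<close> and \<open>B\<close> and is an equality for
    \<open>C\<close>, and scalar concavity connects the two.\<close>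
  also have "\<dots> \<le> (\<Sum>k\<in>UNIV. q A k powr r) + (\<Sum>k\<in>UNIV. q B k powr r)"
    unfolding q_def by (intro add_mono peierls_concave pA eu_unitary hC r)
  also have "\<dots> = (\<Sum>k\<in>UNIV. q A k powr r + q B k powr r)" by (simp add: sum.distrib)
  also have "\<dots> \<le> (\<Sum>k\<in>UNIV. 2 * q C k powr r)"
    unfolding qC by (intro sum_mono half q0)
  also have "\<dots> = 2 * tr (hfun (\<lambda>t. t powr r) C)"
    by (simp add: q_def quad_ev[OF hC] tr_hfun[OF hC] sum_distrib_left)
  also have "\<dots> \<le> 2 * (tr (hfun (\<lambda>t. t powr r) (X ** X)) + tr (hfun (\<lambda>t. t powr r) (D ** D)))"
    unfolding C_def by (intro mult_left_mono tr_powr_add XX r) simp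
  also have "\<dots> = 2 * npow p X + 2 * npow p D" by (simp add: npow_square X D r_def)
  finally show ?thesis .
qed

lemma npow_eu:
  assumes A: "hermitian A"
  shows "npow p A = (\<Sum>k\<in>UNIV. \<bar>col (eu A) k \<bullet> (A *v col (eu A) k)\<bar> powr p)"
  by (simp add: npow_def tr_hfun A quad_ev)

text \<open>In an eigenbasis of \<open>A - B\<close> the diagonal entries of \<open>A\<close> and
  \<open>B\<close> are nonnegative, so their difference is at most the larger one in modulus. The
  triangle inequality would cost a further factor.\<close>

lemma npow_diff:
  assumes A: "psd A" and B: "psd B" and p: "1 < p"
  shows "npow p (A - B) \<le> npow p A + npow p B"
proof -
  have h: "hermitian (A - B)" using A B by (simp add: herm_diff psd_herm)
  define q where "q M k = col (eu (A - B)) k \<bullet> (M *v col (eu (A - B)) k)" for M k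
  have "\<bar>q (A - B) k\<bar> powr p \<le> \<bar>q A k\<bar> powr p + \<bar>q B k\<bar> powr p" for k
  proof -
    have 0: "0 \<le> q A k" "0 \<le> q B k" using A B by (auto simp: q_def psd_def)
    have "q (A - B) k = q A k - q B k"
      by (simp add: q_def matrix_vector_mult_diff_rdistrib inner_diff_right)
    then have "\<bar>q (A - B) k\<bar> \<le> max \<bar>q A k\<bar> \<bar>q B k\<bar>" using 0 by auto
    then have "\<bar>q (A - B) k\<bar> powr p \<le> (max \<bar>q A k\<bar> \<bar>q B k\<bar>) powr p" using p by (intro powr_mono2) auto
    also have "\<dots> \<le> \<bar>q A k\<bar> powr p + \<bar>q B k\<bar> powr p" by (auto simp: max_def)
    finally show ?thesis .
  qed
  then have "npow p (A - B) \<le> (\<Sum>k\<in>UNIV. \<bar>q A k\<bar> powr p + \<bar>q B k\<bar> powr p)"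
    unfolding npow_eu[OF h] q_def by (intro sum_mono) 
  also have "\<dots> \<le> npow p A + npow p B"
    unfolding sum.distrib q_def by (intro add_mono peierls_convex eu_unitary h psd_herm A B p)
  finally show ?thesis .
qed

lemma npow_jensen:
  fixes X :: "'i \<Rightarrow> 'n::finite op"
  assumes S: "finite S" and w: "\<And>i. i \<in> S \<Longrightarrow> 0 \<le> w i" "sum w S = 1"
    and X: "\<And>i. i \<in> S \<Longrightarrow> hermitian (X i)" and p: "1 < p"
  shows "npow p (\<Sum>i\<in>S. w i *\<^sub>R X i) \<le> (\<Sum>i\<in>S. w i * npow p (X i))"
proof -
  define A where "A = (\<Sum>i\<in>S. w i *\<^sub>R X i)"
  have A: "hermitian A" unfolding A_def by (intro herm_sum herm_scaleR X)
  define q where "q M k = col (eu A) k \<bullet> (M *v col (eu A) k)" for M k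
  have qA: "q A k = (\<Sum>i\<in>S. w i * q (X i) k)" for k
  proof -
    have "q (\<Sum>i\<in>T. w i *\<^sub>R X i) k = (\<Sum>i\<in>T. w i * q (X i) k)" if "finite T" for T
      using that by (induction T rule: finite_induct)
        (simp_all add: q_def matrix_vector_mult_add_rdistrib inner_add_right scaleR_mult_vec)
    then show ?thesis using S by (simp add: A_def)
  qed
  have "npow p A = (\<Sum>k\<in>UNIV. \<bar>q A k\<bar> powr p)" by (simp add: npow_eu[OF A] q_def)
  also have "\<dots> \<le> (\<Sum>k\<in>UNIV. \<Sum>i\<in>S. w i * \<bar>q (X i) k\<bar> powr p)"
    unfolding qA by (intro sum_mono powr_sum_le_sum_powr S w p)
  also have "\<dots> = (\<Sum>i\<in>S. w i * (\<Sum>k\<in>UNIV. \<bar>q (X i) k\<bar> powr p))"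
    by (subst sum.swap) (simp add: sum_distrib_left)
  also have "\<dots> \<le> (\<Sum>i\<in>S. w i * npow p (X i))"
    unfolding q_def by (intro sum_mono mult_left_mono peierls_convex X eu_unitary A p w)
  finally show ?thesis unfolding A_def .
qed

text \<open>Symmetrisation: the centred variable is replaced by \<open>Z - Z'\<close> with an independent copy \<open>Z'\<close>.\<close>

lemma npow_step:
  fixes Z :: "'i \<Rightarrow> 'n::finite op"
  assumes S: "finite S" and w: "\<And>i. i \<in> S \<Longrightarrow> 0 \<le> w i" "sum w S = 1"
    and X: "hermitian X" and Z: "\<And>i. i \<in> S \<Longrightarrow> psd (Z i)" and p: "1 < p" "p < 2"
  shows "(\<Sum>i\<in>S. w i * npow p (X + Z i)) \<le> npow p (X + (\<Sum>i\<in>S. w i *\<^sub>R Z i)) + 2 * (\<Sum>i\<in>S. w i * npow p (Z i))"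
proof -
  define \<mu> where "\<mu> = (\<Sum>i\<in>S. w i *\<^sub>R Z i)"
  define Y where "Y = X + \<mu>"
  have hZ: "hermitian (Z i)" if "i \<in> S" for i using Z[OF that] by (rule psd_herm)
  have hY: "hermitian Y" unfolding Y_def \<mu>_def by (intro herm_add X herm_sum herm_scaleR hZ)
  \<comment> \<open>Jensen's inequality with an independent copy \<open>Z j\<close>, whose mean
    \<open>\<mu>\<close> is compensated in \<open>Y\<close>.\<close>
  have 1: "npow p (X + Z i) \<le> (\<Sum>j\<in>S. w j * npow p (Y + (Z i - Z j)))" if i: "i \<in> S" for i
  proof -
    have "(\<Sum>j\<in>S. w j *\<^sub>R (Y + (Z i - Z j))) = (\<Sum>j\<in>S. w j *\<^sub>R (Y + Z i)) - \<mu>"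
      unfolding \<mu>_def sum_subtractf[symmetric] by (intro sum.cong refl) (simp add: algebra_simps)
    also have "\<dots> = X + Z i" by (simp add: scaleR_left.sum[symmetric] w(2) Y_def)
    finally show ?thesis
      using npow_jensen[of S w "\<lambda>j. Y + (Z i - Z j)" p] S w p hZ hY i
      by (simp add: herm_add herm_diff)
  qed
  have "(\<Sum>i\<in>S. w i * npow p (X + Z i)) \<le> (\<Sum>i\<in>S. w i * (\<Sum>j\<in>S. w j * npow p (Y + (Z i - Z j))))"
    by (intro sum_mono mult_left_mono 1 w)
  also have "\<dots> = (\<Sum>i\<in>S. \<Sum>j\<in>S. w i * w j * npow p (Y + (Z i - Z j)))"
    by (simp add: sum_distrib_left mult_ac)
  finally have a: "(\<Sum>i\<in>S. w i * npow p (X + Z i)) \<le> (\<Sum>i\<in>S. \<Sum>j\<in>S. w i * w j * npow p (Y + (Z i - Z j)))" .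
  \<comment> \<open>Exchanging \<open>i\<close> and \<open>j\<close> reverses the sign of
    \<open>Z i - Z j\<close>, so the sum is the mean over both signs, which \<open>clarkson\<close>
    bounds.\<close>
  have b: "(\<Sum>i\<in>S. \<Sum>j\<in>S. w i * w j * npow p (Y + (Z i - Z j))) = (\<Sum>i\<in>S. \<Sum>j\<in>S. w i * w j * npow p (Y - (Z i - Z j)))"
    by (subst sum.swap) (intro sum.cong refl, simp add: algebra_simps)
  have c: "w i * w j * npow p (Y + (Z i - Z j)) + w i * w j * npow p (Y - (Z i - Z j))
      \<le> w i * w j * (2 * npow p Y) + w i * w j * (2 * npow p (Z i)) + w i * w j * (2 * npow p (Z j))"
    if ij: "i \<in> S" "j \<in> S" for i j
  proof -
    have "npow p (Y + (Z i - Z j)) + npow p (Y - (Z i - Z j)) \<le> 2 * npow p Y + 2 * npow p (Z i - Z j)"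
      by (intro clarkson hY herm_diff hZ ij p)
    moreover have "npow p (Z i - Z j) \<le> npow p (Z i) + npow p (Z j)"
      by (intro npow_diff Z ij p)
    ultimately have "npow p (Y + (Z i - Z j)) + npow p (Y - (Z i - Z j)) \<le> 2 * npow p Y + 2 * npow p (Z i) + 2 * npow p (Z j)"
      by linarith
    from mult_left_mono[OF this, of "w i * w j"] w ij show ?thesis by (simp add: distrib_left mult.assoc)
  qed
  have "2 * (\<Sum>i\<in>S. \<Sum>j\<in>S. w i * w j * npow p (Y + (Z i - Z j)))
     = (\<Sum>i\<in>S. \<Sum>j\<in>S. w i * w j * npow p (Y + (Z i - Z j)) + w i * w j * npow p (Y - (Z i - Z j)))"
    using b by (simp add: sum.distrib)
  also have "\<dots> \<le> (\<Sum>i\<in>S. \<Sum>j\<in>S. w i * w j * (2 * npow p Y) + w i * w j * (2 * npow p (Z i)) + w i * w j * (2 * npow p (Z j)))"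
    by (intro sum_mono c)
  also have "\<dots> = 2 * npow p Y + 2 * (\<Sum>i\<in>S. w i * npow p (Z i)) + 2 * (\<Sum>i\<in>S. w i * npow p (Z i))"
  proof -
    have ww: "(\<Sum>i\<in>S. \<Sum>j\<in>S. w i * w j * f j) = (\<Sum>j\<in>S. w j * f j)" for f :: "'i \<Rightarrow> real"
    proof -
      have "(\<Sum>i\<in>S. \<Sum>j\<in>S. w i * w j * f j) = (\<Sum>i\<in>S. w i * (\<Sum>j\<in>S. w j * f j))"
        by (simp add: sum_distrib_left mult_ac)
      then show ?thesis by (simp add: sum_distrib_right[symmetric] w(2))
    qed
    have s3: "(\<Sum>i\<in>S. \<Sum>j\<in>S. w i * w j * (2 * npow p (Z j))) = 2 * (\<Sum>i\<in>S. w i * npow p (Z i))"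
      unfolding ww by (simp add: sum_distrib_left mult_ac)
    have "(\<Sum>i\<in>S. \<Sum>j\<in>S. w i * w j * (2 * npow p (Z i))) = (\<Sum>i\<in>S. \<Sum>j\<in>S. w i * w j * (2 * npow p (Z j)))"
      by (subst sum.swap) (simp add: mult.commute)
    note s2 = this[unfolded s3]
    have s1: "(\<Sum>i\<in>S. \<Sum>j\<in>S. w i * w j * (2 * npow p Y)) = 2 * npow p Y"
      unfolding ww by (simp add: sum_distrib_right[symmetric] w(2))
    show ?thesis unfolding sum.distrib s1 s2 s3 ..
  qed
  finally show ?thesis using a by (simp add: Y_def \<mu>_def)
qed

text \<open>For positive \<open>X\<close>, integrating \<open>phi_step\<close> avoids the factor 2
  of \<open>npow_step\<close>. Otherwise the codebook recursion would lose such a factor with every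
  message.\<close>

lemma npow_step_psd:
  fixes Z :: "'i \<Rightarrow> 'n::finite op"
  assumes S: "finite S" and w: "\<And>i. i \<in> S \<Longrightarrow> 0 \<le> w i" "sum w S = 1"
    and X: "psd X" and Z: "\<And>i. i \<in> S \<Longrightarrow> psd (Z i)" and p: "1 < p" "p < 2"
  shows "(\<Sum>i\<in>S. w i * npow p (X + Z i)) \<le> npow p (X + (\<Sum>i\<in>S. w i *\<^sub>R Z i)) + (\<Sum>i\<in>S. w i * npow p (Z i))"
proof -
  define r where "r = p - 1"
  have r: "0 < r" "r < 1" using p by (auto simp: r_def)
  obtain c where c: "0 < c" "\<And>A :: 'n op. psd A \<Longrightarrow>
      hi (\<lambda>l. l powr (r - 1) * tr (hfun (\<lambda>t. t * (t / (l + t))) A)) (c * tr (hfun (\<lambda>t. t * t powr r) A))"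
    using hi_tr[OF r, of "\<lambda>t. t"] by blast
  have hi: "hi (\<lambda>l. l powr (r - 1) * phi l A) (c * npow p A)" if A: "psd A" for A :: "'n op"
  proof -
    have "hfun (\<lambda>t. t * t powr r) A = hfun (\<lambda>t. \<bar>t\<bar> powr p) A"
    proof (rule hfun_cong_psd[OF A])
      fix t :: real assume t: "0 \<le> t"
      then have "t * t powr r = t powr (1 + r)" by (cases "t = 0") (simp_all add: powr_add)
      then show "t * t powr r = \<bar>t\<bar> powr p" using t by (simp add: r_def)
    qed
    then show ?thesis using c(2)[OF A] by (simp add: phi_def npow_def power2_eq_square)
  qed
  have pm: "psd (X + (\<Sum>i\<in>S. w i *\<^sub>R Z i))" by (intro psd_add X psd_sum psd_scaleR Z w)
  have "(\<Sum>i\<in>S. w i * (c * npow p (X + Z i))) \<le> c * npow p (X + (\<Sum>i\<in>S. w i *\<^sub>R Z i)) + (\<Sum>i\<in>S. w i * (c * npow p (Z i)))"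
  proof (rule hi_mono)
    show "hi (\<lambda>l. \<Sum>i\<in>S. w i * (l powr (r - 1) * phi l (X + Z i))) (\<Sum>i\<in>S. w i * (c * npow p (X + Z i)))"
      by (intro hi_sum hi_cmult hi psd_add X Z)
    show "hi (\<lambda>l. l powr (r - 1) * phi l (X + (\<Sum>i\<in>S. w i *\<^sub>R Z i)) + (\<Sum>i\<in>S. w i * (l powr (r - 1) * phi l (Z i))))
      (c * npow p (X + (\<Sum>i\<in>S. w i *\<^sub>R Z i)) + (\<Sum>i\<in>S. w i * (c * npow p (Z i))))"
      by (intro hi_add hi_sum hi_cmult hi pm Z)
    fix l :: real assume l: "0 < l"
    from mult_left_mono[OF phi_step[OF S w X Z l], of "\<lambda>i. i" "l powr (r - 1)"]
    show "(\<Sum>i\<in>S. w i * (l powr (r - 1) * phi l (X + Z i)))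
      \<le> l powr (r - 1) * phi l (X + (\<Sum>i\<in>S. w i *\<^sub>R Z i)) + (\<Sum>i\<in>S. w i * (l powr (r - 1) * phi l (Z i)))"
      by (simp add: sum_distrib_left distrib_left mult_ac)
  qed
  then have "c * (\<Sum>i\<in>S. w i * npow p (X + Z i))
    \<le> c * (npow p (X + (\<Sum>i\<in>S. w i *\<^sub>R Z i)) + (\<Sum>i\<in>S. w i * npow p (Z i)))"
    by (simp add: sum_distrib_left distrib_left mult_ac)
  then show ?thesis using c(1) by simp
qed

section \<open>Hoelder's inequality against powers of a state, and the trace norm\<close>

lemma tr_mult_conjd:
  assumes V: "unitary V"
  shows "tr (M ** conjd V e) = (\<Sum>l\<in>UNIV. e l * (col V l \<bullet> (M *v col V l)))"
proof -
  have "M *v (c *\<^sub>R v) = c *\<^sub>R (M *v v)" for c v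
    by (simp add: matrix_vector_mult_def vec_eq_iff scaleR_sum_right)
  then show ?thesis
    by (simp add: tr_quad[OF V] matrix_vector_mul_assoc[symmetric] conjd_col[OF V])
qed

text \<open>Hoelder in an eigenbasis of \<open>Y\<close>. The diagonal entries of
  \<open>S ** J ** S\<close> are dominated by those of \<open>S ** S\<close>, the power
  \<open>1 / q\<close> of the state for the conjugate exponent
  \<open>q = (1 + \<alpha>) / \<alpha>\<close>; the \<open>q\<close>-th powers of the latter sum to
  at most the trace 1. Used with a sign operator and with the identity as \<open>J\<close>.\<close>

lemma tr_sandwich_le:
  fixes \<sigma> :: "'n::finite op"
  assumes \<sigma>: "psd \<sigma>" "tr \<sigma> = 1" and Y: "hermitian Y" and J: "psd (mat 1 - J)" "psd (mat 1 + J)"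
    and \<alpha>: "0 < \<alpha>"
  defines "S \<equiv> hfun (\<lambda>t. t powr (\<alpha> / (2 * (1 + \<alpha>)))) \<sigma>"
  shows "tr (J ** (S ** Y ** S)) \<le> npow (1 + \<alpha>) Y powr (1 / (1 + \<alpha>))"
proof -
  define U where "U = eu Y"
  have U: "unitary U" unfolding U_def by (rule eu_unitary[OF Y])
  have S: "hermitian S" unfolding S_def by (intro hfun_herm psd_herm \<sigma>)
  define s where "s k = col U k \<bullet> ((S ** S) *v col U k)" for k
  have pSS: "psd (S ** S)" by (rule psd_herm_square[OF S])
  have s0: "0 \<le> s k" for k using pSS by (simp add: s_def psd_def)
  have SJ: "\<bar>col U k \<bullet> ((S ** J ** S) *v col U k)\<bar> \<le> s k" for k
  proof -
    have "psd (S ** S - S ** J ** S)" "psd (S ** S + S ** J ** S)"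
      using psd_sandwich[OF J(1) S] psd_sandwich[OF J(2) S] by (simp_all add: mx)
    then have "0 \<le> col U k \<bullet> ((S ** S - S ** J ** S) *v col U k)" "0 \<le> col U k \<bullet> ((S ** S + S ** J ** S) *v col U k)"
      by (simp_all add: psd_def)
    then show ?thesis
      by (simp add: s_def matrix_vector_mult_diff_rdistrib inner_diff_right matrix_vector_mult_add_rdistrib inner_add_right)
  qed
  define q where "q = (1 + \<alpha>) / \<alpha>"
  have q: "1 < q" "1 / (1 + \<alpha>) + 1 / q = 1" using \<alpha> by (simp_all add: q_def field_simps)
  have "(\<Sum>k\<in>UNIV. s k powr q) \<le> 1"
  proof -
    have "(\<Sum>k\<in>UNIV. s k powr q) = (\<Sum>k\<in>UNIV. \<bar>s k\<bar> powr q)" using s0 by simp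
    also have "\<dots> \<le> npow q (S ** S)"
      unfolding s_def by (rule peierls_convex[OF psd_herm[OF pSS] U q(1)])
    also have "S ** S = hfun (\<lambda>t. t powr (\<alpha> / (2 * (1 + \<alpha>))) * t powr (\<alpha> / (2 * (1 + \<alpha>)))) \<sigma>"
      unfolding S_def by (rule hfun_mult[OF psd_herm[OF \<sigma>(1)]])
    also have "npow q \<dots> = tr (hfun (\<lambda>t. t) \<sigma>)"
      unfolding npow_def hfun_hfun[OF psd_herm[OF \<sigma>(1)]]
    proof (intro arg_cong[of _ _ tr] hfun_cong_psd[OF \<sigma>(1)])
      fix t :: real assume t: "0 \<le> t"
      have e: "\<alpha> / (2 * (1 + \<alpha>)) + \<alpha> / (2 * (1 + \<alpha>)) = 1 / q"
      proof -
        have t: "\<alpha> / (2 * (1 + \<alpha>)) = 1/2 * (\<alpha> / (1 + \<alpha>))" by (simp only: times_divide_times_eq mult_1)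
        have hh: "1/2 * y + 1/2 * y = y" for y :: real by simp
        have "1 / q = \<alpha> / (1 + \<alpha>)" by (simp add: q_def)
        then show ?thesis by (simp only: t hh)
      qed
      show "\<bar>t powr (\<alpha> / (2 * (1 + \<alpha>))) * t powr (\<alpha> / (2 * (1 + \<alpha>)))\<bar> powr q = t"
        unfolding powr_add[symmetric] e using t q by (simp add: powr_powr)
    qed
    also have "\<dots> = 1" by (simp add: hfun_id psd_herm \<sigma>)
    finally show ?thesis .
  qed
  then have h: "(\<Sum>k\<in>UNIV. \<bar>ev Y k\<bar> * s k) \<le> (\<Sum>k\<in>UNIV. \<bar>ev Y k\<bar> powr (1 + \<alpha>)) powr (1 / (1 + \<alpha>))"
    using \<alpha> q s0 by (intro holder_normalised[where q = q]) auto
  have "tr (J ** (S ** Y ** S)) = tr ((S ** J ** S) ** conjd U (ev Y))"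
    using tr_comm[of "J ** S ** Y" S] by (simp add: U_def eu_ev[OF Y] matrix_mul_assoc)
  also have "\<dots> = (\<Sum>k\<in>UNIV. ev Y k * (col U k \<bullet> ((S ** J ** S) *v col U k)))"
    by (rule tr_mult_conjd[OF U])
  also have "\<dots> \<le> (\<Sum>k\<in>UNIV. \<bar>ev Y k\<bar> * s k)"
  proof (rule sum_mono)
    fix k
    have "ev Y k * (col U k \<bullet> ((S ** J ** S) *v col U k)) \<le> \<bar>ev Y k\<bar> * \<bar>col U k \<bullet> ((S ** J ** S) *v col U k)\<bar>"
      by (metis abs_ge_self abs_mult)
    also have "\<dots> \<le> \<bar>ev Y k\<bar> * s k" by (intro mult_left_mono SJ) simp
    finally show "ev Y k * (col U k \<bullet> ((S ** J ** S) *v col U k)) \<le> \<bar>ev Y k\<bar> * s k" .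
  qed
  also note h
  also have "(\<Sum>k\<in>UNIV. \<bar>ev Y k\<bar> powr (1 + \<alpha>)) = npow (1 + \<alpha>) Y" by (simp add: npow_def tr_hfun Y)
  finally show ?thesis .
qed

lemma trace_norm_hfun:
  assumes A: "hermitian A"
  shows "trace_norm A = tr (hfun sgn A ** A)"
proof -
  have "dagger A ** A = hfun (\<lambda>t. t\<^sup>2) A" using A hfun_square[OF A] by (simp add: hermitian_def)
  then have "trace_norm A = tr (hfun (\<lambda>t. (t\<^sup>2) powr (1/2)) A)"
    by (simp add: trace_norm_def tr_def op_powr_hfun hfun_hfun[OF A])
  also have "\<dots> = tr (hfun (\<lambda>t. sgn t * t) A)"
    by (intro arg_cong[of _ _ tr] hfun_cong[OF A]) (simp add: powr_half_sqrt abs_sgn mult.commute)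
  also have "\<dots> = tr (hfun sgn A ** A)"
    using hfun_mult[OF A, of sgn "\<lambda>t. t"] by (simp add: hfun_id[OF A])
  finally show ?thesis .
qed

lemma sgn_contract:
  assumes A: "hermitian A"
  shows "psd (mat 1 - hfun sgn A)" "psd (mat 1 + hfun sgn A)"
proof -
  have o: "mat 1 = hfun (\<lambda>_. 1) A" using A by (simp add: hfun_const)
  show "psd (mat 1 - hfun sgn A)" "psd (mat 1 + hfun sgn A)"
    unfolding o hfun_diff[OF A] hfun_add[OF A] by (rule psd_hfun[OF A], simp add: sgn_if)+
qed

section \<open>The Araki-Lieb-Thirring inequality\<close>

lemma mult_entry: "((A :: 'n::finite op) ** B) $ i $ j = (\<Sum>k\<in>UNIV. A $ i $ k * B $ k $ j)"
  by (simp add: matrix_matrix_mult_def)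

lemma tr_entries:
  fixes P Q :: "'n::finite op"
  shows "tr (dagger P ** diagm d ** Q) = (\<Sum>i\<in>UNIV. \<Sum>j\<in>UNIV. d i * Re (cnj (P $ i $ j) * Q $ i $ j))"
    and "tr (P ** diagm e ** dagger Q) = (\<Sum>i\<in>UNIV. \<Sum>j\<in>UNIV. e j * Re (P $ i $ j * cnj (Q $ i $ j)))"
proof -
  have "tr (dagger P ** (diagm d ** Q)) = (\<Sum>j\<in>UNIV. \<Sum>i\<in>UNIV. d i * Re (cnj (P $ i $ j) * Q $ i $ j))"
    unfolding tr_def trace_def Re_sum mult_entry[of "dagger P" "diagm d ** Q"]
    by (intro sum.cong refl) (simp add: diagm_left dagger_def algebra_simps)
  then show "tr (dagger P ** diagm d ** Q) = (\<Sum>i\<in>UNIV. \<Sum>j\<in>UNIV. d i * Re (cnj (P $ i $ j) * Q $ i $ j))"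
    by (subst sum.swap) (simp add: matrix_mul_assoc)
  show "tr (P ** diagm e ** dagger Q) = (\<Sum>i\<in>UNIV. \<Sum>j\<in>UNIV. e j * Re (P $ i $ j * cnj (Q $ i $ j)))"
    unfolding tr_def trace_def Re_sum mult_entry[of "P ** diagm e" "dagger Q"]
    by (intro sum.cong refl) (simp add: diagm_right dagger_def algebra_simps)
qed

text \<open>The left-hand side is a concave quadratic in \<open>w\<close>, maximal at
  \<open>w = a m / (a + e)\<close> when \<open>a + e\<close> is positive.\<close>

lemma complex_square_bound:
  fixes m w :: complex and a e :: real
  assumes a: "0 \<le> a" and e: "0 \<le> e"
  shows "2 * (a * Re (cnj m * w)) - (a + e) * (cmod w)\<^sup>2 \<le> (cmod m)\<^sup>2 * (a\<^sup>2 / (a + e))"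
proof (cases "a + e = 0")
  case True
  then have "a = 0" "e = 0" using a e by auto
  then show ?thesis by simp
next
  case False
  define s where "s = a + e"
  have s: "0 < s" using False a e by (simp add: s_def)
  have "Re (cnj m * w) \<le> cmod m * cmod w"
    using complex_Re_le_cmod[of "cnj m * w"] by (simp add: norm_mult)
  then have "2 * (a * Re (cnj m * w)) - s * (cmod w)\<^sup>2 \<le> 2 * (a * (cmod m * cmod w)) - s * (cmod w)\<^sup>2"
    using a by (simp add: mult_left_mono)
  also have "\<dots> \<le> (cmod m)\<^sup>2 * (a\<^sup>2 / s)"
  proof -
    have "0 \<le> (a * cmod m - s * cmod w)\<^sup>2" by simp
    then have "s * (2 * (a * (cmod m * cmod w)) - s * (cmod w)\<^sup>2) \<le> (cmod m)\<^sup>2 * a\<^sup>2"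
      by (simp add: power2_eq_square algebra_simps)
    then show ?thesis using s by (simp add: field_simps)
  qed
  finally show ?thesis by (simp add: s_def)
qed

text \<open>The perspective \<open>a\<^sup>2 / (a + l e)\<close> is compressed to the eigenbasis of \<open>H\<close>.\<close>

lemma perspective_compress:
  fixes B H X :: "'n::finite op"
  assumes B: "psd B" and H: "psd H" and X: "psd X" and l: "0 < l" and r: "0 < r"
  defines "S \<equiv> hfun sqrt H"
    and "A \<equiv> hfun (\<lambda>t. t powr r) B" and "Y \<equiv> hfun (\<lambda>t. t powr r) X"
  defines "M \<equiv> dagger (eu B) ** S ** eu X"
    and "qa \<equiv> \<lambda>j. col (eu H) j \<bullet> (A *v col (eu H) j)" and "qy \<equiv> \<lambda>j. col (eu H) j \<bullet> (Y *v col (eu H) j)"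
  shows "(\<Sum>j\<in>UNIV. ev H j * ((qa j)\<^sup>2 / (qa j + l * qy j)))
    \<le> (\<Sum>i\<in>UNIV. \<Sum>j\<in>UNIV. (cmod (M $ i $ j))\<^sup>2 * ((ev B i powr r)\<^sup>2 / (ev B i powr r + l * ev X j powr r)))"
proof -
  have hB: "hermitian B" and hH: "hermitian H" and hX: "hermitian X" using B H X by (auto simp: psd_herm)
  define Ub Uh Ux where "Ub = eu B" and "Uh = eu H" and "Ux = eu X"
  have U: "unitary Ub" "unitary Uh" "unitary Ux" by (simp_all add: Ub_def Uh_def Ux_def eu_unitary hB hH hX)
  define \<alpha> where "\<alpha> i = ev B i powr r" for i
  define \<eta> where "\<eta> j = ev X j powr r" for j
  have A: "A = conjd Ub \<alpha>" by (simp add: A_def Ub_def \<alpha>_def[abs_def] hfun_eu hB)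
  have Y: "Y = conjd Ux \<eta>" by (simp add: Y_def Ux_def \<eta>_def[abs_def] hfun_eu hX)
  have S: "S = conjd Uh (\<lambda>j. sqrt (ev H j))" by (simp add: S_def Uh_def hfun_eu hH)
  have pA: "psd A" unfolding A_def by (rule psd_hfun'[OF B]) auto
  have pY: "psd Y" unfolding Y_def by (rule psd_hfun'[OF X]) auto
  have qa0: "0 \<le> qa j" and qy0: "0 \<le> qy j" for j using pA pY by (auto simp: qa_def qy_def psd_def)
  \<comment> \<open>Maximises \<open>2 * \<omega> * sqrt (ev H j) * qa j - \<omega>\<^sup>2 * (qa j
    + l * qy j)\<close> for each \<open>j\<close>. So \<open>W\<close> is the best test operator
    diagonal in the eigenbasis of \<open>H\<close>, while \<open>complex_square_bound\<close> holds
    for every test matrix \<open>M'\<close>.\<close>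
  define \<omega> where "\<omega> j = sqrt (ev H j) * qa j / (qa j + l * qy j)" for j
  define W where "W = conjd Uh \<omega>"
  define M' where "M' = dagger Ub ** W ** Ux"
  have hW: "dagger W = W" using conjd_herm[of Uh \<omega>] by (simp add: W_def hermitian_def)
  have hS: "dagger S = S" using conjd_herm[of Uh] by (simp add: S hermitian_def)
  have dM: "dagger M = dagger Ux ** S ** Ub" "dagger M' = dagger Ux ** W ** Ub"
    by (simp_all add: M_def M'_def dagger_mult hW hS Ub_def Ux_def matrix_mul_assoc)
  have c: "Ux ** (dagger Ux ** Z) = Z" "Ub ** (dagger Ub ** Z) = Z" for Z :: "'n op"
    using U by (simp_all add: matrix_mul_assoc unitary_right)
  have cyc: "tr (dagger Ux ** (Z ** Ux)) = tr Z" "tr (dagger Ub ** (Z ** Ub)) = tr Z" for Z :: "'n op"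
    using tr_comm[of "dagger Ux" "Z ** Ux"] tr_comm[of "dagger Ub" "Z ** Ub"] U
    by (simp_all add: matrix_mul_assoc[symmetric] unitary_right)
  have "(\<Sum>i\<in>UNIV. \<Sum>j\<in>UNIV. \<alpha> i * Re (cnj (M $ i $ j) * M' $ i $ j)) = tr (dagger M ** diagm \<alpha> ** M')"
    by (simp add: tr_entries)
  also have "\<dots> = tr (dagger Ux ** ((S ** A ** W) ** Ux))"
    unfolding dM by (simp add: M'_def A conjd_def matrix_mul_assoc)
  also have "\<dots> = tr (A ** (W ** S))"
    using cyc(1)[of "S ** A ** W"] tr_comm[of S "A ** W"] by (simp add: matrix_mul_assoc)
  also have "W ** S = conjd Uh (\<lambda>j. \<omega> j * sqrt (ev H j))" by (simp add: W_def S conjd_mult U)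
  also have "tr (A ** conjd Uh (\<lambda>j. \<omega> j * sqrt (ev H j))) = (\<Sum>j\<in>UNIV. \<omega> j * sqrt (ev H j) * qa j)"
    unfolding tr_mult_conjd[OF U(2)] by (simp add: qa_def Uh_def)
  finally have 1: "(\<Sum>i\<in>UNIV. \<Sum>j\<in>UNIV. \<alpha> i * Re (cnj (M $ i $ j) * M' $ i $ j)) = (\<Sum>j\<in>UNIV. \<omega> j * sqrt (ev H j) * qa j)" .
  have sq: "Re (cnj z * z) = (cmod z)\<^sup>2" "Re (z * cnj z) = (cmod z)\<^sup>2" for z
    by (simp_all add: cmod_power2) (simp_all add: power2_eq_square)
  have WW: "W ** W = conjd Uh (\<lambda>j. (\<omega> j)\<^sup>2)" by (simp add: W_def conjd_mult U power2_eq_square)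
  have "(\<Sum>i\<in>UNIV. \<Sum>j\<in>UNIV. \<alpha> i * (cmod (M' $ i $ j))\<^sup>2) = tr (dagger M' ** diagm \<alpha> ** M')"
    by (simp only: tr_entries sq)
  also have "\<dots> = tr (dagger Ux ** ((W ** A ** W) ** Ux))"
    unfolding dM by (simp add: M'_def A conjd_def matrix_mul_assoc)
  also have "\<dots> = tr (A ** (W ** W))"
    using cyc(1)[of "W ** A ** W"] tr_comm[of W "A ** W"] by (simp add: matrix_mul_assoc)
  also have "\<dots> = (\<Sum>j\<in>UNIV. (\<omega> j)\<^sup>2 * qa j)"
    unfolding WW tr_mult_conjd[OF U(2)] by (simp add: qa_def Uh_def)
  finally have 2: "(\<Sum>i\<in>UNIV. \<Sum>j\<in>UNIV. \<alpha> i * (cmod (M' $ i $ j))\<^sup>2) = (\<Sum>j\<in>UNIV. (\<omega> j)\<^sup>2 * qa j)" .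
  have "(\<Sum>i\<in>UNIV. \<Sum>j\<in>UNIV. \<eta> j * (cmod (M' $ i $ j))\<^sup>2) = tr (M' ** diagm \<eta> ** dagger M')"
    by (simp only: tr_entries sq)
  also have "\<dots> = tr (dagger Ub ** ((W ** Y ** W) ** Ub))"
    unfolding dM by (simp add: M'_def Y conjd_def matrix_mul_assoc)
  also have "\<dots> = tr (Y ** (W ** W))"
    using cyc(2)[of "W ** Y ** W"] tr_comm[of W "Y ** W"] by (simp add: matrix_mul_assoc)
  also have "\<dots> = (\<Sum>j\<in>UNIV. (\<omega> j)\<^sup>2 * qy j)"
    unfolding WW tr_mult_conjd[OF U(2)] by (simp add: qy_def Uh_def)
  finally have 3: "(\<Sum>i\<in>UNIV. \<Sum>j\<in>UNIV. \<eta> j * (cmod (M' $ i $ j))\<^sup>2) = (\<Sum>j\<in>UNIV. (\<omega> j)\<^sup>2 * qy j)" .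
  have "ev H j * ((qa j)\<^sup>2 / (qa j + l * qy j)) = 2 * (\<omega> j * sqrt (ev H j) * qa j) - (\<omega> j)\<^sup>2 * qa j - l * ((\<omega> j)\<^sup>2 * qy j)" for j
  proof (cases "qa j + l * qy j = 0")
    case True
    then have "qa j = 0" using qa0[of j] qy0[of j] l by (simp add: add_nonneg_eq_0_iff)
    then show ?thesis using True by (simp add: \<omega>_def)
  next
    case False
    define D where "D = qa j + l * qy j"
    define g where "g = sqrt (ev H j)"
    have g: "ev H j = g * g" using ev_nonneg[OF H] by (simp add: g_def)
    have w: "\<omega> j * D = g * qa j" using False by (simp add: \<omega>_def D_def g_def)
    have "(\<omega> j)\<^sup>2 * D = \<omega> j * (g * qa j)" by (simp add: power2_eq_square mult.assoc w)
    moreover have "ev H j * ((qa j)\<^sup>2 / D) = \<omega> j * (g * qa j)"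
    proof -
      have "\<omega> j = g * qa j / D" by (simp add: \<omega>_def D_def g_def)
      then show ?thesis by (simp add: g power2_eq_square)
    qed
    moreover have "(\<omega> j)\<^sup>2 * D = (\<omega> j)\<^sup>2 * qa j + l * ((\<omega> j)\<^sup>2 * qy j)" by (simp add: D_def algebra_simps)
    moreover have "\<omega> j * g * qa j = \<omega> j * (g * qa j)" by (rule mult.assoc)
    ultimately show ?thesis unfolding D_def[symmetric] g_def[symmetric] by linarith
  qed
  then have "(\<Sum>j\<in>UNIV. ev H j * ((qa j)\<^sup>2 / (qa j + l * qy j)))
    = 2 * (\<Sum>j\<in>UNIV. \<omega> j * sqrt (ev H j) * qa j) - (\<Sum>j\<in>UNIV. (\<omega> j)\<^sup>2 * qa j) - l * (\<Sum>j\<in>UNIV. (\<omega> j)\<^sup>2 * qy j)"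
    by (simp add: sum_subtractf sum_distrib_left)
  also have "\<dots> = (\<Sum>i\<in>UNIV. \<Sum>j\<in>UNIV. 2 * (\<alpha> i * Re (cnj (M $ i $ j) * M' $ i $ j)) - (\<alpha> i + l * \<eta> j) * (cmod (M' $ i $ j))\<^sup>2)"
    unfolding 1[symmetric] 2[symmetric] 3[symmetric]
    by (simp add: sum_subtractf sum.distrib sum_distrib_left distrib_right mult.assoc)
  also have "\<dots> \<le> (\<Sum>i\<in>UNIV. \<Sum>j\<in>UNIV. (cmod (M $ i $ j))\<^sup>2 * ((\<alpha> i)\<^sup>2 / (\<alpha> i + l * \<eta> j)))"
    using l by (intro sum_mono complex_square_bound) (simp_all add: \<alpha>_def \<eta>_def)
  finally show ?thesis by (simp add: \<alpha>_def \<eta>_def)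
qed

text \<open>At \<open>y = 0\<close> the integrand is \<open>w * x\<close> times a power of
  \<open>l\<close> that is not integrable, whereas \<open>x / 0 = 0\<close> makes the claimed value
  vanish; hence the side condition.\<close>

lemma hi_perspective:
  assumes a: "0 < a" "a < 1"
  shows "\<exists>c>0. \<forall>w\<ge>0. \<forall>x\<ge>0. \<forall>y\<ge>0. (y = 0 \<longrightarrow> w * x = 0) \<longrightarrow>
    hi (\<lambda>l. l powr (a - 1) * (w * (x\<^sup>2 / (x + l * y)))) (c * (w * x * (x / y) powr a))"
proof -
  obtain c where c: "0 < c" "\<And>t. 0 \<le> t \<Longrightarrow> hi (\<lambda>x. x powr (a - 1) * (t / (x + t))) (c * t powr a)"
    using hi_resolvent[OF a] by blast
  have "hi (\<lambda>l. l powr (a - 1) * (w * (x\<^sup>2 / (x + l * y)))) (c * (w * x * (x / y) powr a))"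
    if x: "0 \<le> w" "0 \<le> x" "0 \<le> y" "y = 0 \<longrightarrow> w * x = 0" for w x y :: real
  proof (cases "y = 0")
    case True
    have "hi (\<lambda>l. 0 * (l powr (a - 1) * (1 / (l + 1)))) (0 * (c * 1 powr a))"
      by (intro hi_cmult c) simp
    then show ?thesis using True x by (auto elim!: hi_cong)
  next
    case False
    have "hi (\<lambda>l. w * x * (l powr (a - 1) * (x / y / (l + x / y)))) (w * x * (c * (x / y) powr a))"
      using x by (intro hi_cmult c) simp
    then have h: "hi (\<lambda>l. w * x * (l powr (a - 1) * (x / y / (l + x / y)))) (c * (w * x * (x / y) powr a))"
      by (simp add: mult_ac)
    show ?thesis
    proof (rule hi_cong[OF h])
      fix l :: real assume l: "0 < l"
      have "x / y / (l + x / y) = x / (x + l * y)"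
      proof -
        have "l + x / y = (x + l * y) / y" using False by (simp add: field_simps)
        then show ?thesis using False by simp
      qed
      then have e: "x / y / (l + x / y) = x / (x + l * y)" .
      show "w * x * (l powr (a - 1) * (x / y / (l + x / y))) = l powr (a - 1) * (w * (x\<^sup>2 / (x + l * y)))"
        unfolding e by (simp add: power2_eq_square mult_ac)
    qed
  qed
  then show ?thesis using c(1) by blast
qed

text \<open>Integrating \<open>perspective_compress\<close> over \<open>l\<close> bounds the sum of
  \<open>ev H j * qa j * (qa j / qy j) powr a\<close> by \<open>tr Y\<close>. Young's inequality
  then trades the power of the quotient for the power \<open>r\<close> of \<open>ev H j\<close>. The
  condition \<open>r > 1/2\<close> means \<open>a < 1\<close>, the range of the integral
  representation.\<close>

lemma araki_lieb_thirring:
  fixes B H :: "'n::finite op"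
  assumes B: "psd B" and H: "psd H" and r: "1/2 < r" "r < 1"
  shows "tr (hfun (\<lambda>t. t powr r) B ** hfun (\<lambda>t. t powr r) H)
    \<le> tr (hfun (\<lambda>t. t powr r) (hfun sqrt H ** B ** hfun sqrt H))"
proof -
  \<comment> \<open>Chosen with \<open>r * (1 + a) = 1\<close>, so that the power
    \<open>1 + a\<close> of the eigenvalues of \<open>A\<close> and \<open>Y\<close> gives back
    those of \<open>B\<close> and \<open>X\<close>.\<close>
  define a where "a = (1 - r) / r"
  have a: "0 < a" "a < 1" using r by (auto simp: a_def field_simps)
  have ra: "r * (1 + a) = 1" "r * a = 1 - r" using r by (auto simp: a_def field_simps)
  define S where "S = hfun sqrt H"
  define X where "X = S ** B ** S"
  define A where "A = hfun (\<lambda>t. t powr r) B"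
  define Y where "Y = hfun (\<lambda>t. t powr r) X"
  have hB: "hermitian B" and hH: "hermitian H" using B H by (auto simp: psd_herm)
  have hS: "hermitian S" unfolding S_def by (rule hfun_herm[OF hH])
  have pX: "psd X" unfolding X_def by (rule psd_sandwich[OF B hS])
  have hX: "hermitian X" using pX by (rule psd_herm)
  define Ub Uh Ux where "Ub = eu B" and "Uh = eu H" and "Ux = eu X"
  have U: "unitary Ub" "unitary Uh" "unitary Ux" by (simp_all add: Ub_def Uh_def Ux_def eu_unitary hB hH hX)
  define \<alpha> where "\<alpha> i = ev B i powr r" for i
  define \<eta> where "\<eta> j = ev X j powr r" for j
  have A: "A = conjd Ub \<alpha>" by (simp add: A_def Ub_def \<alpha>_def[abs_def] hfun_eu hB)
  have Y: "Y = conjd Ux \<eta>" by (simp add: Y_def Ux_def \<eta>_def[abs_def] hfun_eu hX)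
  have pA: "psd A" unfolding A_def by (rule psd_hfun'[OF B]) auto
  have pY: "psd Y" unfolding Y_def by (rule psd_hfun'[OF pX]) auto
  define M where "M = dagger Ub ** S ** Ux"
  define w where "w i j = (cmod (M $ i $ j))\<^sup>2" for i j
  define qa where "qa j = col Uh j \<bullet> (A *v col Uh j)" for j
  define qy where "qy j = col Uh j \<bullet> (Y *v col Uh j)" for j
  have qa0: "0 \<le> qa j" and qy0: "0 \<le> qy j" for j using pA pY by (auto simp: qa_def qy_def psd_def)
  \<comment> \<open>Expresses \<open>X = S ** B ** S\<close> in the two eigenbases. It makes the
    right-hand side of the integrated inequality collapse to \<open>tr Y\<close>.\<close>
  have wb: "(\<Sum>i\<in>UNIV. w i j * ev B i) = ev X j" for j
  proof -
    have "dagger M ** diagm (ev B) ** M = dagger Ux ** (S ** conjd Ub (ev B) ** S) ** Ux"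
      using hS by (simp add: M_def dagger_mult conjd_def hermitian_def matrix_mul_assoc)
    also have "\<dots> = dagger Ux ** conjd Ux (ev X) ** Ux"
    proof -
      have "S ** conjd Ub (ev B) ** S = X" by (simp add: Ub_def eu_ev hB X_def)
      moreover have "conjd Ux (ev X) = X" by (simp add: Ux_def eu_ev hX)
      ultimately show ?thesis by simp
    qed
    also have "\<dots> = (dagger Ux ** Ux) ** diagm (ev X) ** (dagger Ux ** Ux)"
      by (simp add: conjd_def matrix_mul_assoc)
    also have "\<dots> = diagm (ev X)" using U by (simp add: unitary_def)
    finally have e: "dagger M ** (diagm (ev B) ** M) = diagm (ev X)" by (simp add: matrix_mul_assoc)
    have "Re ((dagger M ** (diagm (ev B) ** M)) $ j $ j) = (\<Sum>i\<in>UNIV. w i j * ev B i)"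
      unfolding matrix_matrix_mult_def[of "dagger M"]
      by (simp add: diagm_left dagger_def w_def cmod_power2)
        (intro sum.cong refl, simp add: power2_eq_square algebra_simps)
    then show ?thesis unfolding e by (simp add: diagm_def)
  qed
  have w0: "0 \<le> w i j" for i j by (simp add: w_def)
  have b0: "0 \<le> ev B i" "0 \<le> ev X i" "0 \<le> ev H i" for i by (simp_all add: ev_nonneg B pX H)
  have deg1: "w i j * \<alpha> i = 0" if "\<eta> j = 0" for i j
  proof -
    have "(\<Sum>i\<in>UNIV. w i j * ev B i) = 0" using that by (simp add: wb \<eta>_def)
    then have "w i j * ev B i = 0"
      by (subst (asm) sum_nonneg_eq_0_iff) (simp_all add: w0 b0)
    then show ?thesis by (auto simp: \<alpha>_def)
  qed
  \<comment> \<open>The degenerate case of \<open>hi_perspective\<close>: if \<open>Y\<close>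
    vanishes on an eigenvector of \<open>H\<close> outside the kernel of \<open>H\<close>, then so
    does \<open>X = S ** B ** S\<close>, hence \<open>B\<close>, hence \<open>A\<close>.\<close>
  have deg2: "ev H j * qa j = 0" if "qy j = 0" for j
  proof (cases "ev H j = 0")
    case False
    have "qy j = (\<Sum>k\<in>UNIV. \<eta> k * ov Ux Uh k j)" by (simp add: qy_def Y quad_ov)
    then have "\<eta> k * ov Ux Uh k j = 0" for k
      using that by (subst (asm) eq_commute, simp, subst (asm) sum_nonneg_eq_0_iff) (auto simp: \<eta>_def)
    then have "ev X k * ov Ux Uh k j = 0" for k by (simp add: \<eta>_def)
    then have "col Uh j \<bullet> (conjd Ux (ev X) *v col Uh j) = 0" by (simp only: quad_ov sum.neutral_const)
    then have "col Uh j \<bullet> (X *v col Uh j) = 0" by (simp add: Ux_def eu_ev hX)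
    moreover have "X = dagger S ** B ** S" using hS by (simp add: X_def hermitian_def)
    ultimately have "(S *v col Uh j) \<bullet> (B *v (S *v col Uh j)) = 0" by (simp only: inner_conj)
    moreover have "S *v col Uh j = sqrt (ev H j) *\<^sub>R col Uh j"
      using conjd_col[OF U(2), of "\<lambda>j. sqrt (ev H j)" j] by (simp add: S_def Uh_def hfun_eu hH)
    moreover have "B *v (c *\<^sub>R v) = c *\<^sub>R (B *v v)" for c v
      by (simp add: matrix_vector_mult_def vec_eq_iff scaleR_sum_right)
    ultimately have "col Uh j \<bullet> (B *v col Uh j) = 0" using False by simp
    then have "(\<Sum>i\<in>UNIV. ev B i * ov Ub Uh i j) = 0"
      using quad_ov[of Uh j Ub "ev B"] by (simp add: Ub_def eu_ev hB)
    then have "ev B i * ov Ub Uh i j = 0" for i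
      by (subst (asm) sum_nonneg_eq_0_iff) (simp_all add: b0)
    then have "\<alpha> i * ov Ub Uh i j = 0" for i by (auto simp: \<alpha>_def)
    then have "qa j = 0" by (simp only: qa_def A quad_ov sum.neutral_const)
    then show ?thesis by simp
  qed simp
  obtain c where c: "0 < c" "\<And>w x y. 0 \<le> w \<Longrightarrow> 0 \<le> x \<Longrightarrow> 0 \<le> y \<Longrightarrow> (y = 0 \<Longrightarrow> w * x = 0) \<Longrightarrow>
    hi (\<lambda>l. l powr (a - 1) * (w * (x\<^sup>2 / (x + l * y)))) (c * (w * x * (x / y) powr a))"
    using hi_perspective[OF a] by blast
  have "(\<Sum>j\<in>UNIV. c * (ev H j * qa j * (qa j / qy j) powr a)) \<le> (\<Sum>i\<in>UNIV. \<Sum>j\<in>UNIV. c * (w i j * \<alpha> i * (\<alpha> i / \<eta> j) powr a))"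
  proof (rule hi_mono)
    show "hi (\<lambda>l. \<Sum>j\<in>UNIV. l powr (a - 1) * (ev H j * ((qa j)\<^sup>2 / (qa j + l * qy j))))
      (\<Sum>j\<in>UNIV. c * (ev H j * qa j * (qa j / qy j) powr a))"
      by (intro hi_sum c qa0 qy0 b0 deg2)
    show "hi (\<lambda>l. \<Sum>i\<in>UNIV. \<Sum>j\<in>UNIV. l powr (a - 1) * (w i j * ((\<alpha> i)\<^sup>2 / (\<alpha> i + l * \<eta> j))))
      (\<Sum>i\<in>UNIV. \<Sum>j\<in>UNIV. c * (w i j * \<alpha> i * (\<alpha> i / \<eta> j) powr a))"
      by (intro hi_sum c w0 deg1) (simp_all add: \<alpha>_def \<eta>_def)
    fix l :: real assume l: "0 < l"
    have "(\<Sum>j\<in>UNIV. ev H j * ((qa j)\<^sup>2 / (qa j + l * qy j))) \<le> (\<Sum>i\<in>UNIV. \<Sum>j\<in>UNIV. w i j * ((\<alpha> i)\<^sup>2 / (\<alpha> i + l * \<eta> j)))"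
      using perspective_compress[OF B H pX l, of r] r
      by (simp add: qa_def qy_def A_def Y_def Uh_def w_def M_def Ub_def Ux_def S_def \<alpha>_def \<eta>_def)
    from mult_left_mono[OF this, of "l powr (a - 1)"]
    show "(\<Sum>j\<in>UNIV. l powr (a - 1) * (ev H j * ((qa j)\<^sup>2 / (qa j + l * qy j))))
      \<le> (\<Sum>i\<in>UNIV. \<Sum>j\<in>UNIV. l powr (a - 1) * (w i j * ((\<alpha> i)\<^sup>2 / (\<alpha> i + l * \<eta> j))))"
      by (simp add: sum_distrib_left)
  qed
  then have "c * (\<Sum>j\<in>UNIV. ev H j * qa j * (qa j / qy j) powr a) \<le> c * (\<Sum>i\<in>UNIV. \<Sum>j\<in>UNIV. w i j * \<alpha> i * (\<alpha> i / \<eta> j) powr a)"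
    by (simp add: sum_distrib_left)
  then have "(\<Sum>j\<in>UNIV. ev H j * qa j * (qa j / qy j) powr a) \<le> (\<Sum>i\<in>UNIV. \<Sum>j\<in>UNIV. w i j * \<alpha> i * (\<alpha> i / \<eta> j) powr a)"
    using c(1) by simp
  also have "\<dots> = (\<Sum>j\<in>UNIV. \<Sum>i\<in>UNIV. w i j * \<alpha> i * (\<alpha> i / \<eta> j) powr a)" by (rule sum.swap)
  also have "\<dots> = (\<Sum>j\<in>UNIV. \<eta> j)"
  proof (rule sum.cong[OF refl])
    fix j
    show "(\<Sum>i\<in>UNIV. w i j * \<alpha> i * (\<alpha> i / \<eta> j) powr a) = \<eta> j"
    proof (cases "\<eta> j = 0")
      case False
      have "\<alpha> i * (\<alpha> i / \<eta> j) powr a = ev B i / \<eta> j powr a" for i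
      proof -
        have "\<alpha> i * \<alpha> i powr a = ev B i"
        proof (cases "ev B i = 0")
          case False
          then have "\<alpha> i * \<alpha> i powr a = ev B i powr (r * (1 + a))"
            by (simp add: \<alpha>_def powr_powr powr_add[symmetric] distrib_left)
          then show ?thesis using b0(1)[of i] by (simp add: ra)
        qed (simp add: \<alpha>_def)
        then show ?thesis by (simp add: powr_divide \<alpha>_def \<eta>_def)
      qed
      then have "(\<Sum>i\<in>UNIV. w i j * \<alpha> i * (\<alpha> i / \<eta> j) powr a) = (\<Sum>i\<in>UNIV. w i j * ev B i) / \<eta> j powr a"
        by (simp add: mult.assoc sum_divide_distrib)
      also have "\<dots> = ev X j / \<eta> j powr a" by (simp add: wb)
      also have "\<dots> = \<eta> j"
      proof -
        have x: "ev X j \<noteq> 0" using False by (auto simp: \<eta>_def)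
        then have "\<eta> j * \<eta> j powr a = ev X j powr (r * (1 + a))"
          by (simp add: \<eta>_def powr_powr powr_add[symmetric] distrib_left)
        then have "\<eta> j * \<eta> j powr a = ev X j" using b0(2)[of j] by (simp add: ra)
        moreover have "\<eta> j powr a \<noteq> 0" using False by simp
        ultimately show ?thesis by (simp add: field_simps)
      qed
      finally show ?thesis .
    qed (simp add: deg1)
  qed
  also have "\<dots> = tr Y" by (simp add: Y tr_conjd U)
  finally have main: "(\<Sum>j\<in>UNIV. ev H j * qa j * (qa j / qy j) powr a) \<le> tr Y" .
  have trY: "tr Y = (\<Sum>j\<in>UNIV. qy j)" by (simp add: qy_def tr_quad[OF U(2)])
  have young: "ev H j powr r * qa j \<le> r * (ev H j * qa j * (qa j / qy j) powr a) + (1 - r) * qy j" for j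
  proof (cases "ev H j * qa j = 0")
    case True
    then have "ev H j powr r * qa j = 0" by auto
    then show ?thesis using True r qy0[of j] by auto
  next
    case False
    then have p: "0 < ev H j" "0 < qa j" "0 < qy j"
      using b0(3)[of j] qa0[of j] qy0[of j] deg2[of j] by (auto simp: less_le)
    have "(ev H j * qa j * (qa j / qy j) powr a) powr r * qy j powr (1 - r)
        \<le> r * (ev H j * qa j * (qa j / qy j) powr a) + (1 - r) * qy j"
      using p r by (intro Youngs_inequality_0) auto
    moreover have "(ev H j * qa j * (qa j / qy j) powr a) powr r * qy j powr (1 - r) = ev H j powr r * qa j"
    proof -
      have "(ev H j * qa j * (qa j / qy j) powr a) powr r = ev H j powr r * (qa j powr r * qa j powr (r * a)) / qy j powr (r * a)"
        using p by (simp add: powr_mult powr_divide powr_powr mult.commute)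
      also have "qa j powr r * qa j powr (r * a) = qa j"
        using p by (simp add: powr_add[symmetric] distrib_left[symmetric] ra flip: mult_1_right)
      finally show ?thesis using p by (simp add: ra)
    qed
    ultimately show ?thesis by simp
  qed
  have "tr (A ** hfun (\<lambda>t. t powr r) H) = (\<Sum>j\<in>UNIV. ev H j powr r * qa j)"
    by (simp add: hfun_eu[OF hH] tr_mult_conjd[OF U(2)[unfolded Uh_def]] qa_def Uh_def)
  also have "\<dots> \<le> (\<Sum>j\<in>UNIV. r * (ev H j * qa j * (qa j / qy j) powr a) + (1 - r) * qy j)"
    by (intro sum_mono young)
  also have "\<dots> = r * (\<Sum>j\<in>UNIV. ev H j * qa j * (qa j / qy j) powr a) + (1 - r) * tr Y"
    by (simp add: sum.distrib sum_distrib_left trY)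
  also have "\<dots> \<le> r * tr Y + (1 - r) * tr Y" using main r by (intro add_mono mult_left_mono) auto
  finally show ?thesis by (simp add: A_def Y_def X_def S_def algebra_simps)
qed


section \<open>Random codebooks\<close>

text \<open>A plain sum in any real vector space, so that operator-valued expectations commute with
  linear maps by the rules for sums. \<open>Ex_integral\<close> ties it to the expectation for
  finite support.\<close>

definition Ex :: "'a pmf \<Rightarrow> ('a \<Rightarrow> 'b::real_vector) \<Rightarrow> 'b" where
  "Ex p f = (\<Sum>a\<in>set_pmf p. pmf p a *\<^sub>R f a)"

lemma Ex_integral:
  fixes f :: "'a \<Rightarrow> 'b::{banach, second_countable_topology}"
  shows "finite (set_pmf p) \<Longrightarrow> Ex p f = measure_pmf.expectation p f"
  unfolding Ex_def by (subst integral_measure_pmf) auto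

lemma Ex_map:
  fixes f :: "'a \<Rightarrow> 'b::{banach, second_countable_topology}"
  shows "finite (set_pmf p) \<Longrightarrow> Ex (map_pmf g p) f = Ex p (\<lambda>x. f (g x))"
  by (simp add: Ex_integral)

lemma Ex_pair:
  "finite (set_pmf p) \<Longrightarrow> finite (set_pmf q) \<Longrightarrow> Ex (pair_pmf p q) f = Ex p (\<lambda>x. Ex q (\<lambda>y. f (x, y)))"
  unfolding Ex_def set_pair_pmf
  by (subst sum.cartesian_product[symmetric, where g = "\<lambda>x y. pmf (pair_pmf p q) (x, y) *\<^sub>R f (x, y)", simplified split_def, simplified])
    (simp add: pmf_pair scaleR_sum_right)

lemma Ex_swap: "Ex p (\<lambda>x. Ex q (\<lambda>y. f x y)) = Ex q (\<lambda>y. Ex p (\<lambda>x. f x y))"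
  unfolding Ex_def scaleR_sum_right by (subst sum.swap) (simp add: mult.commute)

lemma Ex_cong: "(\<And>x. x \<in> set_pmf p \<Longrightarrow> f x = g x) \<Longrightarrow> Ex p f = Ex p g"
  by (simp add: Ex_def)

lemma Ex_add: "Ex p (\<lambda>x. f x + g x) = Ex p f + Ex p g"
  by (simp add: Ex_def scaleR_add_right sum.distrib)

lemma Ex_scaleR: "Ex p (\<lambda>x. c *\<^sub>R f x) = c *\<^sub>R Ex p f"
  by (simp add: Ex_def scaleR_sum_right mult.commute)

lemma Ex_cmult: "Ex p (\<lambda>x. (c::real) * f x) = c * Ex p f"
  using Ex_scaleR[of p c f] by simp

lemma Ex_sum: "Ex p (\<lambda>x. \<Sum>i\<in>S. f i x) = (\<Sum>i\<in>S. Ex p (f i))"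
  unfolding Ex_def scaleR_sum_right by (rule sum.swap)

lemma sum_pmf: "finite (set_pmf p) \<Longrightarrow> (\<Sum>a\<in>set_pmf p. pmf p a) = 1"
  by (rule sum_pmf_eq_1) auto

lemma Ex_const: "finite (set_pmf p) \<Longrightarrow> Ex p (\<lambda>_. c) = c"
  by (simp add: Ex_def scaleR_left.sum[symmetric] sum_pmf)

lemma Ex_return: "Ex (return_pmf x) f = f x"
  by (simp add: Ex_def)

lemma Ex_mono: 
  fixes f g :: "'a \<Rightarrow> real"
  shows "(\<And>x. x \<in> set_pmf p \<Longrightarrow> f x \<le> g x) \<Longrightarrow> Ex p f \<le> Ex p g"
  unfolding Ex_def by (intro sum_mono) (simp add: mult_left_mono)

lemma Ex_exists:
  fixes f :: "'a \<Rightarrow> real"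
  assumes p: "finite (set_pmf p)" and "Ex p f < c"
  shows "\<exists>x\<in>set_pmf p. f x < c"
proof (rule ccontr)
  assume "\<not> ?thesis"
  then have "Ex p (\<lambda>_. c) \<le> Ex p f" by (intro Ex_mono) auto
  then show False using assms by (simp add: Ex_const)
qed

lemma psd_Ex: "(\<And>x. x \<in> set_pmf p \<Longrightarrow> psd (f x)) \<Longrightarrow> psd (Ex p f)"
  unfolding Ex_def by (intro psd_sum psd_scaleR) auto

lemma tr_Ex: "tr (Ex p f) = Ex p (\<lambda>x. tr (f x))"
  by (simp add: Ex_def tr_sum tr_scaleR)

section \<open>Product laws and the redrawing of coordinates\<close>

lemma finite_set_Pi_pmf:
  assumes "finite A" "\<And>i. i \<in> A \<Longrightarrow> finite (set_pmf (p i))"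
  shows "finite (set_pmf (Pi_pmf A d p))"
  unfolding set_Pi_pmf[OF assms(1)] using assms by (intro finite_PiE_dflt) auto

lemma Ex_component:
  fixes f :: "'a \<Rightarrow> 'b::{banach, second_countable_topology}"
  assumes A: "finite A" "i \<in> A" and p: "\<And>i. i \<in> A \<Longrightarrow> finite (set_pmf (p i))"
  shows "Ex (Pi_pmf A d p) (\<lambda>Y. f (Y i)) = Ex (p i) f"
  using Ex_map[OF finite_set_Pi_pmf[OF A(1) p], where g = "\<lambda>Y. Y i" and f = f]
  by (simp add: Pi_pmf_component A)

text \<open>Combining two independent copies coordinate by coordinate preserves a product law if it
  preserves every factor. The condition on \<open>d\<close> covers the coordinates outside
  \<open>A\<close>, where \<open>Pi_pmf\<close> is constant.\<close>

lemma Pi_pmf_combine: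
  assumes "finite A" and g: "\<And>i. i \<in> A \<Longrightarrow> map_pmf (\<lambda>(a, b). g i a b) (pair_pmf (p i) (p i)) = p i"
    and d: "\<And>i. g i d d = d"
  shows "map_pmf (\<lambda>(Y, Y') i. g i (Y i) (Y' i)) (pair_pmf (Pi_pmf A d p) (Pi_pmf A d p)) = Pi_pmf A d p"
  using assms(1) g
proof (induction A rule: finite_induct)
  case empty
  then show ?case by (simp add: pair_return_pmf1 d)
next
  case (insert x A)
  have pair: "pair_pmf M M' = bind_pmf M (\<lambda>a. bind_pmf M' (\<lambda>b. return_pmf (a, b)))" for M :: "'c pmf" and M' :: "'d pmf"
    by (simp add: pair_pmf_def)
  have e: "(\<lambda>i. g i ((f(x := y)) i) ((f'(x := y')) i)) = (\<lambda>i. g i (f i) (f' i))(x := g x y y')" for f f' y y'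
    by auto
  have "map_pmf (\<lambda>(Y, Y') i. g i (Y i) (Y' i)) (pair_pmf (Pi_pmf (insert x A) d p) (Pi_pmf (insert x A) d p))
    = bind_pmf (p x) (\<lambda>y. bind_pmf (Pi_pmf A d p) (\<lambda>f. bind_pmf (p x) (\<lambda>y'. bind_pmf (Pi_pmf A d p) (\<lambda>f'.
        return_pmf ((\<lambda>i. g i (f i) (f' i))(x := g x y y'))))))"
    using insert.hyps
    by (simp add: Pi_pmf_insert' pair_pmf_def map_pmf_def bind_assoc_pmf bind_return_pmf e del: fun_upd_apply)
  also have "\<dots> = bind_pmf (p x) (\<lambda>y. bind_pmf (p x) (\<lambda>y'. bind_pmf (Pi_pmf A d p) (\<lambda>f. bind_pmf (Pi_pmf A d p) (\<lambda>f'.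
        return_pmf ((\<lambda>i. g i (f i) (f' i))(x := g x y y'))))))"
    by (subst bind_commute_pmf[of "Pi_pmf A d p" "p x"]) (rule refl)
  also have "\<dots> = bind_pmf (map_pmf (\<lambda>(a, b). g x a b) (pair_pmf (p x) (p x))) (\<lambda>z.
      bind_pmf (map_pmf (\<lambda>(Y, Y') i. g i (Y i) (Y' i)) (pair_pmf (Pi_pmf A d p) (Pi_pmf A d p))) (\<lambda>h.
        return_pmf (h(x := z))))"
    by (simp add: pair_pmf_def map_pmf_def bind_assoc_pmf bind_return_pmf)
  also have "\<dots> = bind_pmf (p x) (\<lambda>z. bind_pmf (Pi_pmf A d p) (\<lambda>h. return_pmf (h(x := z))))"
    using insert.IH insert.prems by simp
  also have "\<dots> = Pi_pmf (insert x A) d p" using insert.hyps by (simp add: Pi_pmf_insert')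
  finally show ?case .
qed

definition merge :: "'t set \<Rightarrow> ('t \<Rightarrow> 'w) \<Rightarrow> ('t \<Rightarrow> 'w) \<Rightarrow> 't \<Rightarrow> 'w" where
  "merge J a b = (\<lambda>t. if t \<in> J then b t else a t)"

text \<open>The form in which independence is used: replacing any set of coordinates by those of an
  independent copy leaves the law unchanged.\<close>

definition mergeable :: "('t \<Rightarrow> 'w) pmf \<Rightarrow> bool" where
  "mergeable q \<longleftrightarrow> finite (set_pmf q) \<and> (\<forall>J. map_pmf (\<lambda>(a, b). merge J a b) (pair_pmf q q) = q)"

lemma mergeable_Pi_pmf:
  fixes p :: "'t::finite \<Rightarrow> 'w pmf"
  assumes p: "\<And>t. finite (set_pmf (p t))"
  shows "mergeable (Pi_pmf UNIV d p)"
  unfolding mergeable_def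
proof (intro conjI allI)
  show "finite (set_pmf (Pi_pmf UNIV d p))" by (rule finite_set_Pi_pmf) (simp_all add: p)
  fix J :: "'t set"
  have "map_pmf (\<lambda>(Y, Y') i. (if i \<in> J then Y' i else Y i)) (pair_pmf (Pi_pmf UNIV d p) (Pi_pmf UNIV d p)) = Pi_pmf UNIV d p"
  proof (rule Pi_pmf_combine)
    fix i
    have "(\<lambda>(a, b). if i \<in> J then b else a) = (if i \<in> J then snd else fst :: 'w \<times> 'w \<Rightarrow> 'w)" by auto
    then show "map_pmf (\<lambda>(a, b). if i \<in> J then b else a) (pair_pmf (p i) (p i)) = p i"
      by (simp add: map_fst_pair_pmf map_snd_pair_pmf)
  qed auto
  then show "map_pmf (\<lambda>(a, b). merge J a b) (pair_pmf (Pi_pmf UNIV d p) (Pi_pmf UNIV d p)) = Pi_pmf UNIV d p"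
    by (simp add: merge_def[abs_def])
qed

lemma Ex_merge:
  fixes f :: "('t \<Rightarrow> 'w) \<Rightarrow> 'b::{banach, second_countable_topology}"
  assumes q: "mergeable q"
  shows "Ex q (\<lambda>a. Ex q (\<lambda>b. f (merge J a b))) = Ex q f"
proof -
  have fin: "finite (set_pmf q)" using q by (simp add: mergeable_def)
  have "Ex q f = Ex (map_pmf (\<lambda>(a, b). merge J a b) (pair_pmf q q)) f" using q by (simp add: mergeable_def)
  also have "\<dots> = Ex (pair_pmf q q) (\<lambda>x. f (case x of (a, b) \<Rightarrow> merge J a b))"
    by (rule Ex_map) (simp add: fin)
  also have "\<dots> = Ex q (\<lambda>a. Ex q (\<lambda>b. f (merge J a b)))" by (simp add: Ex_pair fin)
  finally show ?thesis by simp
qed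

text \<open>The conditional expectation given the seeds of the transmitters that know no message of
  \<open>S\<close>.\<close>

definition avg :: "('t::finite \<Rightarrow> 's::finite set) \<Rightarrow> ('t \<Rightarrow> 'w) pmf \<Rightarrow> 's set \<Rightarrow> (('t \<Rightarrow> 'w) \<Rightarrow> 'b::real_vector) \<Rightarrow> ('t \<Rightarrow> 'w) \<Rightarrow> 'b" where
  "avg I q S A \<omega> = Ex q (\<lambda>\<omega>'. A (merge (transmitters_meeting I S) \<omega> \<omega>'))"

lemma avg_empty: "finite (set_pmf q) \<Longrightarrow> avg I q {} A = A"
  by (simp add: avg_def transmitters_meeting_def merge_def Ex_const fun_eq_iff)

text \<open>The tower property. Along the recursion over messages, single averages accumulate to
  averages over sets.\<close>

lemma avg_avg:
  fixes A :: "('t::finite \<Rightarrow> 'w) \<Rightarrow> 'b::{banach, second_countable_topology}"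
  assumes q: "mergeable q"
  shows "avg I q S (avg I q {s} A) \<omega> = avg I q (insert s S) A \<omega>"
proof -
  define J where "J = transmitters_meeting I S"
  define K where "K = transmitters_meeting I {s}"
  have "transmitters_meeting I (insert s S) = J \<union> K" by (auto simp: transmitters_meeting_def J_def K_def)
  moreover have "merge K (merge J \<omega> a) b = merge (J \<union> K) \<omega> (merge K a b)" for a b
    by (auto simp: merge_def)
  ultimately show ?thesis
    using Ex_merge[OF q, of "\<lambda>c. A (merge (J \<union> K) \<omega> c)" K] by (simp add: avg_def J_def K_def)
qed

lemma avg_scaleR: "avg I q S (\<lambda>\<omega>. c *\<^sub>R A \<omega>) \<omega> = c *\<^sub>R avg I q S A \<omega>"
  by (simp add: avg_def Ex_scaleR)

lemma psd_avg: "(\<And>\<omega>. psd (A \<omega>)) \<Longrightarrow> psd (avg I q S A \<omega>)"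
  unfolding avg_def by (intro psd_Ex)

text \<open>For every value \<open>i\<close> of the message \<open>s\<close> there is an independent
  copy \<open>Y i\<close> of the codebook for \<open>U\<close>. Transmitters that know
  \<open>s\<close> read the copy selected by \<open>m s\<close>, all others the shared
  \<open>X\<close>. Values outside \<open>Ms s\<close> select the default of
  \<open>Pi_pmf\<close>.\<close>

primrec codebook :: "('t::finite \<Rightarrow> 's::finite set) \<Rightarrow> ('s \<Rightarrow> nat set) \<Rightarrow> ('t \<Rightarrow> 'w) pmf \<Rightarrow> 's list \<Rightarrow>
    (('s \<Rightarrow> nat) \<Rightarrow> 't \<Rightarrow> 'w) pmf" where
  "codebook I Ms q [] = map_pmf (\<lambda>\<omega> m. \<omega>) q"
| "codebook I Ms q (s # U) =
    map_pmf (\<lambda>(X, Y) m. merge (transmitters_meeting I {s}) (X m) (Y (m s) m))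
      (pair_pmf (codebook I Ms q U) (Pi_pmf (Ms s) (\<lambda>_ _. undefined) (\<lambda>_. codebook I Ms q U)))"

lemma finite_codebook:
  assumes "finite (set_pmf q)" "\<And>s. finite (Ms s)"
  shows "finite (set_pmf (codebook I Ms q U))"
  by (induction U) (simp_all add: assms finite_set_Pi_pmf)

text \<open>This is what makes a codebook realisable by encoders that see only their own
  messages.\<close>

lemma codebook_local:
  assumes Ms: "\<And>s. finite (Ms s)"
  shows "X \<in> set_pmf (codebook I Ms q U) \<Longrightarrow> (\<And>s. s \<in> I t \<inter> set U \<Longrightarrow> m s = m' s) \<Longrightarrow> X m t = X m' t"
proof (induction U arbitrary: X)
  case Nil
  then show ?case by auto
next
  case (Cons s U)
  then obtain X0 Y where X: "X = (\<lambda>m. merge (transmitters_meeting I {s}) (X0 m) (Y (m s) m))"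
    and X0: "X0 \<in> set_pmf (codebook I Ms q U)"
    and Y: "Y \<in> set_pmf (Pi_pmf (Ms s) (\<lambda>_ _. undefined) (\<lambda>_. codebook I Ms q U))"
    by auto
  have Y': "Y i m t = Y i m' t" for i
  proof (cases "i \<in> Ms s")
    case True
    then have "Y i \<in> set_pmf (codebook I Ms q U)"
      using Y unfolding set_Pi_pmf[OF Ms] by (auto simp: PiE_dflt_def)
    then show ?thesis using Cons.IH Cons.prems(2) by auto
  next
    case False
    then have "Y i = (\<lambda>_ _. undefined)" using Y unfolding set_Pi_pmf[OF Ms] by (auto simp: PiE_dflt_def)
    then show ?thesis by simp
  qed
  have "X0 m t = X0 m' t" using Cons.IH[OF X0] Cons.prems(2) by auto
  moreover have "m s = m' s" if "s \<in> I t" using Cons.prems(2)[of s] that by simp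
  ultimately show ?case using Y' by (auto simp: X merge_def transmitters_meeting_def)
qed

lemma codebook_marginal:
  fixes f :: "('t::finite \<Rightarrow> 'w) \<Rightarrow> 'b::{banach, second_countable_topology}"
  assumes q: "mergeable q" and Ms: "\<And>s. finite (Ms s)"
  shows "(\<And>s. s \<in> set U \<Longrightarrow> m s \<in> Ms s) \<Longrightarrow> Ex (codebook I Ms q U) (\<lambda>X. f (X m)) = Ex q f"
proof (induction U arbitrary: f)
  case Nil
  then show ?case using q by (simp add: Ex_map mergeable_def)
next
  case (Cons s U)
  have fin: "finite (set_pmf (codebook I Ms q U))" using q Ms by (simp add: finite_codebook mergeable_def)
  have finP: "finite (set_pmf (Pi_pmf (Ms s) (\<lambda>_ _. undefined) (\<lambda>_. codebook I Ms q U)))"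
    by (intro finite_set_Pi_pmf Ms fin)
  define K where "K = transmitters_meeting I {s}"
  have IH: "Ex (codebook I Ms q U) (\<lambda>X. g (X m)) = Ex q g" for g :: "('t \<Rightarrow> 'w) \<Rightarrow> 'b"
    using Cons by auto
  have IH2: "Ex (codebook I Ms q U) (\<lambda>y. f (merge K a (y m))) = Ex q (\<lambda>b. f (merge K a b))" for a
    by (rule IH[of "\<lambda>b. f (merge K a b)"])
  have "Ex (codebook I Ms q (s # U)) (\<lambda>X. f (X m))
    = Ex (codebook I Ms q U) (\<lambda>X0. Ex (Pi_pmf (Ms s) (\<lambda>_ _. undefined) (\<lambda>_. codebook I Ms q U)) (\<lambda>Y. f (merge K (X0 m) (Y (m s) m))))"
    by (simp add: Ex_map fin finP Ex_pair K_def)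
  also have "\<dots> = Ex (codebook I Ms q U) (\<lambda>X0. Ex (codebook I Ms q U) (\<lambda>y. f (merge K (X0 m) (y m))))"
    using Cons.prems by (subst Ex_component[where f = "\<lambda>y. f (merge K _ (y m))"]) (auto simp: Ms fin)
  also have "\<dots> = Ex q (\<lambda>a. Ex q (\<lambda>b. f (merge K a b)))"
    unfolding IH2 by (rule IH[of "\<lambda>a. Ex q (\<lambda>b. f (merge K a b))"])
  also have "\<dots> = Ex q f" by (rule Ex_merge[OF q])
  finally show ?case .
qed

lemma merge_merge: "merge K (merge J a b) (merge J a' b') = merge J (merge K a a') (merge K b b')"
  by (auto simp: merge_def)

text \<open>The recursion leaves sums over two merged independent codebooks; in law this is a single
  codebook again.\<close>

lemma codebook_merge:
  fixes I :: "'a::finite \<Rightarrow> 'b::finite set" and q :: "('a \<Rightarrow> 'c) pmf"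
  assumes q: "mergeable q" and Ms: "\<And>s. finite (Ms s)"
  shows "map_pmf (\<lambda>(X, X') m. merge K (X m) (X' m)) (pair_pmf (codebook I Ms q U) (codebook I Ms q U)) = codebook I Ms q U"
proof (induction U)
  case Nil
  have "map_pmf (\<lambda>(X, X') m. merge K (X m) (X' m)) (pair_pmf (map_pmf (\<lambda>\<omega> m. \<omega>) q) (map_pmf (\<lambda>\<omega> m. \<omega>) q))
      = map_pmf (\<lambda>\<omega> m. \<omega>) (map_pmf (\<lambda>(a, b). merge K a b) (pair_pmf q q))"
    by (simp add: map_pmf_def pair_pmf_def bind_assoc_pmf bind_return_pmf)
  also have "\<dots> = map_pmf (\<lambda>\<omega> m. \<omega>) q" using q by (simp add: mergeable_def)
  finally show ?case by simp
next
  case (Cons s U)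
  define C where "C = codebook I Ms q U"
  define P where "P = Pi_pmf (Ms s) (\<lambda>_ _. undefined) (\<lambda>_. C)"
  define J where "J = transmitters_meeting I {s}"
  define F where "F X Y = (\<lambda>m. merge J (X m) (Y (m s) m))" for X :: "('b \<Rightarrow> nat) \<Rightarrow> 'a \<Rightarrow> 'c" and Y
  define g where "g X X' = (\<lambda>m. merge K (X m) (X' m))" for X X' :: "('b \<Rightarrow> nat) \<Rightarrow> 'a \<Rightarrow> 'c"
  have C: "map_pmf (\<lambda>(X, X'). g X X') (pair_pmf C C) = C" using Cons by (simp add: C_def g_def)
  have P: "map_pmf (\<lambda>(Y, Y') i. g (Y i) (Y' i)) (pair_pmf P P) = P"
    unfolding P_def by (rule Pi_pmf_combine[OF Ms]) (simp_all add: C, simp add: g_def merge_def)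
  have gF: "g (F X Y) (F X' Y') = F (g X X') (\<lambda>i. g (Y i) (Y' i))" for X X' Y Y'
    by (simp add: g_def F_def merge_merge)
  have cb: "codebook I Ms q (s # U) = bind_pmf C (\<lambda>X. bind_pmf P (\<lambda>Y. return_pmf (F X Y)))"
    by (simp add: C_def P_def F_def[abs_def] J_def map_pmf_def pair_pmf_def bind_assoc_pmf bind_return_pmf)
  have "map_pmf (\<lambda>(X, X'). g X X') (pair_pmf (codebook I Ms q (s # U)) (codebook I Ms q (s # U)))
    = bind_pmf C (\<lambda>X. bind_pmf P (\<lambda>Y. bind_pmf C (\<lambda>X'. bind_pmf P (\<lambda>Y'. return_pmf (F (g X X') (\<lambda>i. g (Y i) (Y' i)))))))"
    unfolding cb by (simp add: map_pmf_def pair_pmf_def bind_assoc_pmf bind_return_pmf gF)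
  also have "\<dots> = bind_pmf C (\<lambda>X. bind_pmf C (\<lambda>X'. bind_pmf P (\<lambda>Y. bind_pmf P (\<lambda>Y'. return_pmf (F (g X X') (\<lambda>i. g (Y i) (Y' i)))))))"
    by (subst bind_commute_pmf[of P C]) (rule refl)
  also have "\<dots> = bind_pmf (map_pmf (\<lambda>(X, X'). g X X') (pair_pmf C C)) (\<lambda>X.
      bind_pmf (map_pmf (\<lambda>(Y, Y') i. g (Y i) (Y' i)) (pair_pmf P P)) (\<lambda>Y. return_pmf (F X Y)))"
    by (simp add: pair_pmf_def map_pmf_def bind_assoc_pmf bind_return_pmf)
  also have "\<dots> = codebook I Ms q (s # U)" unfolding C P cb ..
  finally show ?case by (simp add: g_def)
qed

text \<open>The type argument fixes the sample space, over which the definition cannot quantify.\<close>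

definition step :: "'y itself \<Rightarrow> ('n::finite op \<Rightarrow> real) \<Rightarrow> ('n op \<Rightarrow> real) \<Rightarrow> bool" where
  "step y G H \<longleftrightarrow> (\<forall>(p :: 'y pmf) Z X. finite (set_pmf p) \<longrightarrow> psd X \<longrightarrow> (\<forall>y\<in>set_pmf p. psd (Z y)) \<longrightarrow>
    Ex p (\<lambda>y. G (X + Z y)) \<le> G (X + Ex p Z) + Ex p (\<lambda>y. H (Z y)))"

text \<open>The summands are replaced by their mean one at a time. The induction needs arbitrary
  \<open>X\<close>, which absorbs both the means already taken and the summands still
  random.\<close>

lemma step_iterate:
  fixes p :: "'y pmf" and Z :: "'y \<Rightarrow> 'n::finite op" and I :: "nat set"
  assumes st: "step TYPE('y) G H" and I: "finite I" and p: "finite (set_pmf p)"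
    and Z: "\<And>y. y \<in> set_pmf p \<Longrightarrow> psd (Z y)"
  shows "psd X \<Longrightarrow> Ex (Pi_pmf I d (\<lambda>_. p)) (\<lambda>Y. G (X + (\<Sum>i\<in>I. Z (Y i))))
    \<le> G (X + real (card I) *\<^sub>R Ex p Z) + real (card I) * Ex p (\<lambda>y. H (Z y))"
  using I
proof (induction I arbitrary: X rule: finite_induct)
  case empty
  then show ?case by (simp add: Ex_return)
next
  case (insert x I)
  have fin: "finite (set_pmf (Pi_pmf I d (\<lambda>_. p)))" by (intro finite_set_Pi_pmf insert.hyps p)
  have Zi: "psd (Z (Y i))" if "Y \<in> set_pmf (Pi_pmf I d (\<lambda>_. p))" "i \<in> I" for Y i
    using that unfolding set_Pi_pmf[OF insert.hyps(1)] by (auto simp: PiE_dflt_def intro: Z)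
  have pE: "psd (Ex p Z)" by (rule psd_Ex) (rule Z)
  have s: "(\<Sum>i\<in>insert x I. Z ((f(x := y)) i)) = Z y + (\<Sum>i\<in>I. Z (f i))" for f y
  proof -
    have "(\<Sum>i\<in>I. Z ((f(x := y)) i)) = (\<Sum>i\<in>I. Z (f i))"
      using insert.hyps by (intro sum.cong) auto
    then show ?thesis using insert.hyps by simp
  qed
  have "Ex (Pi_pmf (insert x I) d (\<lambda>_. p)) (\<lambda>Y. G (X + (\<Sum>i\<in>insert x I. Z (Y i))))
    = Ex p (\<lambda>y. Ex (Pi_pmf I d (\<lambda>_. p)) (\<lambda>f. G (X + (Z y + (\<Sum>i\<in>I. Z (f i))))))"
    unfolding Pi_pmf_insert[OF insert.hyps]
    by (subst Ex_map) (simp_all add: fin p Ex_pair s del: fun_upd_apply sum.insert)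
  also have "\<dots> = Ex (Pi_pmf I d (\<lambda>_. p)) (\<lambda>f. Ex p (\<lambda>y. G ((X + (\<Sum>i\<in>I. Z (f i))) + Z y)))"
    by (subst Ex_swap) (simp add: add_ac)
  also have "\<dots> \<le> Ex (Pi_pmf I d (\<lambda>_. p)) (\<lambda>f. G ((X + (\<Sum>i\<in>I. Z (f i))) + Ex p Z) + Ex p (\<lambda>y. H (Z y)))"
    by (intro Ex_mono st[unfolded step_def, rule_format] p psd_add psd_sum insert.prems Zi Z)
  also have "\<dots> = Ex (Pi_pmf I d (\<lambda>_. p)) (\<lambda>f. G ((X + Ex p Z) + (\<Sum>i\<in>I. Z (f i)))) + Ex p (\<lambda>y. H (Z y))"
    by (simp add: Ex_add Ex_const fin add_ac)
  also have "\<dots> \<le> G ((X + Ex p Z) + real (card I) *\<^sub>R Ex p Z) + real (card I) * Ex p (\<lambda>y. H (Z y)) + Ex p (\<lambda>y. H (Z y))"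
    by (intro add_right_mono insert.IH psd_add insert.prems pE)
  also have "\<dots> = G (X + real (card (insert x I)) *\<^sub>R Ex p Z) + real (card (insert x I)) * Ex p (\<lambda>y. H (Z y))"
    using insert.hyps by (simp add: algebra_simps)
  finally show ?case .
qed

definition msize :: "('s \<Rightarrow> nat set) \<Rightarrow> 's set \<Rightarrow> real" where
  "msize Ms S = (\<Prod>s\<in>S. real (card (Ms s)))"

lemma sum_PiE_insert:
  assumes "s \<notin> S" and M: "finite (Ms s)" "finite (PiE S Ms)"
  shows "(\<Sum>m\<in>PiE (insert s S) Ms. f m) = (\<Sum>i\<in>Ms s. \<Sum>m\<in>PiE S Ms. f (m(s := i)))"
proof -
  have inj: "inj_on (\<lambda>(y, g). g(s := y)) (Ms s \<times> PiE S Ms)"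
  proof (rule inj_onI, clarify)
    fix y g y' g'
    assume a: "g \<in> PiE S Ms" "g' \<in> PiE S Ms" "g(s := y) = g'(s := y')"
    then have "y = y'" by (metis fun_upd_same)
    moreover have "g = g'"
    proof
      fix t
      show "g t = g' t"
      proof (cases "t = s")
        case True
        then show ?thesis using a assms(1) by (metis PiE_arb)
      next
        case False
        then show ?thesis using a(3) by (metis fun_upd_other)
      qed
    qed
    ultimately show "y = y' \<and> g = g'" by simp
  qed
  show ?thesis
    unfolding PiE_insert_eq
    by (subst sum.reindex[OF inj]) (simp add: sum.cartesian_product split_def)
qed

lemma sum_strict_subsets_insert:
  fixes f :: "'s::finite set \<Rightarrow> real"
  assumes s: "s \<notin> V"
  shows "(\<Sum>S | S \<subset> insert s V. f S) = (\<Sum>S | S \<subset> V. f (insert s S)) + (f V + (\<Sum>S | S \<subset> V. f S))"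
proof -
  have e: "{S. S \<subset> insert s V} = insert s ` {S. S \<subset> V} \<union> insert V {S. S \<subset> V}"
  proof (intro equalityI subsetI)
    fix S assume S: "S \<in> {S. S \<subset> insert s V}"
    show "S \<in> insert s ` {S. S \<subset> V} \<union> insert V {S. S \<subset> V}"
    proof (cases "s \<in> S")
      case True
      then have "S = insert s (S - {s})" "S - {s} \<subset> V" using S s by auto
      then show ?thesis by blast
    qed (use S in auto)
  qed (use s in auto)
  have d: "insert s ` {S. S \<subset> V} \<inter> insert V {S. S \<subset> V} = {}" using s by auto
  have i: "inj_on (insert s) {S. S \<subset> V}" using s by (auto simp: inj_on_def)
  show ?thesis unfolding e by (subst sum.union_disjoint) (simp_all add: d sum.reindex[OF i])
qed

text \<open>Induction over the messages for arbitrary \<open>A\<close> and \<open>G\<close>. Given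
  the shared part, the sum over all tuples is a sum of independent terms, one for every value of
  \<open>s\<close>. Their mean continues with \<open>A\<close> averaged over \<open>s\<close> and
  yields the sets that contain \<open>s\<close>; the fluctuation continues with \<open>H\<close> and
  yields the others.\<close>

lemma codebook_recursion:
  fixes A :: "('t::finite \<Rightarrow> 'w) \<Rightarrow> 'n::finite op" and Ms :: "'s::finite \<Rightarrow> nat set"
  assumes q: "mergeable q" and Ms: "\<And>s. finite (Ms s)"
    and H: "step TYPE(('s \<Rightarrow> nat) \<Rightarrow> 't \<Rightarrow> 'w) H H"
  shows "step TYPE(('s \<Rightarrow> nat) \<Rightarrow> 't \<Rightarrow> 'w) G H \<Longrightarrow> (\<And>\<omega>. psd (A \<omega>)) \<Longrightarrow> distinct U \<Longrightarrow>
    Ex (codebook I Ms q U) (\<lambda>X. G (\<Sum>m\<in>PiE (set U) Ms. A (X m)))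
    \<le> Ex q (\<lambda>\<omega>. G (msize Ms (set U) *\<^sub>R avg I q (set U) A \<omega>))
      + (\<Sum>S | S \<subset> set U. msize Ms (set U - S) * Ex q (\<lambda>\<omega>. H (msize Ms S *\<^sub>R avg I q S A \<omega>)))"
proof (induction U arbitrary: A G)
  case Nil
  have fin: "finite (set_pmf q)" using q by (simp add: mergeable_def)
  then show ?case by (simp add: Ex_map msize_def avg_empty)
next
  case (Cons s U)
  have finq: "finite (set_pmf q)" using q by (simp add: mergeable_def)
  define C where "C = codebook I Ms q U"
  define V where "V = set U"
  define P where "P = Pi_pmf (Ms s) (\<lambda>_ _. undefined) (\<lambda>_. C)"
  define J where "J = transmitters_meeting I {s}"
  define c where "c = real (card (Ms s))"
  have c0: "0 \<le> c" by (simp add: c_def)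
  have fin: "finite (set_pmf C)" unfolding C_def by (rule finite_codebook[OF finq Ms])
  have finP: "finite (set_pmf P)" unfolding P_def by (intro finite_set_Pi_pmf Ms fin)
  have sV: "s \<notin> V" and dU: "distinct U" using Cons.prems by (auto simp: V_def)
  have fPV: "finite (PiE V Ms)" by (intro finite_PiE Ms) simp
  \<comment> \<open>The inner codebook does not look at the message \<open>s\<close>, so only the
    choice of the copy \<open>Y i\<close> depends on its value.\<close>
  have loc: "X (m(s := i)) = X m" if "X \<in> set_pmf C" for X m i
  proof
    fix t
    show "X (m(s := i)) t = X m t"
      by (rule codebook_local[OF Ms that[unfolded C_def]]) (use sV in \<open>auto simp: V_def\<close>)
  qed
  define Z where "Z X y = (\<Sum>m\<in>PiE V Ms. A (merge J (X m) (y m)))" for X y :: "('s \<Rightarrow> nat) \<Rightarrow> 't \<Rightarrow> 'w"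
  have pZ: "psd (Z X y)" for X y unfolding Z_def by (intro psd_sum Cons.prems)
  have decomp: "(\<Sum>m\<in>PiE (set (s # U)) Ms. A (merge J (X m) (Y (m s) m))) = (\<Sum>i\<in>Ms s. Z X (Y i))"
    if X: "X \<in> set_pmf C" and Y: "Y \<in> set_pmf P" for X Y
  proof -
    have Yi: "Y i \<in> set_pmf C" if "i \<in> Ms s" for i
      using Y that unfolding P_def set_Pi_pmf[OF Ms] by (auto simp: PiE_dflt_def)
    have "(\<Sum>m\<in>PiE (set (s # U)) Ms. A (merge J (X m) (Y (m s) m)))
      = (\<Sum>i\<in>Ms s. \<Sum>m\<in>PiE V Ms. A (merge J (X (m(s := i))) (Y i (m(s := i)))))"
      using sum_PiE_insert[OF sV Ms fPV, of "\<lambda>m. A (merge J (X m) (Y (m s) m))"] by (simp add: V_def)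
    also have "\<dots> = (\<Sum>i\<in>Ms s. Z X (Y i))"
      by (simp add: Z_def loc X Yi)
    finally show ?thesis .
  qed
  have EZ: "Ex C (Z X) = (\<Sum>m\<in>PiE V Ms. avg I q {s} A (X m))" for X
  proof -
    have "Ex C (Z X) = (\<Sum>m\<in>PiE V Ms. Ex C (\<lambda>y. A (merge J (X m) (y m))))"
      unfolding Z_def by (rule Ex_sum)
    also have "\<dots> = (\<Sum>m\<in>PiE V Ms. avg I q {s} A (X m))"
    proof (intro sum.cong refl)
      fix m assume "m \<in> PiE V Ms"
      then have "\<And>s. s \<in> set U \<Longrightarrow> m s \<in> Ms s" by (auto simp: V_def)
      then show "Ex C (\<lambda>y. A (merge J (X m) (y m))) = avg I q {s} A (X m)"
        unfolding C_def avg_def J_def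
        by (rule codebook_marginal[OF q Ms, where f = "\<lambda>b. A (merge (transmitters_meeting I {s}) (X m) b)"])
    qed
    finally show ?thesis .
  qed
  have 1: "Ex (codebook I Ms q (s # U)) (\<lambda>X. G (\<Sum>m\<in>PiE (set (s # U)) Ms. A (X m)))
    = Ex C (\<lambda>X. Ex P (\<lambda>Y. G (\<Sum>m\<in>PiE (set (s # U)) Ms. A (merge J (X m) (Y (m s) m)))))"
    using fin finP by (simp add: Ex_map Ex_pair C_def P_def J_def)
  also have "\<dots> = Ex C (\<lambda>X. Ex P (\<lambda>Y. G (0 + (\<Sum>i\<in>Ms s. Z X (Y i)))))"
    by (intro Ex_cong) (simp only: decomp add_0)
  also have "\<dots> \<le> Ex C (\<lambda>X. G (0 + c *\<^sub>R Ex C (Z X)) + c * Ex C (\<lambda>y. H (Z X y)))"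
    unfolding P_def c_def by (intro Ex_mono step_iterate Cons.prems(1) Ms fin pZ psd_zero)
  also have "\<dots> = Ex C (\<lambda>X. G (\<Sum>m\<in>PiE V Ms. c *\<^sub>R avg I q {s} A (X m))) + c * Ex C (\<lambda>X. Ex C (\<lambda>y. H (Z X y)))"
    by (simp add: EZ Ex_add Ex_cmult scaleR_sum_right)
  \<comment> \<open>Merging the shared codebook with one fresh copy gives a codebook for
    \<open>U\<close>, so the induction hypothesis applies with the original
    \<open>A\<close>.\<close>
  also have "Ex C (\<lambda>X. Ex C (\<lambda>y. H (Z X y))) = Ex C (\<lambda>X. H (\<Sum>m\<in>PiE V Ms. A (X m)))"
  proof -
    have "Ex C (\<lambda>X. H (\<Sum>m\<in>PiE V Ms. A (X m)))
      = Ex (map_pmf (\<lambda>(X, X') m. merge J (X m) (X' m)) (pair_pmf C C)) (\<lambda>X. H (\<Sum>m\<in>PiE V Ms. A (X m)))"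
      unfolding C_def codebook_merge[OF q Ms] ..
    also have "\<dots> = Ex C (\<lambda>X. Ex C (\<lambda>y. H (Z X y)))"
      by (subst Ex_map) (simp_all add: fin Ex_pair Z_def)
    finally show ?thesis by simp
  qed
  finally have main: "Ex (codebook I Ms q (s # U)) (\<lambda>X. G (\<Sum>m\<in>PiE (set (s # U)) Ms. A (X m)))
    \<le> Ex C (\<lambda>X. G (\<Sum>m\<in>PiE V Ms. c *\<^sub>R avg I q {s} A (X m))) + c * Ex C (\<lambda>X. H (\<Sum>m\<in>PiE V Ms. A (X m)))" .
  have ins: "msize Ms S *\<^sub>R avg I q S (\<lambda>\<omega>. c *\<^sub>R avg I q {s} A \<omega>) \<omega> = msize Ms (insert s S) *\<^sub>R avg I q (insert s S) A \<omega>"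
    if "S \<subseteq> V" for S \<omega>
  proof -
    have "s \<notin> S" using that sV by blast
    then show ?thesis by (subst avg_scaleR) (simp add: avg_avg[OF q] msize_def c_def mult.commute)
  qed
  \<comment> \<open>The induction hypothesis for the operators already averaged over
    \<open>s\<close>: each subset \<open>S\<close> of \<open>V\<close> contributes the term of
    \<open>insert s S\<close>.\<close>
  have 2: "Ex C (\<lambda>X. G (\<Sum>m\<in>PiE V Ms. c *\<^sub>R avg I q {s} A (X m)))
    \<le> Ex q (\<lambda>\<omega>. G (msize Ms (insert s V) *\<^sub>R avg I q (insert s V) A \<omega>))
      + (\<Sum>S | S \<subset> V. msize Ms (V - S) * Ex q (\<lambda>\<omega>. H (msize Ms (insert s S) *\<^sub>R avg I q (insert s S) A \<omega>)))"
  proof -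
    have "psd (c *\<^sub>R avg I q {s} A \<omega>)" for \<omega> by (intro psd_scaleR psd_avg Cons.prems c0)
    then have "Ex C (\<lambda>X. G (\<Sum>m\<in>PiE V Ms. c *\<^sub>R avg I q {s} A (X m)))
      \<le> Ex q (\<lambda>\<omega>. G (msize Ms V *\<^sub>R avg I q V (\<lambda>\<omega>. c *\<^sub>R avg I q {s} A \<omega>) \<omega>))
        + (\<Sum>S | S \<subset> V. msize Ms (V - S) * Ex q (\<lambda>\<omega>. H (msize Ms S *\<^sub>R avg I q S (\<lambda>\<omega>. c *\<^sub>R avg I q {s} A \<omega>) \<omega>)))"
      unfolding C_def V_def using Cons.IH[where A = "\<lambda>\<omega>. c *\<^sub>R avg I q {s} A \<omega>", OF Cons.prems(1) _ dU] by blast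
    also have "(\<Sum>S | S \<subset> V. msize Ms (V - S) * Ex q (\<lambda>\<omega>. H (msize Ms S *\<^sub>R avg I q S (\<lambda>\<omega>. c *\<^sub>R avg I q {s} A \<omega>) \<omega>)))
      = (\<Sum>S | S \<subset> V. msize Ms (V - S) * Ex q (\<lambda>\<omega>. H (msize Ms (insert s S) *\<^sub>R avg I q (insert s S) A \<omega>)))"
      by (intro sum.cong refl) (simp add: ins less_imp_le)
    finally show ?thesis by (simp add: ins)
  qed
  have 3: "Ex C (\<lambda>X. H (\<Sum>m\<in>PiE V Ms. A (X m)))
    \<le> Ex q (\<lambda>\<omega>. H (msize Ms V *\<^sub>R avg I q V A \<omega>))
      + (\<Sum>S | S \<subset> V. msize Ms (V - S) * Ex q (\<lambda>\<omega>. H (msize Ms S *\<^sub>R avg I q S A \<omega>)))"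
    using Cons.IH[OF H Cons.prems(2) dU] unfolding C_def V_def[symmetric] .
  define h where "h S = Ex q (\<lambda>\<omega>. H (msize Ms S *\<^sub>R avg I q S A \<omega>))" for S
  have m1: "msize Ms (insert s V - insert s S) = msize Ms (V - S)" for S
    using sV by (intro arg_cong[of _ _ "msize Ms"]) auto
  have m2: "msize Ms (insert s V - S) = c * msize Ms (V - S)" if "S \<subseteq> V" for S
  proof -
    have "insert s V - S = insert s (V - S)" using that sV by auto
    then show ?thesis using sV by (simp add: msize_def c_def)
  qed
  have "(\<Sum>S | S \<subset> insert s V. msize Ms (insert s V - S) * h S)
    = (\<Sum>S | S \<subset> V. msize Ms (V - S) * h (insert s S)) + (c * h V + (\<Sum>S | S \<subset> V. c * msize Ms (V - S) * h S))"
  proof -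
    have a: "(\<Sum>S | S \<subset> V. msize Ms (insert s V - insert s S) * h (insert s S)) = (\<Sum>S | S \<subset> V. msize Ms (V - S) * h (insert s S))"
      unfolding m1 ..
    have b: "(\<Sum>S | S \<subset> V. msize Ms (insert s V - S) * h S) = (\<Sum>S | S \<subset> V. c * msize Ms (V - S) * h S)"
    proof (intro sum.cong refl)
      fix S assume "S \<in> {S. S \<subset> V}"
      then have "S \<subseteq> V" by auto
      then show "msize Ms (insert s V - S) * h S = c * msize Ms (V - S) * h S" by (simp only: m2)
    qed
    have "msize Ms (insert s V - V) = c" using m2[of V] by (simp add: msize_def)
    then show ?thesis unfolding sum_strict_subsets_insert[OF sV] a b by simp
  qed
  also have "\<dots> = (\<Sum>S | S \<subset> V. msize Ms (V - S) * h (insert s S)) + c * (h V + (\<Sum>S | S \<subset> V. msize Ms (V - S) * h S))"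
    by (simp add: distrib_left sum_distrib_left mult.assoc)
  finally show ?case
    using main 2 mult_left_mono[OF 3 c0] unfolding h_def V_def by simp
qed

section \<open>The step inequality for the functionals in use\<close>

lemma step_phi: "step TYPE('y) (phi 1) (phi 1)"
  unfolding step_def Ex_def
proof (intro allI impI)
  fix p :: "'y pmf" and Z :: "'y \<Rightarrow> 'a op" and X :: "'a op"
  assume "finite (set_pmf p)" "psd X" "\<forall>y\<in>set_pmf p. psd (Z y)"
  then show "(\<Sum>a\<in>set_pmf p. pmf p a *\<^sub>R phi 1 (X + Z a))
    \<le> phi 1 (X + (\<Sum>a\<in>set_pmf p. pmf p a *\<^sub>R Z a)) + (\<Sum>a\<in>set_pmf p. pmf p a *\<^sub>R phi 1 (Z a))"
    using phi_step[of "set_pmf p" "pmf p" X Z 1] by (simp add: sum_pmf)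
qed

lemma step_npow:
  assumes p: "1 < p" "p < 2"
  shows "step TYPE('y) (npow p) (npow p)"
  unfolding step_def Ex_def
proof (intro allI impI)
  fix q :: "'y pmf" and Z :: "'y \<Rightarrow> 'a op" and X :: "'a op"
  assume "finite (set_pmf q)" "psd X" "\<forall>y\<in>set_pmf q. psd (Z y)"
  then show "(\<Sum>a\<in>set_pmf q. pmf q a *\<^sub>R npow p (X + Z a))
    \<le> npow p (X + (\<Sum>a\<in>set_pmf q. pmf q a *\<^sub>R Z a)) + (\<Sum>a\<in>set_pmf q. pmf q a *\<^sub>R npow p (Z a))"
    using npow_step_psd[of "set_pmf q" "pmf q" X Z p] p by (simp add: sum_pmf)
qed

lemma step_double:
  assumes "step y H H"
  shows "step y (\<lambda>A. 2 * H A) (\<lambda>A. 2 * H A)"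
  unfolding step_def Ex_cmult
proof (intro allI impI)
  fix p :: "'a pmf" and Z :: "'a \<Rightarrow> 'b op" and X :: "'b op"
  assume "finite (set_pmf p)" "psd X" "\<forall>y\<in>set_pmf p. psd (Z y)"
  then have "Ex p (\<lambda>y. H (X + Z y)) \<le> H (X + Ex p Z) + Ex p (\<lambda>y. H (Z y))"
    using assms by (simp add: step_def)
  then show "2 * Ex p (\<lambda>y. H (X + Z y)) \<le> 2 * H (X + Ex p Z) + 2 * Ex p (\<lambda>y. H (Z y))"
    by linarith
qed

text \<open>Subtracting \<open>C\<close> destroys positivity, so the factor 2 of symmetrisation
  appears. It sits in the second functional, which passes through later steps by
  \<open>step_double\<close> without doubling again.\<close>

lemma step_npow_centred:
  assumes p: "1 < p" "p < 2" and C: "hermitian C"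
  shows "step TYPE('y) (\<lambda>A. npow p (A - C)) (\<lambda>A. 2 * npow p A)"
  unfolding step_def Ex_def
proof (intro allI impI)
  fix q :: "'y pmf" and Z :: "'y \<Rightarrow> 'a op" and X :: "'a op"
  assume a: "finite (set_pmf q)" "psd X" "\<forall>y\<in>set_pmf q. psd (Z y)"
  have e: "X + B - C = (X - C) + B" for B by simp
  show "(\<Sum>a\<in>set_pmf q. pmf q a *\<^sub>R npow p (X + Z a - C))
    \<le> npow p (X + (\<Sum>a\<in>set_pmf q. pmf q a *\<^sub>R Z a) - C) + (\<Sum>a\<in>set_pmf q. pmf q a *\<^sub>R (2 * npow p (Z a)))"
    unfolding e using npow_step[of "set_pmf q" "pmf q" "X - C" Z p] p a C
    by (simp add: sum_pmf herm_diff psd_herm sum_distrib_left mult_ac)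
qed


section \<open>Words from seeds\<close>

text \<open>The recursion runs along strict inclusion of message sets. The value
  \<open>undefined\<close> off the descendants makes the argument of a response equal to the
  restricted word used in \<open>joint_law\<close>.\<close>

function word :: "('t::finite \<Rightarrow> 's::finite set) \<Rightarrow> ('t \<Rightarrow> ('t \<Rightarrow> 'c) \<Rightarrow> 'c) \<Rightarrow> 't \<Rightarrow> 'c" where
  "word I \<omega> t = \<omega> t (\<lambda>t'. if I t' \<subset> I t then word I \<omega> t' else undefined)"
  by pat_completeness auto
termination
  by (relation "Wellfounded.measure (\<lambda>(I, \<omega>, t). card (I t))") (auto intro: psubset_card_mono)

declare word.simps [simp del]

lemma word_restrict: "word I \<omega> t = \<omega> t (restrict (word I \<omega>) (descendants I t))"
proof -
  have "(\<lambda>t'. if I t' \<subset> I t then word I \<omega> t' else undefined) = restrict (word I \<omega>) (descendants I t)"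
    by (auto simp: descendants_def restrict_def)
  then show ?thesis by (subst word.simps) simp
qed

lemma descendants_induct:
  fixes I :: "'t::finite \<Rightarrow> 's::finite set"
  assumes "\<And>t. (\<And>t'. t' \<in> descendants I t \<Longrightarrow> Q t') \<Longrightarrow> Q t"
  shows "Q t"
proof (induction "card (I t)" arbitrary: t rule: less_induct)
  case less
  show ?case
  proof (rule assms)
    fix t' assume "t' \<in> descendants I t"
    then have "card (I t') < card (I t)" by (auto simp: descendants_def intro: psubset_card_mono)
    then show "Q t'" using less by blast
  qed
qed

lemma word_cong:
  fixes I :: "'t::finite \<Rightarrow> 's::finite set"
  assumes "\<And>t'. I t' \<subseteq> I t \<Longrightarrow> \<omega> t' = \<omega>' t'"
  shows "word I \<omega> t = word I \<omega>' t"
  using assms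
proof (induction t rule: descendants_induct[where I = I])
  case (1 t)
  have "word I \<omega> t' = word I \<omega>' t'" if "t' \<in> descendants I t" for t'
  proof (rule 1(1)[OF that])
    fix t'' assume "I t'' \<subseteq> I t'"
    then have "I t'' \<subseteq> I t" using that by (auto simp: descendants_def)
    then show "\<omega> t'' = \<omega>' t''" by (rule 1(2))
  qed
  then have "restrict (word I \<omega>) (descendants I t) = restrict (word I \<omega>') (descendants I t)"
    by (auto simp: restrict_def)
  then show ?case using 1(2)[of t] by (simp add: word_restrict[of I _ t])
qed

lemma word_unique:
  fixes I :: "'t::finite \<Rightarrow> 's::finite set"
  shows "word I \<omega> = x \<longleftrightarrow> (\<forall>t. \<omega> t (restrict x (descendants I t)) = x t)"
proof
  assume "word I \<omega> = x"
  then show "\<forall>t. \<omega> t (restrict x (descendants I t)) = x t" using word_restrict[of I \<omega>] by auto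
next
  assume x: "\<forall>t. \<omega> t (restrict x (descendants I t)) = x t"
  have "word I \<omega> t = x t" for t
  proof (induction t rule: descendants_induct[where I = I])
    case (1 t)
    then have "restrict (word I \<omega>) (descendants I t) = restrict x (descendants I t)"
      by (auto simp: restrict_def)
    then show ?case using x by (simp add: word_restrict[of I _ t])
  qed
  then show "word I \<omega> = x" by auto
qed

text \<open>For illegal symbols of the descendants \<open>p\<close> need not be a probability law,
  so a point mass takes its place.\<close>

definition symbol_pmf :: "('t::finite \<Rightarrow> 's::finite set) \<Rightarrow> ('t \<Rightarrow> 'c::finite set) \<Rightarrow>
    ('t \<Rightarrow> 'c \<Rightarrow> ('t \<Rightarrow> 'c) \<Rightarrow> real) \<Rightarrow> 't \<Rightarrow> ('t \<Rightarrow> 'c) \<Rightarrow> 'c pmf" where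
  "symbol_pmf I L p t y = (if y \<in> Pi\<^sub>E (descendants I t) L
    then embed_pmf (\<lambda>a. if a \<in> L t then p t a y else 0) else return_pmf undefined)"

lemma pmf_symbol:
  assumes p: "conditional_laws I L p" and y: "y \<in> Pi\<^sub>E (descendants I t) L"
  shows "pmf (symbol_pmf I L p t y) a = (if a \<in> L t then p t a y else 0)"
proof -
  have p0: "\<And>a. a \<in> L t \<Longrightarrow> 0 \<le> p t a y" and p1: "(\<Sum>a\<in>L t. p t a y) = 1"
    using p y by (auto simp: conditional_laws_def)
  have "(\<integral>\<^sup>+a. ennreal (if a \<in> L t then p t a y else 0) \<partial>count_space UNIV)
    = (\<Sum>a\<in>UNIV. ennreal (if a \<in> L t then p t a y else 0))"
    by (rule nn_integral_count_space_finite) simp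
  also have "\<dots> = ennreal (\<Sum>a\<in>UNIV. if a \<in> L t then p t a y else 0)"
    using p0 by (intro sum_ennreal) auto
  also have "(\<Sum>a\<in>UNIV. if a \<in> L t then p t a y else 0) = 1"
    by (simp add: sum.If_cases p1)
  finally have "pmf (embed_pmf (\<lambda>a. if a \<in> L t then p t a y else 0)) a = (if a \<in> L t then p t a y else 0)"
    using p0 by (intro pmf_embed_pmf) auto
  then show ?thesis using y by (simp add: symbol_pmf_def)
qed

text \<open>The seed of a transmitter is a response function: its symbol given the symbols of its descendants.
  Unlike the symbols of a word, the seeds are independent.\<close>

definition seeds :: "('t::finite \<Rightarrow> 's::finite set) \<Rightarrow> ('t \<Rightarrow> 'c::finite set) \<Rightarrow>
    ('t \<Rightarrow> 'c \<Rightarrow> ('t \<Rightarrow> 'c) \<Rightarrow> real) \<Rightarrow> ('t \<Rightarrow> ('t \<Rightarrow> 'c) \<Rightarrow> 'c) pmf" where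
  "seeds I L p = Pi_pmf UNIV undefined (\<lambda>t. Pi_pmf UNIV undefined (symbol_pmf I L p t))"

lemma mergeable_seeds: "mergeable (seeds I L p)"
  unfolding seeds_def by (intro mergeable_Pi_pmf finite_set_Pi_pmf) auto

lemma finite_seeds: "finite (set_pmf (seeds I L p))"
  using mergeable_seeds by (auto simp: mergeable_def)

text \<open>By \<open>word_unique\<close>, a word arises exactly if each response is correct at the
  single argument that the word prescribes. Responses of different transmitters are independent, so
  the probability factorises.\<close>

lemma word_law:
  assumes p: "conditional_laws I L p"
  shows "pmf (map_pmf (word I) (seeds I L p)) x = joint_law I L p x"
proof -
  have "pmf (map_pmf (word I) (seeds I L p)) x = measure_pmf.prob (seeds I L p) {\<omega>. word I \<omega> = x}"
    by (simp add: pmf_map vimage_def)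
  also have "{\<omega>. word I \<omega> = x} = Pi UNIV (\<lambda>t. {g. g (restrict x (descendants I t)) = x t})"
    by (auto simp: word_unique)
  also have "measure_pmf.prob (seeds I L p) \<dots>
    = (\<Prod>t\<in>UNIV. measure_pmf.prob (Pi_pmf UNIV undefined (symbol_pmf I L p t)) {g. g (restrict x (descendants I t)) = x t})"
    unfolding seeds_def by (rule measure_Pi_pmf_Pi) simp
  also have "\<dots> = (\<Prod>t\<in>UNIV. pmf (symbol_pmf I L p t (restrict x (descendants I t))) (x t))"
  proof (intro prod.cong refl)
    fix t
    let ?y = "restrict x (descendants I t)"
    have "measure_pmf.prob (Pi_pmf UNIV undefined (symbol_pmf I L p t)) {g. g ?y = x t}
      = pmf (map_pmf (\<lambda>g. g ?y) (Pi_pmf UNIV undefined (symbol_pmf I L p t))) (x t)"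
      by (simp add: pmf_map vimage_def)
    then show "measure_pmf.prob (Pi_pmf UNIV undefined (symbol_pmf I L p t)) {g. g ?y = x t} = pmf (symbol_pmf I L p t ?y) (x t)"
      by (simp add: Pi_pmf_component)
  qed
  also have "\<dots> = joint_law I L p x"
  proof (cases "\<forall>t. x t \<in> L t")
    case True
    then have "restrict x (descendants I t) \<in> Pi\<^sub>E (descendants I t) L" for t by auto
    then show ?thesis using True by (simp add: joint_law_def pmf_symbol[OF p])
  next
    case False
    \<comment> \<open>A minimal transmitter with an illegal symbol: its argument is legal, so its
      factor is governed by \<open>p\<close> and equals 0.\<close>
    have "\<exists>t. x t \<notin> L t \<and> (\<forall>t'\<in>descendants I t. x t' \<in> L t')"
    proof (rule ccontr)
      assume n: "\<not> ?thesis"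
      have "x t \<in> L t" for t
        by (induction t rule: descendants_induct[where I = I]) (use n in auto)
      then show False using False by blast
    qed
    then obtain t where t: "x t \<notin> L t" "\<forall>t'\<in>descendants I t. x t' \<in> L t'" by blast
    then have "restrict x (descendants I t) \<in> Pi\<^sub>E (descendants I t) L" by auto
    then have "pmf (symbol_pmf I L p t (restrict x (descendants I t))) (x t) = 0"
      using t by (simp add: pmf_symbol[OF p])
    then have "(\<Prod>t\<in>UNIV. pmf (symbol_pmf I L p t (restrict x (descendants I t))) (x t)) = 0"
      by (intro prod_zero) auto
    then show ?thesis by (simp only: joint_law_def False if_False)
  qed
  finally show ?thesis .
qed

lemma Ex_word:
  fixes f :: "('t::finite \<Rightarrow> 'c::finite) \<Rightarrow> 'b::{banach, second_countable_topology}"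
  assumes p: "conditional_laws I L p"
  shows "Ex (seeds I L p) (\<lambda>\<omega>. f (word I \<omega>)) = (\<Sum>x\<in>UNIV. joint_law I L p x *\<^sub>R f x)"
proof -
  have "Ex (seeds I L p) (\<lambda>\<omega>. f (word I \<omega>)) = Ex (map_pmf (word I) (seeds I L p)) f"
    by (simp add: Ex_map finite_seeds)
  also have "\<dots> = (\<Sum>x\<in>UNIV. pmf (map_pmf (word I) (seeds I L p)) x *\<^sub>R f x)"
    unfolding Ex_def by (intro sum.mono_neutral_left) (auto simp: pmf_eq_0_set_pmf)
  finally show ?thesis by (simp add: word_law[OF p])
qed

lemma joint_law_pos_word:
  assumes p: "conditional_laws I L p" and "\<omega> \<in> set_pmf (seeds I L p)"
  shows "0 < joint_law I L p (word I \<omega>)"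
proof -
  have "word I \<omega> \<in> set_pmf (map_pmf (word I) (seeds I L p))" using assms by simp
  then show ?thesis by (metis word_law[OF p] pmf_positive)
qed

lemma joint_law_nonneg:
  fixes L :: "'t::finite \<Rightarrow> 'c::finite set"
  shows "conditional_laws I L p \<Longrightarrow> 0 \<le> joint_law I L p x"
  by (metis word_law pmf_nonneg)

lemma joint_law_sum:
  fixes L :: "'t::finite \<Rightarrow> 'c::finite set"
  shows "conditional_laws I L p \<Longrightarrow> (\<Sum>x\<in>UNIV. joint_law I L p x) = 1"
  using Ex_word[of I L p "\<lambda>_. 1 :: real"] by (simp add: Ex_const finite_seeds)

lemma word_in:
  assumes "conditional_laws I L p" "\<omega> \<in> set_pmf (seeds I L p)"
  shows "word I \<omega> t \<in> L t"
  using joint_law_pos_word[OF assms] by (auto simp: joint_law_def split: if_splits)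

text \<open>A transmitter that does not meet \<open>S\<close> has no descendants that do, so its
  symbol depends on untouched seeds only.\<close>

lemma word_merge_outside:
  fixes I :: "'t::finite \<Rightarrow> 's::finite set"
  assumes "t \<notin> transmitters_meeting I S"
  shows "word I (merge (transmitters_meeting I S) \<omega> \<omega>') t = word I \<omega> t"
  using assms by (intro word_cong) (auto simp: merge_def transmitters_meeting_def)

text \<open>Seeds that are kept influence the new word only through the symbols they produced. This
  turns conditioning on seeds into conditioning on symbols.\<close>

lemma word_merge_eq:
  fixes I :: "'t::finite \<Rightarrow> 's::finite set"
  defines "J \<equiv> \<lambda>S. transmitters_meeting I S"
  assumes "restrict (word I \<omega>) (- J S) = restrict (word I \<omega>0) (- J S)"
  shows "word I (merge (J S) \<omega> \<omega>') = word I (merge (J S) \<omega>0 \<omega>')"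
proof
  fix t
  show "word I (merge (J S) \<omega> \<omega>') t = word I (merge (J S) \<omega>0 \<omega>') t"
  proof (induction t rule: descendants_induct[where I = I])
    case (1 t)
    show ?case
    proof (cases "t \<in> J S")
      case True
      have "restrict (word I (merge (J S) \<omega> \<omega>')) (descendants I t) = restrict (word I (merge (J S) \<omega>0 \<omega>')) (descendants I t)"
        using 1 by (auto simp: restrict_def)
      then show ?thesis using True by (simp add: word_restrict[of I _ t] merge_def)
    next
      case False
      then have "word I \<omega> t = word I \<omega>0 t" using fun_cong[OF assms(2), of t] by simp
      then show ?thesis using False unfolding J_def by (simp add: word_merge_outside)
    qed
  qed
qed

text \<open>Redrawing preserves the law of the seeds and the event that \<open>f\<close> has the
  given value. On this event the redrawn average is constant by \<open>word_merge_eq\<close>, hence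
  equal to the conditional state.\<close>

lemma avg_word:
  fixes W :: "('t::finite \<Rightarrow> 'c::finite) \<Rightarrow> 'n::finite op"
    and I :: "'t \<Rightarrow> 's::finite set" and S :: "'s set"
  assumes p: "conditional_laws I L p" and w0: "\<omega>0 \<in> set_pmf (seeds I L p)"
  defines "f \<equiv> \<lambda>x. restrict x (- transmitters_meeting I S)"
  shows "avg I (seeds I L p) S (\<lambda>\<omega>. W (word I \<omega>)) \<omega>0 = cond_state (joint_law I L p) W f (f (word I \<omega>0))"
    and "0 < law_of (joint_law I L p) f (f (word I \<omega>0))"
proof -
  define q where "q = seeds I L p"
  define y where "y = f (word I \<omega>0)"
  define J where "J = transmitters_meeting I S"
  define P where "P = joint_law I L p"
  define a where "a = avg I q S (\<lambda>\<omega>. W (word I \<omega>)) \<omega>0"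
  have ind: "(\<Sum>x | f x = y. P x *\<^sub>R g x) = (\<Sum>x\<in>UNIV. P x *\<^sub>R (of_bool (f x = y) *\<^sub>R g x))" for g :: "_ \<Rightarrow> 'n op"
    by (intro sum.mono_neutral_cong_left) auto
  have law: "law_of P f y = Ex q (\<lambda>\<omega>. of_bool (f (word I \<omega>) = y))"
  proof -
    have "Ex q (\<lambda>\<omega>. of_bool (f (word I \<omega>) = y) :: real) = (\<Sum>x\<in>UNIV. P x *\<^sub>R of_bool (f x = y))"
      unfolding q_def P_def by (rule Ex_word[OF p])
    also have "\<dots> = (\<Sum>x | f x = y. P x)" by (intro sum.mono_neutral_cong_right) auto
    finally show ?thesis by (simp add: law_of_def)
  qed
  have "(\<Sum>x | f x = y. P x *\<^sub>R W x) = Ex q (\<lambda>\<omega>. of_bool (f (word I \<omega>) = y) *\<^sub>R W (word I \<omega>))"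
    unfolding ind unfolding q_def P_def by (rule Ex_word[OF p, symmetric])
  also have "\<dots> = Ex q (\<lambda>\<omega>. Ex q (\<lambda>\<omega>'. of_bool (f (word I (merge J \<omega> \<omega>')) = y) *\<^sub>R W (word I (merge J \<omega> \<omega>'))))"
    unfolding q_def by (rule Ex_merge[OF mergeable_seeds, symmetric])
  also have "\<dots> = Ex q (\<lambda>\<omega>. of_bool (f (word I \<omega>) = y) *\<^sub>R a)"
  proof (intro Ex_cong)
    fix \<omega>
    have f: "f (word I (merge J \<omega> \<omega>')) = f (word I \<omega>)" for \<omega>'
      by (auto simp: f_def J_def restrict_def word_merge_outside)
    have "W (word I (merge J \<omega> \<omega>')) = W (word I (merge J \<omega>0 \<omega>'))" if "f (word I \<omega>) = y" for \<omega>'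
      using word_merge_eq[of I \<omega> S \<omega>0 \<omega>'] that by (simp add: f_def y_def J_def)
    then show "Ex q (\<lambda>\<omega>'. of_bool (f (word I (merge J \<omega> \<omega>')) = y) *\<^sub>R W (word I (merge J \<omega> \<omega>')))
        = of_bool (f (word I \<omega>) = y) *\<^sub>R a"
      unfolding f by (cases "f (word I \<omega>) = y") (simp_all add: a_def avg_def J_def Ex_const finite_seeds q_def)
  qed
  also have "\<dots> = law_of P f y *\<^sub>R a"
    unfolding law by (simp only: Ex_def real_scaleR_def scaleR_scaleR scaleR_left.sum)
  finally have main: "(\<Sum>x | f x = y. P x *\<^sub>R W x) = law_of P f y *\<^sub>R a" .
  have "P (word I \<omega>0) \<le> law_of P f y"
    unfolding law_of_def by (rule member_le_sum) (auto simp: y_def P_def joint_law_nonneg[OF p])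
  then have pos: "0 < law_of P f y" using joint_law_pos_word[OF p w0] by (simp add: P_def)
  then have "cond_state P W f y = a" by (simp add: cond_state_def main)
  then show "avg I (seeds I L p) S (\<lambda>\<omega>. W (word I \<omega>)) \<omega>0 = cond_state (joint_law I L p) W f (f (word I \<omega>0))"
    by (simp add: a_def q_def P_def y_def)
  show "0 < law_of (joint_law I L p) f (f (word I \<omega>0))" using pos by (simp add: P_def y_def)
qed

lemma codebook_support:
  assumes q: "mergeable q" and Ms: "\<And>s. finite (Ms s)"
  shows "X \<in> set_pmf (codebook I Ms q U) \<Longrightarrow> (\<And>s. s \<in> set U \<Longrightarrow> m s \<in> Ms s) \<Longrightarrow> X m \<in> set_pmf q"
proof (induction U arbitrary: X)
  case Nil
  then show ?case by auto
next
  case (Cons s U)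
  then obtain X0 Y where X: "X = (\<lambda>m. merge (transmitters_meeting I {s}) (X0 m) (Y (m s) m))"
    and X0: "X0 \<in> set_pmf (codebook I Ms q U)"
    and Y: "Y \<in> set_pmf (Pi_pmf (Ms s) (\<lambda>_ _. undefined) (\<lambda>_. codebook I Ms q U))"
    by auto
  have "Y (m s) \<in> set_pmf (codebook I Ms q U)"
    using Y Cons.prems(2)[of s] unfolding set_Pi_pmf[OF Ms] by (auto simp: PiE_dflt_def)
  then have "X0 m \<in> set_pmf q" "Y (m s) m \<in> set_pmf q"
    using Cons.IH X0 Cons.prems(2) by auto
  then have "X m \<in> set_pmf (map_pmf (\<lambda>(a, b). merge (transmitters_meeting I {s}) a b) (pair_pmf q q))"
    by (auto simp: X)
  moreover have "map_pmf (\<lambda>(a, b). merge (transmitters_meeting I {s}) a b) (pair_pmf q q) = q"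
    using q unfolding mergeable_def by blast
  ultimately show ?case by (simp only:)
qed

section \<open>States\<close>

lemma Tensor_mult: "Tensor A ** Tensor B = Tensor (\<lambda>t. A t ** B t)"
proof -
  have "(\<Sum>k\<in>UNIV. (\<Prod>t\<in>UNIV. A t $ i t $ k t) * (\<Prod>t\<in>UNIV. B t $ k t $ j t))
    = (\<Prod>t\<in>UNIV. \<Sum>k\<in>UNIV. A t $ i t $ k * B t $ k $ j t)" for i j :: "'a \<Rightarrow> 'b"
    using prod_sum_PiE[of "UNIV :: 'a set" "\<lambda>_. UNIV" "\<lambda>t k. A t $ i t $ k * B t $ k $ j t"]
    by (simp add: prod.distrib PiE_UNIV_domain)
  then show ?thesis by (simp add: vec_eq_iff Tensor_def matrix_matrix_mult_def)
qed

lemma dagger_Tensor: "dagger (Tensor A) = Tensor (\<lambda>t. dagger (A t))"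
  by (simp add: dagger_def Tensor_def)

lemma psd_Tensor:
  assumes "\<And>t. psd (A t)"
  shows "psd (Tensor A)"
proof -
  have "Tensor A = dagger (Tensor (\<lambda>t. hfun sqrt (A t))) ** Tensor (\<lambda>t. hfun sqrt (A t))"
    using assms hfun_herm[OF psd_herm[OF assms], of sqrt]
    by (simp add: dagger_Tensor Tensor_mult sqrt_mult hermitian_def)
  then show ?thesis by (simp add: psd_square)
qed

lemma trace_Tensor: "trace (Tensor A) = (\<Prod>t\<in>UNIV. trace (A t))"
  using prod_sum_PiE[of "UNIV :: 'a set" "\<lambda>_. UNIV" "\<lambda>t k. A t $ k $ k"]
  by (simp add: trace_def Tensor_def PiE_UNIV_domain)

lemma Tensor_operators_on:
  assumes "\<And>t. A t \<in> operators_on (H t)"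
  shows "Tensor A \<in> operators_on {k. \<forall>t. k t \<in> H t}"
proof -
  have "i t \<in> H t \<and> j t \<in> H t" if "(\<Prod>t\<in>UNIV. A t $ i t $ j t) \<noteq> 0" for i j t
  proof -
    have "A t $ i t $ j t \<noteq> 0" using that by auto
    then show ?thesis using assms[of t] by (auto simp: operators_on_def)
  qed
  then show ?thesis by (auto simp: operators_on_def Tensor_def)
qed

text \<open>Positivity of \<open>N A\<close> is the case of a single block in complete
  positivity.\<close>

lemma cptp_density:
  assumes N: "cptp_on K N" and A: "A \<in> operators_on K" "density_op A"
  shows "density_op (N A)"
proof -
  have "block_psd 1 (\<lambda>_ _. A)" using A by (auto simp: block_psd_def density_op_def psd_def hermitian_def)
  moreover have "\<And>n X. (\<forall>k<n. \<forall>l<n. X k l \<in> operators_on K) \<Longrightarrow> block_psd n X \<Longrightarrow> block_psd n (\<lambda>k l. N (X k l))"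
    using N unfolding cptp_on_def by blast
  ultimately have "block_psd 1 (\<lambda>_ _. N A)" using A by simp
  then have b: "N A = dagger (N A)" "\<And>v :: nat \<Rightarrow> _. 0 \<le> v 0 \<bullet> (N A *v v 0)" by (auto simp: block_psd_def)
  have "0 \<le> v \<bullet> (N A *v v)" for v using b(2)[of "\<lambda>_. v"] .
  then have "psd (N A)" using b(1) by (simp add: psd_def hermitian_def)
  moreover have "trace (N A) = 1" using N A by (simp add: cptp_on_def density_op_def)
  ultimately show ?thesis by (simp add: density_op_def)
qed

section \<open>Partial traces of states\<close>

lemma sum_UNIV_pair: "(\<Sum>p\<in>UNIV. f p) = (\<Sum>i\<in>UNIV. \<Sum>k\<in>UNIV. f (i, k))"
  by (simp add: sum.cartesian_product split_def)

lemma inner_mult_vec: "v \<bullet> (A *v v) = Re (\<Sum>i\<in>UNIV. \<Sum>j\<in>UNIV. cnj (v $ i) * A $ i $ j * v $ j)"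
  by (simp add: inner_eq_Re_cinner cinner_def matrix_vector_mult_def sum_distrib_left mult.assoc)

lemma psd_tr_snd:
  fixes A :: "('b::finite \<times> 'e::finite) op"
  assumes A: "psd A"
  shows "psd (tr_snd A)"
  unfolding psd_def
proof (intro conjI allI)
  have h: "cnj (A $ q $ p) = A $ p $ q" for p q
  proof -
    have "dagger A $ p $ q = cnj (A $ q $ p)" by (simp add: dagger_def)
    moreover have "dagger A = A" using A by (simp add: psd_def hermitian_def)
    ultimately show ?thesis by simp
  qed
  show "hermitian (tr_snd A)" by (simp add: hermitian_def dagger_def tr_snd_def vec_eq_iff h)
  fix v :: "complex^'b"
  define w :: "'e \<Rightarrow> complex^('b \<times> 'e)" where "w k = (\<chi> p. if snd p = k then v $ fst p else 0)" for k
  have "w k \<bullet> (A *v w k) = Re (\<Sum>i\<in>UNIV. \<Sum>j\<in>UNIV. cnj (v $ i) * A $ (i, k) $ (j, k) * v $ j)" for k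
  proof -
    have "(\<Sum>j\<in>UNIV. \<Sum>b\<in>UNIV. cnj (w k $ (i, a)) * A $ (i, a) $ (j, b) * w k $ (j, b))
      = (if a = k then \<Sum>j\<in>UNIV. cnj (v $ i) * A $ (i, k) $ (j, k) * v $ j else 0)" for i a
      by (cases "a = k") (simp_all add: w_def mult_delta_right)
    then show ?thesis unfolding inner_mult_vec sum_UNIV_pair by (simp only: sum.delta finite UNIV_I if_True)
  qed
  then have "v \<bullet> (tr_snd A *v v) = (\<Sum>k\<in>UNIV. w k \<bullet> (A *v w k))"
    unfolding inner_mult_vec
    by (simp only: tr_snd_def vec_lambda_beta sum_distrib_left sum_distrib_right Re_sum[symmetric])
      (subst sum.swap[of _ UNIV "UNIV :: 'e set"], subst sum.swap[of _ "UNIV :: 'e set" UNIV], rule refl)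
  then show "0 \<le> v \<bullet> (tr_snd A *v v)" using A by (simp add: psd_def sum_nonneg)
qed

lemma psd_tr_fst:
  fixes A :: "('b::finite \<times> 'e::finite) op"
  assumes A: "psd A"
  shows "psd (tr_fst A)"
  unfolding psd_def
proof (intro conjI allI)
  have h: "cnj (A $ q $ p) = A $ p $ q" for p q
  proof -
    have "dagger A $ p $ q = cnj (A $ q $ p)" by (simp add: dagger_def)
    moreover have "dagger A = A" using A by (simp add: psd_def hermitian_def)
    ultimately show ?thesis by simp
  qed
  show "hermitian (tr_fst A)" by (simp add: hermitian_def dagger_def tr_fst_def vec_eq_iff h)
  fix v :: "complex^'e"
  define w :: "'b \<Rightarrow> complex^('b \<times> 'e)" where "w k = (\<chi> p. if fst p = k then v $ snd p else 0)" for k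
  have "w k \<bullet> (A *v w k) = Re (\<Sum>i\<in>UNIV. \<Sum>j\<in>UNIV. cnj (v $ i) * A $ (k, i) $ (k, j) * v $ j)" for k
  proof -
    have "(\<Sum>b\<in>UNIV. \<Sum>j\<in>UNIV. cnj (w k $ (a, i)) * A $ (a, i) $ (b, j) * w k $ (b, j))
      = (if a = k then \<Sum>j\<in>UNIV. cnj (v $ i) * A $ (k, i) $ (k, j) * v $ j else 0)" for i a
      by (subst sum.swap, cases "a = k") (simp_all add: w_def mult_delta_right)
    then show ?thesis unfolding inner_mult_vec sum_UNIV_pair
      by (subst sum.swap) (simp only: sum.delta finite UNIV_I if_True)
  qed
  then have "v \<bullet> (tr_fst A *v v) = (\<Sum>k\<in>UNIV. w k \<bullet> (A *v w k))"
    unfolding inner_mult_vec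
    by (simp only: tr_fst_def vec_lambda_beta sum_distrib_left sum_distrib_right Re_sum[symmetric])
      (subst sum.swap[of _ UNIV "UNIV :: 'b set"], subst sum.swap[of _ "UNIV :: 'b set" UNIV], rule refl)
  then show "0 \<le> v \<bullet> (tr_fst A *v v)" using A by (simp add: psd_def sum_nonneg)
qed

lemma trace_tr_snd: "trace (tr_snd A) = trace A"
  by (simp add: trace_def tr_snd_def sum_UNIV_pair)

lemma trace_tr_fst: "trace (tr_fst A) = trace A"
  unfolding trace_def tr_fst_def sum_UNIV_pair by (subst sum.swap) simp

lemma density_tr_snd: "density_op A \<Longrightarrow> density_op (tr_snd A)"
  by (simp add: density_op_def psd_tr_snd trace_tr_snd)

lemma density_tr_fst: "density_op A \<Longrightarrow> density_op (tr_fst A)"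
  by (simp add: density_op_def psd_tr_fst trace_tr_fst)

lemma word_output_density:
  assumes N: "cptp_on {k. \<forall>t. k t \<in> H t} N" and \<theta>: "\<forall>t. \<forall>x \<in> X t. \<theta> t x \<in> densities_on (H t)"
    and x: "\<And>t. fst (x t) \<in> X t"
  shows "density_op (word_output N \<theta> x)"
  unfolding word_output_def
proof (rule cptp_density[OF N])
  have d: "\<theta> t (fst (x t)) \<in> densities_on (H t)" for t using \<theta> x by blast
  then show "Tensor (\<lambda>t. \<theta> t (fst (x t))) \<in> operators_on {k. \<forall>t. k t \<in> H t}"
    by (intro Tensor_operators_on) (auto simp: densities_on_def)
  show "density_op (Tensor (\<lambda>t. \<theta> t (fst (x t))))"
    using d by (auto simp: density_op_def densities_on_def trace_Tensor intro: psd_Tensor)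
qed


section \<open>Evaluation of the Renyi quantities\<close>

text \<open>Classical registers make the states block diagonal, so functions and traces of them are
  computed blockwise.\<close>

definition blk :: "('x::finite \<Rightarrow> 'b::finite op) \<Rightarrow> ('x \<times> 'b) op" where
  "blk V = (\<chi> p r. if fst p = fst r then V (fst p) $ snd p $ snd r else 0)"

lemma blk_mult: "blk V ** blk W = blk (\<lambda>x. V x ** W x)"
proof -
  have "(\<Sum>r\<in>UNIV. blk V $ (x, i) $ r * blk W $ r $ (y, j)) = blk (\<lambda>x. V x ** W x) $ (x, i) $ (y, j)" for x i y j
  proof -
    have "(\<Sum>b\<in>UNIV. blk V $ (x, i) $ (a, b) * blk W $ (a, b) $ (y, j))
      = (if a = x then if x = y then \<Sum>b\<in>UNIV. V x $ i $ b * W x $ b $ j else 0 else 0)" for a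
      by (cases "a = x"; cases "x = y") (auto simp: blk_def)
    then show ?thesis
      unfolding sum_UNIV_pair by (simp add: blk_def matrix_matrix_mult_def)
  qed
  then show ?thesis by (simp add: vec_eq_iff matrix_matrix_mult_def)
qed

lemma blk_dagger: "dagger (blk V) = blk (\<lambda>x. dagger (V x))"
  by (auto simp: blk_def dagger_def vec_eq_iff)

lemma blk_diagm: "blk (\<lambda>x. diagm (d x)) = diagm (\<lambda>p. d (fst p) (snd p))"
  by (auto simp: blk_def diagm_def vec_eq_iff)

lemma blk_one: "blk (\<lambda>x. mat 1) = mat 1"
  by (auto simp: blk_def mat_def vec_eq_iff)

lemma tr_blk: "tr (blk V) = (\<Sum>x\<in>UNIV. tr (V x))"
  by (simp add: tr_def trace_def sum_UNIV_pair blk_def)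

lemma hfun_blk:
  assumes V: "\<And>x. hermitian (V x)"
  shows "hfun f (blk V) = blk (\<lambda>x. hfun f (V x))"
proof -
  define U where "U = blk (\<lambda>x. eu (V x))"
  have U: "unitary U"
    using eu_unitary[OF V] by (simp add: unitary_def U_def blk_dagger blk_mult blk_one)
  have c: "conjd U (\<lambda>p. d (fst p) (snd p)) = blk (\<lambda>x. conjd (eu (V x)) (d x))" for d
    by (simp add: conjd_def U_def blk_diagm[symmetric] blk_dagger blk_mult)
  have "blk V = conjd U (\<lambda>p. ev (V (fst p)) (snd p))"
    using c[of "\<lambda>x. ev (V x)"] by (simp add: eu_ev V)
  then have "hfun f (blk V) = conjd U (\<lambda>p. f (ev (V (fst p)) (snd p)))" by (simp add: hfun_conjd[OF U])
  also have "\<dots> = blk (\<lambda>x. hfun f (V x))" using c[of "\<lambda>x k. f (ev (V x) k)"] by (simp add: hfun_eu V)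
  finally show ?thesis .
qed

lemma sum_entry: "(\<Sum>x\<in>S. F x) $ i $ j = (\<Sum>x\<in>S. F x $ i $ j)" for F :: "'a \<Rightarrow> 'n::finite op"
  by (induction S rule: infinite_finite_induct) auto

lemma cq_state_blk: "cq_state q V = blk (\<lambda>x. q x *\<^sub>R V x)"
proof -
  have "(\<Sum>z\<in>UNIV. q z *\<^sub>R ((if x = z \<and> y = z then 1 else 0) * V z $ i $ j)) = (if x = y then q x *\<^sub>R V x $ i $ j else 0)" for x y i j
  proof -
    have "(\<Sum>z\<in>UNIV. q z *\<^sub>R ((if x = z \<and> y = z then 1 else 0) * V z $ i $ j))
      = (\<Sum>z\<in>UNIV. if x = z then if x = y then q z *\<^sub>R V z $ i $ j else 0 else 0)"
      by (intro sum.cong refl) auto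
    then show ?thesis by simp
  qed
  then show ?thesis
    by (simp add: vec_eq_iff cq_state_def sum_entry tensor_def ketbra_def blk_def)
qed

lemma tensor_classical_blk: "tensor (classical_state q) \<sigma> = cq_state q (\<lambda>_. \<sigma>)"
proof -
  have "(\<Sum>z\<in>UNIV. q z *\<^sub>R (if x = z \<and> y = z then 1 else (0::complex))) = (if x = y then of_real (q x) else 0)" for x y
  proof -
    have "(\<Sum>z\<in>UNIV. q z *\<^sub>R (if x = z \<and> y = z then 1 else (0::complex))) = (\<Sum>z\<in>UNIV. if x = z then if x = y then of_real (q z) else 0 else 0)"
      by (intro sum.cong refl) (auto simp: scaleR_conv_of_real[where 'a = complex])
    then show ?thesis by simp
  qed
  then show ?thesis
    by (auto simp: cq_state_blk vec_eq_iff tensor_def classical_state_def sum_entry ketbra_def blk_def) (simp_all add: scaleR_conv_of_real[where 'a = complex])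
qed

definition sandwich :: "real \<Rightarrow> 'n::finite op \<Rightarrow> 'n op \<Rightarrow> 'n op" where
  "sandwich c \<sigma> V = hfun (\<lambda>t. t powr c) \<sigma> ** V ** hfun (\<lambda>t. t powr c) \<sigma>"

lemma psd_sandwich_powr: "psd \<sigma> \<Longrightarrow> psd V \<Longrightarrow> psd (sandwich c \<sigma> V)"
  unfolding sandwich_def by (intro psd_sandwich hfun_herm psd_herm)

lemma renyi_cq:
  fixes V \<sigma> :: "'x::finite \<Rightarrow> 'b::finite op"
  assumes q: "\<And>x. 0 \<le> q x" and V: "\<And>x. psd (V x)" and \<sigma>: "\<And>x. psd (\<sigma> x)" and a: "0 < 1 + a"
  shows "renyi_trace a (cq_state q V) (cq_state q \<sigma>)
    = (\<Sum>x\<in>UNIV. q x * tr (hfun (\<lambda>t. t powr (1 + a)) (sandwich (- a / (2 * (1 + a))) (\<sigma> x) (V x))))"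
proof -
  define c where "c = - a / (2 * (1 + a))"
  \<comment> \<open>The probabilities of both states combine to the power \<open>1 + 2 * c\<close>
    inside the trace functional, so exactly one factor \<open>q x\<close> comes out.\<close>
  have e: "(1 + 2 * c) * (1 + a) = 1" using a by (simp add: c_def field_simps)
  define S where "S x = hfun (\<lambda>t. t powr c) (\<sigma> x)" for x
  have hs: "hermitian (q x *\<^sub>R \<sigma> x)" for x by (intro herm_scaleR psd_herm \<sigma>)
  have qs: "hfun (\<lambda>t. t powr c) (q x *\<^sub>R \<sigma> x) = (q x powr c) *\<^sub>R S x" for x
  proof -
    have "hfun (\<lambda>t. t powr c) (q x *\<^sub>R \<sigma> x) = hfun (\<lambda>t. (q x * t) powr c) (\<sigma> x)"
      by (rule hfun_scaled[OF psd_herm[OF \<sigma>]])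
    also have "\<dots> = hfun (\<lambda>t. q x powr c * t powr c) (\<sigma> x)"
      by (rule hfun_cong_psd[OF \<sigma>]) (simp add: powr_mult q)
    finally show ?thesis by (simp add: S_def hfun_scaleR[OF psd_herm[OF \<sigma>]])
  qed
  define X where "X x = sandwich c (\<sigma> x) (V x)" for x
  have X: "psd (X x)" for x unfolding X_def by (rule psd_sandwich_powr[OF \<sigma> V])
  have op: "op_powr (cq_state q \<sigma>) c = blk (\<lambda>x. (q x powr c) *\<^sub>R S x)"
    unfolding op_powr_hfun cq_state_blk by (simp add: hfun_blk hs qs)
  have b: "((q x powr c) *\<^sub>R S x) ** (q x *\<^sub>R V x) ** ((q x powr c) *\<^sub>R S x) = (q x powr (1 + 2 * c)) *\<^sub>R X x" for x
  proof (cases "q x = 0")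
    case False
    then have "q x powr c * q x * q x powr c = q x powr (1 + 2 * c)"
      using q[of x] by (simp add: powr_add) (simp add: powr_add[symmetric])
    moreover have "((q x powr c) *\<^sub>R S x) ** (q x *\<^sub>R V x) ** ((q x powr c) *\<^sub>R S x) = (q x powr c * q x * q x powr c) *\<^sub>R X x"
      by (simp add: X_def sandwich_def S_def mx mult_ac)
    ultimately show ?thesis by simp
  qed (simp add: mx)
  have t: "tr (hfun (\<lambda>t. t powr (1 + a)) ((q x powr (1 + 2 * c)) *\<^sub>R X x)) = q x * tr (hfun (\<lambda>t. t powr (1 + a)) (X x))" for x
  proof -
    have "hfun (\<lambda>t. t powr (1 + a)) ((q x powr (1 + 2 * c)) *\<^sub>R X x) = hfun (\<lambda>t. (q x powr (1 + 2 * c) * t) powr (1 + a)) (X x)"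
      by (rule hfun_scaled[OF psd_herm[OF X]])
    also have "\<dots> = hfun (\<lambda>t. q x * t powr (1 + a)) (X x)"
      by (rule hfun_cong_psd[OF X]) (simp add: powr_mult powr_powr e q)
    finally show ?thesis by (simp add: hfun_scaleR[OF psd_herm[OF X], symmetric] tr_scaleR)
  qed
  have hX: "hermitian ((q x powr (1 + 2 * c)) *\<^sub>R X x)" for x by (intro herm_scaleR psd_herm X)
  have "renyi_trace a (cq_state q V) (cq_state q \<sigma>) = tr (hfun (\<lambda>t. t powr (1 + a)) (blk (\<lambda>x. (q x powr (1 + 2 * c)) *\<^sub>R X x)))"
    unfolding renyi_trace_def Let_def c_def[symmetric] op tr_def
    by (simp add: cq_state_blk blk_mult b op_powr_hfun)
  also have "\<dots> = (\<Sum>x\<in>UNIV. q x * tr (hfun (\<lambda>t. t powr (1 + a)) (X x)))"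
    by (simp add: hfun_blk hX tr_blk t)
  finally show ?thesis by (simp add: X_def c_def)
qed

text \<open>The trace in the Petz-Renyi quantity of order \<open>1 - \<alpha>\<close>, which the
  integral over \<open>h\<close> produces.\<close>

definition petz :: "real \<Rightarrow> 'n::finite op \<Rightarrow> 'n op \<Rightarrow> real" where
  "petz \<alpha> V \<sigma> = tr (hfun (\<lambda>t. t powr (1 - \<alpha>)) V ** hfun (\<lambda>t. t powr \<alpha>) \<sigma>)"

lemma petz_nonneg: "psd V \<Longrightarrow> psd \<sigma> \<Longrightarrow> 0 \<le> petz \<alpha> V \<sigma>"
  unfolding petz_def by (intro tr_mult_psd psd_hfun') auto

lemma petz_le_sandwich:
  assumes V: "psd V" and \<sigma>: "psd \<sigma>" and \<alpha>: "0 < \<alpha>" "\<alpha> < 1/2"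
  shows "petz \<alpha> V \<sigma> \<le> tr (hfun (\<lambda>t. t powr (1 + - \<alpha>)) (sandwich (- (- \<alpha>) / (2 * (1 + - \<alpha>))) \<sigma> V))"
proof -
  \<comment> \<open>With this exponent the power \<open>1 - \<alpha>\<close> of \<open>H\<close> is
    \<open>\<sigma> powr \<alpha>\<close>, and the root of \<open>H\<close> is the factor in the
    sandwiched quantity.\<close>
  define a where "a = \<alpha> / (1 - \<alpha>)"
  define H where "H = hfun (\<lambda>t. t powr a) \<sigma>"
  have hs: "hermitian \<sigma>" by (rule psd_herm[OF \<sigma>])
  have H: "psd H" unfolding H_def by (rule psd_hfun'[OF \<sigma>]) auto
  have 1: "hfun (\<lambda>t. t powr (1 - \<alpha>)) H = hfun (\<lambda>t. t powr \<alpha>) \<sigma>"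
    unfolding H_def hfun_hfun[OF hs] using \<alpha> by (simp add: powr_powr a_def)
  have c: "- (- \<alpha>) / (2 * (1 + - \<alpha>)) = a / 2" by (simp add: a_def)
  have 2: "hfun sqrt H = hfun (\<lambda>t. t powr (a / 2)) \<sigma>"
    unfolding H_def hfun_hfun[OF hs] by (simp add: powr_half_sqrt[symmetric] powr_powr)
  show ?thesis
    using araki_lieb_thirring[OF V H, of "1 - \<alpha>"] \<alpha> unfolding petz_def sandwich_def c 1 2 by simp
qed

text \<open>Young's inequality for pairs of eigenvalues, averaged with the overlaps. Needed where an
  infinite Renyi quantity is read as 0.\<close>

lemma petz_le_one:
  assumes V: "density_op V" and \<sigma>: "density_op \<sigma>" and \<alpha>: "0 < \<alpha>" "\<alpha> < 1"
  shows "petz \<alpha> V \<sigma> \<le> 1"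
proof -
  have p: "psd V" "psd \<sigma>" and t: "tr V = 1" "tr \<sigma> = 1" using V \<sigma> by (auto simp: density_op_def tr_def)
  have h: "hermitian V" "hermitian \<sigma>" using p by (auto simp: psd_herm)
  have U: "unitary (eu V)" "unitary (eu \<sigma>)" using h by (auto simp: eu_unitary)
  have y: "v powr (1 - \<alpha>) * s powr \<alpha> \<le> (1 - \<alpha>) * v + \<alpha> * s" if "0 \<le> v" "0 \<le> s" for v s :: real
  proof (cases "v = 0 \<or> s = 0")
    case False
    then show ?thesis using that \<alpha> by (intro Youngs_inequality_0) auto
  qed (use that \<alpha> in auto)
  have "petz \<alpha> V \<sigma> = (\<Sum>k\<in>UNIV. \<Sum>l\<in>UNIV. ov (eu V) (eu \<sigma>) k l * (ev V k powr (1 - \<alpha>) * ev \<sigma> l powr \<alpha>))"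
    unfolding petz_def tr_hfun_mult[OF h] by (simp add: mult.assoc)
  also have "\<dots> \<le> (\<Sum>k\<in>UNIV. \<Sum>l\<in>UNIV. ov (eu V) (eu \<sigma>) k l * ((1 - \<alpha>) * ev V k + \<alpha> * ev \<sigma> l))"
    by (intro sum_mono mult_left_mono y ev_nonneg p) simp
  also have "\<dots> = (1 - \<alpha>) * (\<Sum>k\<in>UNIV. \<Sum>l\<in>UNIV. ov (eu V) (eu \<sigma>) k l * ev V k) + \<alpha> * (\<Sum>k\<in>UNIV. \<Sum>l\<in>UNIV. ov (eu V) (eu \<sigma>) k l * ev \<sigma> l)"
    by (simp add: distrib_left sum.distrib sum_distrib_left mult_ac)
  also have "(\<Sum>k\<in>UNIV. \<Sum>l\<in>UNIV. ov (eu V) (eu \<sigma>) k l * ev V k) = 1"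
    by (simp add: sum_distrib_right[symmetric] ov_sum_right[OF U] tr_ev[OF h(1), symmetric] t)
  also have "(\<Sum>k\<in>UNIV. \<Sum>l\<in>UNIV. ov (eu V) (eu \<sigma>) k l * ev \<sigma> l) = 1"
    by (subst sum.swap) (simp add: sum_distrib_right[symmetric] ov_sum_left[OF U] tr_ev[OF h(2), symmetric] t)
  finally show ?thesis by simp
qed

section \<open>Laws, conditional states and means\<close>

lemma sum_law_of:
  fixes f :: "'w::finite \<Rightarrow> 'y::finite" and F :: "'y \<Rightarrow> real"
  shows "(\<Sum>y\<in>UNIV. law_of P f y * F y) = (\<Sum>x\<in>UNIV. P x * F (f x))"
proof -
  have "(\<Sum>x\<in>UNIV. P x * F (f x)) = (\<Sum>y\<in>UNIV. \<Sum>x | x \<in> UNIV \<and> f x = y. P x * F (f x))"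
    by (rule sum.group[symmetric]) auto
  also have "\<dots> = (\<Sum>y\<in>UNIV. law_of P f y * F y)"
    by (simp add: law_of_def sum_distrib_right)
  finally show ?thesis by simp
qed

lemma law_of_nonneg: "(\<And>x. 0 \<le> P x) \<Longrightarrow> 0 \<le> law_of P f y"
  by (simp add: law_of_def sum_nonneg)

lemma cond_state_inj:
  assumes "inj f" "0 < P x"
  shows "cond_state P W f (f x) = W x"
proof -
  have "{x'. f x' = f x} = {x}" using assms(1) by (auto simp: inj_def)
  then show ?thesis using assms(2) by (simp add: cond_state_def law_of_def)
qed

lemma psd_cond_state:
  assumes "\<And>x. 0 \<le> P x" "\<And>x. 0 < P x \<Longrightarrow> psd (W x)"
  shows "psd (cond_state P W f y)"
proof -
  have "psd (P x *\<^sub>R W x)" for x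
    using assms by (cases "P x = 0") (auto simp: psd_scaleR less_le)
  then have "psd (\<Sum>x | f x = y. P x *\<^sub>R W x)" by (intro psd_sum)
  then show ?thesis unfolding cond_state_def by (rule psd_scaleR) (simp add: law_of_nonneg assms)
qed

lemma psd_mean_state:
  assumes "\<And>x. 0 \<le> P x" "\<And>x. 0 < P x \<Longrightarrow> psd (W x)"
  shows "psd (mean_state P W)"
proof -
  have "psd (P x *\<^sub>R W x)" for x
    using assms by (cases "P x = 0") (auto simp: psd_scaleR less_le)
  then show ?thesis unfolding mean_state_def by (intro psd_sum)
qed

lemma trace_scaleR: "trace (c *\<^sub>R A) = c *\<^sub>R trace A" for A :: "'n::finite op"
  by (simp add: trace_def scaleR_sum_right)

lemma trace_zero: "trace (0 :: 'n::finite op) = 0"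
  by (simp add: trace_def)

lemma trace_sum: "trace (\<Sum>i\<in>S. F i) = (\<Sum>i\<in>S. trace (F i))" for F :: "'a \<Rightarrow> 'n::finite op"
  by (induction S rule: infinite_finite_induct) (auto simp: trace_add trace_zero)

lemma density_cond_state:
  assumes P: "\<And>x. 0 \<le> P x" and W: "\<And>x. 0 < P x \<Longrightarrow> density_op (W x)" and l: "0 < law_of P f y"
  shows "density_op (cond_state P W f y)"
proof -
  have "trace (P x *\<^sub>R W x) = of_real (P x)" for x
    unfolding trace_scaleR using W[of x] P[of x]
    by (cases "P x = 0") (auto simp: density_op_def less_le scaleR_conv_of_real[where 'a = complex])
  then have "trace (cond_state P W f y) = (1 / law_of P f y) *\<^sub>R of_real (law_of P f y)"
    unfolding cond_state_def trace_scaleR trace_sum by (simp add: law_of_def)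
  then have "trace (cond_state P W f y) = 1" using l by (simp add: scaleR_conv_of_real[where 'a = complex])
  then show ?thesis using W P by (simp add: density_op_def psd_cond_state)
qed

lemma density_mean_state:
  assumes P: "\<And>x. 0 \<le> P x" "(\<Sum>x\<in>UNIV. P x) = 1" and W: "\<And>x. 0 < P x \<Longrightarrow> density_op (W x)"
  shows "density_op (mean_state P W)"
proof -
  have "trace (P x *\<^sub>R W x) = of_real (P x)" for x
    unfolding trace_scaleR using W[of x] P(1)[of x]
    by (cases "P x = 0") (auto simp: density_op_def less_le scaleR_conv_of_real[where 'a = complex])
  then have "trace (mean_state P W) = of_real (\<Sum>x\<in>UNIV. P x)"
    unfolding mean_state_def trace_sum by simp
  then show ?thesis using W P by (simp add: density_op_def psd_mean_state)
qed

lemma powr_renyi: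
  assumes "0 < Q" "a \<noteq> 0"
  shows "2 powr (a * (1 / a * log 2 Q)) = Q"
  using assms by simp

lemma petz_le_D:
  fixes W :: "'w::finite \<Rightarrow> 'b::finite op"
  assumes P: "\<And>x. 0 \<le> P x" and W: "\<And>x. 0 < P x \<Longrightarrow> density_op (W x)" and \<alpha>: "0 < \<alpha>" "\<alpha> < 1/2"
  shows "(\<Sum>x\<in>UNIV. P x * petz \<alpha> (W x) (mean_state P W)) \<le> 2 powr (- \<alpha> * D_of (- \<alpha>) P W (\<lambda>x. x))"
proof -
  define q V \<sigma> where "q = law_of P (\<lambda>x. x)" and "V = cond_state P W (\<lambda>x. x)" and "\<sigma> = mean_state P W"
  have Wp: "psd (W x)" if "0 < P x" for x using W[OF that] by (simp add: density_op_def)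
  have q0: "0 \<le> q x" for x by (simp add: q_def law_of_nonneg P)
  have V: "psd (V x)" for x unfolding V_def by (rule psd_cond_state[OF P Wp])
  have \<sigma>: "psd \<sigma>" unfolding \<sigma>_def by (rule psd_mean_state[OF P Wp])
  define Q where "Q = renyi_trace (- \<alpha>) (cq_state q V) (cq_state q (\<lambda>_. \<sigma>))"
  have Q: "Q = (\<Sum>x\<in>UNIV. q x * tr (hfun (\<lambda>t. t powr (1 + - \<alpha>)) (sandwich (- (- \<alpha>) / (2 * (1 + - \<alpha>))) \<sigma> (V x))))"
    unfolding Q_def using \<alpha> by (intro renyi_cq q0 V \<sigma>) auto
  have "(\<Sum>x\<in>UNIV. P x * petz \<alpha> (W x) \<sigma>) = (\<Sum>x\<in>UNIV. P x * petz \<alpha> (V x) \<sigma>)"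
  proof (intro sum.cong refl)
    fix x show "P x * petz \<alpha> (W x) \<sigma> = P x * petz \<alpha> (V x) \<sigma>"
      using cond_state_inj[of "\<lambda>x. x" P x W] P[of x] by (cases "P x = 0") (auto simp: V_def less_le)
  qed
  also have "\<dots> = (\<Sum>x\<in>UNIV. q x * petz \<alpha> (V x) \<sigma>)" unfolding q_def by (simp add: sum_law_of)
  also have "\<dots> \<le> Q" unfolding Q by (intro sum_mono mult_left_mono petz_le_sandwich V \<sigma> \<alpha> q0)
  finally have le: "(\<Sum>x\<in>UNIV. P x * petz \<alpha> (W x) \<sigma>) \<le> Q" .
  have Q0: "0 \<le> Q" unfolding Q by (intro sum_nonneg mult_nonneg_nonneg q0 tr_psd psd_hfun' psd_sandwich_powr \<sigma> V) auto
  \<comment> \<open>At \<open>Q = 0\<close> the relative entropy is infinite and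
    \<open>real_of_ereal\<close> returns 0; the bound then reads \<open>0 \<le> 1\<close>.\<close>
  have D: "D_of (- \<alpha>) P W (\<lambda>x. x) = (if Q = 0 then 0 else 1 / (- \<alpha>) * log 2 Q)"
    using \<alpha> unfolding D_of_def renyi_D_def tensor_classical_blk q_def[symmetric] V_def[symmetric] \<sigma>_def[symmetric] Q_def[symmetric]
    by simp
  have "Q \<le> 2 powr (- \<alpha> * D_of (- \<alpha>) P W (\<lambda>x. x))"
  proof (cases "Q = 0")
    case False
    then have "2 powr (- \<alpha> * D_of (- \<alpha>) P W (\<lambda>x. x)) = Q"
      unfolding D using powr_renyi[of Q "- \<alpha>"] Q0 \<alpha> by simp
    then show ?thesis by simp
  qed simp
  with le show ?thesis unfolding \<sigma>_def by simp
qed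

text \<open>If the infimum is infinite, \<open>real_of_ereal\<close> returns \<open>0\<close>, and the left-hand side is at most \<open>1\<close>.\<close>

lemma petz_le_I:
  fixes W :: "'w::finite \<Rightarrow> 'b::finite op" and f :: "'w \<Rightarrow> 'u::finite" and g :: "'w \<Rightarrow> 'v::finite"
  assumes P: "\<And>x. 0 \<le> P x" "(\<Sum>x\<in>UNIV. P x) = 1" and W: "\<And>x. 0 < P x \<Longrightarrow> density_op (W x)"
    and inj: "inj (\<lambda>x. (f x, g x))" and \<alpha>: "0 < \<alpha>" "\<alpha> < 1/2"
  shows "(\<Sum>x\<in>UNIV. P x * petz \<alpha> (W x) (cond_state P W g (g x))) \<le> 2 powr (- \<alpha> * I_of (- \<alpha>) P W f g)"
proof -
  define h where "h = (\<lambda>x. (f x, g x))"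
  define q V where "q = law_of P h" and "V = cond_state P W h"
  have Wp: "psd (W x)" if "0 < P x" for x using W[OF that] by (simp add: density_op_def)
  have q0: "0 \<le> q x" for x by (simp add: q_def law_of_nonneg P)
  have V: "psd (V x)" for x unfolding V_def by (rule psd_cond_state[OF P(1) Wp])
  \<comment> \<open>The competitor in the infimum. It must be a density operator for every
    \<open>v\<close>, but \<open>cond_state\<close> is 0 at values of probability zero, so the mean
    state is substituted there.\<close>
  define \<sigma> where "\<sigma> v = (if 0 < law_of P g v then cond_state P W g v else mean_state P W)" for v
  have d\<sigma>: "density_op (\<sigma> v)" for v
    using density_cond_state[of P W g v] density_mean_state[of P W] P W by (simp add: \<sigma>_def)
  have \<sigma>: "psd (\<sigma> v)" for v using d\<sigma> by (simp add: density_op_def)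
  have gx: "\<sigma> (g x) = cond_state P W g (g x)" if "0 < P x" for x
  proof -
    have "P x \<le> law_of P g (g x)" unfolding law_of_def by (rule member_le_sum) (auto simp: P)
    then show ?thesis using that by (simp add: \<sigma>_def)
  qed
  define Z where "Z = (\<Sum>x\<in>UNIV. P x * petz \<alpha> (W x) (cond_state P W g (g x)))"
  define Q where "Q = renyi_trace (- \<alpha>) (cq_state q V) (cq_state q (\<lambda>(u, v). \<sigma> v))"
  have Q: "Q = (\<Sum>x\<in>UNIV. q x * tr (hfun (\<lambda>t. t powr (1 + - \<alpha>)) (sandwich (- (- \<alpha>) / (2 * (1 + - \<alpha>))) ((\<lambda>(u, v). \<sigma> v) x) (V x))))"
    unfolding Q_def using \<alpha> by (intro renyi_cq q0 V) (auto simp: \<sigma>)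
  have Z: "Z = (\<Sum>x\<in>UNIV. P x * petz \<alpha> (V (h x)) ((\<lambda>(u, v). \<sigma> v) (h x)))"
    unfolding Z_def
  proof (intro sum.cong refl)
    fix x
    show "P x * petz \<alpha> (W x) (cond_state P W g (g x)) = P x * petz \<alpha> (V (h x)) ((\<lambda>(u, v). \<sigma> v) (h x))"
      using cond_state_inj[of h P x W] inj P(1)[of x] gx[of x] by (cases "P x = 0") (auto simp: V_def h_def less_le)
  qed
  also have "\<dots> = (\<Sum>y\<in>UNIV. q y * petz \<alpha> (V y) ((\<lambda>(u, v). \<sigma> v) y))" unfolding q_def by (simp add: sum_law_of)
  also have "\<dots> \<le> Q" unfolding Q by (intro sum_mono mult_left_mono petz_le_sandwich V \<alpha> q0) (auto simp: \<sigma>)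
  finally have le: "Z \<le> Q" .
  have Q0: "0 \<le> Q" unfolding Q
    by (intro sum_nonneg mult_nonneg_nonneg q0 tr_psd psd_hfun' psd_sandwich_powr V) (auto simp: \<sigma>)
  have Z1: "Z \<le> 1"
  proof -
    have "P x * petz \<alpha> (W x) (cond_state P W g (g x)) \<le> P x" for x
    proof (cases "P x = 0")
      case False
      then have p: "0 < P x" using P(1)[of x] by simp
      have "petz \<alpha> (W x) (cond_state P W g (g x)) \<le> 1"
        using gx[OF p] d\<sigma>[of "g x"] \<alpha> by (intro petz_le_one W p) auto
      from mult_left_mono[OF this, of "P x"] p show ?thesis by simp
    qed simp
    then have "Z \<le> (\<Sum>x\<in>UNIV. P x)" unfolding Z_def by (intro sum_mono)
    then show ?thesis by (simp add: P)
  qed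
  define Inf0 where "Inf0 = renyi_I (- \<alpha>) q V"
  have Iof: "I_of (- \<alpha>) P W f g = real_of_ereal Inf0" unfolding I_of_def Inf0_def q_def V_def h_def Let_def ..
  have "Z \<le> 2 powr (- \<alpha> * real_of_ereal Inf0)"
  proof (cases "\<bar>Inf0\<bar> = \<infinity> \<or> Q = 0")
    case True
    then show ?thesis
    proof
      assume "\<bar>Inf0\<bar> = \<infinity>"
      then have "real_of_ereal Inf0 = 0" by (cases Inf0) auto
      then show ?thesis using Z1 by simp
    next
      assume "Q = 0"
      then have "Z \<le> 0" using le by simp
      also have "0 \<le> 2 powr (- \<alpha> * real_of_ereal Inf0)" by simp
      finally show ?thesis .
    qed
  next
    case False
    then obtain r where r: "Inf0 = ereal r" by (cases Inf0) auto
    have "Inf0 \<le> renyi_D (- \<alpha>) (cq_state q V) (cq_state q (\<lambda>(u, v). \<sigma> v))"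
      unfolding Inf0_def renyi_I_def by (rule INF_lower) (simp add: d\<sigma>)
    also have "\<dots> = ereal (1 / (- \<alpha>) * log 2 Q)"
      using False \<alpha> by (simp add: renyi_D_def Q_def[symmetric])
    finally have "r \<le> 1 / (- \<alpha>) * log 2 Q" by (simp add: r)
    then have "- \<alpha> * (1 / (- \<alpha>) * log 2 Q) \<le> - \<alpha> * r" using \<alpha> by (intro mult_left_mono_neg) auto
    then have "2 powr (- \<alpha> * (1 / (- \<alpha>) * log 2 Q)) \<le> 2 powr (- \<alpha> * r)" by (intro powr_mono) auto
    moreover have "2 powr (- \<alpha> * (1 / (- \<alpha>) * log 2 Q)) = Q" using False Q0 \<alpha> by (intro powr_renyi) auto
    ultimately have "Q \<le> 2 powr (- \<alpha> * r)" by (simp only:)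
    with le show ?thesis by (simp add: r)
  qed
  then show ?thesis by (simp add: Iof Z_def)
qed

section \<open>Supports, and the relative entropy at the warden\<close>

lemma psd_kernel:
  assumes A: "psd A" and v: "v \<bullet> (A *v v) = 0"
  shows "A *v v = 0"
proof -
  define S where "S = hfun sqrt A"
  have S: "hermitian S" "S ** S = A" using A by (auto simp: S_def hfun_herm psd_herm sqrt_mult)
  have "v \<bullet> ((dagger S ** mat 1 ** S) *v v) = 0" using v S by (simp add: hermitian_def)
  then have "S *v v = 0" unfolding inner_conj by simp
  then show ?thesis by (simp add: S(2)[symmetric] matrix_vector_mul_assoc[symmetric])
qed

lemma kernel_mono:
  assumes A: "psd A" and B: "psd (B - A)" and v: "B *v v = 0"
  shows "A *v v = 0"
proof (rule psd_kernel[OF A])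
  have "0 \<le> v \<bullet> ((B - A) *v v)" using B by (simp add: psd_def)
  then have "v \<bullet> (A *v v) \<le> 0" using v by (simp add: matrix_vector_mult_diff_rdistrib inner_diff_right)
  moreover have "0 \<le> v \<bullet> (A *v v)" using A by (simp add: psd_def)
  ultimately show "v \<bullet> (A *v v) = 0" by simp
qed

lemma blk_vec: "(blk V *v v) $ (x, i) = (V x *v (\<chi> j. v $ (x, j))) $ i"
proof -
  have "(\<Sum>b\<in>UNIV. blk V $ (x, i) $ (a, b) * v $ (a, b)) = (if a = x then \<Sum>b\<in>UNIV. V x $ i $ b * v $ (x, b) else 0)" for a
    by (cases "a = x") (auto simp: blk_def)
  then show ?thesis by (simp add: matrix_vector_mult_def sum_UNIV_pair)
qed

lemma cond_le_mean:
  fixes W :: "'w::finite \<Rightarrow> 'b::finite op"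
  assumes P: "\<And>x. 0 \<le> P x" and W: "\<And>x. 0 < P x \<Longrightarrow> psd (W x)"
  shows "psd (mean_state P W - law_of P f y *\<^sub>R cond_state P W f y)"
proof -
  have PW: "psd (P x *\<^sub>R W x)" for x
    using P[of x] W[of x] by (cases "P x = 0") (auto simp: psd_scaleR less_le)
  show ?thesis
  proof (cases "law_of P f y = 0")
    case True
    then show ?thesis using psd_mean_state[of P W] P W by simp
  next
    case False
    then have "law_of P f y *\<^sub>R cond_state P W f y = (\<Sum>x | f x = y. P x *\<^sub>R W x)"
      by (simp add: cond_state_def)
    moreover have "mean_state P W = (\<Sum>x | f x = y. P x *\<^sub>R W x) + (\<Sum>x | f x \<noteq> y. P x *\<^sub>R W x)"
      unfolding mean_state_def
      by (subst sum.union_disjoint[symmetric]) (auto intro!: sum.cong)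
    ultimately show ?thesis using PW by (simp add: psd_sum)
  qed
qed

lemma covert_D:
  fixes W :: "'w::finite \<Rightarrow> 'b::finite op" and f :: "'w \<Rightarrow> 'y::finite"
  assumes P: "\<And>x. 0 \<le> P x" and W: "\<And>x. 0 < P x \<Longrightarrow> psd (W x)" and \<alpha>: "0 < \<alpha>"
  defines "Q \<equiv> (\<Sum>x\<in>UNIV. P x * npow (1 + \<alpha>) (sandwich (- \<alpha> / (2 * (1 + \<alpha>))) (mean_state P W) (cond_state P W f (f x))))"
  assumes Q: "0 < Q"
  shows "2 powr (\<alpha> * D_of \<alpha> P W f) = Q"
proof -
  define q V \<sigma> where "q = law_of P f" and "V = cond_state P W f" and "\<sigma> = mean_state P W"
  have q0: "0 \<le> q x" for x by (simp add: q_def law_of_nonneg P)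
  have V: "psd (V x)" for x unfolding V_def by (rule psd_cond_state[OF P W])
  have \<sigma>: "psd \<sigma>" unfolding \<sigma>_def by (rule psd_mean_state[OF P W])
  have "renyi_trace \<alpha> (cq_state q V) (cq_state q (\<lambda>_. \<sigma>))
    = (\<Sum>y\<in>UNIV. q y * tr (hfun (\<lambda>t. t powr (1 + \<alpha>)) (sandwich (- \<alpha> / (2 * (1 + \<alpha>))) \<sigma> (V y))))"
    using \<alpha> by (intro renyi_cq q0 V \<sigma>) auto
  also have "\<dots> = (\<Sum>y\<in>UNIV. q y * npow (1 + \<alpha>) (sandwich (- \<alpha> / (2 * (1 + \<alpha>))) \<sigma> (V y)))"
  proof (intro sum.cong refl)
    fix y
    have "psd (sandwich (- \<alpha> / (2 * (1 + \<alpha>))) \<sigma> (V y))" by (rule psd_sandwich_powr[OF \<sigma> V])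
    then have "hfun (\<lambda>t. t powr (1 + \<alpha>)) (sandwich (- \<alpha> / (2 * (1 + \<alpha>))) \<sigma> (V y)) = hfun (\<lambda>t. \<bar>t\<bar> powr (1 + \<alpha>)) (sandwich (- \<alpha> / (2 * (1 + \<alpha>))) \<sigma> (V y))"
      by (rule hfun_cong_psd) simp
    then show "q y * tr (hfun (\<lambda>t. t powr (1 + \<alpha>)) (sandwich (- \<alpha> / (2 * (1 + \<alpha>))) \<sigma> (V y))) = q y * npow (1 + \<alpha>) (sandwich (- \<alpha> / (2 * (1 + \<alpha>))) \<sigma> (V y))"
      by (simp add: npow_def)
  qed
  also have "\<dots> = Q" unfolding q_def V_def \<sigma>_def Q_def by (rule sum_law_of)
  finally have r: "renyi_trace \<alpha> (cq_state q V) (cq_state q (\<lambda>_. \<sigma>)) = Q" .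
  \<comment> \<open>The support condition in \<open>renyi_D\<close> holds since
    \<open>q y *\<^sub>R V y\<close> is below the mean state in every block; the relative entropy is
    therefore finite.\<close>
  have ker: "cq_state q V *v v = 0" if "cq_state q (\<lambda>_. \<sigma>) *v v = 0" for v
  proof -
    have "(cq_state q V *v v) $ (y, i) = 0" for y i
    proof -
      define u where "u = (\<chi> j. v $ (y, j))"
      have "((q y *\<^sub>R \<sigma>) *v u) $ j = 0" for j
        using arg_cong[OF that, of "\<lambda>w. w $ (y, j)"] by (simp add: cq_state_blk blk_vec u_def)
      then have "(q y *\<^sub>R \<sigma>) *v u = 0" by (simp add: vec_eq_iff)
      then have z: "q y = 0 \<or> \<sigma> *v u = 0" by (simp add: scaleR_mult_vec)
      have "(q y *\<^sub>R V y) *v u = 0"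
      proof (cases "q y = 0")
        case False
        then have k: "\<sigma> *v u = 0" using z by simp
        have B: "psd (\<sigma> - q y *\<^sub>R V y)"
          unfolding q_def V_def \<sigma>_def by (rule cond_le_mean[OF P W])
        show ?thesis by (rule kernel_mono[OF psd_scaleR[OF V q0] B k])
      qed (simp add: scaleR_mult_vec)
      then show ?thesis by (simp add: cq_state_blk blk_vec u_def[symmetric])
    qed
    then show ?thesis by (simp add: vec_eq_iff)
  qed
  have "D_of \<alpha> P W f = 1 / \<alpha> * log 2 Q"
    using ker \<alpha> unfolding D_of_def renyi_D_def tensor_classical_blk q_def[symmetric] V_def[symmetric] \<sigma>_def[symmetric] r
    by auto
  then show ?thesis using powr_renyi[OF Q, of \<alpha>] \<alpha> by simp
qed


section \<open>Expected error and expected leakage\<close>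

lemma hi_error:
  assumes \<alpha>: "0 < \<alpha>" "\<alpha> < 1/2"
  shows "\<exists>J\<ge>0. 2 / pi * J \<le> 1 + 96/100 * \<alpha> \<and> (\<forall>v\<ge>0. \<forall>z\<ge>0.
    hi (\<lambda>h. v\<^sup>2 / (v\<^sup>2 + 2 * h\<^sup>2) * (z / (2 * sqrt 2 * h)) powr \<alpha>)
      (2 powr (- \<alpha>) / sqrt 2 * J * (v powr (1 - \<alpha>) * z powr \<alpha>)))"
proof -
  obtain J where J: "hi (\<lambda>y. y powr (- \<alpha>) / (1 + y\<^sup>2)) J" "2 / pi * J \<le> 1 + 96/100 * \<alpha>"
    using hi_powr_cauchy[OF \<alpha>] by blast
  have z: "hi (\<lambda>y. 0) 0" using hi_cmult[OF J(1), of 0] by simp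
  have J0: "0 \<le> J" by (rule hi_mono[OF z J(1)]) simp
  have "hi (\<lambda>h. v\<^sup>2 / (v\<^sup>2 + 2 * h\<^sup>2) * (z / (2 * sqrt 2 * h)) powr \<alpha>)
      (2 powr (- \<alpha>) / sqrt 2 * J * (v powr (1 - \<alpha>) * z powr \<alpha>))" if vz: "0 \<le> v" "0 \<le> z" for v z
  proof (cases "v = 0")
    case True
    then show ?thesis using z by simp
  next
    case False
    then have v: "0 < v" using vz by simp
    \<comment> \<open>The substitution \<open>y = sqrt 2 * h / v\<close> turns the damping factor
      into \<open>1 / (1 + y\<^sup>2)\<close> and \<open>z / (2 * sqrt 2 * h)\<close> into
      \<open>z / (2 * v * y)\<close>.\<close>
    define c where "c = sqrt 2 / v"
    have c: "0 < c" using v by (simp add: c_def)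
    have e: "hi (\<lambda>h. (z / (2 * v)) powr \<alpha> * ((c * h) powr (- \<alpha>) / (1 + (c * h)\<^sup>2))) ((z / (2 * v)) powr \<alpha> * (J / c))"
      by (intro hi_cmult hi_scale[OF J(1) c])
    have val: "(z / (2 * v)) powr \<alpha> * (J / c) = 2 powr (- \<alpha>) / sqrt 2 * J * (v powr (1 - \<alpha>) * z powr \<alpha>)"
    proof -
      have 1: "(z / (2 * v)) powr \<alpha> = z powr \<alpha> / (2 powr \<alpha> * v powr \<alpha>)"
        using v vz by (simp add: powr_divide powr_mult)
      have 2: "v powr (1 - \<alpha>) = v / v powr \<alpha>" using v by (simp add: powr_diff)
      show ?thesis unfolding 1 2 powr_minus_divide using v by (simp add: c_def mult_ac)
    qed
    show ?thesis
    proof (rule hi_cong[OF e[unfolded val]])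
      fix h :: real assume h: "0 < h"
      have "(z / (2 * v)) powr \<alpha> * (c * h) powr (- \<alpha>) = (z / (2 * v) / (c * h)) powr \<alpha>"
        unfolding powr_minus_divide using v vz c h by (subst (2) powr_divide) auto
      also have "z / (2 * v) / (c * h) = z / (2 * sqrt 2 * h)"
        using v h by (simp add: c_def)
      finally have 1: "(z / (2 * v)) powr \<alpha> * (c * h) powr (- \<alpha>) = (z / (2 * sqrt 2 * h)) powr \<alpha>" .
      have "1 + (c * h)\<^sup>2 = (v\<^sup>2 + 2 * h\<^sup>2) / v\<^sup>2"
        using v by (simp add: c_def power_mult_distrib power_divide add_divide_distrib)
      then have 2: "1 / (1 + (c * h)\<^sup>2) = v\<^sup>2 / (v\<^sup>2 + 2 * h\<^sup>2)" by simp
      have "(z / (2 * v)) powr \<alpha> * ((c * h) powr (- \<alpha>) / (1 + (c * h)\<^sup>2))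
        = ((z / (2 * v)) powr \<alpha> * (c * h) powr (- \<alpha>)) * (1 / (1 + (c * h)\<^sup>2))" by simp
      then show "(z / (2 * v)) powr \<alpha> * ((c * h) powr (- \<alpha>) / (1 + (c * h)\<^sup>2)) = v\<^sup>2 / (v\<^sup>2 + 2 * h\<^sup>2) * (z / (2 * sqrt 2 * h)) powr \<alpha>"
        unfolding 1 2 by simp
    qed
  qed
  then show ?thesis using J(2) J0 by blast
qed

section \<open>Bookkeeping over sets of messages\<close>

lemma msize_compl: 
  fixes S :: "'s::finite set"
  shows "msize Ms (- S) * msize Ms S = msize Ms UNIV"
  unfolding msize_def by (subst prod.union_disjoint[symmetric]) (auto simp: Compl_partition2)

lemma msize_nonneg: "0 \<le> msize Ms S"
  by (simp add: msize_def prod_nonneg)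

lemma card_PiE_msize: "real (card (PiE UNIV Ms)) = msize Ms (UNIV :: 's::finite set)"
  by (simp add: card_PiE msize_def)

lemma sum_nonempty_sets:
  fixes F :: "'s::finite set \<Rightarrow> real"
  shows "F UNIV + (\<Sum>S | S \<subset> UNIV. F S) = F {} + (\<Sum>S | S \<noteq> {}. F S)"
proof -
  have 1: "(\<Sum>S\<in>UNIV. F S) = F UNIV + (\<Sum>S\<in>UNIV - {UNIV}. F S)" by (rule sum.remove) auto
  have 2: "(\<Sum>S\<in>UNIV. F S) = F {} + (\<Sum>S\<in>UNIV - {{}}. F S)" by (rule sum.remove) auto
  have "UNIV - {UNIV} = {S :: 's set. S \<subset> UNIV}" "UNIV - {{}} = {S :: 's set. S \<noteq> {}}" by auto
  then show ?thesis using 1 2 by simp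
qed

lemma avg_invariant:
  fixes I :: "'t::finite \<Rightarrow> 's::finite set" and \<omega> :: "'t \<Rightarrow> 'w"
  shows "avg I q S A (merge (transmitters_meeting I S) \<omega> \<omega>') = avg I q S A \<omega>"
proof -
  have "merge J (merge J \<omega> \<omega>') \<omega>'' = merge J \<omega> \<omega>''" for J :: "'t set" and \<omega>''
    by (auto simp: merge_def)
  then show ?thesis by (simp add: avg_def)
qed

lemma sum_codebook:
  fixes g :: "('t::finite \<Rightarrow> 'w) \<Rightarrow> real" and Ms :: "'s::finite \<Rightarrow> nat set"
  assumes q: "mergeable q" and Ms: "\<And>s. finite (Ms s)"
  shows "Ex (codebook I Ms q U) (\<lambda>X. \<Sum>m\<in>PiE UNIV Ms. g (X m)) = msize Ms UNIV * Ex q g"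
proof -
  have "Ex (codebook I Ms q U) (\<lambda>X. \<Sum>m\<in>PiE UNIV Ms. g (X m)) = (\<Sum>m\<in>PiE UNIV Ms. Ex (codebook I Ms q U) (\<lambda>X. g (X m)))"
    by (rule Ex_sum)
  also have "\<dots> = (\<Sum>m\<in>PiE UNIV Ms. Ex q g)"
    by (intro sum.cong refl codebook_marginal[OF q Ms]) auto
  finally show ?thesis by (simp add: card_PiE_msize)
qed

lemma error_level:
  fixes V :: "('t::finite \<Rightarrow> 'w) \<Rightarrow> 'n::finite op" and Ms :: "'s::finite \<Rightarrow> nat set"
  assumes q: "mergeable q" and Ms: "\<And>s. finite (Ms s)" and V: "\<And>\<omega>. psd (V \<omega>)"
    and U: "distinct U" "set U = UNIV" and h: "0 < h"
  shows "msize Ms UNIV * Ex q (\<lambda>\<omega>. tr (hfun (\<lambda>t. t\<^sup>2 / (t\<^sup>2 + h\<^sup>2)) (V \<omega>)))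
    \<le> Ex (codebook I Ms q U) (\<lambda>X. tr (hfun (\<lambda>t. t / (t + h\<^sup>2)) (\<Sum>m\<in>PiE UNIV Ms. V (X m) ** V (X m))))
      + 4 * msize Ms UNIV * (\<Sum>S | S \<noteq> {}. Ex q (\<lambda>\<omega>. tr (damp h (V \<omega>) **
          hfun (\<lambda>t. t / (1 + t)) ((msize Ms S / (2 * sqrt 2 * h)) *\<^sub>R avg I q S V \<omega>))))"
proof -
  define C where "C = codebook I Ms q U"
  define A where "A \<omega> = damp h (V \<omega>)" for \<omega>
  define \<kappa> where "\<kappa> = 1 / (2 * sqrt 2 * h)"
  define Cs where "Cs S \<omega> = (msize Ms S / (2 * sqrt 2 * h)) *\<^sub>R avg I q S V \<omega>" for S \<omega>
  define f :: "'n op \<Rightarrow> 'n op" where "f = hfun (\<lambda>t. t / (1 + t))"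
  have finq: "finite (set_pmf q)" using q by (simp add: mergeable_def)
  have fPE: "finite (PiE UNIV Ms)" by (intro finite_PiE Ms) simp
  have pA: "psd (A \<omega>)" for \<omega> unfolding A_def by (rule psd_damp[OF V])
  have lev: "Ex C (\<lambda>X. \<Sum>m\<in>PiE UNIV Ms. tr (hfun (\<lambda>t. t\<^sup>2 / (t\<^sup>2 + h\<^sup>2)) (V (X m)))) + 4 * Ex C (\<lambda>X. \<Sum>m\<in>PiE UNIV Ms. phi 1 (A (X m)))
    \<le> Ex C (\<lambda>X. tr (hfun (\<lambda>t. t / (t + h\<^sup>2)) (\<Sum>m\<in>PiE UNIV Ms. V (X m) ** V (X m)))) + 4 * Ex C (\<lambda>X. phi 1 (\<Sum>m\<in>PiE UNIV Ms. A (X m)))"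
    unfolding Ex_cmult[symmetric] Ex_add[symmetric] A_def
    by (intro Ex_mono decode_level fPE V h)
  have "Ex C (\<lambda>X. phi 1 (\<Sum>m\<in>PiE UNIV Ms. A (X m)))
    \<le> Ex q (\<lambda>\<omega>. phi 1 (msize Ms UNIV *\<^sub>R avg I q UNIV A \<omega>))
      + (\<Sum>S | S \<subset> UNIV. msize Ms (UNIV - S) * Ex q (\<lambda>\<omega>. phi 1 (msize Ms S *\<^sub>R avg I q S A \<omega>)))"
    using codebook_recursion[where I = I and Ms = Ms and A = A, OF q Ms step_phi step_phi pA U(1)] unfolding U(2) C_def .
  also have "\<dots> = msize Ms (- UNIV) * Ex q (\<lambda>\<omega>. phi 1 (msize Ms UNIV *\<^sub>R avg I q UNIV A \<omega>))
      + (\<Sum>S | S \<subset> UNIV. msize Ms (- S) * Ex q (\<lambda>\<omega>. phi 1 (msize Ms S *\<^sub>R avg I q S A \<omega>)))"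
    by (simp add: Compl_eq_Diff_UNIV msize_def[of _ "{}"])
  also have "\<dots> = msize Ms (- {}) * Ex q (\<lambda>\<omega>. phi 1 (msize Ms {} *\<^sub>R avg I q {} A \<omega>))
      + (\<Sum>S | S \<noteq> {}. msize Ms (- S) * Ex q (\<lambda>\<omega>. phi 1 (msize Ms S *\<^sub>R avg I q S A \<omega>)))"
    by (rule sum_nonempty_sets)
  \<comment> \<open>The empty set contributes the expected sum of the single-codeword terms, which
    cancels against the left-hand side of \<open>decode_level\<close>.\<close>
  also have "msize Ms (- {}) * Ex q (\<lambda>\<omega>. phi 1 (msize Ms {} *\<^sub>R avg I q {} A \<omega>)) = Ex C (\<lambda>X. \<Sum>m\<in>PiE UNIV Ms. phi 1 (A (X m)))"
    unfolding C_def sum_codebook[where Ms = Ms and g = "\<lambda>\<omega>. phi 1 (A \<omega>)", OF q Ms] by (simp add: avg_empty finq msize_def[of _ "{}"])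
  finally have rec: "Ex C (\<lambda>X. phi 1 (\<Sum>m\<in>PiE UNIV Ms. A (X m)))
    \<le> Ex C (\<lambda>X. \<Sum>m\<in>PiE UNIV Ms. phi 1 (A (X m)))
      + (\<Sum>S | S \<noteq> {}. msize Ms (- S) * Ex q (\<lambda>\<omega>. phi 1 (msize Ms S *\<^sub>R avg I q S A \<omega>)))" .
  have trm: "msize Ms (- S) * Ex q (\<lambda>\<omega>. phi 1 (msize Ms S *\<^sub>R avg I q S A \<omega>)) \<le> msize Ms UNIV * Ex q (\<lambda>\<omega>. tr (A \<omega> ** f (Cs S \<omega>)))" for S
  proof -
    have "phi 1 (msize Ms S *\<^sub>R avg I q S A \<omega>) \<le> msize Ms S * tr (avg I q S A \<omega> ** f (Cs S \<omega>))" for \<omega>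
    proof -
      \<comment> \<open>\<open>Cs S\<close> is the average of the undamped states;
        \<open>damp_le\<close> survives averaging, so it dominates the damped one.\<close>
      have "Cs S \<omega> - msize Ms S *\<^sub>R avg I q S A \<omega> = msize Ms S *\<^sub>R avg I q S (\<lambda>\<omega>. \<kappa> *\<^sub>R V \<omega> - A \<omega>) \<omega>"
        by (simp add: Cs_def avg_def Ex_def \<kappa>_def scaleR_sum_right scaleR_diff_right sum_subtractf mult_ac)
      moreover have "psd (msize Ms S *\<^sub>R avg I q S (\<lambda>\<omega>. \<kappa> *\<^sub>R V \<omega> - A \<omega>) \<omega>)"
        unfolding A_def \<kappa>_def by (intro psd_scaleR psd_avg damp_le V h msize_nonneg)
      ultimately have "psd (Cs S \<omega> - msize Ms S *\<^sub>R avg I q S A \<omega>)" by simp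
      then have "phi 1 (msize Ms S *\<^sub>R avg I q S A \<omega>) \<le> tr ((msize Ms S *\<^sub>R avg I q S A \<omega>) ** f (Cs S \<omega>))"
        unfolding f_def using h by (intro phi_le_tr psd_scaleR psd_avg pA msize_nonneg) (auto simp: Cs_def intro!: psd_scaleR psd_avg V msize_nonneg divide_nonneg_nonneg)
      then show ?thesis by (simp add: mx tr_scaleR)
    qed
    then have "Ex q (\<lambda>\<omega>. phi 1 (msize Ms S *\<^sub>R avg I q S A \<omega>)) \<le> Ex q (\<lambda>\<omega>. msize Ms S * tr (avg I q S A \<omega> ** f (Cs S \<omega>)))"
      by (intro Ex_mono)
    \<comment> \<open>\<open>Cs S\<close> does not depend on the redrawn seeds. The average over
      them can hence be taken outside the trace, where \<open>Ex_merge\<close> absorbs it.\<close>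
    also have "\<dots> = msize Ms S * Ex q (\<lambda>\<omega>. Ex q (\<lambda>\<omega>'. tr (A (merge (transmitters_meeting I S) \<omega> \<omega>') ** f (Cs S (merge (transmitters_meeting I S) \<omega> \<omega>')))))"
    proof -
      have "tr (avg I q S A \<omega> ** f (Cs S \<omega>)) = Ex q (\<lambda>\<omega>'. tr (A (merge (transmitters_meeting I S) \<omega> \<omega>') ** f (Cs S (merge (transmitters_meeting I S) \<omega> \<omega>'))))" for \<omega>
        unfolding Cs_def avg_invariant
        by (simp add: avg_def[of I q S A] Ex_def matrix_sum_left matrix_scaleR_left tr_sum tr_scaleR)
      then show ?thesis by (simp add: Ex_cmult)
    qed
    also have "\<dots> = msize Ms S * Ex q (\<lambda>\<omega>. tr (A \<omega> ** f (Cs S \<omega>)))"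
      by (subst Ex_merge[OF q, where f = "\<lambda>\<omega>. tr (A \<omega> ** f (Cs S \<omega>))"]) (rule refl)
    finally have "msize Ms (- S) * Ex q (\<lambda>\<omega>. phi 1 (msize Ms S *\<^sub>R avg I q S A \<omega>)) \<le> msize Ms (- S) * (msize Ms S * Ex q (\<lambda>\<omega>. tr (A \<omega> ** f (Cs S \<omega>))))"
      by (rule mult_left_mono) (rule msize_nonneg)
    then show ?thesis by (simp add: mult.assoc[symmetric] msize_compl)
  qed
  have "(\<Sum>S | S \<noteq> {}. msize Ms (- S) * Ex q (\<lambda>\<omega>. phi 1 (msize Ms S *\<^sub>R avg I q S A \<omega>)))
    \<le> (\<Sum>S | S \<noteq> {}. msize Ms UNIV * Ex q (\<lambda>\<omega>. tr (A \<omega> ** f (Cs S \<omega>))))"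
    by (intro sum_mono trm)
  also have "\<dots> = msize Ms UNIV * (\<Sum>S | S \<noteq> {}. Ex q (\<lambda>\<omega>. tr (A \<omega> ** f (Cs S \<omega>))))"
    by (rule sum_distrib_left[symmetric])
  finally have "Ex C (\<lambda>X. \<Sum>m\<in>PiE UNIV Ms. tr (hfun (\<lambda>t. t\<^sup>2 / (t\<^sup>2 + h\<^sup>2)) (V (X m))))
    \<le> Ex C (\<lambda>X. tr (hfun (\<lambda>t. t / (t + h\<^sup>2)) (\<Sum>m\<in>PiE UNIV Ms. V (X m) ** V (X m))))
      + 4 * (msize Ms UNIV * (\<Sum>S | S \<noteq> {}. Ex q (\<lambda>\<omega>. tr (A \<omega> ** f (Cs S \<omega>)))))"
    using lev rec by linarith
  then show ?thesis
    unfolding C_def sum_codebook[where Ms = Ms and g = "\<lambda>\<omega>. tr (hfun (\<lambda>t. t\<^sup>2 / (t\<^sup>2 + h\<^sup>2)) (V \<omega>))", OF q Ms]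
    by (simp add: A_def Cs_def f_def)
qed

lemma hi_Ex: "(\<And>\<omega>. \<omega> \<in> set_pmf q \<Longrightarrow> hi (F \<omega>) (v \<omega>)) \<Longrightarrow> hi (\<lambda>h. Ex q (\<lambda>\<omega>. F \<omega> h)) (Ex q v)"
  unfolding Ex_def real_scaleR_def by (intro hi_sum hi_cmult)

text \<open>\<open>error_level\<close> integrated over \<open>h\<close> and divided by pi / 2. The
  constant is the product of \<open>4 * (1 - \<alpha>)\<close>, the prefactor
  \<open>2 powr (- \<alpha>) / sqrt 2\<close> of \<open>hi_error\<close>, and
  \<open>2 / pi * J\<close>.\<close>

lemma expected_error:
  fixes V :: "('t::finite \<Rightarrow> 'w) \<Rightarrow> 'n::finite op" and Ms :: "'s::finite \<Rightarrow> nat set"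
  assumes q: "mergeable q" and Ms: "\<And>s. finite (Ms s)" and V: "\<And>\<omega>. psd (V \<omega>)"
    and U: "distinct U" "set U = UNIV" and \<alpha>: "0 < \<alpha>" "\<alpha> < 1/2"
  shows "Ex (codebook I Ms q U) (\<lambda>X. (\<Sum>m\<in>PiE UNIV Ms. tr (V (X m))) - tr (hfun sqrt (\<Sum>m\<in>PiE UNIV Ms. V (X m) ** V (X m))))
    \<le> msize Ms UNIV * (2 * sqrt 2 * 2 powr (- \<alpha>) * (1 - \<alpha>) * (1 + 96/100 * \<alpha>))
        * (\<Sum>S | S \<noteq> {}. msize Ms S powr \<alpha> * Ex q (\<lambda>\<omega>. petz \<alpha> (V \<omega>) (avg I q S V \<omega>)))"
proof -
  define C where "C = codebook I Ms q U"
  obtain J where J: "0 \<le> J" "2 / pi * J \<le> 1 + 96/100 * \<alpha>" and hJ: "\<And>v z. 0 \<le> v \<Longrightarrow> 0 \<le> z \<Longrightarrow>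
    hi (\<lambda>h. v\<^sup>2 / (v\<^sup>2 + 2 * h\<^sup>2) * (z / (2 * sqrt 2 * h)) powr \<alpha>)
      (2 powr (- \<alpha>) / sqrt 2 * J * (v powr (1 - \<alpha>) * z powr \<alpha>))"
    using hi_error[OF \<alpha>] by blast
  define j where "j = 2 powr (- \<alpha>) / sqrt 2 * J"
  have hV: "hermitian (V \<omega>)" for \<omega> using V by (rule psd_herm)
  have pav: "psd (avg I q S V \<omega>)" for S \<omega> by (intro psd_avg V)
  have hav: "hermitian (avg I q S V \<omega>)" for S \<omega> using pav by (rule psd_herm)
  define O' where "O' X = (\<Sum>m\<in>PiE UNIV Ms. V (X m) ** V (X m))" for X :: "('s \<Rightarrow> nat) \<Rightarrow> 't \<Rightarrow> 'w"
  have pO: "psd (O' X)" for X unfolding O'_def by (intro psd_sum psd_herm_square hV)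
  have hO: "hermitian (O' X)" for X using pO by (rule psd_herm)
  define P where "P S \<omega> h = (\<Sum>k\<in>UNIV. \<Sum>l\<in>UNIV. ov (eu (V \<omega>)) (eu (avg I q S V \<omega>)) k l *
    ((ev (V \<omega>) k)\<^sup>2 / ((ev (V \<omega>) k)\<^sup>2 + 2 * h\<^sup>2) * (msize Ms S * ev (avg I q S V \<omega>) l / (2 * sqrt 2 * h)) powr \<alpha>))" for S \<omega> h
  have P: "hi (P S \<omega>) (j * msize Ms S powr \<alpha> * petz \<alpha> (V \<omega>) (avg I q S V \<omega>))" for S \<omega>
  proof -
    have "hi (P S \<omega>) (\<Sum>k\<in>UNIV. \<Sum>l\<in>UNIV. ov (eu (V \<omega>)) (eu (avg I q S V \<omega>)) k l *
      (2 powr (- \<alpha>) / sqrt 2 * J * ((ev (V \<omega>) k) powr (1 - \<alpha>) * (msize Ms S * ev (avg I q S V \<omega>) l) powr \<alpha>)))"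
      unfolding P_def[abs_def] by (intro hi_sum hi_cmult hJ ev_nonneg V mult_nonneg_nonneg msize_nonneg pav)
    also have "(\<Sum>k\<in>UNIV. \<Sum>l\<in>UNIV. ov (eu (V \<omega>)) (eu (avg I q S V \<omega>)) k l *
      (2 powr (- \<alpha>) / sqrt 2 * J * ((ev (V \<omega>) k) powr (1 - \<alpha>) * (msize Ms S * ev (avg I q S V \<omega>) l) powr \<alpha>)))
      = j * msize Ms S powr \<alpha> * petz \<alpha> (V \<omega>) (avg I q S V \<omega>)"
      unfolding petz_def tr_hfun_mult[OF hV hav] j_def sum_distrib_left
      by (intro sum.cong refl) (simp add: powr_mult msize_nonneg ev_nonneg[OF pav])
    finally show ?thesis .
  qed
  have level: "msize Ms UNIV * Ex q (\<lambda>\<omega>. \<Sum>k\<in>UNIV. (ev (V \<omega>) k)\<^sup>2 / ((ev (V \<omega>) k)\<^sup>2 + h\<^sup>2))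
    \<le> Ex C (\<lambda>X. \<Sum>k\<in>UNIV. (sqrt (ev (O' X) k))\<^sup>2 / ((sqrt (ev (O' X) k))\<^sup>2 + h\<^sup>2))
      + 4 * msize Ms UNIV * (1 - \<alpha>) * (\<Sum>S | S \<noteq> {}. Ex q (\<lambda>\<omega>. P S \<omega> h))" if h: "0 < h" for h
  proof -
    have t: "tr (damp h (V \<omega>) ** hfun (\<lambda>t. t / (1 + t)) ((msize Ms S / (2 * sqrt 2 * h)) *\<^sub>R avg I q S V \<omega>)) \<le> (1 - \<alpha>) * P S \<omega> h" for S \<omega>
    proof -
      have "tr (damp h (V \<omega>) ** hfun (\<lambda>t. t / (1 + t)) ((msize Ms S / (2 * sqrt 2 * h)) *\<^sub>R avg I q S V \<omega>))
        = (\<Sum>k\<in>UNIV. \<Sum>l\<in>UNIV. ov (eu (V \<omega>)) (eu (avg I q S V \<omega>)) k l * ((ev (V \<omega>) k)\<^sup>2 / ((ev (V \<omega>) k)\<^sup>2 + 2 * h\<^sup>2))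
          * (msize Ms S / (2 * sqrt 2 * h) * ev (avg I q S V \<omega>) l / (1 + msize Ms S / (2 * sqrt 2 * h) * ev (avg I q S V \<omega>) l)))"
        unfolding damp_def hfun_scaled[OF hav] by (rule tr_hfun_mult[OF hV hav])
      also have "\<dots> \<le> (\<Sum>k\<in>UNIV. \<Sum>l\<in>UNIV. ov (eu (V \<omega>)) (eu (avg I q S V \<omega>)) k l * ((ev (V \<omega>) k)\<^sup>2 / ((ev (V \<omega>) k)\<^sup>2 + 2 * h\<^sup>2))
          * ((1 - \<alpha>) * (msize Ms S / (2 * sqrt 2 * h) * ev (avg I q S V \<omega>) l) powr \<alpha>))"
        using h by (intro sum_mono mult_left_mono frac_le_powr \<alpha> mult_nonneg_nonneg divide_nonneg_nonneg msize_nonneg ev_nonneg pav) auto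
      also have "\<dots> = (1 - \<alpha>) * P S \<omega> h"
        by (simp add: P_def sum_distrib_left mult_ac)
      finally show ?thesis .
    qed
    have "Ex q (\<lambda>\<omega>. tr (damp h (V \<omega>) ** hfun (\<lambda>t. t / (1 + t)) ((msize Ms S / (2 * sqrt 2 * h)) *\<^sub>R avg I q S V \<omega>)))
      \<le> (1 - \<alpha>) * Ex q (\<lambda>\<omega>. P S \<omega> h)" for S
      unfolding Ex_cmult[symmetric] by (intro Ex_mono t)
    then have "(\<Sum>S | S \<noteq> {}. Ex q (\<lambda>\<omega>. tr (damp h (V \<omega>) ** hfun (\<lambda>t. t / (1 + t)) ((msize Ms S / (2 * sqrt 2 * h)) *\<^sub>R avg I q S V \<omega>))))
      \<le> (\<Sum>S | S \<noteq> {}. (1 - \<alpha>) * Ex q (\<lambda>\<omega>. P S \<omega> h))" by (intro sum_mono)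
    then have "4 * msize Ms UNIV * (\<Sum>S | S \<noteq> {}. Ex q (\<lambda>\<omega>. tr (damp h (V \<omega>) ** hfun (\<lambda>t. t / (1 + t)) ((msize Ms S / (2 * sqrt 2 * h)) *\<^sub>R avg I q S V \<omega>))))
      \<le> 4 * msize Ms UNIV * (\<Sum>S | S \<noteq> {}. (1 - \<alpha>) * Ex q (\<lambda>\<omega>. P S \<omega> h))"
      by (intro mult_left_mono) (simp_all add: msize_nonneg)
    also have "\<dots> = 4 * msize Ms UNIV * (1 - \<alpha>) * (\<Sum>S | S \<noteq> {}. Ex q (\<lambda>\<omega>. P S \<omega> h))"
      by (simp add: sum_distrib_left mult_ac)
    finally show ?thesis
      using error_level[where I = I and Ms = Ms and V = V, OF q Ms V U h] unfolding C_def[symmetric] O'_def[symmetric]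
      by (simp add: tr_hfun hV hO ev_nonneg pO)
  qed
  have h1: "hi (\<lambda>h. msize Ms UNIV * Ex q (\<lambda>\<omega>. \<Sum>k\<in>UNIV. (ev (V \<omega>) k)\<^sup>2 / ((ev (V \<omega>) k)\<^sup>2 + h\<^sup>2)))
    (msize Ms UNIV * Ex q (\<lambda>\<omega>. \<Sum>k\<in>UNIV. pi / 2 * ev (V \<omega>) k))"
    by (intro hi_cmult hi_Ex hi_sum hi_square ev_nonneg V)
  have h2: "hi (\<lambda>h. Ex C (\<lambda>X. \<Sum>k\<in>UNIV. (sqrt (ev (O' X) k))\<^sup>2 / ((sqrt (ev (O' X) k))\<^sup>2 + h\<^sup>2))
      + 4 * msize Ms UNIV * (1 - \<alpha>) * (\<Sum>S | S \<noteq> {}. Ex q (\<lambda>\<omega>. P S \<omega> h)))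
    (Ex C (\<lambda>X. \<Sum>k\<in>UNIV. pi / 2 * sqrt (ev (O' X) k))
      + 4 * msize Ms UNIV * (1 - \<alpha>) * (\<Sum>S | S \<noteq> {}. Ex q (\<lambda>\<omega>. j * msize Ms S powr \<alpha> * petz \<alpha> (V \<omega>) (avg I q S V \<omega>))))"
    by (intro hi_add hi_cmult hi_Ex hi_sum hi_square P real_sqrt_ge_zero ev_nonneg pO)
  define Z where "Z = (\<Sum>S | S \<noteq> {}. msize Ms S powr \<alpha> * Ex q (\<lambda>\<omega>. petz \<alpha> (V \<omega>) (avg I q S V \<omega>)))"
  have Z0: "0 \<le> Z" unfolding Z_def Ex_def by (intro sum_nonneg mult_nonneg_nonneg) (simp_all add: petz_nonneg V pav)
  have "(\<Sum>S | S \<noteq> {}. Ex q (\<lambda>\<omega>. j * msize Ms S powr \<alpha> * petz \<alpha> (V \<omega>) (avg I q S V \<omega>))) = j * Z"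
    unfolding Z_def by (simp add: mult.assoc Ex_cmult sum_distrib_left)
  then have "msize Ms UNIV * Ex q (\<lambda>\<omega>. \<Sum>k\<in>UNIV. pi / 2 * ev (V \<omega>) k)
    \<le> Ex C (\<lambda>X. \<Sum>k\<in>UNIV. pi / 2 * sqrt (ev (O' X) k)) + 4 * msize Ms UNIV * (1 - \<alpha>) * (j * Z)"
    using hi_mono[OF h1 h2 level] by simp
  moreover have E1: "Ex q (\<lambda>\<omega>. \<Sum>k\<in>UNIV. pi / 2 * ev (V \<omega>) k) = pi / 2 * Ex q (\<lambda>\<omega>. tr (V \<omega>))"
    by (simp only: tr_ev[OF hV] sum_distrib_left[symmetric] Ex_cmult)
  moreover have E2: "Ex C (\<lambda>X. \<Sum>k\<in>UNIV. pi / 2 * sqrt (ev (O' X) k)) = pi / 2 * Ex C (\<lambda>X. tr (hfun sqrt (O' X)))"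
    by (simp only: tr_hfun[OF hO] sum_distrib_left[symmetric] Ex_cmult)
  ultimately have "msize Ms UNIV * (pi / 2 * Ex q (\<lambda>\<omega>. tr (V \<omega>)))
    \<le> pi / 2 * Ex C (\<lambda>X. tr (hfun sqrt (O' X))) + 4 * msize Ms UNIV * (1 - \<alpha>) * (j * Z)"
    by (simp only:)
  then have "pi / 2 * (msize Ms UNIV * Ex q (\<lambda>\<omega>. tr (V \<omega>)) - Ex C (\<lambda>X. tr (hfun sqrt (O' X)))) \<le> 4 * msize Ms UNIV * (1 - \<alpha>) * (j * Z)"
    by (simp add: algebra_simps)
  then have F: "2 / pi * (pi / 2 * (msize Ms UNIV * Ex q (\<lambda>\<omega>. tr (V \<omega>)) - Ex C (\<lambda>X. tr (hfun sqrt (O' X))))) \<le> 2 / pi * (4 * msize Ms UNIV * (1 - \<alpha>) * (j * Z))"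
    by (intro mult_left_mono) auto
  then have "msize Ms UNIV * Ex q (\<lambda>\<omega>. tr (V \<omega>)) - Ex C (\<lambda>X. tr (hfun sqrt (O' X))) \<le> (4 / sqrt 2 * 2 powr (- \<alpha>) * msize Ms UNIV * (1 - \<alpha>) * Z) * (2 / pi * J)"
  proof -
    have r1: "2 / pi * (pi / 2 * x) = x" for x :: real by simp
    have r2: "2 / pi * (4 * msize Ms UNIV * (1 - \<alpha>) * (j * Z)) = (4 / sqrt 2 * 2 powr (- \<alpha>) * msize Ms UNIV * (1 - \<alpha>) * Z) * (2 / pi * J)"
      by (simp add: j_def mult_ac)
    show ?thesis using F unfolding r1 r2 .
  qed
  also have "\<dots> \<le> (4 / sqrt 2 * 2 powr (- \<alpha>) * msize Ms UNIV * (1 - \<alpha>) * Z) * (1 + 96/100 * \<alpha>)"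
    using J(2) \<alpha> Z0 by (intro mult_left_mono mult_nonneg_nonneg) (simp_all add: msize_nonneg)
  also have "4 / sqrt 2 = 2 * sqrt 2" by (simp add: field_simps)
  finally have fin: "msize Ms UNIV * Ex q (\<lambda>\<omega>. tr (V \<omega>)) - Ex C (\<lambda>X. tr (hfun sqrt (O' X)))
    \<le> msize Ms UNIV * (2 * sqrt 2 * 2 powr (- \<alpha>) * (1 - \<alpha>) * (1 + 96/100 * \<alpha>)) * Z"
    by (simp add: mult_ac)
  have "Ex C (\<lambda>X. (\<Sum>m\<in>PiE UNIV Ms. tr (V (X m))) - tr (hfun sqrt (O' X))) = Ex C (\<lambda>X. \<Sum>m\<in>PiE UNIV Ms. tr (V (X m))) - Ex C (\<lambda>X. tr (hfun sqrt (O' X)))"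
    by (simp add: Ex_def right_diff_distrib sum_subtractf)
  also have "Ex C (\<lambda>X. \<Sum>m\<in>PiE UNIV Ms. tr (V (X m))) = msize Ms UNIV * Ex q (\<lambda>\<omega>. tr (V \<omega>))"
    unfolding C_def by (rule sum_codebook[where Ms = Ms and g = "\<lambda>\<omega>. tr (V \<omega>)", OF q Ms])
  finally show ?thesis using fin unfolding C_def O'_def Z_def by simp
qed

section \<open>Expected leakage\<close>

lemma npow_scaleR:
  assumes A: "hermitian A" and c: "0 \<le> c"
  shows "npow p (c *\<^sub>R A) = c powr p * npow p A"
proof -
  have "hfun (\<lambda>t. \<bar>t\<bar> powr p) (c *\<^sub>R A) = hfun (\<lambda>t. c powr p * \<bar>t\<bar> powr p) A"
    unfolding hfun_scaled[OF A] using c by (intro hfun_cong[OF A]) (simp add: abs_mult powr_mult)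
  then show ?thesis by (simp add: npow_def hfun_scaleR[OF A, symmetric] tr_scaleR)
qed

text \<open>\<open>S\<close> is here the complement of the set in the recursion, the messages that
  are not redrawn: the transmitters that keep their seeds are those with
  \<open>I t \<subseteq> S\<close>.\<close>

lemma expected_leakage:
  fixes A :: "('t::finite \<Rightarrow> 'w) \<Rightarrow> 'n::finite op" and Ms :: "'s::finite \<Rightarrow> nat set"
  assumes q: "mergeable q" and Ms: "\<And>s. finite (Ms s)" "\<And>s. Ms s \<noteq> {}" and A: "\<And>\<omega>. psd (A \<omega>)"
    and I: "\<And>t. I t \<noteq> {}" and U: "distinct U" "set U = UNIV" and \<alpha>: "0 < \<alpha>" "\<alpha> < 1"
  shows "Ex (codebook I Ms q U) (\<lambda>X. npow (1 + \<alpha>) ((1 / msize Ms UNIV) *\<^sub>R (\<Sum>m\<in>PiE UNIV Ms. A (X m)) - Ex q A))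
    \<le> 2 * (\<Sum>S | S \<noteq> {}. msize Ms S powr (- \<alpha>) * Ex q (\<lambda>\<omega>. npow (1 + \<alpha>) (avg I q (- S) A \<omega>)))"
proof -
  define M where "M = msize Ms UNIV"
  have mpos: "0 < msize Ms S" for S
    unfolding msize_def by (intro prod_pos) (simp add: Ms card_gt_0_iff)
  then have M: "0 < M" by (simp add: M_def)
  define p where "p = 1 + \<alpha>"
  have p: "1 < p" "p < 2" using \<alpha> by (auto simp: p_def)
  define o' where "o' = Ex q A"
  have po: "psd o'" unfolding o'_def by (rule psd_Ex) (rule A)
  define G where "G B = npow p (B - M *\<^sub>R o')" for B
  have hC: "hermitian (M *\<^sub>R o')" by (intro herm_scaleR psd_herm po)
  have pav: "psd (avg I q S A \<omega>)" for S \<omega> by (intro psd_avg A)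
  have hav: "hermitian (avg I q S A \<omega>)" for S \<omega> using pav by (rule psd_herm)
  \<comment> \<open>Every transmitter knows some message, so redrawing for all messages forgets
    everything. The centred term of the recursion is therefore 0.\<close>
  have z: "avg I q UNIV A \<omega> = o'" for \<omega>
    using I by (simp add: avg_def transmitters_meeting_def merge_def o'_def)
  have n0: "npow p (0 :: 'n op) = 0" using npow_scaleR[of 0 0 p] p by simp
  define C where "C = codebook I Ms q U"
  have "Ex C (\<lambda>X. G (\<Sum>m\<in>PiE UNIV Ms. A (X m)))
    \<le> Ex q (\<lambda>\<omega>. G (M *\<^sub>R avg I q UNIV A \<omega>))
      + (\<Sum>S | S \<subset> UNIV. msize Ms (UNIV - S) * Ex q (\<lambda>\<omega>. 2 * npow p (msize Ms S *\<^sub>R avg I q S A \<omega>)))"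
    using codebook_recursion[where I = I and Ms = Ms and A = A, OF q Ms(1) step_double[OF step_npow[OF p]] step_npow_centred[OF p hC] A U(1)]
    unfolding U(2) C_def G_def M_def by simp
  also have "Ex q (\<lambda>\<omega>. G (M *\<^sub>R avg I q UNIV A \<omega>)) = 0" by (simp add: z G_def n0 Ex_def)
  also have "(\<Sum>S | S \<subset> UNIV. msize Ms (UNIV - S) * Ex q (\<lambda>\<omega>. 2 * npow p (msize Ms S *\<^sub>R avg I q S A \<omega>)))
    = (\<Sum>S | S \<noteq> {}. msize Ms S * Ex q (\<lambda>\<omega>. 2 * npow p (msize Ms (- S) *\<^sub>R avg I q (- S) A \<omega>)))"
    by (rule sum.reindex_bij_witness[of _ uminus uminus]) (auto simp flip: Compl_eq_Diff_UNIV)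
  also have "\<dots> = (\<Sum>S | S \<noteq> {}. M powr p * (2 * (msize Ms S powr (- \<alpha>) * Ex q (\<lambda>\<omega>. npow p (avg I q (- S) A \<omega>)))))"
  proof (intro sum.cong refl)
    fix S
    have "msize Ms S * msize Ms (- S) powr p = M powr p * msize Ms S powr (- \<alpha>)"
    proof -
      have "M powr p = msize Ms (- S) powr p * msize Ms S powr p"
        unfolding M_def msize_compl[of Ms S, symmetric] by (simp add: powr_mult)
      moreover have "msize Ms S powr p * msize Ms S powr (- \<alpha>) = msize Ms S"
        using mpos[of S] by (simp add: powr_add[symmetric] p_def)
      ultimately show ?thesis by (simp add: mult_ac)
    qed
    then show "msize Ms S * Ex q (\<lambda>\<omega>. 2 * npow p (msize Ms (- S) *\<^sub>R avg I q (- S) A \<omega>))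
      = M powr p * (2 * (msize Ms S powr (- \<alpha>) * Ex q (\<lambda>\<omega>. npow p (avg I q (- S) A \<omega>))))"
      by (simp add: npow_scaleR[OF hav] msize_nonneg Ex_cmult mult_ac)
  qed
  finally have main: "Ex C (\<lambda>X. G (\<Sum>m\<in>PiE UNIV Ms. A (X m))) \<le> M powr p * (2 * (\<Sum>S | S \<noteq> {}. msize Ms S powr (- \<alpha>) * Ex q (\<lambda>\<omega>. npow p (avg I q (- S) A \<omega>))))"
    by (simp add: sum_distrib_left)
  have "npow p ((1 / M) *\<^sub>R B - o') = M powr (- p) * G B" if B: "hermitian B" for B
  proof -
    have "(1 / M) *\<^sub>R B - o' = (1 / M) *\<^sub>R (B - M *\<^sub>R o')" using M by (simp add: scaleR_diff_right)
    then have "npow p ((1 / M) *\<^sub>R B - o') = (1 / M) powr p * G B"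
      unfolding G_def using M by (simp only:) (intro npow_scaleR herm_diff B hC, simp)
    moreover have "(1 / M) powr p = M powr (- p)" using M by (simp add: powr_divide powr_minus_divide)
    ultimately show ?thesis by (simp only:)
  qed
  then have "Ex C (\<lambda>X. npow p ((1 / M) *\<^sub>R (\<Sum>m\<in>PiE UNIV Ms. A (X m)) - o')) = M powr (- p) * Ex C (\<lambda>X. G (\<Sum>m\<in>PiE UNIV Ms. A (X m)))"
    by (simp add: herm_sum psd_herm A Ex_cmult)
  also have "\<dots> \<le> M powr (- p) * (M powr p * (2 * (\<Sum>S | S \<noteq> {}. msize Ms S powr (- \<alpha>) * Ex q (\<lambda>\<omega>. npow p (avg I q (- S) A \<omega>)))))"
    by (intro mult_left_mono main) simp
  also have "\<dots> = 2 * (\<Sum>S | S \<noteq> {}. msize Ms S powr (- \<alpha>) * Ex q (\<lambda>\<omega>. npow p (avg I q (- S) A \<omega>)))"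
    using M by (simp add: mult.assoc[symmetric] powr_add[symmetric])
  finally show ?thesis by (simp add: C_def M_def o'_def p_def)
qed


lemma merge_support:
  assumes q: "mergeable q" and "a \<in> set_pmf q" "b \<in> set_pmf q"
  shows "merge J a b \<in> set_pmf q"
proof -
  have "merge J a b \<in> set_pmf (map_pmf (\<lambda>(a, b). merge J a b) (pair_pmf q q))"
    using assms by force
  moreover have "map_pmf (\<lambda>(a, b). merge J a b) (pair_pmf q q) = q"
    using q unfolding mergeable_def by blast
  ultimately show ?thesis by (simp only:)
qed

lemma avg_cong:
  assumes "mergeable q" "\<omega> \<in> set_pmf q" "\<And>\<omega>. \<omega> \<in> set_pmf q \<Longrightarrow> A \<omega> = B \<omega>"
  shows "avg I q S A \<omega> = avg I q S B \<omega>"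
  unfolding avg_def by (intro Ex_cong assms merge_support)

subsection \<open>Numbers of eigenvalues\<close>

lemma hermitian_eigproj: "hermitian \<sigma> \<Longrightarrow> hermitian (eigproj \<sigma> l)"
  by (metis eigproj_conjd conjd_herm eu_unitary eu_ev)

lemma hermitian_pinching:
  assumes "hermitian \<sigma>" "hermitian \<rho>"
  shows "hermitian (pinching \<sigma> \<rho>)"
  unfolding pinching_def by (intro herm_sum herm_sandwich assms hermitian_eigproj)

lemma one_le_Max_card:
  assumes "\<exists>x. 0 < (P :: 'w::finite \<Rightarrow> real) x" "\<And>x. 0 < P x \<Longrightarrow> hermitian (F x)"
  shows "1 \<le> real (Max ((\<lambda>x. card (eigvals (F x))) ` {x. 0 < P x}))"
proof -
  obtain x where x: "0 < P x" using assms(1) by blast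
  have "1 \<le> card (eigvals (F x))" by (rule card_eigvals[OF assms(2)[OF x]])
  also have "\<dots> \<le> Max ((\<lambda>x. card (eigvals (F x))) ` {x. 0 < P x})"
    using x by (intro Max_ge) auto
  finally show ?thesis by simp
qed

lemma mu_B_ge_1:
  assumes "\<exists>x. 0 < P x" "\<And>x. 0 \<le> P x" "\<And>x. 0 < P x \<Longrightarrow> psd (W x)"
  shows "1 \<le> real (mu_B P W T)"
  unfolding mu_B_def Let_def using assms
  by (intro one_le_Max_card hermitian_pinching psd_herm psd_mean_state psd_cond_state)

lemma mu_E_ge_1:
  assumes "\<exists>x. 0 < P x" "\<And>x. 0 \<le> P x" "\<And>x. 0 < P x \<Longrightarrow> psd (W x)"
  shows "1 \<le> real (mu_E I Bs P W i)"
proof -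
  have "hermitian (omega I Bs P W x i)" for x
    by (induction i) (simp_all add: Let_def hermitian_pinching psd_herm psd_mean_state psd_cond_state assms)
  then show ?thesis unfolding mu_E_def using assms(1) by (intro one_le_Max_card)
qed

subsection \<open>Trace norms\<close>

lemma trace_norm_sandwich:
  assumes \<sigma>: "psd \<sigma>" "tr \<sigma> = 1" and Y: "hermitian Y" and \<alpha>: "0 < \<alpha>"
  shows "trace_norm (sandwich (\<alpha> / (2 * (1 + \<alpha>))) \<sigma> Y) \<le> npow (1 + \<alpha>) Y powr (1 / (1 + \<alpha>))"
proof -
  define D where "D = sandwich (\<alpha> / (2 * (1 + \<alpha>))) \<sigma> Y"
  have D: "hermitian D" unfolding D_def sandwich_def by (intro herm_sandwich Y hfun_herm psd_herm \<sigma>)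
  show ?thesis
    unfolding D_def[symmetric] trace_norm_hfun[OF D]
    by (rule tr_sandwich_le[OF \<sigma> Y sgn_contract[OF D] \<alpha>, folded sandwich_def D_def])
qed

lemma trace_norm_density_diff:
  assumes "density_op A" "density_op B"
  shows "trace_norm (A - B) \<le> 2"
proof -
  have p: "psd A" "psd B" and t: "tr A = 1" "tr B = 1" using assms by (auto simp: density_op_def tr_def)
  have D: "hermitian (A - B)" using p by (simp add: herm_diff psd_herm)
  define J where "J = hfun sgn (A - B)"
  have "0 \<le> tr (A ** (mat 1 - J))" "0 \<le> tr (B ** (mat 1 + J))"
    unfolding J_def by (intro tr_mult_psd p sgn_contract[OF D])+
  then have "tr (A ** J) \<le> 1" "- tr (B ** J) \<le> 1" using t by (simp_all add: mx trs)
  moreover have "trace_norm (A - B) = tr (A ** J) - tr (B ** J)"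
    using tr_comm[of J "A - B"] by (simp add: trace_norm_hfun[OF D] J_def[symmetric] mx trs)
  ultimately show ?thesis by linarith
qed

text \<open>Negative powers act on the support only, so the two powers multiply to the support
  projection \<open>pj\<close>. A positive multiple of \<open>W\<close> is below
  \<open>\<sigma>\<close>, hence \<open>W\<close> lives on that support.\<close>

lemma sandwich_inverse:
  assumes \<sigma>: "psd \<sigma>" and W: "psd W" and p: "0 < p" and le: "psd (\<sigma> - p *\<^sub>R W)"
  shows "sandwich c \<sigma> (sandwich (- c) \<sigma> W) = W"
proof -
  have h: "hermitian \<sigma>" using \<sigma> by (rule psd_herm)
  define pj where "pj = hfun (\<lambda>t. if t = 0 then 0 else 1) \<sigma>"
  have e: "hfun (\<lambda>t. t powr c) \<sigma> ** hfun (\<lambda>t. t powr (- c)) \<sigma> = pj" "hfun (\<lambda>t. t powr (- c)) \<sigma> ** hfun (\<lambda>t. t powr c) \<sigma> = pj"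
    unfolding hfun_mult[OF h] pj_def by (rule hfun_cong_psd[OF \<sigma>], simp add: powr_add[symmetric])+
  have z: "\<sigma> ** (mat 1 - pj) = 0"
  proof -
    have "\<sigma> ** pj = hfun (\<lambda>t. t * (if t = 0 then 0 else 1)) \<sigma>"
      using hfun_mult[OF h, of "\<lambda>t. t" "\<lambda>t. if t = 0 then 0 else 1"] by (simp only: pj_def hfun_id[OF h])
    also have "\<dots> = hfun (\<lambda>t. t) \<sigma>" by (rule hfun_cong[OF h]) simp
    finally show ?thesis by (simp add: mx hfun_id[OF h])
  qed
  have "W ** (mat 1 - pj) = 0"
  proof -
    have "(W ** (mat 1 - pj)) *v v = 0" for v
    proof -
      have "\<sigma> *v ((mat 1 - pj) *v v) = 0" by (simp add: matrix_vector_mul_assoc z)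
      then have "(p *\<^sub>R W) *v ((mat 1 - pj) *v v) = 0"
        using p by (intro kernel_mono[OF psd_scaleR[OF W] le]) simp
      then have "p *\<^sub>R (W *v ((mat 1 - pj) *v v)) = 0" by (simp only: scaleR_mult_vec)
      then have "W *v ((mat 1 - pj) *v v) = 0" using p by simp
      then show ?thesis by (simp only: matrix_vector_mul_assoc)
    qed
    then show ?thesis by (simp add: matrix_eq)
  qed
  then have r: "W ** pj = W" by (simp add: mx)
  have "hermitian pj" unfolding pj_def by (rule hfun_herm[OF h])
  then have l: "pj ** W = W"
    using arg_cong[OF r, of dagger] psd_herm[OF W] by (simp add: dagger_mult hermitian_def)
  have "sandwich c \<sigma> (sandwich (- c) \<sigma> W) = (hfun (\<lambda>t. t powr c) \<sigma> ** hfun (\<lambda>t. t powr (- c)) \<sigma>) ** W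
    ** (hfun (\<lambda>t. t powr (- c)) \<sigma> ** hfun (\<lambda>t. t powr c) \<sigma>)"
    by (simp add: sandwich_def matrix_mul_assoc)
  then show ?thesis by (simp add: e r l)
qed

lemma sandwich_linear:
  "sandwich c \<sigma> (A - B) = sandwich c \<sigma> A - sandwich c \<sigma> B"
  "sandwich c \<sigma> (r *\<^sub>R A) = r *\<^sub>R sandwich c \<sigma> A"
  "sandwich c \<sigma> (\<Sum>i\<in>S. F i) = (\<Sum>i\<in>S. sandwich c \<sigma> (F i))"
  by (simp_all add: sandwich_def mx matrix_sum_left matrix_sum_right)

lemma sandwich_Ex: "sandwich c \<sigma> (Ex p F) = Ex p (\<lambda>x. sandwich c \<sigma> (F x))"
  by (simp add: Ex_def sandwich_linear)

lemma weighted_le_mean: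
  fixes W :: "'w::finite \<Rightarrow> 'b::finite op"
  assumes P: "\<And>x. 0 \<le> P x" and W: "\<And>x. 0 < P x \<Longrightarrow> psd (W x)"
  shows "psd (mean_state P W - P x *\<^sub>R W x)"
proof (cases "P x = 0")
  case True
  then show ?thesis using psd_mean_state[of P W] P W by simp
next
  case False
  then have "0 < P x" using P[of x] by simp
  moreover have "law_of P (\<lambda>x. x) x = P x" by (simp add: law_of_def)
  ultimately show ?thesis
    using cond_le_mean[of P W "\<lambda>x. x" x] P W cond_state_inj[of "\<lambda>x. x" P x W] by simp
qed

subsection \<open>Numbers of messages\<close>

lemma message_set_card:
  assumes "0 \<le> r"
  shows "finite (message_set r)" "message_set r \<noteq> {}" "1 \<in> message_set r" "1 \<le> real (card (message_set r))"
    "real (card (message_set r)) \<le> 2 powr r" "2 powr r < real (card (message_set r)) + 1"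
proof -
  have "1 \<le> 2 powr r" using assms ge_one_powr_ge_zero[of 2 r] by simp
  then have f: "1 \<le> \<lfloor>2 powr r\<rfloor>" by simp
  have c: "real (card (message_set r)) = of_int \<lfloor>2 powr r\<rfloor>" using f by (simp add: message_set_def)
  show "finite (message_set r)" "message_set r \<noteq> {}" "1 \<in> message_set r"
    using f by (auto simp: message_set_def le_nat_iff)
  show "1 \<le> real (card (message_set r))" using f unfolding c by linarith
  show "real (card (message_set r)) \<le> 2 powr r" "2 powr r < real (card (message_set r)) + 1"
    unfolding c by linarith+
qed

text \<open>The Weierstrass product inequality; the bounds by 0 and 1 are carried along for the
  induction.\<close>

lemma one_minus_sum_le_prod:
  fixes y :: "'s \<Rightarrow> real"
  assumes "finite S" "\<And>s. s \<in> S \<Longrightarrow> 0 \<le> y s \<and> y s \<le> 1"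
  shows "1 - sum y S \<le> (\<Prod>s\<in>S. 1 - y s) \<and> (\<Prod>s\<in>S. 1 - y s) \<le> 1 \<and> 0 \<le> (\<Prod>s\<in>S. 1 - y s)"
  using assms
proof (induction S rule: finite_induct)
  case (insert s S)
  then have IH: "1 - sum y S \<le> (\<Prod>s\<in>S. 1 - y s)" "(\<Prod>s\<in>S. 1 - y s) \<le> 1" "0 \<le> (\<Prod>s\<in>S. 1 - y s)"
    and y: "0 \<le> y s" "y s \<le> 1" by auto
  have "y s * (\<Prod>s\<in>S. 1 - y s) \<le> y s * 1" using IH y by (intro mult_left_mono) auto
  moreover have "0 \<le> y s * (\<Prod>s\<in>S. 1 - y s)" using IH y by simp
  moreover have "0 \<le> (1 - y s) * (\<Prod>s\<in>S. 1 - y s)" using IH y by simp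
  ultimately show ?case using insert.hyps IH by (simp add: left_diff_distrib)
qed simp

lemma sum_squares_le_square_sum:
  fixes y :: "'s \<Rightarrow> real"
  assumes "finite S" "\<And>s. s \<in> S \<Longrightarrow> 0 \<le> y s"
  shows "(\<Sum>s\<in>S. (y s)\<^sup>2) \<le> (sum y S)\<^sup>2"
  using assms
proof (induction S rule: finite_induct)
  case (insert s S)
  then have "0 \<le> 2 * y s * sum y S" by (simp add: sum_nonneg)
  then show ?case using insert by (simp add: power2_sum)
qed simp

text \<open>Rounding the numbers of messages down costs at most the factor \<open>2 powr \<alpha>\<close> once the bound on the
  leakage is below \<open>2\<close>: the singleton terms then force \<open>\<Sum>\<^sub>s 1 / (n s + 1) \<le> 1/2\<close>.\<close>

lemma leakage_rounding:
  fixes n R :: "'s::finite \<Rightarrow> real" and Q y :: "'s set \<Rightarrow> real"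
  assumes \<alpha>: "0 < \<alpha>" "\<alpha> < 1/2" and n: "\<And>s. 1 \<le> n s" "\<And>s. 2 powr R s < n s + 1"
    and Q: "\<And>S. 1 \<le> Q S" and y: "\<And>S. 0 \<le> y S" "\<And>S. (y S)\<^sup>2 = 2 powr (- \<alpha> * (\<Sum>s\<in>S. R s)) * Q S"
    and B: "0 < B" "B < 2" "2 / sqrt \<alpha> * (\<Sum>S | S \<noteq> {}. y S) \<le> B"
  shows "2 * (\<Sum>S | S \<noteq> {}. (\<Prod>s\<in>S. n s) powr (- \<alpha>) * Q S) \<le> \<alpha> * B powr (1 + \<alpha>)"
proof -
  define Y where "Y = (\<Sum>S | S \<noteq> {}. y S)"
  have Y0: "0 \<le> Y" by (simp add: Y_def sum_nonneg y)
  have sa: "0 < sqrt \<alpha>" using \<alpha> by simp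
  have YB: "2 * Y \<le> B * sqrt \<alpha>" using B(3) sa by (simp add: Y_def[symmetric] field_simps)
  have Y1: "Y < sqrt \<alpha>"
  proof -
    have "B * sqrt \<alpha> < 2 * sqrt \<alpha>" using B sa by simp
    then show ?thesis using YB by linarith
  qed
  \<comment> \<open>The root of a lower bound for the singleton term:
    \<open>2 powr R s < n s + 1\<close> and \<open>1 \<le> Q {s}\<close> give
    \<open>x s \<le> y {s}\<close>.\<close>
  define x where "x s = (n s + 1) powr (- \<alpha> / 2)" for s
  have x0: "0 \<le> x s" for s by (simp add: x_def)
  have xy: "x s \<le> y {s}" for s
  proof (rule power2_le_imp_le[OF _ y(1)])
    have "(x s)\<^sup>2 = (n s + 1) powr (- \<alpha>)"
      using n(1)[of s] unfolding x_def by (simp add: power2_eq_square powr_add[symmetric])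
    also have "\<dots> \<le> (2 powr R s) powr (- \<alpha>)"
      using n(2)[of s] \<alpha> by (intro powr_mono2') auto
    also have "\<dots> = 2 powr (- \<alpha> * (\<Sum>s\<in>{s}. R s)) * 1" by (simp add: powr_powr mult.commute)
    also have "\<dots> \<le> 2 powr (- \<alpha> * (\<Sum>s\<in>{s}. R s)) * Q {s}" by (intro mult_left_mono Q) simp
    finally show "(x s)\<^sup>2 \<le> (y {s})\<^sup>2" by (simp only: y(2))
  qed
  have "(\<Sum>s\<in>UNIV. x s) \<le> (\<Sum>s\<in>UNIV. y {s})" by (intro sum_mono xy)
  also have "\<dots> = (\<Sum>S\<in>range (\<lambda>s. {s}). y S)" by (simp add: sum.reindex inj_def)
  also have "\<dots> \<le> Y" unfolding Y_def by (intro sum_mono2) (auto simp: y)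
  finally have xs: "(\<Sum>s\<in>UNIV. x s) < sqrt \<alpha>" using Y1 by simp
  define r where "r s = 1 / (n s + 1)" for s
  have r: "0 \<le> r s \<and> r s \<le> 1" for s using n(1)[of s] by (simp add: r_def)
  have rx: "r s \<le> (x s)\<^sup>2" for s
  proof -
    have "r s = (n s + 1) powr (- 1)" using n(1)[of s] by (simp add: r_def powr_minus_divide)
    also have "\<dots> \<le> (n s + 1) powr (- \<alpha>)" using n(1)[of s] \<alpha> by (intro powr_mono) auto
    also have "\<dots> = (x s)\<^sup>2" using n(1)[of s] unfolding x_def by (simp add: power2_eq_square powr_add[symmetric])
    finally show ?thesis .
  qed
  \<comment> \<open>The sum of the relative rounding losses is bounded by the squared sum of the
    singleton roots, hence by \<alpha>, which is below 1/2.\<close>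
  have "(\<Sum>s\<in>UNIV. r s) \<le> (\<Sum>s\<in>UNIV. (x s)\<^sup>2)" by (intro sum_mono rx)
  also have "\<dots> \<le> (\<Sum>s\<in>UNIV. x s)\<^sup>2" by (intro sum_squares_le_square_sum) (simp_all add: x0)
  also have "\<dots> \<le> (sqrt \<alpha>)\<^sup>2" using xs by (intro power_mono) (auto simp: sum_nonneg x0)
  finally have rs: "(\<Sum>s\<in>UNIV. r s) < 1/2" using \<alpha> by simp
  have prod: "1/2 \<le> (\<Prod>s\<in>S. 1 - r s)" for S
  proof -
    have "(\<Sum>s\<in>S. r s) \<le> (\<Sum>s\<in>UNIV. r s)" by (intro sum_mono2) (auto simp: r)
    moreover have "1 - (\<Sum>s\<in>S. r s) \<le> (\<Prod>s\<in>S. 1 - r s)"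
      using one_minus_sum_le_prod[of S r] r by simp
    ultimately show ?thesis using rs by linarith
  qed
  have m: "(\<Prod>s\<in>S. n s) powr (- \<alpha>) \<le> 2 powr \<alpha> * 2 powr (- \<alpha> * (\<Sum>s\<in>S. R s))" for S
  proof -
    \<comment> \<open>Writing \<open>n s = (n s + 1) * (1 - r s)\<close> shows that all roundings
      together lose at most a factor 2.\<close>
    have "2 powr (\<Sum>s\<in>S. R s) * (1/2) \<le> (\<Prod>s\<in>S. n s)"
    proof -
      have ns: "n s = (n s + 1) * (1 - r s)" for s using n(1)[of s] by (simp add: r_def field_simps)
      have "2 powr (\<Sum>s\<in>S. R s) = (\<Prod>s\<in>S. 2 powr R s)" by (simp add: powr_sum)
      also have "\<dots> \<le> (\<Prod>s\<in>S. n s + 1)" using n(2) by (intro prod_mono) (auto intro: less_imp_le)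
      finally have "2 powr (\<Sum>s\<in>S. R s) * (1/2) \<le> (\<Prod>s\<in>S. n s + 1) * (\<Prod>s\<in>S. 1 - r s)"
        using n(1) by (intro mult_mono prod prod_nonneg) (auto intro: add_nonneg_nonneg order_trans[OF zero_le_one])
      also have "\<dots> = (\<Prod>s\<in>S. n s)" unfolding prod.distrib[symmetric] ns[symmetric] ..
      finally show ?thesis .
    qed
    then have "(\<Prod>s\<in>S. n s) powr (- \<alpha>) \<le> (2 powr (\<Sum>s\<in>S. R s) * (1/2)) powr (- \<alpha>)"
      using \<alpha> by (intro powr_mono2') auto
    also have "\<dots> = 2 powr (- \<alpha> * (\<Sum>s\<in>S. R s)) * (1/2) powr (- \<alpha>)"
      by (subst powr_mult) (simp_all add: powr_powr mult.commute)
    also have "(1/2) powr (- \<alpha>) = (2 :: real) powr \<alpha>" by (simp add: powr_divide powr_minus_divide)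
    finally show ?thesis by (simp add: mult.commute)
  qed
  have "(\<Sum>S | S \<noteq> {}. (\<Prod>s\<in>S. n s) powr (- \<alpha>) * Q S) \<le> (\<Sum>S | S \<noteq> {}. 2 powr \<alpha> * (y S)\<^sup>2)"
  proof (intro sum_mono)
    fix S
    have "(\<Prod>s\<in>S. n s) powr (- \<alpha>) * Q S \<le> 2 powr \<alpha> * 2 powr (- \<alpha> * (\<Sum>s\<in>S. R s)) * Q S"
      using Q[of S] by (intro mult_right_mono m) auto
    then show "(\<Prod>s\<in>S. n s) powr (- \<alpha>) * Q S \<le> 2 powr \<alpha> * (y S)\<^sup>2" by (simp add: y(2) mult.assoc)
  qed
  also have "\<dots> = 2 powr \<alpha> * (\<Sum>S | S \<noteq> {}. (y S)\<^sup>2)" by (simp add: sum_distrib_left)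
  also have "\<dots> \<le> 2 powr \<alpha> * Y\<^sup>2" unfolding Y_def by (intro mult_left_mono sum_squares_le_square_sum) (auto simp: y)
  also have "\<dots> \<le> 2 powr \<alpha> * (B * sqrt \<alpha> / 2)\<^sup>2" using YB Y0 by (intro mult_left_mono power_mono) auto
  also have "(B * sqrt \<alpha> / 2)\<^sup>2 = \<alpha> * B\<^sup>2 / 4" using \<alpha> by (simp add: power_divide power_mult_distrib)
  finally have "2 * (\<Sum>S | S \<noteq> {}. (\<Prod>s\<in>S. n s) powr (- \<alpha>) * Q S) \<le> \<alpha> * (2 powr \<alpha> / 2 * B\<^sup>2)" by (simp add: mult_ac)
  \<comment> \<open>\<open>B < 2\<close> exchanges a power \<open>1 - \<alpha>\<close> of
    \<open>B\<close> for one of 2, which uses up the factor \<open>2 powr \<alpha> / 2\<close> left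
    over from rounding.\<close>
  also have "\<dots> \<le> \<alpha> * B powr (1 + \<alpha>)"
  proof (intro mult_left_mono)
    have "B\<^sup>2 = B powr (1 + \<alpha>) * B powr (1 - \<alpha>)" using B by (simp add: powr_add[symmetric])
    also have "\<dots> \<le> B powr (1 + \<alpha>) * 2 powr (1 - \<alpha>)" using B \<alpha> by (intro mult_left_mono powr_mono2) auto
    finally have "2 powr \<alpha> / 2 * B\<^sup>2 \<le> 2 powr \<alpha> / 2 * (B powr (1 + \<alpha>) * 2 powr (1 - \<alpha>))" by (intro mult_left_mono) auto
    also have "\<dots> = B powr (1 + \<alpha>) * (2 powr \<alpha> * 2 powr (1 - \<alpha>) / 2)" by simp
    also have "(2::real) powr \<alpha> * 2 powr (1 - \<alpha>) / 2 = 1" by (simp add: powr_add[symmetric])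
    finally show "2 powr \<alpha> / 2 * B\<^sup>2 \<le> B powr (1 + \<alpha>)" by simp
  qed (use \<alpha> in simp)
  finally show ?thesis .
qed


section \<open>From seeds back to words, encoders and the code\<close>

lemma avg_word_support:
  fixes W :: "('t::finite \<Rightarrow> 'c::finite) \<Rightarrow> 'n::finite op"
    and I :: "'t \<Rightarrow> 's::finite set" and S :: "'s set"
  assumes p: "conditional_laws I L p" and w: "\<omega> \<in> set_pmf (seeds I L p)"
    and V: "\<And>\<omega>. \<omega> \<in> set_pmf (seeds I L p) \<Longrightarrow> V \<omega> = W (word I \<omega>)"
  shows "avg I (seeds I L p) S V \<omega> = cond_state (joint_law I L p) W
    (\<lambda>x. restrict x (- transmitters_meeting I S)) (restrict (word I \<omega>) (- transmitters_meeting I S))"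
proof -
  have "avg I (seeds I L p) S V \<omega> = avg I (seeds I L p) S (\<lambda>\<omega>. W (word I \<omega>)) \<omega>"
    by (rule avg_cong[OF mergeable_seeds w V])
  also have "\<dots> = cond_state (joint_law I L p) W
    (\<lambda>x. restrict x (- transmitters_meeting I S)) (restrict (word I \<omega>) (- transmitters_meeting I S))"
    by (rule avg_word(1)[OF p w])
  finally show ?thesis .
qed

text \<open>The averages over the seeds of all transmitters meeting \<open>S\<close> produce the reference states of
  the relative entropies in the error bound.\<close>

lemma petz_term:
  fixes W :: "('t::finite \<Rightarrow> 'c::finite) \<Rightarrow> 'n::finite op"
    and I :: "'t \<Rightarrow> 's::finite set" and S :: "'s set"
  assumes p: "conditional_laws I L p" and \<alpha>: "0 < \<alpha>" "\<alpha> < 1/2" and I: "\<And>t. I t \<noteq> {}"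
    and W: "\<And>x. 0 < joint_law I L p x \<Longrightarrow> density_op (W x)"
    and V: "\<And>\<omega>. \<omega> \<in> set_pmf (seeds I L p) \<Longrightarrow> V \<omega> = W (word I \<omega>)"
  shows "Ex (seeds I L p) (\<lambda>\<omega>. petz \<alpha> (V \<omega>) (avg I (seeds I L p) S V \<omega>))
    \<le> 2 powr (- \<alpha> * (if S = UNIV then D_of (- \<alpha>) (joint_law I L p) W (\<lambda>x. x)
        else I_of (- \<alpha>) (joint_law I L p) W (\<lambda>x. restrict x (transmitters_meeting I S))
                          (\<lambda>x. restrict x (- transmitters_meeting I S))))"
proof -
  define P where "P = joint_law I L p"
  define g where "g = (\<lambda>x :: 't \<Rightarrow> 'c. restrict x (- transmitters_meeting I S))"
  have P0: "0 \<le> P x" for x unfolding P_def by (rule joint_law_nonneg[OF p])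
  have P1: "(\<Sum>x\<in>UNIV. P x) = 1" unfolding P_def by (rule joint_law_sum[OF p])
  have W': "0 < P x \<Longrightarrow> density_op (W x)" for x using W by (simp add: P_def)
  have "Ex (seeds I L p) (\<lambda>\<omega>. petz \<alpha> (V \<omega>) (avg I (seeds I L p) S V \<omega>))
    = Ex (seeds I L p) (\<lambda>\<omega>. petz \<alpha> (W (word I \<omega>)) (cond_state P W g (g (word I \<omega>))))"
    by (intro Ex_cong) (simp add: V avg_word_support[where V = V and W = W, OF p _ V] P_def g_def)
  also have "\<dots> = (\<Sum>x\<in>UNIV. P x * petz \<alpha> (W x) (cond_state P W g (g x)))"
    unfolding P_def using Ex_word[OF p, of "\<lambda>x. petz \<alpha> (W x) (cond_state (joint_law I L p) W g (g x))"] by simp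
  finally have e: "Ex (seeds I L p) (\<lambda>\<omega>. petz \<alpha> (V \<omega>) (avg I (seeds I L p) S V \<omega>))
    = (\<Sum>x\<in>UNIV. P x * petz \<alpha> (W x) (cond_state P W g (g x)))" .
  show ?thesis
  proof (cases "S = UNIV")
    case True
    \<comment> \<open>Every transmitter meets \<open>UNIV\<close>, so nothing is conditioned on and
      the reference state is the mean.\<close>
    have "g x = g x'" for x x' using I by (auto simp: g_def True transmitters_meeting_def restrict_def)
    then have "{x'. g x' = g x} = UNIV" for x by auto
    then have "cond_state P W g (g x) = mean_state P W" for x
      by (simp add: cond_state_def law_of_def mean_state_def P1)
    then show ?thesis unfolding e using petz_le_D[OF P0 W' \<alpha>] True by (simp add: P_def)
  next
    case False
    have "inj (\<lambda>x :: 't \<Rightarrow> 'c. (restrict x (transmitters_meeting I S), g x))"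
    proof (rule injI)
      fix x x' :: "'t \<Rightarrow> 'c"
      assume a: "(restrict x (transmitters_meeting I S), g x) = (restrict x' (transmitters_meeting I S), g x')"
      show "x = x'"
      proof
        fix t
        show "x t = x' t"
        proof (cases "t \<in> transmitters_meeting I S")
          case True
          have "restrict x (transmitters_meeting I S) t = restrict x' (transmitters_meeting I S) t" using a by simp
          then show ?thesis using True by simp
        next
          case False
          have "g x t = g x' t" using a by simp
          then show ?thesis using False by (simp add: g_def)
        qed
      qed
    qed
    from petz_le_I[OF P0 P1 W' this \<alpha>] show ?thesis unfolding e using False by (simp add: P_def g_def)
  qed
qed

lemma inside_compl: "- transmitters_meeting I (- S) = transmitters_inside I S"
  by (auto simp: transmitters_meeting_def transmitters_inside_def)

lemma codebook_encoders:
  fixes I :: "'t::finite \<Rightarrow> 's::finite set" and X :: "'t \<Rightarrow> 'x::finite set" and U :: "'t \<Rightarrow> 'u::finite set"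
    and \<theta> :: "'t \<Rightarrow> 'x \<Rightarrow> 'a::finite op" and R :: "'s \<Rightarrow> real"
  defines "L \<equiv> symbols I X U"
  defines "Ms \<equiv> \<lambda>s. message_set (R s)"
  assumes p: "conditional_laws I L p" and R: "\<And>s. 0 \<le> R s" and \<theta>: "\<forall>t. \<forall>x \<in> X t. \<theta> t x \<in> densities_on (H t)"
    and V: "set V = UNIV" and C: "C \<in> set_pmf (codebook I Ms (seeds I L p) V)"
  defines "F \<equiv> \<lambda>t m. \<theta> t (fst (word I (C m) t))"
  shows "m \<in> Pi\<^sub>E (I t) Ms \<Longrightarrow> F t m \<in> densities_on (H t)"
    and "code_output N I F m = word_output N \<theta> (word I (C m))"
proof -
  have fMs: "finite (Ms s)" for s unfolding Ms_def by (rule message_set_card(1)[OF R])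
  have loc: "word I (C m) t = word I (C m') t" if "\<And>s. s \<in> I t \<Longrightarrow> m s = m' s" for m m' t
    using that by (intro word_cong codebook_local[OF fMs C]) auto
  show "F t m \<in> densities_on (H t)" if m: "m \<in> Pi\<^sub>E (I t) Ms"
  proof -
    \<comment> \<open>An encoder sees only part of the messages; filling in the message 1 elsewhere
      gives a full legal tuple with the same symbol.\<close>
    define m' where "m' s = (if s \<in> I t then m s else 1)" for s
    have "m' s \<in> Ms s" for s using m message_set_card(3)[OF R[of s]] by (auto simp: m'_def Ms_def)
    then have "C m' \<in> set_pmf (seeds I L p)" by (intro codebook_support[OF mergeable_seeds fMs C])
    then have "word I (C m') t \<in> L t" by (rule word_in[OF p])
    then have "fst (word I (C m') t) \<in> X t" by (auto simp: L_def symbols_def)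
    moreover have "word I (C m) t = word I (C m') t" by (rule loc) (simp add: m'_def)
    ultimately show ?thesis using \<theta> by (simp add: F_def)
  qed
  have "word I (C (restrict m (I t))) t = word I (C m) t" for t by (rule loc) simp
  then show "code_output N I F m = word_output N \<theta> (word I (C m))"
    by (simp add: code_output_def word_output_def F_def)
qed

theorem theorem1:
  fixes H :: "'t::finite \<Rightarrow> 'a::finite set"
    and N :: "('t \<Rightarrow> 'a) op \<Rightarrow> ('b::finite \<times> 'e::finite) op"
    and \<phi>0 :: "'t \<Rightarrow> 'a op"
    and I :: "'t \<Rightarrow> 's::finite set"
    and Bs :: "'s set list"
    and R :: "'s \<Rightarrow> real"
    and X :: "'t \<Rightarrow> 'x::finite set"
    and U :: "'t \<Rightarrow> 'u::finite set"
    and p :: "'t \<Rightarrow> 'x \<times> 'u option \<Rightarrow> ('t \<Rightarrow> 'x \<times> 'u option) \<Rightarrow> real"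
    and \<theta> :: "'t \<Rightarrow> 'x \<Rightarrow> 'a op"
    and \<alpha> :: real
  defines "P \<equiv> joint_law I (symbols I X U) p"
    and "WB \<equiv> (\<lambda>x. tr_snd (word_output N \<theta> x))"
    and "WE \<equiv> (\<lambda>x. tr_fst (word_output N \<theta> x))"
    and "\<rho>0 \<equiv> tr_fst (N (Tensor \<phi>0))"
  assumes "cptp_on {k. \<forall>t. k t \<in> H t} N"
    and "\<forall>t. \<phi>0 t \<in> densities_on (H t)"
    and "message_assignment I"
    and "special_hierarchy I"
    and "subset_ordering Bs"
    and "\<forall>s. 0 \<le> R s"
    and "conditional_laws I (symbols I X U) p"
    and "\<forall>t. \<forall>x \<in> X t. \<theta> t x \<in> densities_on (H t)"
    and "mean_state P WE = \<rho>0"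
    and "0 < \<alpha>" and "\<alpha> < 1/2"
  shows "\<exists>F \<Lambda>. is_code H I R F \<Lambda> \<and>
    error_prob N I R F \<Lambda> \<le>
      6 * real (mu_B P WB UNIV) powr \<alpha> *
        2 powr (\<alpha> * ((\<Sum>s\<in>UNIV. R s) - D_of (- \<alpha>) P WB (\<lambda>x. x))) +
      6 * (\<Sum>S | S \<noteq> {} \<and> S \<subset> UNIV.
        real (mu_B P WB (- transmitters_meeting I S)) powr \<alpha> *
        2 powr (\<alpha> * ((\<Sum>s\<in>S. R s) -
          I_of (- \<alpha>) P WB (\<lambda>x. restrict x (transmitters_meeting I S))
                          (\<lambda>x. restrict x (- transmitters_meeting I S))))) \<and>
    trace_norm (warden_state N I R F - \<rho>0) \<le>
      2 / sqrt \<alpha> *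
        (real (mu_E I Bs P WE (length Bs)) powr (\<alpha> / 2) *
           2 powr (\<alpha> / 2 * (- (\<Sum>s\<in>UNIV. R s) + D_of \<alpha> P WE (\<lambda>x. x))) +
         (\<Sum>i<length Bs. real (mu_E I Bs P WE i) powr (\<alpha> / 2) *
           2 powr (\<alpha> / 2 * (- (\<Sum>s\<in>Bs ! i. R s) +
             D_of \<alpha> P WE (\<lambda>x. restrict x (transmitters_inside I (Bs ! i)))))))"
proof -
  define L where "L = symbols I X U"
  define q where "q = seeds I L p"
  define Ms where "Ms s = message_set (R s)" for s
  have cl: "conditional_laws I L p" using assms(11) by (simp add: L_def)
  have P: "P = joint_law I L p" by (simp add: P_def L_def)
  have \<alpha>: "0 < \<alpha>" "\<alpha> < 1/2" using assms(14,15) by auto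
  have R0: "0 \<le> R s" for s using assms(10) by blast
  have I0: "I t \<noteq> {}" for t using assms(7) by (simp add: message_assignment_def)
  have q: "mergeable q" unfolding q_def by (rule mergeable_seeds)
  have finq: "finite (set_pmf q)" unfolding q_def by (rule finite_seeds)
  have Ms: "finite (Ms s)" "Ms s \<noteq> {}" for s unfolding Ms_def by (rule message_set_card[OF R0])+
  obtain Us :: "'s list" where Us: "distinct Us" "set Us = UNIV"
    using finite_distinct_list[of "UNIV :: 's set"] by auto
  define C where "C = codebook I Ms q Us"
  have finC: "finite (set_pmf C)" unfolding C_def by (rule finite_codebook[OF finq Ms(1)])
  have msg: "messages R = PiE UNIV Ms" by (auto simp: messages_def Ms_def PiE_UNIV_domain)
  have fmsg: "finite (messages R)" unfolding msg by (intro finite_PiE Ms) simp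
  have nmsg: "messages R \<noteq> {}" unfolding msg PiE_eq_empty_iff using Ms by auto
  define M where "M = msize Ms (UNIV :: 's set)"
  have cM: "real (card (messages R)) = M" unfolding msg M_def by (rule card_PiE_msize)
  have M: "0 < M" using fmsg nmsg unfolding cM[symmetric] by (simp add: card_gt_0_iff)
  have P0: "0 \<le> P x" for x unfolding P by (rule joint_law_nonneg[OF cl])
  have P1: "(\<Sum>x\<in>UNIV. P x) = 1" unfolding P by (rule joint_law_sum[OF cl])
  have Pex: "\<exists>x. 0 < P x"
  proof (rule ccontr)
    assume "\<not> ?thesis"
    then have "\<not> 0 < P x" for x by blast
    then have "P x = 0" for x using P0[of x] by (simp add: not_less antisym)
    then show False using P1 by simp
  qed
  define ok where "ok x = (\<forall>t. fst (x t) \<in> X t)" for x :: "'t \<Rightarrow> 'x \<times> 'u option"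
  have okP: "ok x" if "0 < P x" for x
  proof -
    have "x t \<in> L t" for t using that by (auto simp: P joint_law_def split: if_splits)
    then show ?thesis by (auto simp: ok_def L_def symbols_def mem_Times_iff)
  qed
  have okw: "ok (word I \<omega>)" if "\<omega> \<in> set_pmf q" for \<omega>
    using joint_law_pos_word[OF cl] that by (intro okP) (simp add: P q_def)
  have dW: "density_op (word_output N \<theta> x)" if "ok x" for x
    using that by (intro word_output_density[OF assms(5) assms(12)]) (simp add: ok_def)
  have dWB: "density_op (WB x)" and dWE: "density_op (WE x)" if "ok x" for x
    unfolding WB_def WE_def by (rule density_tr_snd[OF dW[OF that]], rule density_tr_fst[OF dW[OF that]])
  have pWB: "psd (WB x)" and pWE: "psd (WE x)" if "0 < P x" for x
    using dWB dWE okP[OF that] by (auto simp: density_op_def)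
  have d0: "density_op \<rho>0" unfolding assms(13)[symmetric] by (rule density_mean_state[OF P0 P1 dWE[OF okP]])
  have p0: "psd \<rho>0" and t0: "tr \<rho>0 = 1" using d0 by (auto simp: density_op_def tr_def)

  define c where "c = \<alpha> / (2 * (1 + \<alpha>))"
  \<comment> \<open>Seeds outside the support may produce illegal words, for which no state is
    guaranteed. The guard keeps the operators positive for all seeds, as the lemmas on codebooks
    demand.\<close>
  define V where "V \<omega> = (if ok (word I \<omega>) then WB (word I \<omega>) else 0)" for \<omega>
  define E where "E \<omega> = (if ok (word I \<omega>) then WE (word I \<omega>) else 0)" for \<omega>
  \<comment> \<open>Sandwiching before the recursion makes \<open>npow\<close> of the averages the
    quantity inside \<open>D_of\<close>; \<open>sandwich c\<close> later converts the deviation back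
    into a difference of states.\<close>
  define A where "A \<omega> = sandwich (- c) \<rho>0 (E \<omega>)" for \<omega>
  have pV: "psd (V \<omega>)" and pE: "psd (E \<omega>)" for \<omega>
    using dWB dWE by (auto simp: V_def E_def density_op_def)
  have pA: "psd (A \<omega>)" for \<omega> unfolding A_def by (rule psd_sandwich_powr[OF p0 pE])
  have Vq: "V \<omega> = WB (word I \<omega>)" and Eq: "E \<omega> = WE (word I \<omega>)" if "\<omega> \<in> set_pmf q" for \<omega>
    using okw[OF that] by (simp_all add: V_def E_def)
  have inv: "sandwich c \<rho>0 (A \<omega>) = WE (word I \<omega>)" if "\<omega> \<in> set_pmf q" for \<omega>
  proof -
    have pos: "0 < P (word I \<omega>)" using joint_law_pos_word[OF cl] that by (simp add: P q_def)
    have "psd (\<rho>0 - P (word I \<omega>) *\<^sub>R WE (word I \<omega>))"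
      unfolding assms(13)[symmetric] by (rule weighted_le_mean[OF P0 pWE])
    then show ?thesis unfolding A_def Eq[OF that] by (rule sandwich_inverse[OF p0 pWE[OF pos] pos])
  qed
  have msz: "msize Ms S \<le> 2 powr (\<Sum>s\<in>S. R s)" for S
  proof -
    have "msize Ms S \<le> (\<Prod>s\<in>S. 2 powr R s)"
      unfolding msize_def Ms_def by (intro prod_mono) (simp add: message_set_card[OF R0])
    then show ?thesis by (simp add: powr_sum)
  qed

  define TB where "TB S = (if S = UNIV then D_of (- \<alpha>) P WB (\<lambda>x. x)
    else I_of (- \<alpha>) P WB (\<lambda>x. restrict x (transmitters_meeting I S)) (\<lambda>x. restrict x (- transmitters_meeting I S)))" for S
  define E1 where "E1 = 6 * real (mu_B P WB UNIV) powr \<alpha> *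
        2 powr (\<alpha> * ((\<Sum>s\<in>UNIV. R s) - D_of (- \<alpha>) P WB (\<lambda>x. x))) +
      6 * (\<Sum>S | S \<noteq> {} \<and> S \<subset> UNIV.
        real (mu_B P WB (- transmitters_meeting I S)) powr \<alpha> *
        2 powr (\<alpha> * ((\<Sum>s\<in>S. R s) -
          I_of (- \<alpha>) P WB (\<lambda>x. restrict x (transmitters_meeting I S))
                          (\<lambda>x. restrict x (- transmitters_meeting I S)))))"
  have split: "(\<Sum>S | S \<noteq> {}. h S) = h UNIV + (\<Sum>S | S \<noteq> {} \<and> S \<subset> UNIV. h S)" for h :: "'s set \<Rightarrow> real"
  proof -
    have "{S :: 's set. S \<noteq> {}} = insert UNIV {S. S \<noteq> {} \<and> S \<subset> UNIV}" by auto
    then show ?thesis by (simp only:) simp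
  qed
  have grow: "y \<le> real m powr a * y" if "1 \<le> real m" "0 \<le> y" "0 \<le> a" for m a y
  proof -
    have "1 \<le> real m powr a" using that by (simp add: ge_one_powr_ge_zero)
    then show ?thesis using mult_right_mono[of 1 "real m powr a" y] that by simp
  qed
  have muB: "1 \<le> real (mu_B P WB T)" for T by (rule mu_B_ge_1[OF Pex P0 pWB])
  have muE: "1 \<le> real (mu_E I Bs P WE i)" for i by (rule mu_E_ge_1[OF Pex P0 pWE])
  define qB where "qB = (\<Sum>S | S \<noteq> {}. 2 powr (\<alpha> * ((\<Sum>s\<in>S. R s) - TB S)))"
  have qB0: "0 < qB"
    unfolding qB_def split by (intro add_pos_nonneg sum_nonneg) simp_all
  have qE: "6 * qB \<le> E1"
  proof -
    have "qB \<le> real (mu_B P WB UNIV) powr \<alpha> * 2 powr (\<alpha> * ((\<Sum>s\<in>UNIV. R s) - TB UNIV))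
      + (\<Sum>S | S \<noteq> {} \<and> S \<subset> UNIV. real (mu_B P WB (- transmitters_meeting I S)) powr \<alpha> * 2 powr (\<alpha> * ((\<Sum>s\<in>S. R s) - TB S)))"
      unfolding qB_def split using \<alpha> by (intro add_mono sum_mono grow muB) auto
    also have "(\<Sum>S | S \<noteq> {} \<and> S \<subset> UNIV. real (mu_B P WB (- transmitters_meeting I S)) powr \<alpha> * 2 powr (\<alpha> * ((\<Sum>s\<in>S. R s) - TB S)))
      = (\<Sum>S | S \<noteq> {} \<and> S \<subset> UNIV. real (mu_B P WB (- transmitters_meeting I S)) powr \<alpha> *
        2 powr (\<alpha> * ((\<Sum>s\<in>S. R s) - I_of (- \<alpha>) P WB (\<lambda>x. restrict x (transmitters_meeting I S)) (\<lambda>x. restrict x (- transmitters_meeting I S)))))"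
      by (intro sum.cong refl) (auto simp: TB_def)
    finally show ?thesis by (simp add: E1_def TB_def)
  qed
  have E1: "0 < E1" using qE qB0 by linarith

  define Err where "Err Z = (1 / M) * (2 * ((\<Sum>m\<in>PiE UNIV Ms. tr (V (Z m))) - tr (hfun sqrt (\<Sum>m\<in>PiE UNIV Ms. V (Z m) ** V (Z m)))))" for Z
  have ExErr: "Ex C Err < (1 - \<alpha>) * E1"
  proof -
    define k where "k = 2 * sqrt 2 * 2 powr (- \<alpha>) * (1 - \<alpha>) * (1 + 96/100 * \<alpha>)"
    have k0: "0 \<le> k" unfolding k_def using \<alpha> by (intro mult_nonneg_nonneg) auto
    \<comment> \<open>Together with the factor 2 from \<open>povm_exists\<close> this stays below
      \<open>6 * (1 - \<alpha>)\<close>; strictness is what later makes the two shares add up to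
      less than 1.\<close>
    have k3: "k < 3 * (1 - \<alpha>)"
    proof -
      have "2 * sqrt 2 / 3 * (1 + 96/100 * \<alpha>) * 2 powr (- \<alpha>) < 2 powr \<alpha> * 2 powr (- \<alpha>)"
        by (rule mult_strict_right_mono[OF two_powr_lower[OF \<alpha>]]) simp
      also have "(2::real) powr \<alpha> * 2 powr (- \<alpha>) = 1" by (simp add: powr_add[symmetric])
      finally have "3 * (1 - \<alpha>) * (2 * sqrt 2 / 3 * (1 + 96/100 * \<alpha>) * 2 powr (- \<alpha>)) < 3 * (1 - \<alpha>) * 1"
        using \<alpha> by (intro mult_strict_left_mono) auto
      moreover have e: "3 * (1 - \<alpha>) * (2 * sqrt 2 / 3 * u * v) = 2 * sqrt 2 * v * (1 - \<alpha>) * u" for u v :: real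
        by (simp add: field_simps)
      ultimately show ?thesis unfolding k_def by (simp only: e mult_1_right)
    qed
    have "Ex C Err = (1 / M) * (2 * Ex C (\<lambda>Z. (\<Sum>m\<in>PiE UNIV Ms. tr (V (Z m))) - tr (hfun sqrt (\<Sum>m\<in>PiE UNIV Ms. V (Z m) ** V (Z m)))))"
      unfolding Err_def Ex_cmult ..
    also have "\<dots> \<le> (1 / M) * (2 * (msize Ms UNIV * k * (\<Sum>S | S \<noteq> {}. msize Ms S powr \<alpha> * Ex q (\<lambda>\<omega>. petz \<alpha> (V \<omega>) (avg I q S V \<omega>)))))"
      unfolding C_def k_def using M
      by (intro mult_left_mono expected_error[where I = I and Ms = Ms and V = V, OF q Ms(1) pV Us \<alpha>]) auto
    also have "\<dots> = 2 * k * (\<Sum>S | S \<noteq> {}. msize Ms S powr \<alpha> * Ex q (\<lambda>\<omega>. petz \<alpha> (V \<omega>) (avg I q S V \<omega>)))"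
      using M by (simp add: M_def[symmetric])
    also have "\<dots> \<le> 2 * k * qB"
      unfolding qB_def
    proof (intro mult_left_mono sum_mono)
      fix S :: "'s set"
      have "msize Ms S powr \<alpha> \<le> (2 powr (\<Sum>s\<in>S. R s)) powr \<alpha>"
        using \<alpha> by (intro powr_mono2 msz msize_nonneg) auto
      also have "\<dots> = 2 powr (\<alpha> * (\<Sum>s\<in>S. R s))" by (simp add: powr_powr mult.commute)
      finally have 1: "msize Ms S powr \<alpha> \<le> 2 powr (\<alpha> * (\<Sum>s\<in>S. R s))" .
      have 2: "Ex q (\<lambda>\<omega>. petz \<alpha> (V \<omega>) (avg I q S V \<omega>)) \<le> 2 powr (- \<alpha> * TB S)"
        unfolding q_def TB_def P by (rule petz_term[OF cl \<alpha> I0]) (auto simp: P[symmetric] dWB okP Vq q_def)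
      have "0 \<le> Ex q (\<lambda>\<omega>. petz \<alpha> (V \<omega>) (avg I q S V \<omega>))"
        unfolding Ex_def by (intro sum_nonneg) (simp add: petz_nonneg pV psd_avg)
      then have "msize Ms S powr \<alpha> * Ex q (\<lambda>\<omega>. petz \<alpha> (V \<omega>) (avg I q S V \<omega>)) \<le> 2 powr (\<alpha> * (\<Sum>s\<in>S. R s)) * 2 powr (- \<alpha> * TB S)"
        using 1 2 by (intro mult_mono) auto
      also have "\<dots> = 2 powr (\<alpha> * ((\<Sum>s\<in>S. R s) - TB S))" by (simp add: powr_add[symmetric] right_diff_distrib)
      finally show "msize Ms S powr \<alpha> * Ex q (\<lambda>\<omega>. petz \<alpha> (V \<omega>) (avg I q S V \<omega>)) \<le> 2 powr (\<alpha> * ((\<Sum>s\<in>S. R s) - TB S))" .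
    qed (use k0 in simp)
    also have "\<dots> < 2 * (3 * (1 - \<alpha>)) * qB" using k3 qB0 by simp
    also have "\<dots> = (1 - \<alpha>) * (6 * qB)" by simp
    also have "\<dots> \<le> (1 - \<alpha>) * E1" using qE \<alpha> by (intro mult_left_mono) auto
    finally show ?thesis .
  qed

  define Np where "Np Z = npow (1 + \<alpha>) ((1 / M) *\<^sub>R (\<Sum>m\<in>PiE UNIV Ms. A (Z m)) - Ex q A)" for Z
  have oA: "sandwich c \<rho>0 (Ex q A) = \<rho>0"
  proof -
    have "sandwich c \<rho>0 (Ex q A) = Ex q (\<lambda>\<omega>. WE (word I \<omega>))"
      unfolding sandwich_Ex by (intro Ex_cong inv)
    also have "\<dots> = mean_state P WE" unfolding q_def Ex_word[OF cl] P mean_state_def ..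
    finally show ?thesis using assms(13) by simp
  qed
  have code: "\<exists>F \<Lambda>. is_code H I R F \<Lambda> \<and> error_prob N I R F \<Lambda> \<le> Err Z \<and> 0 \<le> Err Z \<and>
    trace_norm (warden_state N I R F - \<rho>0) \<le> 2 \<and> trace_norm (warden_state N I R F - \<rho>0) \<le> Np Z powr (1 / (1 + \<alpha>))"
    if Z: "Z \<in> set_pmf C" for Z
  proof -
    define F where "F = (\<lambda>t m. \<theta> t (fst (word I (Z m) t)))"
    have Z': "Z \<in> set_pmf (codebook I (\<lambda>s. message_set (R s)) (seeds I (symbols I X U) p) Us)"
      using Z by (simp add: C_def Ms_def[abs_def] q_def L_def)
    have Fd: "\<forall>t. \<forall>m \<in> Pi\<^sub>E (I t) (\<lambda>s. message_set (R s)). F t m \<in> densities_on (H t)"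
      unfolding F_def using codebook_encoders(1)[OF assms(11) R0 assms(12) Us(2) Z'] by blast
    have out: "code_output N I F m = word_output N \<theta> (word I (Z m))" for m
      unfolding F_def by (rule codebook_encoders(2)[OF assms(11) R0 assms(12) Us(2) Z'])
    have Zq: "Z m \<in> set_pmf q" if "m \<in> messages R" for m
      using that Z unfolding C_def msg by (intro codebook_support[where I = I and Ms = Ms and U = Us, OF q Ms(1)]) auto
    have outB: "tr_snd (code_output N I F m) = V (Z m)" and outE: "tr_fst (code_output N I F m) = WE (word I (Z m))"
      if "m \<in> messages R" for m
      using Vq[OF Zq[OF that]] by (simp_all add: out WB_def WE_def)
    obtain \<Lambda> where \<Lambda>: "\<forall>m\<in>messages R. psd (\<Lambda> m)" "(\<Sum>m\<in>messages R. \<Lambda> m) = mat 1"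
      "(\<Sum>m\<in>messages R. \<Sum>m'\<in>messages R - {m}. tr (\<Lambda> m' ** V (Z m)))
        \<le> 2 * ((\<Sum>m\<in>messages R. tr (V (Z m))) - tr (hfun sqrt (\<Sum>m\<in>messages R. V (Z m) ** V (Z m))))"
      using povm_exists[of "messages R" "\<lambda>m. V (Z m)", OF fmsg nmsg pV] by blast
    have "error_prob N I R F \<Lambda> = (1 / M) * (\<Sum>m\<in>messages R. \<Sum>m'\<in>messages R - {m}. tr (\<Lambda> m' ** V (Z m)))"
      unfolding error_prob_def cM by (simp add: outB tr_def cong: sum.cong)
    also have "\<dots> \<le> Err Z" unfolding Err_def msg[symmetric] using M by (intro mult_left_mono \<Lambda>) auto
    finally have err: "error_prob N I R F \<Lambda> \<le> Err Z" .
    have "0 \<le> tr (\<Lambda> m' ** V (Z m))" if "m' \<in> messages R" for m m'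
      using \<Lambda>(1) that by (intro tr_mult_psd pV) auto
    then have "0 \<le> (\<Sum>m\<in>messages R. \<Sum>m'\<in>messages R - {m}. tr (\<Lambda> m' ** V (Z m)))" by (intro sum_nonneg) auto
    then have Err0: "0 \<le> Err Z"
      using \<Lambda>(3) M unfolding Err_def msg[symmetric] by (intro mult_nonneg_nonneg) auto
    have ws: "warden_state N I R F = (1 / M) *\<^sub>R (\<Sum>m\<in>messages R. WE (word I (Z m)))"
      unfolding warden_state_def cM by (simp add: outE cong: sum.cong)
    have dws: "density_op (warden_state N I R F)"
    proof -
      have d: "density_op (WE (word I (Z m)))" if "m \<in> messages R" for m by (rule dWE[OF okw[OF Zq[OF that]]])
      have "psd (\<Sum>m\<in>messages R. WE (word I (Z m)))" using d by (intro psd_sum) (simp add: density_op_def)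
      then have "psd (warden_state N I R F)" unfolding ws using M by (intro psd_scaleR) auto
      moreover have "trace (\<Sum>m\<in>messages R. WE (word I (Z m))) = of_real M"
        using d unfolding trace_sum cM[symmetric] by (simp add: density_op_def)
      then have "trace (warden_state N I R F) = 1"
        unfolding ws trace_scaleR using M by (simp add: scaleR_conv_of_real[where 'a = complex])
      ultimately show ?thesis by (simp add: density_op_def)
    qed
    have "sandwich c \<rho>0 ((1 / M) *\<^sub>R (\<Sum>m\<in>PiE UNIV Ms. A (Z m)) - Ex q A) = warden_state N I R F - \<rho>0"
      unfolding sandwich_linear oA ws msg[symmetric] by (simp add: inv Zq cong: sum.cong)
    moreover have "hermitian ((1 / M) *\<^sub>R (\<Sum>m\<in>PiE UNIV Ms. A (Z m)) - Ex q A)"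
      by (intro herm_diff herm_scaleR herm_sum psd_herm pA psd_Ex)
    ultimately have "trace_norm (warden_state N I R F - \<rho>0) \<le> Np Z powr (1 / (1 + \<alpha>))"
      using trace_norm_sandwich[OF p0 t0, of "(1 / M) *\<^sub>R (\<Sum>m\<in>PiE UNIV Ms. A (Z m)) - Ex q A" \<alpha>] \<alpha>
      unfolding Np_def c_def by simp
    moreover have "is_code H I R F \<Lambda>" using Fd \<Lambda> by (simp add: is_code_def)
    moreover have "trace_norm (warden_state N I R F - \<rho>0) \<le> 2" by (rule trace_norm_density_diff[OF dws d0])
    ultimately show ?thesis using err Err0 by blast
  qed

  define DE where "DE S = D_of \<alpha> P WE (\<lambda>x. restrict x (transmitters_inside I S))" for S
  define y where "y S = 2 powr (\<alpha> / 2 * (- (\<Sum>s\<in>S. R s) + DE S))" for S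
  define B where "B = 2 / sqrt \<alpha> *
        (real (mu_E I Bs P WE (length Bs)) powr (\<alpha> / 2) *
           2 powr (\<alpha> / 2 * (- (\<Sum>s\<in>UNIV. R s) + D_of \<alpha> P WE (\<lambda>x. x))) +
         (\<Sum>i<length Bs. real (mu_E I Bs P WE i) powr (\<alpha> / 2) *
           2 powr (\<alpha> / 2 * (- (\<Sum>s\<in>Bs ! i. R s) +
             D_of \<alpha> P WE (\<lambda>x. restrict x (transmitters_inside I (Bs ! i)))))))"
  have sa: "0 < sqrt \<alpha>" using \<alpha> by simp
  have yU: "2 powr (\<alpha> / 2 * (- (\<Sum>s\<in>UNIV. R s) + D_of \<alpha> P WE (\<lambda>x. x))) = y UNIV"
  proof -
    have "restrict x UNIV = x" for x :: "'t \<Rightarrow> 'x \<times> 'u option" by (simp add: restrict_def)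
    then show ?thesis by (simp add: y_def DE_def transmitters_inside_def)
  qed
  have yB: "2 / sqrt \<alpha> * (\<Sum>S | S \<noteq> {}. y S) \<le> B"
  proof -
    have Bs: "distinct Bs" "set Bs = {S. S \<noteq> {} \<and> S \<subset> UNIV}" using assms(9) by (auto simp: subset_ordering_def)
    have "(\<Sum>S | S \<noteq> {} \<and> S \<subset> UNIV. y S) = (\<Sum>i<length Bs. y (Bs ! i))"
      unfolding Bs(2)[symmetric] using sum.reindex_bij_betw[OF bij_betw_nth[OF Bs(1) refl refl], of y] by simp
    also have "\<dots> \<le> (\<Sum>i<length Bs. real (mu_E I Bs P WE i) powr (\<alpha> / 2) * y (Bs ! i))"
      using \<alpha> by (intro sum_mono grow muE) (auto simp: y_def)
    finally have s: "(\<Sum>S | S \<noteq> {} \<and> S \<subset> UNIV. y S) \<le> (\<Sum>i<length Bs. real (mu_E I Bs P WE i) powr (\<alpha> / 2) * y (Bs ! i))" .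
    have "(\<Sum>S | S \<noteq> {}. y S) \<le> real (mu_E I Bs P WE (length Bs)) powr (\<alpha> / 2) * y UNIV
      + (\<Sum>i<length Bs. real (mu_E I Bs P WE i) powr (\<alpha> / 2) * y (Bs ! i))"
      unfolding split using \<alpha> by (intro add_mono s grow muE) (auto simp: y_def)
    then have "2 / sqrt \<alpha> * (\<Sum>S | S \<noteq> {}. y S) \<le> 2 / sqrt \<alpha> * (real (mu_E I Bs P WE (length Bs)) powr (\<alpha> / 2) * y UNIV
      + (\<Sum>i<length Bs. real (mu_E I Bs P WE i) powr (\<alpha> / 2) * y (Bs ! i)))"
      using sa by (intro mult_left_mono) auto
    also have "\<dots> = B" unfolding B_def yU by (simp add: y_def DE_def)
    finally show ?thesis .
  qed
  have B0: "0 < B"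
  proof -
    have "0 < (\<Sum>S | S \<noteq> {}. y S)" unfolding split by (intro add_pos_nonneg sum_nonneg) (simp_all add: y_def)
    then have "0 < 2 / sqrt \<alpha> * (\<Sum>S | S \<noteq> {}. y S)" using sa by simp
    then show ?thesis using yB by linarith
  qed
  show ?thesis
  \<comment> \<open>A difference of two states has trace norm at most 2, so a large \<open>B\<close>
    restricts nothing. Only for \<open>B < 2\<close> is \<open>leakage_rounding\<close>
    available.\<close>
  proof (cases "2 \<le> B")
    case True
    have "(1 - \<alpha>) * E1 \<le> 1 * E1" using \<alpha> E1 by (intro mult_right_mono) auto
    then have "Ex C Err < E1" using ExErr by simp
    then obtain Z where Z: "Z \<in> set_pmf C" "Err Z < E1" using Ex_exists[OF finC] by blast
    from code[OF Z(1)] obtain F \<Lambda> where "is_code H I R F \<Lambda>" "error_prob N I R F \<Lambda> \<le> Err Z"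
      "trace_norm (warden_state N I R F - \<rho>0) \<le> 2" by blast
    then show ?thesis unfolding E1_def[symmetric] B_def[symmetric] using Z(2) True
      by (intro exI[of _ F] exI[of _ \<Lambda>]) auto
  next
    case False
    define Q where "Q S = Ex q (\<lambda>\<omega>. npow (1 + \<alpha>) (avg I q (- S) A \<omega>))" for S
    have cond: "avg I q (- S) A \<omega> = sandwich (- c) \<rho>0 (cond_state P WE (\<lambda>x. restrict x (transmitters_inside I S)) (restrict (word I \<omega>) (transmitters_inside I S)))"
      if w: "\<omega> \<in> set_pmf q" for S \<omega>
    proof -
      have "avg I q (- S) A \<omega> = sandwich (- c) \<rho>0 (avg I q (- S) E \<omega>)"
        by (simp add: avg_def A_def[abs_def] sandwich_Ex)
      also have "avg I q (- S) E \<omega> = cond_state P WE (\<lambda>x. restrict x (transmitters_inside I S)) (restrict (word I \<omega>) (transmitters_inside I S))"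
        unfolding q_def P inside_compl[symmetric]
        using w Eq by (intro avg_word_support[OF cl]) (auto simp: q_def)
      finally show ?thesis .
    qed
    \<comment> \<open>Hoelder's inequality with the identity as \<open>J\<close>: un-sandwiching
      gives a state of trace 1, so the norm is at least 1. The rounding lemma needs this
      bound.\<close>
    have Q1: "1 \<le> Q S" for S
    proof -
      have "1 \<le> npow (1 + \<alpha>) (avg I q (- S) A \<omega>)" if w: "\<omega> \<in> set_pmf q" for \<omega>
      proof -
        define Y where "Y = avg I q (- S) A \<omega>"
        have Y: "hermitian Y" unfolding Y_def by (intro psd_herm psd_avg pA)
        have "sandwich c \<rho>0 Y = avg I q (- S) (\<lambda>\<omega>. WE (word I \<omega>)) \<omega>"
          unfolding Y_def avg_def sandwich_Ex by (intro Ex_cong inv merge_support[OF q w])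
        then have "tr (sandwich c \<rho>0 Y) = Ex q (\<lambda>\<omega>'. tr (WE (word I (merge (transmitters_meeting I (- S)) \<omega> \<omega>'))))"
          by (simp add: avg_def tr_Ex)
        also have "\<dots> = Ex q (\<lambda>_. 1)"
          using dWE[OF okw[OF merge_support[OF q w]]] by (intro Ex_cong) (simp add: density_op_def tr_def)
        also have "\<dots> = 1" by (simp add: Ex_const finq)
        finally have t: "tr (mat 1 ** sandwich c \<rho>0 Y) = 1" by simp
        have pp: "psd (mat 1 - mat 1 :: 'e op)" "psd (mat 1 + mat 1 :: 'e op)" by (simp, rule psd_add[OF psd_one psd_one])
        have "1 \<le> npow (1 + \<alpha>) Y powr (1 / (1 + \<alpha>))"
          using tr_sandwich_le[OF p0 t0 Y pp \<alpha>(1)] t unfolding sandwich_def c_def by simp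
        then have "1 powr (1 + \<alpha>) \<le> (npow (1 + \<alpha>) Y powr (1 / (1 + \<alpha>))) powr (1 + \<alpha>)"
          using \<alpha> by (intro powr_mono2) auto
        then show ?thesis using \<alpha> npow_nonneg[OF Y] by (simp add: powr_powr Y_def)
      qed
      then have "Ex q (\<lambda>_. 1) \<le> Q S" unfolding Q_def by (intro Ex_mono)
      then show ?thesis by (simp add: Ex_const finq)
    qed
    have QD: "2 powr (\<alpha> * DE S) = Q S" for S
    proof -
      define f where "f = (\<lambda>x :: 't \<Rightarrow> 'x \<times> 'u option. restrict x (transmitters_inside I S))"
      have "Q S = Ex q (\<lambda>\<omega>. npow (1 + \<alpha>) (sandwich (- \<alpha> / (2 * (1 + \<alpha>))) (mean_state P WE) (cond_state P WE f (f (word I \<omega>)))))"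
        unfolding Q_def by (intro Ex_cong) (simp add: cond f_def c_def assms(13))
      also have "\<dots> = (\<Sum>x\<in>UNIV. P x * npow (1 + \<alpha>) (sandwich (- \<alpha> / (2 * (1 + \<alpha>))) (mean_state P WE) (cond_state P WE f (f x))))"
        unfolding q_def P
        using Ex_word[OF cl, of "\<lambda>x. npow (1 + \<alpha>) (sandwich (- \<alpha> / (2 * (1 + \<alpha>))) (mean_state (joint_law I L p) WE) (cond_state (joint_law I L p) WE f (f x)))"]
        by simp
      finally have e: "Q S = (\<Sum>x\<in>UNIV. P x * npow (1 + \<alpha>) (sandwich (- \<alpha> / (2 * (1 + \<alpha>))) (mean_state P WE) (cond_state P WE f (f x))))" .
      have "0 < (\<Sum>x\<in>UNIV. P x * npow (1 + \<alpha>) (sandwich (- \<alpha> / (2 * (1 + \<alpha>))) (mean_state P WE) (cond_state P WE f (f x))))"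
        using Q1[of S] unfolding e by linarith
      from covert_D[OF P0 pWE \<alpha>(1) this] show ?thesis unfolding e DE_def f_def .
    qed
    have y2: "(y S)\<^sup>2 = 2 powr (- \<alpha> * (\<Sum>s\<in>S. R s)) * Q S" for S
    proof -
      have "(y S)\<^sup>2 = 2 powr (- \<alpha> * (\<Sum>s\<in>S. R s) + \<alpha> * DE S)"
        by (simp add: y_def power2_eq_square powr_add[symmetric] algebra_simps)
      then show ?thesis by (simp only: powr_add QD)
    qed
    have "Ex C Np \<le> 2 * (\<Sum>S | S \<noteq> {}. msize Ms S powr (- \<alpha>) * Q S)"
      using expected_leakage[where I = I and Ms = Ms and A = A and \<alpha> = \<alpha>, OF q Ms pA I0 Us] \<alpha>
      unfolding C_def Np_def[abs_def] Q_def M_def by simp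
    also have "\<dots> \<le> \<alpha> * B powr (1 + \<alpha>)"
      unfolding msize_def Ms_def
      by (rule leakage_rounding[where R = R and Q = Q and y = y, OF \<alpha>])
        (use B0 False yB Q1 y2 message_set_card[OF R0] in \<open>auto simp: y_def\<close>)
    finally have ENp: "Ex C Np \<le> \<alpha> * B powr (1 + \<alpha>)" .
    have Bp: "0 < B powr (1 + \<alpha>)" using B0 by simp
    \<comment> \<open>Each quantity is measured in units of its own bound. The expected total is
      below 1, so some codebook has both nonnegative summands below 1.\<close>
    have "Ex C (\<lambda>Z. 1 / E1 * Err Z + 1 / B powr (1 + \<alpha>) * Np Z) = 1 / E1 * Ex C Err + 1 / B powr (1 + \<alpha>) * Ex C Np"
      by (simp only: Ex_add Ex_cmult)
    also have "\<dots> < 1 / E1 * ((1 - \<alpha>) * E1) + 1 / B powr (1 + \<alpha>) * (\<alpha> * B powr (1 + \<alpha>))"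
      using E1 Bp by (intro add_less_le_mono mult_strict_left_mono mult_left_mono ExErr ENp) auto
    also have "\<dots> = 1" using E1 B0 by simp
    finally obtain Z where Z: "Z \<in> set_pmf C" "1 / E1 * Err Z + 1 / B powr (1 + \<alpha>) * Np Z < 1"
      using Ex_exists[OF finC] by blast
    from code[OF Z(1)] obtain F \<Lambda> where FL: "is_code H I R F \<Lambda>" "error_prob N I R F \<Lambda> \<le> Err Z"
      and Err0: "0 \<le> Err Z" and FL3:
      "trace_norm (warden_state N I R F - \<rho>0) \<le> Np Z powr (1 / (1 + \<alpha>))" by blast
    have Np0: "0 \<le> Np Z"
      unfolding Np_def by (intro npow_nonneg herm_diff herm_scaleR herm_sum psd_herm pA psd_Ex)
    have "1 / E1 * Err Z < 1" "1 / B powr (1 + \<alpha>) * Np Z < 1"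
      using Z(2) Err0 Np0 E1 Bp by (smt (verit) divide_nonneg_pos mult_nonneg_nonneg zero_le_divide_1_iff)+
    then have 1: "Err Z \<le> E1" and 2: "Np Z \<le> B powr (1 + \<alpha>)" using E1 Bp by (simp_all add: field_simps)
    have "Np Z powr (1 / (1 + \<alpha>)) \<le> (B powr (1 + \<alpha>)) powr (1 / (1 + \<alpha>))"
      using 2 Np0 \<alpha> by (intro powr_mono2) auto
    also have "\<dots> = B" using \<alpha> B0 by (simp add: powr_powr)
    finally have "trace_norm (warden_state N I R F - \<rho>0) \<le> B" using FL3 by linarith
    then show ?thesis unfolding E1_def[symmetric] B_def[symmetric] using FL(1,2) 1
      by (intro exI[of _ F] exI[of _ \<Lambda>]) auto
  qed
qed

end
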